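(* Let $d\geqslant1$ and let $H\in\mathcal C^2(\mathbb R^d)$ go to infinity at infinity (i.e. $H(x)\to+\infty$ as $|x|\to\infty$). For all $\varepsilon>0$, define $U_\varepsilon:\mathbb Z^d\to\mathbb R$ by $U_\varepsilon(x)=H(\varepsilon x)$ for all $x\in\mathbb Z^d$. Let $(X^\varepsilon_k,V^\varepsilon_k)_{k\in\mathbb N}$ be the Zig-Zag walk on $\mathbb Z^d$ associated to $U_\varepsilon$, with some initial condition $(x_0^\varepsilon,v_0)\in\mathbb Z^d\times\{-1,1\}^d$. Suppose that $\varepsilon x_0^\varepsilon$ converges to some $x_0^*\in\mathbb R^d$ as $\varepsilon\to0$. Then $$\left(\varepsilon X^\varepsilon_{\lfloor t/\varepsilon\rfloor},V^\varepsilon_{\lfloor t/\varepsilon\rfloor}\right)_{t\geqslant0}\ \underset{\varepsilon\to0}{\longrightarrow}\ (Y_t,W_t)_{t\geqslant0}$$ in law in the Skorohod topology, where $(Y_t,W_t)_{t\geqslant0}$ is a Zig-Zag process on $\mathbb R^d$ associated to $H$ with $(Y_0,W_0)=(x_0^*,v_0)$.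
   Context: Let $(r)_+=\max(r,0)$ and let $e_i$ be the $i$-th vector of the canonical basis of $\mathbb R^d$. For $U:\mathbb Z^d\to\mathbb R$, $x\in\mathbb Z^d$, $v,w\in\{-1,1\}^d$, set $$q_i(x,v_i)=e^{-(U(x+v_ie_i)-U(x))_+},\qquad p_i(x,v_i;w_i)=q_i(x,v_i)\mathbf 1_{w_i=v_i}+(1-q_i(x,v_i))\mathbf 1_{w_i=-v_i},$$ $$p(x,v;w)=\prod_{i=1}^d p_i\Big(x+\sum_{j=1}^{i-1}\frac{v_j+w_j}2e_j,\ v_i;\ w_i\Big).$$ The Zig-Zag walk on $\mathbb Z^d$ associated to $U$ is the Markov chain $(X_n,V_n)_{n\in\mathbb N}$ on $\mathbb Z^d\times\{-1,1\}^d$ with transitions $V_{n+1}\sim p(X_n,V_n;\cdot)$, $X_{n+1}=X_n+\frac12(V_n+V_{n+1})$. The continuous-time Zig-Zag process on $\mathbb R^d$ associated to $H$ is the (piecewise deterministic) Markov process on $\mathbb R^d\times\{-1,1\}^d$ with generator $$Lf(x,v)=v\cdot\nabla_xf(x,v)+\sum_{i=1}^d(v_i\partial_{x_i}H(x))_+\big(f(x,v_{-i})-f(x,v)\big),$$ where $v_{-i}$ is obtained from $v$ by multiplying its $i$-th coordinate by $-1$: the position moves at velocity $v$ and the $i$-th velocity coordinate is flipped at rate $(v_i\partial_{x_i}H(x))_+$. Skorohod topology on càdlàg functions from $\mathbb R_+$ to $\mathbb R^{2d}$: $x_n\to x$ if there exist increasing $\gamma_n:\mathbb R_+\to\mathbb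 R_+$ such that $\sup_{t\in[0,T]}(|x_n(\gamma_n(t))-x(t)|+|\gamma_n(t)-t|)\to0$ for all $T>0$. *)

theory Defs
  imports "HOL-Probability.Probability"
begin

section \<open>Functions of class C1 and C2\<close>

definition partial_deriv :: "'d \<Rightarrow> (real ^ 'd \<Rightarrow> real) \<Rightarrow> real ^ 'd::finite \<Rightarrow> real" where
  "partial_deriv i g x = frechet_derivative g (at x) (axis i 1)"

definition gradient :: "(real ^ 'd::finite \<Rightarrow> real) \<Rightarrow> real ^ 'd \<Rightarrow> real ^ 'd" where
  "gradient g x = (\<chi> i. partial_deriv i g x)"

definition class_C1 :: "(real ^ 'd::finite \<Rightarrow> real) \<Rightarrow> bool" where
  "class_C1 g \<longleftrightarrow> (\<forall>x. g differentiable at x) \<and> (\<forall>i. continuous_on UNIV (partial_deriv i g))"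

definition class_C2 :: "(real ^ 'd::finite \<Rightarrow> real) \<Rightarrow> bool" where
  "class_C2 g \<longleftrightarrow> class_C1 g \<and> (\<forall>i. class_C1 (partial_deriv i g))"


section \<open>The Zig-Zag walk\<close>

text \<open>The coordinates are indexed by a finite linearly ordered type, since the order of the
  coordinates enters the transition probabilities.\<close>

definition signs :: "('a::ring_1 ^ 'd::finite) set" where
  "signs = {v. \<forall>i. v $ i = 1 \<or> v $ i = - 1}"

definition real_vec :: "int ^ 'd::finite \<Rightarrow> real ^ 'd" where
  "real_vec x = (\<chi> i. real_of_int (x $ i))"

definition zz_q :: "(int ^ 'd \<Rightarrow> real) \<Rightarrow> 'd::finite \<Rightarrow> int ^ 'd \<Rightarrow> int \<Rightarrow> real" where
  "zz_q U i x a = exp (- max (U (x + axis i a) - U x) 0)"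

definition zz_p_coord :: "(int ^ 'd \<Rightarrow> real) \<Rightarrow> 'd::finite \<Rightarrow> int ^ 'd \<Rightarrow> int \<Rightarrow> int \<Rightarrow> real" where
  "zz_p_coord U i x a b =
     zz_q U i x a * (if b = a then 1 else 0) + (1 - zz_q U i x a) * (if b = - a then 1 else 0)"

text \<open>For \<open>v, w \<in> signs\<close> every \<open>v $ j + w $ j\<close> is even, so that the integer divisions by 2
  below are exact.\<close>

definition zz_p ::
    "(int ^ 'd::{finite,linorder} \<Rightarrow> real) \<Rightarrow> int ^ 'd::{finite,linorder} \<Rightarrow>
     int ^ 'd::{finite,linorder} \<Rightarrow> int ^ 'd::{finite,linorder} \<Rightarrow> real" where
  "zz_p U x v w =
     (\<Prod>i\<in>UNIV. zz_p_coord U i (x + (\<Sum>j\<in>{..<i}. axis j ((v $ j + w $ j) div 2))) (v $ i) (w $ i))"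

fun zz_transition ::
    "(int ^ 'd::{finite,linorder} \<Rightarrow> real) \<Rightarrow>
     (int ^ 'd::{finite,linorder}) \<times> (int ^ 'd::{finite,linorder}) \<Rightarrow> (int ^ 'd::{finite,linorder}) \<times> (int ^ 'd::{finite,linorder}) \<Rightarrow> real" where
  "zz_transition U (x, v) (y, w) =
     (if y = x + (\<chi> i. (v $ i + w $ i) div 2) then zz_p U x v w else 0)"

text \<open>Markov chain on a countable state space \<open>S\<close> with transition matrix \<open>P\<close>. The equation is
  the Markov property multiplied by the probability of the conditioning event.\<close>

definition markov_chain ::
    "'a measure \<Rightarrow> 's set \<Rightarrow> ('s \<Rightarrow> 's \<Rightarrow> real) \<Rightarrow> (nat \<Rightarrow> 'a \<Rightarrow> 's) \<Rightarrow> bool" where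
  "markov_chain M S P Z \<longleftrightarrow>
     prob_space M \<and> (\<forall>n. Z n \<in> M \<rightarrow>\<^sub>M count_space S) \<and>
     (\<forall>n. \<forall>z\<in>{..Suc n} \<rightarrow> S.
        measure M {\<omega> \<in> space M. \<forall>k\<le>Suc n. Z k \<omega> = z k} =
        measure M {\<omega> \<in> space M. \<forall>k\<le>n. Z k \<omega> = z k} * P (z n) (z (Suc n)))"

definition zigzag_walk ::
    "'a measure \<Rightarrow> (int ^ 'd::{finite,linorder} \<Rightarrow> real) \<Rightarrow>
     (nat \<Rightarrow> 'a \<Rightarrow> int ^ 'd::{finite,linorder}) \<Rightarrow> (nat \<Rightarrow> 'a \<Rightarrow> int ^ 'd::{finite,linorder}) \<Rightarrow> bool" where
  "zigzag_walk M U X V \<longleftrightarrow>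
     markov_chain M (UNIV \<times> signs) (zz_transition U) (\<lambda>n \<omega>. (X n \<omega>, V n \<omega>))"


section \<open>Cadlag paths and the Skorohod topology\<close>

definition cadlag :: "(real \<Rightarrow> 'b::topological_space) \<Rightarrow> bool" where
  "cadlag x \<longleftrightarrow>
     (\<forall>t\<ge>0. (x \<longlongrightarrow> x t) (at_right t)) \<and> (\<forall>t>0. \<exists>l. (x \<longlongrightarrow> l) (at_left t))"

definition skorohod_space :: "(real \<Rightarrow> 'b::real_normed_vector) set" where
  "skorohod_space = {x \<in> extensional {0..}. cadlag x}"

text \<open>The time changes are increasing bijections of \<open>{0..}\<close>, as usual for the Skorohod (J1)
  topology; a time change with jumps could skip over excursions of \<open>xs n\<close>.\<close>

definition skorohod_tendsto ::
    "(nat \<Rightarrow> real \<Rightarrow> 'b::real_normed_vector) \<Rightarrow> (real \<Rightarrow> 'b) \<Rightarrow> bool" where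
  "skorohod_tendsto xs x \<longleftrightarrow>
     (\<exists>\<gamma> :: nat \<Rightarrow> real \<Rightarrow> real.
        (\<forall>n. strict_mono_on {0..} (\<gamma> n) \<and> bij_betw (\<gamma> n) {0..} {0..}) \<and>
        (\<forall>T>0. uniform_limit {0..T}
           (\<lambda>n t. norm (xs n (\<gamma> n t) - x t) + \<bar>\<gamma> n t - t\<bar>) (\<lambda>_. 0) sequentially))"

text \<open>The Skorohod topology is metrizable, hence its open sets are the sequentially open ones.\<close>

definition skorohod_topology :: "(real \<Rightarrow> 'b::real_normed_vector) topology" where
  "skorohod_topology = topology (\<lambda>G. G \<subseteq> skorohod_space \<and>
     (\<forall>x\<in>G. \<forall>xs. (\<forall>n. xs n \<in> skorohod_space) \<and> skorohod_tendsto xs x \<longrightarrow>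
        (\<forall>\<^sub>F n in sequentially. xs n \<in> G)))"

lemma openin_skorohod_topology:
  fixes G :: "(real \<Rightarrow> 'b::real_normed_vector) set"
  shows "openin skorohod_topology G \<longleftrightarrow> G \<subseteq> skorohod_space \<and>
     (\<forall>x\<in>G. \<forall>xs. (\<forall>n. xs n \<in> skorohod_space) \<and> skorohod_tendsto xs x \<longrightarrow>
        (\<forall>\<^sub>F n in sequentially. xs n \<in> G))"
proof -
  have "istopology (\<lambda>G :: (real \<Rightarrow> 'b) set. G \<subseteq> skorohod_space \<and>
     (\<forall>x\<in>G. \<forall>xs. (\<forall>n. xs n \<in> skorohod_space) \<and> skorohod_tendsto xs x \<longrightarrow>
        (\<forall>\<^sub>F n in sequentially. xs n \<in> G)))" (is "istopology ?P")
  proof -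
    have Int: "?P (S \<inter> T)" if "?P S" "?P T" for S T
      using that by (auto simp: eventually_conj_iff)
    have Un: "?P (\<Union>K)" if K: "\<forall>k\<in>K. ?P k" for K
    proof -
      have "\<forall>\<^sub>F n in sequentially. xs n \<in> \<Union>K"
        if x: "x \<in> \<Union>K" and xs: "\<forall>n. xs n \<in> skorohod_space" "skorohod_tendsto xs x" for x xs
      proof -
        obtain k where k: "k \<in> K" "x \<in> k" using x by blast
        then have "\<forall>\<^sub>F n in sequentially. xs n \<in> k" using K xs by blast
        then show ?thesis by (rule eventually_mono) (use k in blast)
      qed
      moreover have "\<Union>K \<subseteq> skorohod_space" using K by blast
      ultimately show ?thesis by blast
    qed
    show ?thesis
      unfolding istopology_def using Int Un by blast
  qed
  then show ?thesis
    unfolding skorohod_topology_def by (simp add: topology_inverse')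
qed

lemma topspace_skorohod_topology: "topspace skorohod_topology = skorohod_space"
proof
  show "topspace skorohod_topology \<subseteq> skorohod_space"
    using openin_topspace[of skorohod_topology] unfolding openin_skorohod_topology by blast
  have "openin skorohod_topology skorohod_space"
    by (simp add: openin_skorohod_topology)
  then show "skorohod_space \<subseteq> topspace skorohod_topology"
    by (rule openin_subset)
qed

text \<open>Convergence in law, along the filter \<open>F\<close>, of the \<open>T\<close>-valued random elements \<open>Z i\<close>
  on \<open>M i\<close> to \<open>Z'\<close> on \<open>N\<close>.\<close>

definition converges_in_law ::
    "'s topology \<Rightarrow> ('i \<Rightarrow> 'a measure) \<Rightarrow> ('i \<Rightarrow> 'a \<Rightarrow> 's) \<Rightarrow> 'b measure \<Rightarrow> ('b \<Rightarrow> 's) \<Rightarrow>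
     'i filter \<Rightarrow> bool" where
  "converges_in_law T M Z N Z' F \<longleftrightarrow>
     (\<forall>\<Phi> :: 's \<Rightarrow> real. continuous_map T euclideanreal \<Phi> \<and> bounded (\<Phi> ` topspace T) \<longrightarrow>
        ((\<lambda>i. \<integral>\<omega>. \<Phi> (Z i \<omega>) \<partial>M i) \<longlongrightarrow> (\<integral>\<omega>. \<Phi> (Z' \<omega>) \<partial>N)) F)"


section \<open>Markov processes and their generators\<close>

definition markov_semigroup :: "'s measure \<Rightarrow> (real \<Rightarrow> 's \<Rightarrow> 's measure) \<Rightarrow> bool" where
  "markov_semigroup E P \<longleftrightarrow>
     (\<forall>t\<ge>0. P t \<in> E \<rightarrow>\<^sub>M prob_algebra E) \<and>
     (\<forall>z\<in>space E. P 0 z = return E z) \<and>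
     (\<forall>s\<ge>0. \<forall>t\<ge>0. \<forall>z\<in>space E. P (s + t) z = P s z \<bind> P t)"

definition natural_filtration ::
    "'a measure \<Rightarrow> 's measure \<Rightarrow> (real \<Rightarrow> 'a \<Rightarrow> 's) \<Rightarrow> real \<Rightarrow> 'a measure" where
  "natural_filtration M E Z s =
     sigma (space M) {Z u -` A \<inter> space M | u A. 0 \<le> u \<and> u \<le> s \<and> A \<in> sets E}"

definition markov_process ::
    "'a measure \<Rightarrow> 's measure \<Rightarrow> (real \<Rightarrow> 's \<Rightarrow> 's measure) \<Rightarrow> (real \<Rightarrow> 'a \<Rightarrow> 's) \<Rightarrow> bool" where
  "markov_process M E P Z \<longleftrightarrow>
     prob_space M \<and> markov_semigroup E P \<and> (\<forall>t\<ge>0. Z t \<in> M \<rightarrow>\<^sub>M E) \<and>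
     (\<forall>s\<ge>0. \<forall>t\<ge>0. \<forall>A\<in>sets E. AE \<omega> in M.
        real_cond_exp M (natural_filtration M E Z s) (\<lambda>\<omega>. indicator A (Z (s + t) \<omega>)) \<omega> =
        measure (P t (Z s \<omega>)) A)"

text \<open>The infinitesimal generator of \<open>P\<close>, defined with uniform convergence, is \<open>L\<close>
  on the class \<open>D\<close> of functions.\<close>

definition has_generator ::
    "'s measure \<Rightarrow> (real \<Rightarrow> 's \<Rightarrow> 's measure) \<Rightarrow> ('s \<Rightarrow> real) set \<Rightarrow>
     (('s \<Rightarrow> real) \<Rightarrow> 's \<Rightarrow> real) \<Rightarrow> bool" where
  "has_generator E P D L \<longleftrightarrow>
     (\<forall>f\<in>D. uniform_limit (space E) (\<lambda>t z. ((\<integral>y. f y \<partial>P t z) - f z) / t) (L f) (at_right 0))"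


section \<open>The continuous-time Zig-Zag process\<close>

definition zz_state_space :: "((real ^ 'd::finite) \<times> (real ^ 'd)) measure" where
  "zz_state_space = restrict_space borel (UNIV \<times> signs)"

definition flip :: "'d \<Rightarrow> real ^ 'd::finite \<Rightarrow> real ^ 'd" where
  "flip i v = (\<chi> j. if j = i then - (v $ j) else v $ j)"

fun zz_generator ::
    "(real ^ 'd::finite \<Rightarrow> real) \<Rightarrow> ((real ^ 'd) \<times> (real ^ 'd) \<Rightarrow> real) \<Rightarrow>
     (real ^ 'd) \<times> (real ^ 'd) \<Rightarrow> real" where
  "zz_generator H f (x, v) =
     v \<bullet> gradient (\<lambda>y. f (y, v)) x +
     (\<Sum>i\<in>UNIV. max (v $ i * partial_deriv i H x) 0 * (f (x, flip i v) - f (x, v)))"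

text \<open>Since the rates are locally bounded and the speed is bounded, this class is contained in the
  domain of the generator for every \<open>H\<close> of class C1, and it is large enough to determine the
  law of the process.\<close>

definition zz_test_functions :: "((real ^ 'd::finite) \<times> (real ^ 'd) \<Rightarrow> real) set" where
  "zz_test_functions =
     {f. \<forall>v\<in>signs. class_C1 (\<lambda>x. f (x, v)) \<and> compact (closure {x. f (x, v) \<noteq> 0})}"

definition zigzag_process ::
    "'a measure \<Rightarrow> (real ^ 'd::finite \<Rightarrow> real) \<Rightarrow> (real \<Rightarrow> 'a \<Rightarrow> real ^ 'd) \<Rightarrow>
     (real \<Rightarrow> 'a \<Rightarrow> real ^ 'd) \<Rightarrow> bool" where
  "zigzag_process M H Y W \<longleftrightarrow>
     (\<exists>P. markov_process M zz_state_space P (\<lambda>t \<omega>. (Y t \<omega>, W t \<omega>)) \<and>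
          has_generator zz_state_space P zz_test_functions (zz_generator H)) \<and>
     (\<forall>\<omega>\<in>space M. cadlag (\<lambda>t. (Y t \<omega>, W t \<omega>)))"

end

theory Submission
  imports Defs
begin

text \<open>Compactness is avoided: a bounded functional \<open>\<Phi>\<close> that is continuous for the Skorohod topology is the
  increasing limit of its Lipschitz envelopes \<open>lip_env \<Phi> k\<close> with respect to the distance \<open>sk_dist\<close>. Two
  flips of the walk within a macroscopic time \<open>2 / m\<close> are improbable, and without them the path is close
  to the step path through its values on the grid \<open>\<nat> / m\<close>; so a lower bound for \<open>\<integral>\<Phi>\<close> follows from the
  convergence of finite-dimensional distributions, and the upper bound is the lower bound for \<open>- \<Phi>\<close>.
  The finite-dimensional distributions converge because the transition operator \<open>T\<close> of the walk and the
  semigroup of the process agree up to \<open>O(\<epsilon>^2)\<close> over the time \<open>\<epsilon>\<close>, uniformly on functions with given Lipschitz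
  constant and support. The generator is only given on C1 test functions, and the expansion extends to
  Lipschitz functions by approximation; the Lipschitz bounds for the powers of \<open>T\<close> pass to the semigroup in the
  limit.\<close>


section \<open>The Skorohod distance\<close>

text \<open>The semigroup is known only through its generator on C1 functions, and its action need
  not visibly preserve them: the jump rates contain a positive part and are merely Lipschitz. So
  regularity is tracked on the walk, whose operators are explicit. A step enlarges the Lipschitz
  constant by a multiple of \<epsilon> that depends on the sup norm, and the sup norm does not grow;
  over T / \<epsilon> steps the growth is linear in T. The error is telescoped so that the one-step
  estimate meets a power of \<open>zz_op\<close> while the semigroup acts only as a contraction; T /
  \<epsilon> errors of order \<epsilon>^2 add up to order \<epsilon>. Finite speed localizes
  everything: supports stay bounded up to time T, only bounds of the derivatives of \<open>H\<close>
  on one ball enter, and the values on the grid lie in a compact product, where Stone-Weierstrass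
  reduces functionals to sums of products. In the expansion of the semigroup the transport is undone
  by the flow, so that no derivative of the test function remains in the bounds; this is why they
  survive uniform approximation.\<close>

definition time_change :: "(real \<Rightarrow> real) \<Rightarrow> bool" where
  "time_change \<gamma> \<longleftrightarrow> strict_mono_on {0..} \<gamma> \<and> bij_betw \<gamma> {0..} {0..}"

lemma time_change_nonneg: "time_change \<gamma> \<Longrightarrow> 0 \<le> t \<Longrightarrow> 0 \<le> \<gamma> t"
  by (auto simp: time_change_def bij_betw_def)

lemma time_change_less_iff:
  assumes "time_change \<gamma>" "0 \<le> s" "0 \<le> t"
  shows "\<gamma> s < \<gamma> t \<longleftrightarrow> s < t"
  using assms unfolding time_change_def
  by (metis atLeast_iff linorder_less_linear order_less_asym strict_mono_onD)

lemma time_change_le_iff: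
  assumes "time_change \<gamma>" "0 \<le> s" "0 \<le> t"
  shows "\<gamma> s \<le> \<gamma> t \<longleftrightarrow> s \<le> t"
  using time_change_less_iff[OF assms(1,3,2)] by linarith

lemma time_change_id: "time_change (\<lambda>t. t)"
  by (auto simp: time_change_def strict_mono_on_def bij_betw_def)

lemma time_change_comp:
  assumes "time_change \<gamma>" "time_change \<gamma>'"
  shows "time_change (\<lambda>t. \<gamma> (\<gamma>' t))"
proof -
  have "strict_mono_on {0..} (\<lambda>t. \<gamma> (\<gamma>' t))"
    using assms by (auto intro!: strict_mono_onI simp: time_change_less_iff time_change_nonneg)
  moreover have "bij_betw (\<lambda>t. \<gamma> (\<gamma>' t)) {0..} {0..}"
    using assms bij_betw_trans[of \<gamma>' "{0..}" "{0..}" \<gamma> "{0..}"]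
    by (auto simp: time_change_def o_def)
  ultimately show ?thesis by (simp add: time_change_def)
qed

lemma time_change_inverse:
  assumes "time_change \<gamma>"
  obtains \<gamma>' where "time_change \<gamma>'" "\<And>t. 0 \<le> t \<Longrightarrow> \<gamma> (\<gamma>' t) = t" "\<And>t. 0 \<le> t \<Longrightarrow> \<gamma>' (\<gamma> t) = t"
proof -
  define \<gamma>' where "\<gamma>' = inv_into {0..} \<gamma>"
  have b: "bij_betw \<gamma> {0..} {0..}" using assms by (simp add: time_change_def)
  have b': "bij_betw \<gamma>' {0..} {0..}" unfolding \<gamma>'_def by (rule bij_betw_inv_into[OF b])
  have 1: "\<gamma> (\<gamma>' t) = t" if "0 \<le> t" for t
    using b that unfolding \<gamma>'_def by (simp add: bij_betw_inv_into_right)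
  have 2: "\<gamma>' (\<gamma> t) = t" if "0 \<le> t" for t
    using b that unfolding \<gamma>'_def by (simp add: bij_betw_inv_into_left)
  have nn: "0 \<le> \<gamma>' t" if "0 \<le> t" for t using b' that by (auto simp: bij_betw_def)
  have "strict_mono_on {0..} \<gamma>'"
    using time_change_less_iff[OF assms nn nn] 1 by (auto intro!: strict_mono_onI)
  with b' have "time_change \<gamma>'" by (simp add: time_change_def)
  with 1 2 show ?thesis using that by blast
qed

text \<open>Both time scales enter the cut-off at \<open>1 / r\<close>, which makes the relation symmetric.\<close>

definition sk_close :: "real \<Rightarrow> (real \<Rightarrow> 'b::real_normed_vector) \<Rightarrow> (real \<Rightarrow> 'b) \<Rightarrow> bool" where
  "sk_close r x y \<longleftrightarrow> (\<exists>\<gamma>. time_change \<gamma> \<and>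
     (\<forall>t\<ge>0. min t (\<gamma> t) \<le> 1 / r \<longrightarrow> norm (x (\<gamma> t) - y t) \<le> r \<and> \<bar>\<gamma> t - t\<bar> \<le> r))"

lemma sk_close_sym:
  assumes "sk_close r x y"
  shows "sk_close r y x"
proof -
  obtain \<gamma> where \<gamma>: "time_change \<gamma>"
    "\<And>t. t \<ge> 0 \<Longrightarrow> min t (\<gamma> t) \<le> 1 / r \<Longrightarrow> norm (x (\<gamma> t) - y t) \<le> r \<and> \<bar>\<gamma> t - t\<bar> \<le> r"
    using assms unfolding sk_close_def by blast
  obtain \<gamma>' where \<gamma>': "time_change \<gamma>'" "\<And>t. 0 \<le> t \<Longrightarrow> \<gamma> (\<gamma>' t) = t" "\<And>t. 0 \<le> t \<Longrightarrow> \<gamma>' (\<gamma> t) = t"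
    using time_change_inverse[OF \<gamma>(1)] by metis
  show ?thesis unfolding sk_close_def
  proof (rule exI[of _ \<gamma>'], intro conjI allI impI \<gamma>'(1))
    fix t :: real assume t: "t \<ge> 0" "min t (\<gamma>' t) \<le> 1 / r"
    have "\<gamma>' t \<ge> 0" using \<gamma>'(1) t by (simp add: time_change_nonneg)
    then show "norm (y (\<gamma>' t) - x t) \<le> r" "\<bar>\<gamma>' t - t\<bar> \<le> r"
      using \<gamma>(2)[of "\<gamma>' t"] \<gamma>'(2)[of t] t by (auto simp: min.commute norm_minus_commute)
  qed
qed

text \<open>The time changes are composed; the issue is the horizon, which must stay below
  \<open>1 / r\<close> and \<open>1 / s\<close> after one of the shifts. Since 1/a - 1/(a+b) =
  b/(a(a+b)) and a(a+b) \<le> 1, shrinking the horizon from 1/a to 1/(a+b) leaves room for a shift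
  by b. This is where \<open>r + s \<le> 1\<close> enters.\<close>

lemma sk_close_trans:
  assumes "sk_close r x y" "sk_close s y z" "0 < r" "0 < s" "r + s \<le> 1"
  shows "sk_close (r + s) x z"
proof -
  obtain \<gamma> where \<gamma>: "time_change \<gamma>"
    "\<And>t. t \<ge> 0 \<Longrightarrow> min t (\<gamma> t) \<le> 1 / r \<Longrightarrow> norm (x (\<gamma> t) - y t) \<le> r \<and> \<bar>\<gamma> t - t\<bar> \<le> r"
    using assms unfolding sk_close_def by blast
  obtain \<gamma>' where \<gamma>': "time_change \<gamma>'"
    "\<And>t. t \<ge> 0 \<Longrightarrow> min t (\<gamma>' t) \<le> 1 / s \<Longrightarrow> norm (y (\<gamma>' t) - z t) \<le> s \<and> \<bar>\<gamma>' t - t\<bar> \<le> s"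
    using assms unfolding sk_close_def by blast
  have horizon: "1 / (a + b) + b \<le> 1 / a" if "0 < a" "0 < b" "a + b \<le> 1" for a b :: real
  proof -
    have "a * (a + b) \<le> 1" using that by (intro mult_le_one) auto
    then have "b * (a * (a + b)) \<le> b * 1" using that by (intro mult_left_mono) auto
    moreover have "1 / a - 1 / (a + b) = b / (a * (a + b))"
      using that by (simp add: field_simps)
    moreover have "b \<le> b / (a * (a + b))"
      using calculation(1) that by (subst pos_le_divide_eq) auto
    ultimately show ?thesis by linarith
  qed
  have mono: "1 / (r + s) \<le> 1 / r" "1 / (r + s) \<le> 1 / s"
    using assms by (auto intro!: divide_left_mono)
  show ?thesis unfolding sk_close_def
  proof (rule exI[of _ "\<lambda>t. \<gamma> (\<gamma>' t)"], intro conjI allI impI)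
    show "time_change (\<lambda>t. \<gamma> (\<gamma>' t))" by (rule time_change_comp[OF \<gamma>(1) \<gamma>'(1)])
    fix t :: real assume t: "t \<ge> 0" "min t (\<gamma> (\<gamma>' t)) \<le> 1 / (r + s)"
    have nn: "\<gamma>' t \<ge> 0" using \<gamma>'(1) t by (simp add: time_change_nonneg)
    \<comment> \<open>Only one of the two end times is known to be small. If it is \<open>t\<close>,
      the middle time is reached forwards by a shift of at most \<open>s\<close>; otherwise it is
      reached backwards from \<open>\<gamma> (\<gamma>' t)\<close> by a shift of at most
      \<open>r\<close>.\<close>
    have "min (\<gamma>' t) (\<gamma> (\<gamma>' t)) \<le> 1 / r \<and> min t (\<gamma>' t) \<le> 1 / s"
    proof (cases "t \<le> 1 / (r + s)")
      case True
      then have "min t (\<gamma>' t) \<le> 1 / s" using mono by linarith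
      moreover have "\<gamma>' t \<le> 1 / (r + s) + s"
        using \<gamma>'(2)[OF t(1) calculation] True by linarith
      ultimately show ?thesis using horizon[of r s] assms by linarith
    next
      case False
      then have *: "min (\<gamma>' t) (\<gamma> (\<gamma>' t)) \<le> 1 / r" using mono t by linarith
      have "\<gamma>' t \<le> 1 / (s + r) + r" using \<gamma>(2)[OF nn *] False t by (simp add: add.commute) linarith
      then show ?thesis using * horizon[of s r] assms by linarith
    qed
    then have m: "min (\<gamma>' t) (\<gamma> (\<gamma>' t)) \<le> 1 / r" "min t (\<gamma>' t) \<le> 1 / s" by simp_all
    note \<gamma>(2)[OF nn m(1)] \<gamma>'(2)[OF t(1) m(2)]
    then show "norm (x (\<gamma> (\<gamma>' t)) - z t) \<le> r + s" "\<bar>\<gamma> (\<gamma>' t) - t\<bar> \<le> r + s"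
      using norm_triangle_ineq[of "x (\<gamma> (\<gamma>' t)) - y (\<gamma>' t)" "y (\<gamma>' t) - z t"]
      unfolding diff_add_cancel add_diff_eq by linarith+
  qed
qed

lemma sk_close_refl: "0 < r \<Longrightarrow> sk_close r x x"
  unfolding sk_close_def by (intro exI[of _ "\<lambda>t. t"]) (auto simp: time_change_id)

text \<open>The cap at 1 matches \<open>sk_close_trans\<close>, which covers only radii with sum at
  most 1; it also keeps the set nonempty, so that the infimum is meaningful.\<close>

definition sk_dist :: "(real \<Rightarrow> 'b::real_normed_vector) \<Rightarrow> (real \<Rightarrow> 'b) \<Rightarrow> real" where
  "sk_dist x y = Inf (insert 1 {r. 0 < r \<and> sk_close r x y})"

lemma sk_dist_bdd: "bdd_below (insert 1 {r. 0 < r \<and> sk_close r x y})"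
  by (intro bdd_belowI[of _ 0]) auto

lemma sk_dist_nonneg: "0 \<le> sk_dist x y"
  unfolding sk_dist_def by (intro cInf_greatest) auto

lemma sk_dist_le_1: "sk_dist x y \<le> 1"
  unfolding sk_dist_def by (intro cInf_lower sk_dist_bdd) auto

lemma sk_dist_le: "0 < r \<Longrightarrow> sk_close r x y \<Longrightarrow> sk_dist x y \<le> r"
  unfolding sk_dist_def by (intro cInf_lower sk_dist_bdd) auto

lemma sk_dist_lessD:
  assumes "sk_dist x y < c" "c \<le> 1"
  obtains r where "0 < r" "r < c" "sk_close r x y"
  using cInf_lessD[OF _ assms(1)[unfolded sk_dist_def]] assms(2) by auto

lemma sk_dist_sym: "sk_dist x y = sk_dist y x"
  unfolding sk_dist_def using sk_close_sym by metis

lemma sk_dist_self: "sk_dist x x = 0"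
proof (rule antisym[OF field_le_epsilon sk_dist_nonneg])
  show "sk_dist x x \<le> 0 + e" if "0 < e" for e
    using sk_dist_le[OF that sk_close_refl[OF that]] by simp
qed

lemma sk_dist_triangle: "sk_dist x z \<le> sk_dist x y + sk_dist y z"
proof (rule field_le_epsilon)
  fix e :: real assume e: "0 < e"
  let ?a = "sk_dist x y" and ?b = "sk_dist y z"
  show "sk_dist x z \<le> ?a + ?b + e"
  proof (cases "?a + ?b + e \<le> 1")
    case True
    have ab: "0 \<le> ?a" "0 \<le> ?b" by (simp_all add: sk_dist_nonneg)
    have "?a < ?a + e / 2" "?a + e / 2 \<le> 1" using True e ab by auto
    then obtain r where r: "0 < r" "r < ?a + e / 2" "sk_close r x y"
      by (elim sk_dist_lessD)
    have "?b < ?b + e / 2" "?b + e / 2 \<le> 1" using True e ab by auto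
    then obtain s where s: "0 < s" "s < ?b + e / 2" "sk_close s y z"
      by (elim sk_dist_lessD)
    have "sk_close (r + s) x z" using r s True by (intro sk_close_trans) auto
    then show ?thesis using sk_dist_le[of "r + s" x z] r s by auto
  next
    case False
    then show ?thesis using sk_dist_le_1[of x z] by linarith
  qed
qed

text \<open>Links the metric to the convergence that defines the topology; through it, functionals
  continuous for \<open>skorohod_topology\<close> become sequentially continuous along
  \<open>sk_dist\<close>. The infimum need not be attained, so the time changes come from radii
  slightly above the distance.\<close>

lemma skorohod_tendsto_sk_dist:
  assumes "(\<lambda>n. sk_dist (xs n) x) \<longlonglongrightarrow> 0"
  shows "skorohod_tendsto xs x"
proof -
  define Q where "Q n c \<gamma> \<longleftrightarrow> (\<exists>r>0. r < c \<and> (\<forall>t\<ge>0. min t (\<gamma> t) \<le> 1 / r \<longrightarrow>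
      norm (xs n (\<gamma> t) - x t) \<le> r \<and> \<bar>\<gamma> t - t\<bar> \<le> r))" for n c and \<gamma> :: "real \<Rightarrow> real"
  \<comment> \<open>The identity is the default where the tolerance exceeds 1:
    \<open>skorohod_tendsto\<close> asks for a time change at every index, while closeness matters
    only eventually.\<close>
  have ex: "\<exists>\<gamma>. time_change \<gamma> \<and> (sk_dist (xs n) x < c \<and> c \<le> 1 \<longrightarrow> Q n c \<gamma>)" for n c
  proof (cases "sk_dist (xs n) x < c \<and> c \<le> 1")
    case True
    then obtain r where r: "0 < r" "r < c" "sk_close r (xs n) x" by (elim conjE sk_dist_lessD)
    from r(3) obtain \<gamma> where "time_change \<gamma>" "\<forall>t\<ge>0. min t (\<gamma> t) \<le> 1 / r \<longrightarrow>
      norm (xs n (\<gamma> t) - x t) \<le> r \<and> \<bar>\<gamma> t - t\<bar> \<le> r" unfolding sk_close_def by blast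
    with r(1,2) have "time_change \<gamma> \<and> Q n c \<gamma>" unfolding Q_def by blast
    then show ?thesis by blast
  next
    case False
    then show ?thesis using time_change_id by blast
  qed
  define G where "G n c = (SOME \<gamma>. time_change \<gamma> \<and> (sk_dist (xs n) x < c \<and> c \<le> 1 \<longrightarrow> Q n c \<gamma>))" for n c
  have "time_change (G n c) \<and> (sk_dist (xs n) x < c \<and> c \<le> 1 \<longrightarrow> Q n c (G n c))" for n c
    unfolding G_def by (rule someI_ex[OF ex])
  then have G: "time_change (G n c)" "sk_dist (xs n) x < c \<Longrightarrow> c \<le> 1 \<Longrightarrow> Q n c (G n c)" for n c
    by blast+
  define c where "c n = sk_dist (xs n) x + inverse (real (Suc n))" for n
  have c: "c \<longlonglongrightarrow> 0"
    unfolding c_def using tendsto_add[OF assms LIMSEQ_inverse_real_of_nat] by simp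
  have less: "sk_dist (xs n) x < c n" for n by (simp add: c_def)
  show ?thesis unfolding skorohod_tendsto_def
  proof (rule exI[of _ "\<lambda>n. G n (c n)"], intro conjI allI impI)
    show "strict_mono_on {0..} (G n (c n))" "bij_betw (G n (c n)) {0..} {0..}" for n
      using G(1)[of n "c n"] by (auto simp: time_change_def)
    fix T :: real assume T: "T > 0"
    show "uniform_limit {0..T} (\<lambda>n t. norm (xs n (G n (c n) t) - x t) + \<bar>G n (c n) t - t\<bar>)
        (\<lambda>_. 0) sequentially"
      unfolding uniform_limit_iff
    proof (intro allI impI)
      fix e :: real assume e: "0 < e"
      \<comment> \<open>A radius below \<open>1 / T\<close> has its horizon \<open>1 / r\<close>
        beyond T, and below \<open>e / 2\<close> the two summands, each at most r, stay under
        e.\<close>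
      have "\<forall>\<^sub>F n in sequentially. c n < min 1 (min (1 / T) (e / 2))"
        using order_tendstoD(2)[OF c, of "min 1 (min (1 / T) (e / 2))"] T e by simp
      then show "\<forall>\<^sub>F n in sequentially. \<forall>t\<in>{0..T}.
          dist (norm (xs n (G n (c n) t) - x t) + \<bar>G n (c n) t - t\<bar>) 0 < e"
      proof eventually_elim
        case (elim n)
        then obtain r where r: "r > 0" "r < c n" "\<And>t. t \<ge> 0 \<Longrightarrow> min t (G n (c n) t) \<le> 1 / r \<Longrightarrow>
            norm (xs n (G n (c n) t) - x t) \<le> r \<and> \<bar>G n (c n) t - t\<bar> \<le> r"
          using G(2)[OF less[of n]] unfolding Q_def by auto
        have "T \<le> 1 / r"
        proof -
          have "r < 1 / T" using r elim by linarith
          then show ?thesis using T r(1) by (simp add: field_simps)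
        qed
        show ?case
        proof
          fix t assume t: "t \<in> {0..T}"
          then have "min t (G n (c n) t) \<le> 1 / r" using \<open>T \<le> 1 / r\<close> by auto
          then have "norm (xs n (G n (c n) t) - x t) \<le> r \<and> \<bar>G n (c n) t - t\<bar> \<le> r"
            using r(3) t by auto
          then show "dist (norm (xs n (G n (c n) t) - x t) + \<bar>G n (c n) t - t\<bar>) 0 < e"
            using r elim by auto
        qed
      qed
    qed
  qed
qed

text \<open>Open sets of the topology are sequentially open by definition, so the preimage of a
  neighbourhood of \<open>\<Phi> x\<close> eventually contains the sequence.\<close>

lemma continuous_skorohod_tendsto:
  fixes \<Phi> :: "(real \<Rightarrow> 'b::real_normed_vector) \<Rightarrow> real"
  assumes "continuous_map skorohod_topology euclideanreal \<Phi>"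
    and "x \<in> skorohod_space" "\<And>n. xs n \<in> skorohod_space"
    and "(\<lambda>n. sk_dist (xs n) x) \<longlonglongrightarrow> 0"
  shows "(\<lambda>n. \<Phi> (xs n)) \<longlonglongrightarrow> \<Phi> x"
proof (rule topological_tendstoI)
  fix S :: "real set" assume S: "open S" "\<Phi> x \<in> S"
  let ?G = "{y \<in> topspace skorohod_topology. \<Phi> y \<in> S}"
  have "openin skorohod_topology ?G"
    using assms(1) S by (simp add: continuous_map_def)
  moreover have "x \<in> ?G" using assms(2) S by (simp add: topspace_skorohod_topology)
  ultimately have "\<forall>\<^sub>F n in sequentially. xs n \<in> ?G"
    unfolding openin_skorohod_topology using assms(3) skorohod_tendsto_sk_dist[OF assms(4)] by blast
  then show "\<forall>\<^sub>F n in sequentially. \<Phi> (xs n) \<in> S" by (rule eventually_mono) simp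
qed

text \<open>The largest \<open>k\<close>-Lipschitz function below \<open>\<Phi>\<close>. Approximating \<open>\<Phi>\<close> from below by
  these functions replaces the compactness arguments of the usual proofs of convergence in law.\<close>

definition lip_env :: "((real \<Rightarrow> 'b::real_normed_vector) \<Rightarrow> real) \<Rightarrow> real \<Rightarrow> (real \<Rightarrow> 'b) \<Rightarrow> real" where
  "lip_env \<Phi> k x = (INF y\<in>skorohod_space. \<Phi> y + k * sk_dist x y)"

context
  fixes \<Phi> :: "(real \<Rightarrow> 'b::real_normed_vector) \<Rightarrow> real" and C :: real
  assumes bound: "\<And>x. x \<in> skorohod_space \<Longrightarrow> \<bar>\<Phi> x\<bar> \<le> C"
begin

lemma lip_env_bdd:
  assumes "0 \<le> k"
  shows "bdd_below ((\<lambda>y. \<Phi> y + k * sk_dist x y) ` skorohod_space)"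
proof (intro bdd_belowI2)
  fix y :: "real \<Rightarrow> 'b" assume "y \<in> skorohod_space"
  then have "- C \<le> \<Phi> y" using bound[of y] by (simp add: abs_le_iff)
  moreover have "0 \<le> k * sk_dist x y" by (intro mult_nonneg_nonneg assms sk_dist_nonneg)
  ultimately show "- C \<le> \<Phi> y + k * sk_dist x y" by simp
qed

lemma lip_env_le:
  assumes "0 \<le> k" "x \<in> skorohod_space"
  shows "lip_env \<Phi> k x \<le> \<Phi> x"
proof -
  have "(INF y\<in>skorohod_space. \<Phi> y + k * sk_dist x y) \<le> \<Phi> x + k * sk_dist x x"
    by (rule cINF_lower[OF lip_env_bdd[OF assms(1)] assms(2)])
  then show ?thesis by (simp add: sk_dist_self lip_env_def)
qed

lemma lip_env_ge:
  assumes "0 \<le> k" "x \<in> skorohod_space"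
  shows "- C \<le> lip_env \<Phi> k x"
  unfolding lip_env_def
proof (rule cINF_greatest)
  show "skorohod_space \<noteq> ({} :: (real \<Rightarrow> 'b) set)" using assms(2) by (rule_tac ex_in_conv[THEN iffD1], rule_tac exI)
  show "- C \<le> \<Phi> y + k * sk_dist x y" if "y \<in> skorohod_space" for y
    using bound[OF that] mult_nonneg_nonneg[OF assms(1) sk_dist_nonneg[of x y]] by linarith
qed

lemma lip_env_abs:
  assumes "0 \<le> k" "x \<in> skorohod_space"
  shows "\<bar>lip_env \<Phi> k x\<bar> \<le> C"
  using lip_env_le[OF assms] lip_env_ge[OF assms] bound[OF assms(2)] by linarith

lemma lip_env_lipschitz:
  assumes "0 \<le> k" "x \<in> skorohod_space"
  shows "lip_env \<Phi> k x \<le> lip_env \<Phi> k x' + k * sk_dist x x'"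
proof -
  have "lip_env \<Phi> k x - k * sk_dist x x' \<le> lip_env \<Phi> k x'"
    unfolding lip_env_def[of \<Phi> k x']
  proof (rule cINF_greatest)
    show "skorohod_space \<noteq> ({} :: (real \<Rightarrow> 'b) set)" using assms(2) by (rule_tac ex_in_conv[THEN iffD1], rule_tac exI)
    fix y :: "real \<Rightarrow> 'b" assume y: "y \<in> skorohod_space"
    have "lip_env \<Phi> k x \<le> \<Phi> y + k * sk_dist x y"
      unfolding lip_env_def by (rule cINF_lower[OF lip_env_bdd[OF assms(1)] y])
    moreover have "k * sk_dist x y \<le> k * sk_dist x x' + k * sk_dist x' y"
      using mult_left_mono[OF sk_dist_triangle assms(1)] by (simp add: distrib_left)
    ultimately show "lip_env \<Phi> k x - k * sk_dist x x' \<le> \<Phi> y + k * sk_dist x' y" by simp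
  qed
  then show ?thesis by simp
qed

lemma lip_env_abs_diff:
  assumes "0 \<le> k" "x \<in> skorohod_space" "x' \<in> skorohod_space"
  shows "\<bar>lip_env \<Phi> k x - lip_env \<Phi> k x'\<bar> \<le> k * sk_dist x x'"
  using lip_env_lipschitz[OF assms(1,2), of x'] lip_env_lipschitz[OF assms(1,3), of x]
  by (simp add: sk_dist_sym)

text \<open>A near-minimizer \<open>y k\<close> of the envelope pays at most the oscillation 2C of
  \<Phi> plus the slack 1 for its distance, hence \<open>sk_dist (y k) x\<close> is O(1/k).
  Continuity then gives convergence of \<open>\<Phi> (y k)\<close> to \<open>\<Phi> x\<close>, and
  the envelope is squeezed between \<open>\<Phi> (y k)\<close>, up to the slack, and
  \<open>\<Phi> x\<close>.\<close>

lemma lip_env_tendsto: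
  assumes cont: "continuous_map skorohod_topology euclideanreal \<Phi>" and x: "x \<in> skorohod_space"
  shows "(\<lambda>k. lip_env \<Phi> (real k) x) \<longlonglongrightarrow> \<Phi> x"
proof -
  have "\<exists>y\<in>skorohod_space. \<Phi> y + real k * sk_dist x y < lip_env \<Phi> (real k) x + inverse (real (Suc k))" for k
  proof -
    have "(INF y\<in>skorohod_space. \<Phi> y + real k * sk_dist x y) < lip_env \<Phi> (real k) x + inverse (real (Suc k))"
      unfolding lip_env_def by simp
    then show ?thesis
      using cINF_less_iff[OF _ lip_env_bdd[of "real k" x]] x by auto
  qed
  then obtain y where y: "\<And>k. y k \<in> skorohod_space"
    "\<And>k. \<Phi> (y k) + real k * sk_dist x (y k) < lip_env \<Phi> (real k) x + inverse (real (Suc k))"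
    by metis
  have "real k * sk_dist (y k) x \<le> 2 * C + 1" for k
  proof -
    have "lip_env \<Phi> (real k) x \<le> C" using lip_env_abs[of "real k" x] x by auto
    moreover have "- C \<le> \<Phi> (y k)" using bound[OF y(1)[of k]] by auto
    moreover have "inverse (real (Suc k)) \<le> 1" by (simp add: inverse_le_1_iff)
    ultimately show ?thesis using y(2)[of k] by (simp add: sk_dist_sym)
  qed
  then have le: "sk_dist (y k) x \<le> (2 * C + 1) * inverse (real k)" if "k > 0" for k
    using that by (simp add: field_simps)
  have lim0: "(\<lambda>k. sk_dist (y k) x) \<longlonglongrightarrow> 0"
  proof (rule tendsto_sandwich[OF _ _ tendsto_const])
    show "(\<lambda>k. (2 * C + 1) * inverse (real k)) \<longlonglongrightarrow> 0"
      using tendsto_mult_left[OF lim_inverse_n[where 'a=real], of "2 * C + 1"] by simp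
    show "\<forall>\<^sub>F k in sequentially. sk_dist (y k) x \<le> (2 * C + 1) * inverse (real k)"
      using eventually_gt_at_top[of 0] by eventually_elim (rule le)
  qed (simp add: sk_dist_nonneg)
  have lim: "(\<lambda>k. \<Phi> (y k) - inverse (real (Suc k))) \<longlonglongrightarrow> \<Phi> x - 0"
    using continuous_skorohod_tendsto[OF cont x y(1) lim0] LIMSEQ_inverse_real_of_nat
    by (intro tendsto_diff)
  show ?thesis
  proof (rule tendsto_sandwich)
    show "(\<lambda>k. \<Phi> (y k) - inverse (real (Suc k))) \<longlonglongrightarrow> \<Phi> x" using lim by simp
    show "(\<lambda>k. \<Phi> x) \<longlonglongrightarrow> \<Phi> x" by simp
    show "\<forall>\<^sub>F k in sequentially. lip_env \<Phi> (real k) x \<le> \<Phi> x"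
      using lip_env_le[OF _ x] by simp
    show "\<forall>\<^sub>F k in sequentially. \<Phi> (y k) - inverse (real (Suc k)) \<le> lip_env \<Phi> (real k) x"
    proof (rule always_eventually, rule allI)
      fix k
      have "0 \<le> real k * sk_dist x (y k)" by (simp add: sk_dist_nonneg)
      then show "\<Phi> (y k) - inverse (real (Suc k)) \<le> lip_env \<Phi> (real k) x" using y(2)[of k] by linarith
    qed
  qed
qed

end


section \<open>Discretization of paths\<close>

definition sk_step :: "nat \<Rightarrow> (nat \<Rightarrow> 'b) \<Rightarrow> real \<Rightarrow> 'b" where
  "sk_step m z = (\<lambda>t\<in>{0..}. z (nat \<lfloor>real m * t\<rfloor>))"

lemma eventually_floor_right:
  fixes t :: real
  assumes "0 < c"
  shows "\<forall>\<^sub>F s in at_right t. \<lfloor>c * s\<rfloor> = \<lfloor>c * t\<rfloor>"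
proof -
  have "c * t < of_int (\<lfloor>c * t\<rfloor> + 1)" by linarith
  then have "t < of_int (\<lfloor>c * t\<rfloor> + 1) / c" using assms by (simp add: pos_less_divide_eq mult.commute)
  then show ?thesis
  proof (rule eventually_at_rightI[rotated])
    fix s assume s: "s \<in> {t<..<of_int (\<lfloor>c * t\<rfloor> + 1) / c}"
    then have "c * t \<le> c * s" "c * s < of_int (\<lfloor>c * t\<rfloor> + 1)"
      using assms by (auto simp: pos_less_divide_eq mult.commute)
    then show "\<lfloor>c * s\<rfloor> = \<lfloor>c * t\<rfloor>" by linarith
  qed
qed

text \<open>Ceiling minus one instead of the floor: where \<open>c * t\<close> is an integer the
  floor jumps exactly at t, and elsewhere both agree.\<close>

lemma eventually_floor_left:
  fixes t :: real
  assumes "0 < c"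
  shows "\<forall>\<^sub>F s in at_left t. \<lfloor>c * s\<rfloor> = \<lceil>c * t\<rceil> - 1"
proof -
  have "of_int (\<lceil>c * t\<rceil> - 1) < c * t" by linarith
  then have "of_int (\<lceil>c * t\<rceil> - 1) / c < t" using assms by (simp add: pos_divide_less_eq mult.commute)
  then show ?thesis
  proof (rule eventually_at_leftI[rotated])
    fix s assume s: "s \<in> {of_int (\<lceil>c * t\<rceil> - 1) / c<..<t}"
    then have "c * s < c * t" "of_int (\<lceil>c * t\<rceil> - 1) < c * s"
      using assms by (auto simp: pos_divide_less_eq mult.commute)
    then show "\<lfloor>c * s\<rfloor> = \<lceil>c * t\<rceil> - 1" by linarith
  qed
qed

lemma cadlag_floor:
  fixes z :: "nat \<Rightarrow> 'b::real_normed_vector"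
  assumes "0 < c" "\<And>t. 0 \<le> t \<Longrightarrow> x t = z (nat \<lfloor>c * t\<rfloor>)"
  shows "cadlag x"
  unfolding cadlag_def
proof (intro conjI allI impI)
  fix t :: real assume t: "0 \<le> t"
  have "\<forall>\<^sub>F s in at_right t. x s = x t"
    using eventually_floor_right[OF assms(1), of t] eventually_at_right_less[of t]
    by eventually_elim (use t assms(2) in auto)
  then show "(x \<longlongrightarrow> x t) (at_right t)" by (rule tendsto_eventually)
next
  fix t :: real assume t: "0 < t"
  have "\<forall>\<^sub>F s in at_left t. 0 < s" using t by (rule eventually_at_left_real[THEN eventually_mono]) auto
  with eventually_floor_left[OF assms(1), of t]
  have "\<forall>\<^sub>F s in at_left t. x s = z (nat (\<lceil>c * t\<rceil> - 1))"
    by eventually_elim (use assms(2) in auto)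
  then show "\<exists>l. (x \<longlongrightarrow> l) (at_left t)" using tendsto_eventually by blast
qed

text \<open>The free rate \<open>c\<close> serves both kinds of step paths: the grid has rate m, the
  walk has rate \<open>inverse \<epsilon>\<close>.\<close>

lemma skorohod_space_floor:
  fixes z :: "nat \<Rightarrow> 'b::real_normed_vector"
  assumes "0 < c"
  shows "(\<lambda>t\<in>{0..}. z (nat \<lfloor>c * t\<rfloor>)) \<in> skorohod_space"
  unfolding skorohod_space_def using cadlag_floor[OF assms, of "\<lambda>t\<in>{0..}. z (nat \<lfloor>c * t\<rfloor>)" z] by simp

lemma sk_step_in_space: "0 < m \<Longrightarrow> sk_step m z \<in> skorohod_space"
  for z :: "nat \<Rightarrow> 'b::real_normed_vector"
  unfolding sk_step_def by (rule skorohod_space_floor) simp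

lemma sk_dist_step:
  fixes z z' :: "nat \<Rightarrow> 'b::real_normed_vector"
  assumes "0 < r" "\<And>k. real k \<le> real m * (1 / r) \<Longrightarrow> norm (z k - z' k) \<le> r"
  shows "sk_dist (sk_step m z) (sk_step m z') \<le> r"
proof (rule sk_dist_le[OF assms(1)])
  show "sk_close r (sk_step m z) (sk_step m z')"
    unfolding sk_close_def
  proof (intro exI[of _ "\<lambda>t. t"] conjI allI impI)
    show "time_change (\<lambda>t. t)" by (rule time_change_id)
    fix t :: real assume t: "0 \<le> t" "min t t \<le> 1 / r"
    have "real (nat \<lfloor>real m * t\<rfloor>) \<le> real m * t" using t by simp
    also have "\<dots> \<le> real m * (1 / r)" using t by (intro mult_left_mono) auto
    finally show "norm (sk_step m z t - sk_step m z' t) \<le> r"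
      using t assms(2) by (simp add: sk_step_def)
    show "\<bar>t - t\<bar> \<le> r" using assms by simp
  qed
qed

text \<open>Slope at least 1/2 gives strict monotonicity, and bounded displacement gives
  surjectivity by the intermediate value theorem, since the value y is reached no later than at
  \<open>y + c\<close>.\<close>

lemma time_change_perturb:
  fixes \<delta> :: "real \<Rightarrow> real"
  assumes lip: "\<And>s t. 0 \<le> s \<Longrightarrow> s \<le> t \<Longrightarrow> \<bar>\<delta> t - \<delta> s\<bar> \<le> (t - s) / 2"
    and z: "\<delta> 0 = 0" and b: "\<And>t. 0 \<le> t \<Longrightarrow> \<bar>\<delta> t\<bar> \<le> c"
  shows "time_change (\<lambda>t. t + \<delta> t)"
proof -
  have mono: "s + \<delta> s < t + \<delta> t" if "0 \<le> s" "s < t" for s t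
    using abs_le_D2[OF lip[OF that(1) less_imp_le[OF that(2)]]] that by (simp add: field_simps)
  have "continuous_on {0..} (\<lambda>t. t + \<delta> t)"
  proof -
    have "(1/2)-lipschitz_on {0..} \<delta>"
    proof (rule lipschitz_onI)
      fix s t :: real assume "s \<in> {0..}" "t \<in> {0..}"
      then show "dist (\<delta> s) (\<delta> t) \<le> 1/2 * dist s t"
        using lip[of s t] lip[of t s] by (cases "s \<le> t") (auto simp: dist_real_def abs_minus_commute)
    qed simp
    then show ?thesis by (intro continuous_intros lipschitz_on_continuous_on)
  qed
  then have cont: "continuous_on {0..T} (\<lambda>t. t + \<delta> t)" for T
    by (rule continuous_on_subset) auto
  have nn: "0 \<le> t + \<delta> t" if "0 \<le> t" for t
    using mono[of 0 t] that z by (cases "t = 0") auto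
  have "y \<in> (\<lambda>t. t + \<delta> t) ` {0..}" if y: "0 \<le> y" for y
  proof -
    have c: "0 \<le> c" using b[of 0] by simp
    have "\<exists>t\<ge>0. t \<le> y + c \<and> t + \<delta> t = y"
    proof (rule IVT')
      show "0 + \<delta> 0 \<le> y" using z y by simp
      show "y \<le> (y + c) + \<delta> (y + c)" using b[of "y + c"] y c by linarith
      show "0 \<le> y + c" using y c by simp
    qed (rule cont)
    then show ?thesis by force
  qed
  then have "(\<lambda>t. t + \<delta> t) ` {0..} = {0..}" using nn by auto
  moreover have sm: "strict_mono_on {0..} (\<lambda>t. t + \<delta> t)"
    using mono by (auto intro: strict_mono_onI)
  moreover have "inj_on (\<lambda>t. t + \<delta> t) {0..}" by (rule strict_mono_on_imp_inj_on[OF sm])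
  ultimately show ?thesis by (simp add: time_change_def bij_betw_def)
qed

text \<open>McShane extension of the shifts \<open>a \<mapsto> \<lceil>m a\<rceil> / m - a\<close>, which are
  \<open>1/2\<close>-Lipschitz on a set with gaps of length at least \<open>2 / m\<close>.\<close>

lemma time_change_to_grid:
  assumes A: "finite A" "0 \<in> A" "A \<subseteq> {0..}" and m: "0 < m"
    and gap: "\<And>a b. a \<in> A \<Longrightarrow> b \<in> A \<Longrightarrow> a < b \<Longrightarrow> 2 / real m \<le> b - a"
  shows "\<exists>\<gamma>. time_change \<gamma> \<and> (\<forall>t\<ge>0. \<bar>\<gamma> t - t\<bar> \<le> 1 / real m) \<and>
    (\<forall>a\<in>A. \<gamma> a = of_int \<lceil>real m * a\<rceil> / real m)"
proof -
  define g where "g a = of_int \<lceil>real m * a\<rceil> / real m - a" for a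
  \<comment> \<open>All shifts lie between 0 and 1/m, and the cap \<open>1 / real m\<close> keeps
    \<delta> in that range far from A. The slope 1/2 of the cones is (1/m)/(2/m): the largest
    difference of two shifts over the least gap.\<close>
  define \<delta> where "\<delta> t = Min (insert (1 / real m) ((\<lambda>a. g a + \<bar>t - a\<bar> / 2) ` A))" for t
  have g: "0 \<le> g a" "g a \<le> 1 / real m" for a
  proof -
    have "real m * a \<le> of_int \<lceil>real m * a\<rceil>" "of_int \<lceil>real m * a\<rceil> \<le> real m * a + 1" by linarith+
    then have "real m * a / real m \<le> of_int \<lceil>real m * a\<rceil> / real m"
      "of_int \<lceil>real m * a\<rceil> / real m \<le> (real m * a + 1) / real m"
      by (intro divide_right_mono; simp)+
    then show "0 \<le> g a" "g a \<le> 1 / real m" using m unfolding g_def by (simp_all add: add_divide_distrib)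
  qed
  have fin: "finite (insert (1 / real m) ((\<lambda>a. g a + \<bar>t - a\<bar> / 2) ` A))" for t using A by simp
  have \<delta>: "0 \<le> \<delta> t" "\<delta> t \<le> 1 / real m" for t
    unfolding \<delta>_def using fin g m by (auto intro!: add_nonneg_nonneg)
  have \<delta>A: "\<delta> a = g a" if a: "a \<in> A" for a
  proof (rule antisym)
    show "\<delta> a \<le> g a" unfolding \<delta>_def using fin a by (intro Min_le) (auto intro!: image_eqI[of _ _ a])
    have "g a \<le> g b + \<bar>a - b\<bar> / 2" if b: "b \<in> A" for b
    proof (cases "a = b")
      case False
      then have "2 / real m \<le> \<bar>a - b\<bar>" using gap[OF a b] gap[OF b a] by linarith
      then have "1 / real m \<le> \<bar>a - b\<bar> / 2" by simp
      then show ?thesis using g[of a] g[of b] by linarith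
    qed simp
    then show "g a \<le> \<delta> a" unfolding \<delta>_def using fin g by auto
  qed
  have half: "\<delta> t \<le> \<delta> s + \<bar>t - s\<bar> / 2" for s t
  proof -
    have "\<delta> s \<in> insert (1 / real m) ((\<lambda>a. g a + \<bar>s - a\<bar> / 2) ` A)"
      unfolding \<delta>_def by (rule Min_in[OF fin]) simp
    then consider "\<delta> s = 1 / real m" | a where "a \<in> A" "\<delta> s = g a + \<bar>s - a\<bar> / 2" by auto
    then show ?thesis
    proof cases
      case 1
      then show ?thesis using add_mono[OF \<delta>(2)[of t], of 0 "\<bar>t - s\<bar> / 2"] by simp
    next
      case 2
      have "\<delta> t \<le> g a + \<bar>t - a\<bar> / 2" unfolding \<delta>_def using fin 2 by (intro Min_le) auto
      moreover have "\<bar>t - a\<bar> \<le> \<bar>s - a\<bar> + \<bar>t - s\<bar>" by linarith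
      then have "\<bar>t - a\<bar> / 2 \<le> \<bar>s - a\<bar> / 2 + \<bar>t - s\<bar> / 2" by (simp add: field_simps)
      ultimately show ?thesis using 2 by simp
    qed
  qed
  show ?thesis
  proof (intro exI[of _ "\<lambda>t. t + \<delta> t"] conjI allI ballI impI)
    show "time_change (\<lambda>t. t + \<delta> t)"
    proof (rule time_change_perturb)
      fix s t :: real assume "0 \<le> s" "s \<le> t"
      then show "\<bar>\<delta> t - \<delta> s\<bar> \<le> (t - s) / 2"
        using half[of s t] half[of t s] unfolding abs_le_iff by (simp add: field_simps)
    next
      show "\<delta> 0 = 0" using \<delta>A[OF A(2)] by (simp add: g_def)
      show "\<bar>\<delta> t\<bar> \<le> 1 / real m" for t using \<delta>[of t] by simp
    qed
    show "\<bar>t + \<delta> t - t\<bar> \<le> 1 / real m" for t using \<delta>[of t] by simp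
    show "a + \<delta> a = of_int \<lceil>real m * a\<rceil> / real m" if "a \<in> A" for a
      using \<delta>A[OF that] by (simp add: g_def)
  qed
qed

text \<open>The time change carries each point of \<open>A\<close> to the first grid point after it.
  Rounding down to the grid then never crosses a point of A, so only the oscillation of x inside a
  cell between consecutive points of A counts. The horizon is enlarged by 1 because the time change
  may push beyond \<open>1 / r\<close>.\<close>

lemma sk_close_discretization:
  fixes x :: "real \<Rightarrow> 'b::real_normed_vector"
  assumes A: "finite A" "0 \<in> A" "A \<subseteq> {0..}" and m: "0 < m" "1 / real m \<le> r"
    and gap: "\<And>a b. a \<in> A \<Longrightarrow> b \<in> A \<Longrightarrow> a < b \<Longrightarrow> 2 / real m \<le> b - a"
    and osc: "\<And>s t. 0 \<le> s \<Longrightarrow> 0 \<le> t \<Longrightarrow> s \<le> 1 / r + 1 \<Longrightarrow> t \<le> 1 / r + 1 \<Longrightarrow>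
      \<bar>s - t\<bar> \<le> 2 / real m \<Longrightarrow> (\<And>a. a \<in> A \<Longrightarrow> a \<le> s \<longleftrightarrow> a \<le> t) \<Longrightarrow> norm (x s - x t) \<le> r"
  shows "sk_close r (sk_step m (\<lambda>k. x (real k / real m))) x"
proof -
  obtain \<gamma> where \<gamma>: "time_change \<gamma>" "\<And>t. 0 \<le> t \<Longrightarrow> \<bar>\<gamma> t - t\<bar> \<le> 1 / real m"
    "\<And>a. a \<in> A \<Longrightarrow> \<gamma> a = of_int \<lceil>real m * a\<rceil> / real m"
    using time_change_to_grid[OF A m(1)] gap by blast
  show ?thesis unfolding sk_close_def
  proof (rule exI[of _ \<gamma>], intro conjI allI impI \<gamma>(1))
    fix t :: real assume t: "0 \<le> t" "min t (\<gamma> t) \<le> 1 / r"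
    show "\<bar>\<gamma> t - t\<bar> \<le> r" using \<gamma>(2)[OF t(1)] m by linarith
    have g0: "0 \<le> \<gamma> t" using \<gamma>(1) t(1) by (rule time_change_nonneg)
    \<comment> \<open>The grid point at which the step path reads x when evaluated at
      \<open>\<gamma> t\<close>. It is within 2/m of t: 1/m from the time change and 1/m from
      rounding down.\<close>
    define u where "u = real (nat \<lfloor>real m * \<gamma> t\<rfloor>) / real m"
    have u_eq: "u = of_int \<lfloor>real m * \<gamma> t\<rfloor> / real m" using g0 by (simp add: u_def)
    have "of_int \<lfloor>real m * \<gamma> t\<rfloor> \<le> real m * \<gamma> t" "real m * \<gamma> t - 1 \<le> of_int \<lfloor>real m * \<gamma> t\<rfloor>" by linarith+
    then have "of_int \<lfloor>real m * \<gamma> t\<rfloor> / real m \<le> real m * \<gamma> t / real m"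
      "(real m * \<gamma> t - 1) / real m \<le> of_int \<lfloor>real m * \<gamma> t\<rfloor> / real m"
      by (intro divide_right_mono; simp)+
    then have u: "u \<le> \<gamma> t" "\<gamma> t - 1 / real m \<le> u"
      using m unfolding u_eq by (simp_all add: diff_divide_distrib)
    have m1: "1 / real m \<le> 1" using m by simp
    have tg: "t \<le> 1 / r + 1" "\<gamma> t \<le> 1 / r + 1" using t \<gamma>(2)[OF t(1)] m1 by linarith+
    have "norm (x u - x t) \<le> r"
    proof (rule osc)
      show "0 \<le> u" by (simp add: u_def)
      show "\<bar>u - t\<bar> \<le> 2 / real m" using u \<gamma>(2)[OF t(1)] by linarith
      fix a assume a: "a \<in> A"
      \<comment> \<open>Because \<open>\<gamma> a\<close> is a grid point, the comparison becomes
        one between integers, and these do not see the rounding of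
        \<open>\<gamma> t\<close>.\<close>
      have "a \<le> t \<longleftrightarrow> \<gamma> a \<le> \<gamma> t"
        using time_change_le_iff[OF \<gamma>(1)] a A(3) t(1) by auto
      also have "\<dots> \<longleftrightarrow> of_int \<lceil>real m * a\<rceil> \<le> real m * \<gamma> t"
        using m \<gamma>(3)[OF a] by (simp add: pos_divide_le_eq mult.commute)
      also have "\<dots> \<longleftrightarrow> \<lceil>real m * a\<rceil> \<le> \<lfloor>real m * \<gamma> t\<rfloor>" by (simp add: le_floor_iff)
      also have "\<dots> \<longleftrightarrow> real m * a \<le> of_int \<lfloor>real m * \<gamma> t\<rfloor>" by (simp add: ceiling_le_iff)
      also have "\<dots> \<longleftrightarrow> a \<le> u" unfolding u_eq using m by (simp add: pos_le_divide_eq mult.commute)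
      finally show "a \<le> u \<longleftrightarrow> a \<le> t" by simp
    qed (use t tg u in auto)
    then show "norm (sk_step m (\<lambda>k. x (real k / real m)) (\<gamma> t) - x t) \<le> r"
      using g0 by (simp add: sk_step_def u_def)
  qed
qed

text \<open>The classical finite partition of a cadlag path, by compactness of [0, T]: around each
  point c, right continuity controls the oscillation on [c, c+e) and the left limit controls it on
  (c-e, c). The condition \<open>\<forall>a\<in>A. a \<le> s \<longleftrightarrow> a \<le> t\<close>
  says that s and t lie in the same half-open cell.\<close>

lemma cadlag_partition:
  fixes x :: "real \<Rightarrow> 'b::real_normed_vector"
  assumes x: "cadlag x" and r: "0 < r"
  shows "\<exists>A. finite A \<and> 0 \<in> A \<and> A \<subseteq> {0..} \<and>
    (\<forall>s t. 0 \<le> s \<longrightarrow> s \<le> T \<longrightarrow> 0 \<le> t \<longrightarrow> t \<le> T \<longrightarrow> (\<forall>a\<in>A. a \<le> s \<longleftrightarrow> a \<le> t) \<longrightarrow>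
      norm (x s - x t) \<le> r)"
proof -
  have ex: "\<exists>e>0. (\<forall>s t. c \<le> s \<and> s < c + e \<and> c \<le> t \<and> t < c + e \<longrightarrow> norm (x s - x t) \<le> r) \<and>
       (\<forall>s t. 0 \<le> s \<and> c - e < s \<and> s < c \<and> 0 \<le> t \<and> c - e < t \<and> t < c \<longrightarrow> norm (x s - x t) \<le> r)"
      (is "\<exists>e>0. ?P c e")
    if c: "0 \<le> c" for c
  proof -
    have half: "norm (x s - x t) \<le> r" if "dist (x s) l < r / 2" "dist (x t) l < r / 2" for s t l
      using dist_triangle_half_l[of "x s" l r "x t"] that by (simp add: dist_norm)
    have "\<forall>\<^sub>F s in at_right c. dist (x s) (x c) < r / 2"
      using x c r unfolding cadlag_def by (intro tendstoD) auto
    then obtain b where b: "b > c" "\<And>s. c < s \<Longrightarrow> s < b \<Longrightarrow> dist (x s) (x c) < r / 2"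
      unfolding eventually_at_right_field by blast
    have b': "dist (x s) (x c) < r / 2" if "c \<le> s" "s < b" for s
      using b(2)[of s] that r by (cases "s = c") auto
    obtain b0 where b0: "b0 < c" "\<And>s t. \<lbrakk>0 \<le> s; b0 < s; s < c; 0 \<le> t; b0 < t; t < c\<rbrakk> \<Longrightarrow> norm (x s - x t) \<le> r"
    proof (cases "c = 0")
      case True
      then show ?thesis using that[of "-1"] by auto
    next
      case False
      then obtain l where "(x \<longlongrightarrow> l) (at_left c)" using x c unfolding cadlag_def by force
      then have "\<forall>\<^sub>F s in at_left c. dist (x s) l < r / 2" using r by (intro tendstoD) auto
      then obtain b where b: "b < c" "\<And>s. b < s \<Longrightarrow> s < c \<Longrightarrow> dist (x s) l < r / 2"
        unfolding eventually_at_left_field by blast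
      show ?thesis by (rule that[of b]) (use b half in blast)+
    qed
    show ?thesis
    proof (intro exI[of _ "min (b - c) (c - b0)"] conjI allI impI)
      show "0 < min (b - c) (c - b0)" using b(1) b0(1) by simp
    next
      fix s t assume "c \<le> s \<and> s < c + min (b - c) (c - b0) \<and> c \<le> t \<and> t < c + min (b - c) (c - b0)"
      then show "norm (x s - x t) \<le> r" by (intro half[of _ "x c"] b') auto
    next
      fix s t assume "0 \<le> s \<and> c - min (b - c) (c - b0) < s \<and> s < c \<and>
        0 \<le> t \<and> c - min (b - c) (c - b0) < t \<and> t < c"
      then show "norm (x s - x t) \<le> r" by (intro b0(2)) auto
    qed
  qed
  define e where "e c = (SOME e. 0 < e \<and> ?P c e)" for c
  have "0 < e c \<and> ?P c (e c)" if "0 \<le> c" for c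
    unfolding e_def by (rule someI_ex[OF ex[OF that]])
  then have e: "0 \<le> c \<Longrightarrow> 0 < e c"
    "0 \<le> c \<Longrightarrow> c \<le> s \<Longrightarrow> s < c + e c \<Longrightarrow> c \<le> t \<Longrightarrow> t < c + e c \<Longrightarrow> norm (x s - x t) \<le> r"
    "0 \<le> c \<Longrightarrow> 0 \<le> s \<Longrightarrow> c - e c < s \<Longrightarrow> s < c \<Longrightarrow> 0 \<le> t \<Longrightarrow> c - e c < t \<Longrightarrow> t < c
      \<Longrightarrow> norm (x s - x t) \<le> r" for c s t
    by blast+
  have "{0..T} \<subseteq> (\<Union>c\<in>{0..T}. ball c (e c))" using e(1) by force
  then obtain C where C: "C \<subseteq> {0..T}" "finite C" "{0..T} \<subseteq> (\<Union>c\<in>C. ball c (e c))"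
    using compactE_image[OF compact_Icc[of 0 T], of "{0..T}" "\<lambda>c. ball c (e c)"] by auto
  \<comment> \<open>The left ends \<open>c - e c\<close> need not be breakpoints: with s \<le> t,
    once s lies beyond such an end so does t.\<close>
  define A where "A = insert 0 (C \<union> (\<lambda>c. c + e c) ` C)"
  have main: "norm (x s - x t) \<le> r"
    if st: "0 \<le> s" "s \<le> t" "t \<le> T" "\<And>a. a \<in> A \<Longrightarrow> a \<le> s \<longleftrightarrow> a \<le> t" for s t
  proof -
    obtain c where c: "c \<in> C" "s \<in> ball c (e c)" using C(3) st by force
    have c0: "0 \<le> c" using c C by auto
    have s: "c - e c < s" "s < c + e c" using c by (auto simp: dist_real_def)
    have "c \<le> s \<longleftrightarrow> c \<le> t" "c + e c \<le> s \<longleftrightarrow> c + e c \<le> t"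
      using st(4)[of c] st(4)[of "c + e c"] c(1) by (auto simp: A_def)
    then show ?thesis
      using e(2)[OF c0, of s t] e(3)[OF c0, of s t] s st(1,2) by (cases "c \<le> s") auto
  qed
  show ?thesis
  proof (intro exI[of _ A] conjI allI impI)
    show "finite A" "0 \<in> A" using C by (auto simp: A_def)
    have "0 \<le> c \<and> 0 \<le> c + e c" if "c \<in> C" for c
      using that C(1) e(1)[of c] by fastforce
    then show "A \<subseteq> {0..}" unfolding A_def by auto
    fix s t assume st: "0 \<le> s" "s \<le> T" "0 \<le> t" "t \<le> T" "\<forall>a\<in>A. a \<le> s \<longleftrightarrow> a \<le> t"
    show "norm (x s - x t) \<le> r"
    proof (cases "s \<le> t")
      case True
      show ?thesis by (rule main[OF st(1) True st(4)]) (use st(5) in blast)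
    next
      case False
      then have "t \<le> s" by simp
      have "norm (x t - x s) \<le> r" by (rule main[OF st(3) \<open>t \<le> s\<close> st(2)]) (use st(5) in blast)
      then show ?thesis by (simp add: norm_minus_commute)
    qed
  qed
qed

lemma finite_set_gap:
  fixes A :: "real set"
  assumes "finite A"
  shows "\<exists>e>0. \<forall>a\<in>A. \<forall>b\<in>A. a < b \<longrightarrow> e \<le> b - a"
proof -
  define D where "D = (\<lambda>p. snd p - fst p) ` {p \<in> A \<times> A. fst p < snd p}"
  have "finite {p \<in> A \<times> A. fst p < snd p}"
    using finite_cartesian_product[OF assms assms] by (rule finite_subset[rotated]) auto
  then have fin: "finite (insert 1 D)" unfolding D_def by simp
  show ?thesis
  proof (intro exI[of _ "Min (insert 1 D)"] conjI ballI impI)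
    show "0 < Min (insert 1 D)" using fin by (auto simp: D_def)
    show "Min (insert 1 D) \<le> b - a" if "a \<in> A" "b \<in> A" "a < b" for a b
    proof (rule Min_le[OF fin])
      show "b - a \<in> insert 1 D"
        unfolding D_def using that by (intro insertI2 image_eqI[of _ _ "(a, b)"]) auto
    qed
  qed
qed

text \<open>A partition adapted to \<open>r / 2\<close> has a positive least gap; as soon as 2/m is
  below it, the cell boundaries can be moved to the grid by one time change. Working with half of r
  leaves room for the strict inequality.\<close>

lemma sk_dist_discretization_tendsto:
  fixes x :: "real \<Rightarrow> 'b::real_normed_vector"
  assumes x: "cadlag x"
  shows "(\<lambda>m. sk_dist (sk_step m (\<lambda>k. x (real k / real m))) x) \<longlonglongrightarrow> 0"
proof (rule tendstoI)
  fix r :: real assume r: "0 < r"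
  obtain A where A: "finite A" "0 \<in> A" "A \<subseteq> {0..}" and
    osc: "\<forall>s t. 0 \<le> s \<longrightarrow> s \<le> 1 / (r/2) + 1 \<longrightarrow> 0 \<le> t \<longrightarrow> t \<le> 1 / (r/2) + 1 \<longrightarrow>
      (\<forall>a\<in>A. a \<le> s \<longleftrightarrow> a \<le> t) \<longrightarrow> norm (x s - x t) \<le> r/2"
    using cadlag_partition[OF x half_gt_zero[OF r], of "1 / (r/2) + 1"] by (elim exE conjE) (rule that)
  obtain e where e: "0 < e" "\<forall>a\<in>A. \<forall>b\<in>A. a < b \<longrightarrow> e \<le> b - a"
    using finite_set_gap[OF A(1)] by (elim exE conjE) (rule that)
  have "(\<lambda>m. 2 / real m) \<longlonglongrightarrow> 0" by (rule lim_const_over_n)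
  then have "\<forall>\<^sub>F m in sequentially. 2 / real m < min e r"
    using e(1) r by (intro order_tendstoD(2)) simp_all
  then show "\<forall>\<^sub>F m in sequentially. dist (sk_dist (sk_step m (\<lambda>k. x (real k / real m))) x) 0 < r"
    using eventually_gt_at_top[of "0::nat"]
  proof (rule eventually_elim2)
    fix m :: nat assume "2 / real m < min e r" and m: "0 < m"
    then have less: "2 / real m < e" "2 / real m < r" by simp_all
    have "sk_close (r/2) (sk_step m (\<lambda>k. x (real k / real m))) x"
    proof (rule sk_close_discretization[OF A m])
      show "1 / real m \<le> r / 2" using less(2) by simp
    next
      fix a b assume "a \<in> A" "b \<in> A" "a < b"
      then have "e \<le> b - a" using e(2) by blast
      then show "2 / real m \<le> b - a" using less(1) by linarith
    next
      fix s t assume st: "0 \<le> s" "0 \<le> t" "s \<le> 1 / (r/2) + 1" "t \<le> 1 / (r/2) + 1"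
        "\<And>a. a \<in> A \<Longrightarrow> a \<le> s \<longleftrightarrow> a \<le> t"
      show "norm (x s - x t) \<le> r / 2"
        by (rule osc[rule_format, OF st(1,3,2,4)]) (rule st(5))
    qed
    then have "sk_dist (sk_step m (\<lambda>k. x (real k / real m))) x \<le> r/2" using r by (intro sk_dist_le) auto
    then show "dist (sk_dist (sk_step m (\<lambda>k. x (real k / real m))) x) 0 < r"
      using r sk_dist_nonneg[of "sk_step m (\<lambda>k. x (real k / real m))" x] by (simp add: dist_real_def)
  qed
qed


section \<open>One step of the rescaled walk\<close>

type_synonym 'd phase = "(real, 'd) vec \<times> (real, 'd) vec"

lemma axis_scale: "axis i (r::real) = r *\<^sub>R axis i 1"
  by (simp add: vec_eq_iff axis_def)

lemma vec_eq_sum_axis: "(h :: real ^ 'd::finite) = (\<Sum>i\<in>UNIV. h $ i *\<^sub>R axis i 1)"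
  using basis_expansion[of h] by (simp add: scalar_mult_eq_scaleR)

lemma frechet_derivative_eq:
  assumes "class_C1 (g :: real ^ 'd::finite \<Rightarrow> real)"
  shows "frechet_derivative g (at x) h = h \<bullet> gradient g x"
proof -
  have "(g has_derivative frechet_derivative g (at x)) (at x)"
    using assms by (simp add: class_C1_def frechet_derivative_works)
  then interpret l: bounded_linear "frechet_derivative g (at x)" by (rule has_derivative_bounded_linear)
  have "frechet_derivative g (at x) h = frechet_derivative g (at x) (\<Sum>i\<in>UNIV. h $ i *\<^sub>R axis i 1)"
    using vec_eq_sum_axis[of h] by simp
  also have "\<dots> = (\<Sum>i\<in>UNIV. h $ i * partial_deriv i g x)"
    by (simp add: l.sum l.scaleR partial_deriv_def)
  finally show ?thesis by (simp add: inner_vec_def gradient_def)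
qed

lemma class_C1_has_derivative:
  assumes "class_C1 g"
  shows "(g has_derivative (\<lambda>h. h \<bullet> gradient g x)) (at x)"
proof -
  have "(g has_derivative frechet_derivative g (at x)) (at x)"
    using assms by (simp add: class_C1_def frechet_derivative_works)
  moreover have "frechet_derivative g (at x) = (\<lambda>h. h \<bullet> gradient g x)"
    using frechet_derivative_eq[OF assms] by auto
  ultimately show ?thesis by simp
qed

lemma class_C1_continuous: "class_C1 g \<Longrightarrow> continuous_on UNIV g"
  by (auto simp: class_C1_def intro!: continuous_at_imp_continuous_on differentiable_imp_continuous_within)

lemma class_C1_line:
  assumes "class_C1 g"
  shows "((\<lambda>r. g (x + r *\<^sub>R h)) has_real_derivative h \<bullet> gradient g (x + r *\<^sub>R h)) (at r)"
proof -
  have "((\<lambda>r. x + r *\<^sub>R h) has_derivative (\<lambda>r. r *\<^sub>R h)) (at r)"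
    by (auto intro!: derivative_eq_intros)
  from has_derivative_compose[OF this class_C1_has_derivative[OF assms]]
  show ?thesis by (simp add: has_field_derivative_def mult.commute[of _ "h \<bullet> _"])
qed

lemma gradient_inner_axis: "axis i r \<bullet> gradient g x = r * partial_deriv i g x"
  by (simp add: inner_axis' gradient_def)

lemma class_C1_lipschitz:
  fixes g :: "real ^ 'd::finite \<Rightarrow> real"
  assumes "class_C1 g" "\<And>i z. norm z \<le> R \<Longrightarrow> \<bar>partial_deriv i g z\<bar> \<le> K"
    and "norm x \<le> R" "norm y \<le> R"
  shows "\<bar>g x - g y\<bar> \<le> real CARD('d) * K * norm (x - y)"
proof -
  have "norm (g x - g y) \<le> real CARD('d) * K * norm (x - y)"
  proof (rule differentiable_bound[of "cball 0 R"])
    fix z :: "real ^ 'd" assume z: "z \<in> cball 0 R"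
    show "(g has_derivative (\<lambda>h. h \<bullet> gradient g z)) (at z within cball 0 R)"
      using class_C1_has_derivative[OF assms(1)] by (rule has_derivative_at_withinI)
    show "onorm (\<lambda>h. h \<bullet> gradient g z) \<le> real CARD('d) * K"
    proof (rule onorm_le)
      fix h :: "real ^ 'd"
      have "\<bar>h \<bullet> gradient g z\<bar> \<le> (\<Sum>i\<in>UNIV. \<bar>h $ i * partial_deriv i g z\<bar>)"
        unfolding inner_vec_def gradient_def by (simp add: sum_abs)
      also have "\<dots> \<le> (\<Sum>i\<in>(UNIV::'d set). norm h * K)"
      proof (rule sum_mono)
        fix i
        show "\<bar>h $ i * partial_deriv i g z\<bar> \<le> norm h * K"
          unfolding abs_mult using component_le_norm_cart[of h i] assms(2)[of z i] z
          by (intro mult_mono) auto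
      qed
      finally show "norm (h \<bullet> gradient g z) \<le> real CARD('d) * K * norm h" by (simp add: mult_ac)
    qed
  qed (use assms in auto)
  then show ?thesis by simp
qed

lemma class_C1_bounded:
  fixes g :: "real ^ 'd::finite \<Rightarrow> real"
  assumes "continuous_on UNIV g"
  obtains K where "0 \<le> K" "\<And>x. norm x \<le> R \<Longrightarrow> \<bar>g x\<bar> \<le> K"
proof -
  have "compact (g ` cball 0 R)"
    using continuous_on_subset[OF assms] by (intro compact_continuous_image) auto
  then have "bounded (g ` cball 0 R)" by (rule compact_imp_bounded)
  then obtain K where K: "\<forall>y\<in>g ` cball 0 R. norm y \<le> K" unfolding bounded_iff by (elim exE)
  have "\<bar>g x\<bar> \<le> max K 0" if "norm x \<le> R" for x
  proof -
    have "norm (g x) \<le> K" using K that by simp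
    then show ?thesis by simp
  qed
  then show ?thesis using that[of "max K 0"] by simp
qed

section \<open>Sign vectors and Lipschitz functions of bounded support\<close>

lemma signsD: "v \<in> signs \<Longrightarrow> v $ i = 1 \<or> v $ i = (- 1 :: 'a::ring_1)"
  by (simp add: signs_def)

lemma signs_abs: "v \<in> signs \<Longrightarrow> \<bar>v $ i\<bar> = (1::real)"
  using signsD[of v i] by auto

lemma flip_signs: "v \<in> signs \<Longrightarrow> flip i v \<in> signs"
  unfolding signs_def flip_def by (auto simp: minus_equation_iff)

lemma norm_axis_real: "norm (axis i (r::real)) = \<bar>r\<bar>"
  by (subst axis_scale) (simp add: norm_axis_1)

text \<open>The support radius, the sup norm and the Lipschitz constant in the position are kept
  apart because the walk treats them differently: the sup norm does not grow, the other two grow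
  linearly in time. For the velocity, which ranges over a finite set, no regularity is
  imposed.\<close>

definition lip_supp :: "real \<Rightarrow> real \<Rightarrow> real \<Rightarrow> ('d::finite phase \<Rightarrow> real) \<Rightarrow> bool" where
  "lip_supp R C L g \<longleftrightarrow> (\<forall>v\<in>signs. (\<forall>x. \<bar>g (x, v)\<bar> \<le> C) \<and>
     (\<forall>x y. \<bar>g (x, v) - g (y, v)\<bar> \<le> L * norm (x - y)) \<and> (\<forall>x. R \<le> norm x \<longrightarrow> g (x, v) = 0))"

lemma lipcD:
  assumes "lip_supp R C L g" "v \<in> signs"
  shows "\<bar>g (x, v)\<bar> \<le> C" "\<bar>g (x, v) - g (y, v)\<bar> \<le> L * norm (x - y)" "R \<le> norm x \<Longrightarrow> g (x, v) = 0"
  using assms unfolding lip_supp_def by blast+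

lemma lipcI:
  assumes "\<And>v x. v \<in> signs \<Longrightarrow> \<bar>g (x, v)\<bar> \<le> C"
    and "\<And>v x y. v \<in> signs \<Longrightarrow> \<bar>g (x, v) - g (y, v)\<bar> \<le> L * norm (x - y)"
    and "\<And>v x. v \<in> signs \<Longrightarrow> R \<le> norm x \<Longrightarrow> g (x, v) = 0"
  shows "lip_supp R C L g"
  using assms unfolding lip_supp_def by blast

lemma ones_signs: "(\<chi> i. 1) \<in> signs"
  by (simp add: signs_def)

lemma lip_supp_nonneg:
  fixes g :: "'d::finite phase \<Rightarrow> real"
  assumes "lip_supp R C L g"
  shows "0 \<le> C" "0 \<le> L"
proof -
  define v :: "real ^ 'd" where "v = (\<chi> i. 1)"
  have v: "v \<in> signs" unfolding v_def by (rule ones_signs)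
  have "\<bar>g (0, v)\<bar> \<le> C" by (rule lipcD(1)[OF assms v])
  then show "0 \<le> C" by linarith
  have "\<bar>g (axis undefined 1, v) - g (0, v)\<bar> \<le> L * norm (axis undefined 1 - 0 :: real ^ 'd)"
    by (rule lipcD(2)[OF assms v])
  then have "\<bar>g (axis undefined 1, v) - g (0, v)\<bar> \<le> L" by (simp add: norm_axis_real)
  then show "0 \<le> L" by linarith
qed

lemma lip_supp_mono:
  fixes g :: "'d::finite phase \<Rightarrow> real"
  assumes "lip_supp R C L g" "R \<le> R'" "C \<le> C'" "L \<le> L'"
  shows "lip_supp R' C' L' g"
proof (rule lipcI)
  fix v :: "real ^ 'd" and x y assume v: "v \<in> signs"
  show "\<bar>g (x, v)\<bar> \<le> C'" using lipcD(1)[OF assms(1) v, of x] assms(3) by simp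
  have "L * norm (x - y) \<le> L' * norm (x - y)" using assms(4) by (intro mult_right_mono) auto
  then show "\<bar>g (x, v) - g (y, v)\<bar> \<le> L' * norm (x - y)"
    using lipcD(2)[OF assms(1) v, of x y] by simp
  show "g (x, v) = 0" if "R' \<le> norm x" using lipcD(3)[OF assms(1) v, of x] that assms(2) by simp
qed

lemma lip_supp_add:
  fixes g :: "'d::finite phase \<Rightarrow> real"
  assumes "lip_supp R C L g" "lip_supp R C' L' g'"
  shows "lip_supp R (C + C') (L + L') (\<lambda>z. g z + g' z)"
proof (rule lipcI)
  fix v :: "real ^ 'd" and x y assume v: "v \<in> signs"
  note a = lipcD[OF assms(1) v] and b = lipcD[OF assms(2) v]
  show "\<bar>g (x, v) + g' (x, v)\<bar> \<le> C + C'" using a(1)[of x] b(1)[of x] by linarith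
  show "\<bar>g (x, v) + g' (x, v) - (g (y, v) + g' (y, v))\<bar> \<le> (L + L') * norm (x - y)"
    using a(2)[of x y] b(2)[of x y] unfolding distrib_right by linarith
  show "g (x, v) + g' (x, v) = 0" if "R \<le> norm x" using a(3)[of x] b(3)[of x] that by simp
qed

text \<open>The walk updates its coordinates one after the other; in the scale of the limit, \<open>zz_coord_op H \<epsilon> i\<close> is the
  update of coordinate \<open>i\<close>. Its expansion in \<open>\<epsilon>\<close> is \<open>zz_coord_shift \<epsilon> i + \<epsilon> * zz_coord_jump H i\<close>, transport plus jump.\<close>

definition zz_coord_op :: "(real ^ 'd::finite \<Rightarrow> real) \<Rightarrow> real \<Rightarrow> 'd \<Rightarrow> ('d phase \<Rightarrow> real) \<Rightarrow>
    'd phase \<Rightarrow> real" where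
  "zz_coord_op H \<epsilon> i g z = (let q = exp (- max (H (fst z + axis i (\<epsilon> * snd z $ i)) - H (fst z)) 0) in
     q * g (fst z + axis i (\<epsilon> * snd z $ i), snd z) + (1 - q) * g (fst z, flip i (snd z)))"

definition zz_coord_shift :: "real \<Rightarrow> 'd::finite \<Rightarrow> ('d phase \<Rightarrow> real) \<Rightarrow>
    'd phase \<Rightarrow> real" where
  "zz_coord_shift \<epsilon> i g z = g (fst z + axis i (\<epsilon> * snd z $ i), snd z)"

definition zz_coord_jump :: "(real ^ 'd::finite \<Rightarrow> real) \<Rightarrow> 'd \<Rightarrow> ('d phase \<Rightarrow> real) \<Rightarrow>
    'd phase \<Rightarrow> real" where
  "zz_coord_jump H i g z = max (snd z $ i * partial_deriv i H (fst z)) 0 * (g (fst z, flip i (snd z)) - g z)"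

lemma max0_diff: "\<bar>max a 0 - max b 0\<bar> \<le> \<bar>a - b\<bar>" for a b :: real
  by (auto simp: max_def)

lemma max0_abs: "\<bar>max a 0\<bar> \<le> \<bar>a\<bar>" for a :: real
  by (auto simp: max_def)

lemma exp_diff_nonpos: "0 \<le> a \<Longrightarrow> 0 \<le> b \<Longrightarrow> \<bar>exp (- a) - exp (- b)\<bar> \<le> \<bar>a - b\<bar>" for a b :: real
proof (induction a b rule: linorder_wlog)
  case (le a b)
  have "1 + (a - b) \<le> exp (a - b)" by (rule exp_ge_add_one_self)
  then have "1 - exp (a - b) \<le> b - a" by linarith
  moreover have "0 \<le> 1 - exp (a - b)" using le by simp
  moreover have "exp (- a) * (1 - exp (a - b)) \<le> 1 * (b - a)"
    using le calculation by (intro mult_mono) auto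
  moreover have "exp (- a) * (1 - exp (a - b)) = exp (- a) - exp (- b)"
    by (simp add: right_diff_distrib mult_exp_exp)
  moreover have "exp (- b) \<le> exp (- a)" using le by simp
  ultimately show ?case using le by simp
next
  case (sym a b)
  then show ?case by (simp add: abs_minus_commute)
qed

lemma one_minus_exp_bound: "0 \<le> a \<Longrightarrow> \<bar>1 - exp (- a) - a\<bar> \<le> a\<^sup>2" for a :: real
proof -
  assume a: "0 \<le> a"
  have "1 - a \<le> exp (- a)" using exp_ge_add_one_self[of "- a"] by simp
  moreover have "exp (- a) \<le> 1 - a + a\<^sup>2"
  proof -
    have "1 + a \<le> exp a" by (rule exp_ge_add_one_self)
    then have "exp (- a) \<le> 1 / (1 + a)" using a by (simp add: exp_minus divide_inverse le_imp_inverse_le)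
    also have "1 \<le> (1 - a + a\<^sup>2) * (1 + a)"
      using a by (simp add: algebra_simps power2_eq_square)
    then have "1 / (1 + a) \<le> 1 - a + a\<^sup>2" using a by (simp add: pos_divide_le_eq)
    finally show ?thesis .
  qed
  ultimately show ?thesis by (simp add: abs_le_iff)
qed

text \<open>One constant for the size and for the Lipschitz modulus of the gradient on a ball. The
  second part is how the second derivatives of H enter; it is the form used by all error terms of
  order \<epsilon>^2.\<close>

definition gradient_bound :: "(real ^ 'd::finite \<Rightarrow> real) \<Rightarrow> real \<Rightarrow> real \<Rightarrow> bool" where
  "gradient_bound H R K \<longleftrightarrow> 0 \<le> K \<and> (\<forall>i x y. norm x \<le> R \<longrightarrow> norm y \<le> R \<longrightarrow>
     \<bar>partial_deriv i H x\<bar> \<le> K \<and> \<bar>partial_deriv i H x - partial_deriv i H y\<bar> \<le> K * norm (x - y))"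

lemma hboundD:
  assumes "gradient_bound H R K"
  shows "0 \<le> K" "norm x \<le> R \<Longrightarrow> \<bar>partial_deriv i H x\<bar> \<le> K"
    "norm x \<le> R \<Longrightarrow> norm y \<le> R \<Longrightarrow> \<bar>partial_deriv i H x - partial_deriv i H y\<bar> \<le> K * norm (x - y)"
  using assms unfolding gradient_bound_def by blast+

lemma gradient_bound_mono: "gradient_bound H R K \<Longrightarrow> R' \<le> R \<Longrightarrow> gradient_bound H R' K"
  unfolding gradient_bound_def by (meson order_trans)

lemma gradient_bound_exists:
  fixes H :: "real ^ 'd::finite \<Rightarrow> real"
  assumes "class_C2 H"
  obtains K where "gradient_bound H R K"
proof -
  have C1: "class_C1 (partial_deriv i H)" for i using assms by (simp add: class_C2_def)
  have "\<exists>K. 0 \<le> K \<and> (\<forall>x. norm x \<le> R \<longrightarrow> \<bar>partial_deriv i H x\<bar> \<le> K)" for i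
    using class_C1_bounded[OF class_C1_continuous[OF C1[of i]]] by metis
  then obtain K0 where K0: "\<And>i. 0 \<le> K0 i" "\<And>i x. norm x \<le> R \<Longrightarrow> \<bar>partial_deriv i H x\<bar> \<le> K0 i" by metis
  have cont: "continuous_on UNIV (partial_deriv j (partial_deriv i H))" for i j
    using C1[of i] by (simp add: class_C1_def)
  have "\<exists>K. 0 \<le> K \<and> (\<forall>x. norm x \<le> R \<longrightarrow> \<bar>partial_deriv j (partial_deriv i H) x\<bar> \<le> K)" for i j
    using class_C1_bounded[OF cont[of j i]] by metis
  then have ex: "\<exists>K. 0 \<le> K \<and> (\<forall>x. norm x \<le> R \<longrightarrow> \<bar>partial_deriv j (partial_deriv i H) x\<bar> \<le> K)" for i j .
  define K1 where "K1 i j = (SOME K. 0 \<le> K \<and> (\<forall>x. norm x \<le> R \<longrightarrow> \<bar>partial_deriv j (partial_deriv i H) x\<bar> \<le> K))" for i j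
  have K1: "0 \<le> K1 i j" "norm x \<le> R \<Longrightarrow> \<bar>partial_deriv j (partial_deriv i H) x\<bar> \<le> K1 i j" for i j x
    using someI_ex[OF ex[of j i]] unfolding K1_def by blast+
  define K where "K = (\<Sum>i\<in>UNIV. K0 i) + real CARD('d) * (\<Sum>i\<in>UNIV. \<Sum>j\<in>UNIV. K1 i j)"
  have s1: "0 \<le> (\<Sum>i\<in>UNIV. K0 i)" using K0 by (intro sum_nonneg) auto
  have s2: "0 \<le> (\<Sum>i\<in>UNIV. \<Sum>j\<in>UNIV. K1 i j)" using K1 by (intro sum_nonneg) auto
  have le1: "K0 i \<le> (\<Sum>i\<in>UNIV. K0 i)" for i using K0 by (intro member_le_sum) auto
  have le2: "K1 i j \<le> (\<Sum>i\<in>UNIV. \<Sum>j\<in>UNIV. K1 i j)" for i j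
  proof -
    have "K1 i j \<le> (\<Sum>j\<in>UNIV. K1 i j)" using K1 by (intro member_le_sum) auto
    also have "\<dots> \<le> (\<Sum>i\<in>UNIV. \<Sum>j\<in>UNIV. K1 i j)"
      using K1 by (intro member_le_sum[where f="\<lambda>i. \<Sum>j\<in>UNIV. K1 i j"] sum_nonneg) auto
    finally show ?thesis .
  qed
  have "gradient_bound H R K" unfolding gradient_bound_def
  proof (intro conjI allI impI)
    show "0 \<le> K" unfolding K_def using s1 s2 by simp
  next
    fix i and x y :: "real ^ 'd" assume x: "norm x \<le> R" and y: "norm y \<le> R"
    have "0 \<le> real CARD('d) * (\<Sum>i\<in>UNIV. \<Sum>j\<in>UNIV. K1 i j)" using s2 by simp
    then show "\<bar>partial_deriv i H x\<bar> \<le> K" using K0(2)[OF x, of i] le1[of i] unfolding K_def by linarith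
    have "\<bar>partial_deriv i H x - partial_deriv i H y\<bar> \<le>
        real CARD('d) * (\<Sum>i\<in>UNIV. \<Sum>j\<in>UNIV. K1 i j) * norm (x - y)"
      by (rule class_C1_lipschitz[OF C1 order_trans[OF K1(2) le2] x y])
    also have "\<dots> \<le> K * norm (x - y)" unfolding K_def using s1 by (intro mult_right_mono) auto
    finally show "\<bar>partial_deriv i H x - partial_deriv i H y\<bar> \<le> K * norm (x - y)" .
  qed
  then show ?thesis by (rule that)
qed

section \<open>Expansion of the update of one coordinate\<close>

lemma axis_line_norm:
  assumes "norm x \<le> R + 1" "\<bar>r\<bar> \<le> 1"
  shows "norm (x + r *\<^sub>R axis i 1 :: real ^ 'd::finite) \<le> R + 2"
proof -
  have "norm (x + r *\<^sub>R axis i 1) \<le> norm x + \<bar>r\<bar>"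
    using norm_triangle_ineq[of x "r *\<^sub>R axis i 1"] by (simp add: norm_axis_real)
  then show ?thesis using assms by simp
qed

context
  fixes H :: "real ^ 'd::finite \<Rightarrow> real"
  assumes C1: "class_C1 H"
begin

lemma H_incr_mvt:
  assumes "r \<noteq> 0"
  obtains \<xi> where "\<bar>\<xi>\<bar> \<le> \<bar>r\<bar>" "H (x + axis i r) - H x = r * partial_deriv i H (x + \<xi> *\<^sub>R axis i 1)"
proof -
  have d: "((\<lambda>r. H (x + r *\<^sub>R axis i 1)) has_real_derivative partial_deriv i H (x + s *\<^sub>R axis i 1)) (at s)" for s
    using class_C1_line[OF C1, of x "axis i 1" s] by (simp add: gradient_inner_axis)
  show ?thesis
  proof (cases "0 < r")
    case True
    from MVT2[OF True d] obtain \<xi> where "0 < \<xi>" "\<xi> < r"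
      "H (x + r *\<^sub>R axis i 1) - H (x + 0 *\<^sub>R axis i 1) = (r - 0) * partial_deriv i H (x + \<xi> *\<^sub>R axis i 1)" by blast
    then show ?thesis using that[of \<xi>] by (simp add: axis_scale[of i r])
  next
    case False
    then have "r < 0" using assms by simp
    from MVT2[OF this d] obtain \<xi> where "r < \<xi>" "\<xi> < 0"
      "H (x + 0 *\<^sub>R axis i 1) - H (x + r *\<^sub>R axis i 1) = (0 - r) * partial_deriv i H (x + \<xi> *\<^sub>R axis i 1)" by blast
    then show ?thesis using that[of \<xi>] by (simp add: axis_scale[of i r])
  qed
qed

text \<open>The mean value theorem is applied to the difference of the two increments as a single
  function of r. This yields a common intermediate shift \<xi>, so that the two evaluation points
  differ by exactly \<open>x - y\<close>; separate intermediate points would leave an error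
  independent of the distance.\<close>

lemma H_incr_diff_mvt:
  assumes "r \<noteq> 0"
  obtains \<xi> where "\<bar>\<xi>\<bar> \<le> \<bar>r\<bar>" "(H (x + axis i r) - H x) - (H (y + axis i r) - H y) =
    r * (partial_deriv i H (x + \<xi> *\<^sub>R axis i 1) - partial_deriv i H (y + \<xi> *\<^sub>R axis i 1))"
proof -
  have d: "((\<lambda>r. H (x + r *\<^sub>R axis i 1)) has_real_derivative partial_deriv i H (x + s *\<^sub>R axis i 1)) (at s)" for s x
    using class_C1_line[OF C1, of x "axis i 1" s] by (simp add: gradient_inner_axis)
  have d: "((\<lambda>r. H (x + r *\<^sub>R axis i 1) - H (y + r *\<^sub>R axis i 1)) has_real_derivative
      partial_deriv i H (x + s *\<^sub>R axis i 1) - partial_deriv i H (y + s *\<^sub>R axis i 1)) (at s)" for s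
    by (intro DERIV_diff d)
  show ?thesis
  proof (cases "0 < r")
    case True
    from MVT2[OF True d] obtain \<xi> where "0 < \<xi>" "\<xi> < r"
      "H (x + r *\<^sub>R axis i 1) - H (y + r *\<^sub>R axis i 1) - (H (x + 0 *\<^sub>R axis i 1) - H (y + 0 *\<^sub>R axis i 1)) =
       (r - 0) * (partial_deriv i H (x + \<xi> *\<^sub>R axis i 1) - partial_deriv i H (y + \<xi> *\<^sub>R axis i 1))" by blast
    then show ?thesis using that[of \<xi>] by (simp add: axis_scale[of i r] algebra_simps)
  next
    case False
    then have "r < 0" using assms by simp
    from MVT2[OF this d] obtain \<xi> where "r < \<xi>" "\<xi> < 0"
      "H (x + 0 *\<^sub>R axis i 1) - H (y + 0 *\<^sub>R axis i 1) - (H (x + r *\<^sub>R axis i 1) - H (y + r *\<^sub>R axis i 1)) =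
       (0 - r) * (partial_deriv i H (x + \<xi> *\<^sub>R axis i 1) - partial_deriv i H (y + \<xi> *\<^sub>R axis i 1))" by blast
    then show ?thesis using that[of \<xi>] by (simp add: axis_scale[of i r] algebra_simps)
  qed
qed

text \<open>The factor \<open>\<bar>r\<bar>\<close> is the point: with r of size \<epsilon>, the
  acceptance probability has a Lipschitz constant of order \<epsilon>, and the Lipschitz bounds
  survive T / \<epsilon> steps.\<close>

lemma zz_accept_lipschitz:
  assumes hb: "gradient_bound H (R + 2) K" and r: "\<bar>r\<bar> \<le> 1" "r \<noteq> 0"
    and x: "norm x \<le> R + 1" and y: "norm y \<le> R + 1"
  shows "\<bar>exp (- max (H (x + axis i r) - H x) 0) - exp (- max (H (y + axis i r) - H y) 0)\<bar>
    \<le> \<bar>r\<bar> * (K * norm (x - y))"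
proof -
  obtain \<xi> where \<xi>: "\<bar>\<xi>\<bar> \<le> \<bar>r\<bar>" "(H (x + axis i r) - H x) - (H (y + axis i r) - H y) =
    r * (partial_deriv i H (x + \<xi> *\<^sub>R axis i 1) - partial_deriv i H (y + \<xi> *\<^sub>R axis i 1))"
    by (rule H_incr_diff_mvt[OF r(2)])
  have \<xi>1: "\<bar>\<xi>\<bar> \<le> 1" using \<xi>(1) r(1) by simp
  have "\<bar>exp (- max (H (x + axis i r) - H x) 0) - exp (- max (H (y + axis i r) - H y) 0)\<bar>
      \<le> \<bar>max (H (x + axis i r) - H x) 0 - max (H (y + axis i r) - H y) 0\<bar>"
    by (rule exp_diff_nonpos) auto
  also have "\<dots> \<le> \<bar>(H (x + axis i r) - H x) - (H (y + axis i r) - H y)\<bar>" by (rule max0_diff)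
  also have "\<dots> = \<bar>r\<bar> * \<bar>partial_deriv i H (x + \<xi> *\<^sub>R axis i 1) - partial_deriv i H (y + \<xi> *\<^sub>R axis i 1)\<bar>"
    unfolding \<xi>(2) by (rule abs_mult)
  also have "\<dots> \<le> \<bar>r\<bar> * (K * norm ((x + \<xi> *\<^sub>R axis i 1) - (y + \<xi> *\<^sub>R axis i 1)))"
    by (intro mult_left_mono hboundD(3)[OF hb] axis_line_norm x y \<xi>1) simp
  finally show ?thesis by simp
qed

text \<open>Here \<open>1 - q\<close> is the flip probability of coordinate i, to first order
  \<epsilon> times the jump rate. The term with K comes from evaluating the derivative of H at an
  intermediate point, the term with K^2 from linearizing the exponential.\<close>

lemma zz_reject_bounds:
  fixes i :: 'd
  assumes hb: "gradient_bound H (R + 2) K" and \<epsilon>: "0 < \<epsilon>" "\<epsilon> \<le> 1" and x: "norm x \<le> R + 1" and v: "v \<in> signs"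
  defines "q \<equiv> exp (- max (H (x + axis i (\<epsilon> * v $ i)) - H x) 0)"
  shows "0 \<le> 1 - q" "1 - q \<le> K * \<epsilon>" "\<bar>(1 - q) - \<epsilon> * max (v $ i * partial_deriv i H x) 0\<bar> \<le> (K + K\<^sup>2) * \<epsilon>\<^sup>2"
proof -
  let ?r = "\<epsilon> * v $ i" and ?a = "max (H (x + axis i (\<epsilon> * v $ i)) - H x) 0"
  have r: "\<bar>?r\<bar> = \<epsilon>" using signs_abs[OF v] \<epsilon> by (simp add: abs_mult)
  then have "?r \<noteq> 0" using \<epsilon> by auto
  then obtain \<xi> where \<xi>: "\<bar>\<xi>\<bar> \<le> \<bar>?r\<bar>" "H (x + axis i ?r) - H x = ?r * partial_deriv i H (x + \<xi> *\<^sub>R axis i 1)"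
    by (rule H_incr_mvt)
  have n\<xi>: "norm (x + \<xi> *\<^sub>R axis i 1) \<le> R + 2" using \<xi>(1) r \<epsilon> x by (intro axis_line_norm) auto
  have nx: "norm x \<le> R + 2" using x by simp
  have a0: "0 \<le> ?a" by simp
  have "\<bar>?r * partial_deriv i H (x + \<xi> *\<^sub>R axis i 1)\<bar> \<le> \<epsilon> * K"
    unfolding abs_mult r[unfolded abs_mult] using hboundD(2)[OF hb n\<xi>, of i] \<epsilon> by (intro mult_mono) auto
  then have "?r * partial_deriv i H (x + \<xi> *\<^sub>R axis i 1) \<le> K * \<epsilon>" by (simp add: abs_le_iff mult.commute[of K])
  then have aK: "?a \<le> K * \<epsilon>"
    unfolding \<xi>(2) using hboundD(1)[OF hb] \<epsilon> by (intro max.boundedI) auto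
  show "0 \<le> 1 - q" unfolding q_def by simp
  have "1 + - ?a \<le> exp (- ?a)" by (rule exp_ge_add_one_self)
  then show "1 - q \<le> K * \<epsilon>" unfolding q_def using aK by linarith
  have "\<bar>?a - \<epsilon> * max (v $ i * partial_deriv i H x) 0\<bar> =
      \<bar>max (?r * partial_deriv i H (x + \<xi> *\<^sub>R axis i 1)) 0 - max (?r * partial_deriv i H x) 0\<bar>"
  proof -
    have "\<epsilon> * max (v $ i * partial_deriv i H x) 0 = max (?r * partial_deriv i H x) 0"
      using \<epsilon> max_mult_distrib_left[of \<epsilon> "v $ i * partial_deriv i H x" 0] by (simp add: mult.assoc)
    then show ?thesis unfolding \<xi>(2) by simp
  qed
  also have "\<dots> \<le> \<bar>?r * partial_deriv i H (x + \<xi> *\<^sub>R axis i 1) - ?r * partial_deriv i H x\<bar>" by (rule max0_diff)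
  also have "\<dots> = \<epsilon> * \<bar>partial_deriv i H (x + \<xi> *\<^sub>R axis i 1) - partial_deriv i H x\<bar>"
    unfolding right_diff_distrib[symmetric] abs_mult r[unfolded abs_mult] ..
  also have "\<dots> \<le> \<epsilon> * (K * norm ((x + \<xi> *\<^sub>R axis i 1) - x))"
    using \<epsilon> by (intro mult_left_mono hboundD(3)[OF hb] n\<xi> nx) auto
  also have "\<dots> \<le> \<epsilon> * (K * \<epsilon>)"
    using \<epsilon> \<xi>(1) r hboundD(1)[OF hb] by (intro mult_left_mono) (auto simp: norm_axis_real)
  finally have 1: "\<bar>?a - \<epsilon> * max (v $ i * partial_deriv i H x) 0\<bar> \<le> K * \<epsilon>\<^sup>2"
    by (simp add: power2_eq_square mult_ac)
  have "\<bar>1 - q - ?a\<bar> \<le> ?a\<^sup>2" unfolding q_def by (rule one_minus_exp_bound[OF a0])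
  also have "?a\<^sup>2 \<le> (K * \<epsilon>)\<^sup>2" using aK a0 by (intro power_mono)
  finally have "\<bar>1 - q - ?a\<bar> \<le> K\<^sup>2 * \<epsilon>\<^sup>2" by (simp add: power_mult_distrib)
  with 1 show "\<bar>(1 - q) - \<epsilon> * max (v $ i * partial_deriv i H x) 0\<bar> \<le> (K + K\<^sup>2) * \<epsilon>\<^sup>2"
    unfolding distrib_right by linarith
qed

lemma norm_shift:
  assumes "v \<in> signs" "0 < \<epsilon>"
  shows "norm x \<le> norm (x + axis i (\<epsilon> * v $ i) :: real ^ 'd) + \<epsilon>"
proof -
  have "norm x \<le> norm (x + axis i (\<epsilon> * v $ i)) + norm (axis i (\<epsilon> * v $ i))"
    using norm_triangle_ineq4[of "x + axis i (\<epsilon> * v $ i)" "axis i (\<epsilon> * v $ i)"] by simp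
  then show ?thesis using assms signs_abs[of v i] by (simp add: norm_axis_real abs_mult)
qed

text \<open>The update is a convex combination, so the sup norm is kept and the support grows by one
  step length. In the Lipschitz estimate only the variation of the weight q costs something: it is
  of order K \<epsilon> and multiplies a difference of two values of g, hence the increase
  \<open>2 * K * C * \<epsilon>\<close>.\<close>

lemma lip_supp_zz_coord_op:
  assumes hb: "gradient_bound H (R + 2) K" and g: "lip_supp R C L g" and \<epsilon>: "0 < \<epsilon>" "\<epsilon> \<le> 1"
  shows "lip_supp (R + \<epsilon>) C (L + 2 * K * C * \<epsilon>) (zz_coord_op H \<epsilon> i g)"
proof (rule lipcI)
  fix v :: "real ^ 'd" and x y assume v: "v \<in> signs"
  note fv = flip_signs[OF v, of i]
  let ?q = "\<lambda>x. exp (- max (H (x + axis i (\<epsilon> * v $ i)) - H x) 0)"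
  let ?s = "\<lambda>x. x + axis i (\<epsilon> * v $ i)"
  have q: "0 \<le> ?q x" "?q x \<le> 1" for x by simp_all
  have A: "zz_coord_op H \<epsilon> i g (x, v) = ?q x * g (?s x, v) + (1 - ?q x) * g (x, flip i v)" for x
    by (simp add: zz_coord_op_def Let_def)
  have out: "g (?s x, v) = 0" "g (x, flip i v) = 0" if "R + \<epsilon> \<le> norm x" for x
    using lipcD(3)[OF g v, of "?s x"] lipcD(3)[OF g fv, of x] norm_shift[OF v \<epsilon>(1), of x i] that \<epsilon> by auto
  show "R + \<epsilon> \<le> norm x \<Longrightarrow> zz_coord_op H \<epsilon> i g (x, v) = 0" unfolding A using out[of x] by simp
  have "\<bar>?q x * g (?s x, v) + (1 - ?q x) * g (x, flip i v)\<bar> \<le> ?q x * C + (1 - ?q x) * C"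
  proof (rule order_trans[OF abs_triangle_ineq], rule add_mono)
    show "\<bar>?q x * g (?s x, v)\<bar> \<le> ?q x * C"
      unfolding abs_mult using lipcD(1)[OF g v] by (simp add: mult_left_mono)
    show "\<bar>(1 - ?q x) * g (x, flip i v)\<bar> \<le> (1 - ?q x) * C"
      unfolding abs_mult using lipcD(1)[OF g fv] by (simp add: mult_left_mono)
  qed
  then show "\<bar>zz_coord_op H \<epsilon> i g (x, v)\<bar> \<le> C" unfolding A by (simp add: algebra_simps)
  have main: "\<bar>zz_coord_op H \<epsilon> i g (x, v) - zz_coord_op H \<epsilon> i g (y, v)\<bar> \<le> (L + 2 * K * C * \<epsilon>) * norm (x - y)"
    \<comment> \<open>The bounds on H hold near the support only. The variation of q multiplies
      values taken at y, so it is harmless when y lies outside the enlarged support; when only x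
      lies outside, the roles are exchanged.\<close>
    if y: "norm x \<le> R + 1 \<and> norm y \<le> R + 1 \<or> R + \<epsilon> \<le> norm y" for x y
  proof -
    have eq: "zz_coord_op H \<epsilon> i g (x, v) - zz_coord_op H \<epsilon> i g (y, v) = ?q x * (g (?s x, v) - g (?s y, v)) +
        (1 - ?q x) * (g (x, flip i v) - g (y, flip i v)) + (?q x - ?q y) * (g (?s y, v) - g (y, flip i v))"
      unfolding A by algebra
    have "\<bar>?q x * (g (?s x, v) - g (?s y, v))\<bar> \<le> ?q x * (L * norm (x - y))"
      unfolding abs_mult using lipcD(2)[OF g v, of "?s x" "?s y"] by (simp add: mult_left_mono)
    moreover have "\<bar>(1 - ?q x) * (g (x, flip i v) - g (y, flip i v))\<bar> \<le> (1 - ?q x) * (L * norm (x - y))"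
      unfolding abs_mult using lipcD(2)[OF g fv, of x y] by (simp add: mult_left_mono)
    moreover have "\<bar>(?q x - ?q y) * (g (?s y, v) - g (y, flip i v))\<bar> \<le> (\<epsilon> * (K * norm (x - y))) * (2 * C)"
    proof (cases "R + \<epsilon> \<le> norm y")
      case True
      then show ?thesis using out[OF True] \<epsilon> hboundD(1)[OF hb] lip_supp_nonneg[OF g] by simp
    next
      case False
      then have xy: "norm x \<le> R + 1" "norm y \<le> R + 1" using y by auto
      have "\<bar>\<epsilon> * v $ i\<bar> = \<epsilon>" using signs_abs[OF v] \<epsilon> by (simp add: abs_mult)
      then have "\<bar>?q x - ?q y\<bar> \<le> \<epsilon> * (K * norm (x - y))"
        using zz_accept_lipschitz[OF hb _ _ xy, of "\<epsilon> * v $ i" i] \<epsilon> by force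
      moreover have "\<bar>g (?s y, v) - g (y, flip i v)\<bar> \<le> 2 * C"
        using lipcD(1)[OF g v, of "?s y"] lipcD(1)[OF g fv, of y] by linarith
      ultimately show ?thesis unfolding abs_mult by (intro mult_mono) auto
    qed
    moreover have "?q x * (L * norm (x - y)) + (1 - ?q x) * (L * norm (x - y)) + (\<epsilon> * (K * norm (x - y))) * (2 * C)
      = (L + 2 * K * C * \<epsilon>) * norm (x - y)" by (simp add: algebra_simps)
    ultimately show ?thesis unfolding eq by linarith
  qed
  show "\<bar>zz_coord_op H \<epsilon> i g (x, v) - zz_coord_op H \<epsilon> i g (y, v)\<bar> \<le> (L + 2 * K * C * \<epsilon>) * norm (x - y)"
  proof (cases "norm x \<le> R + 1 \<and> norm y \<le> R + 1 \<or> R + \<epsilon> \<le> norm y")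
    case False
    then have "R + \<epsilon> \<le> norm x" using \<epsilon> by auto
    then show ?thesis using main[of y x] by (simp add: abs_minus_commute norm_minus_commute)
  qed (rule main)
qed

lemma zz_coord_op_expansion:
  assumes hb: "gradient_bound H (R + 2) K" and g: "lip_supp R C L g" and \<epsilon>: "0 < \<epsilon>" "\<epsilon> \<le> 1" and v: "v \<in> signs"
  shows "\<bar>zz_coord_op H \<epsilon> i g (x, v) - zz_coord_shift \<epsilon> i g (x, v) - \<epsilon> * zz_coord_jump H i g (x, v)\<bar>
    \<le> ((K + K\<^sup>2) * (2 * C) + K * L) * \<epsilon>\<^sup>2"
proof -
  note fv = flip_signs[OF v, of i]
  let ?q = "exp (- max (H (x + axis i (\<epsilon> * v $ i)) - H x) 0)"
  let ?s = "x + axis i (\<epsilon> * v $ i)"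
  let ?l = "max (v $ i * partial_deriv i H x) 0"
  let ?D' = "g (x, flip i v) - g (?s, v)" and ?D = "g (x, flip i v) - g (x, v)"
  have K: "0 \<le> K" by (rule hboundD(1)[OF hb])
  \<comment> \<open>\<open>?D'\<close> compares the flip with the moved point, \<open>?D\<close>
    with the old one. The first product is the error of the rate times 2C, the second is the rate
    \<epsilon> K times the displacement error L \<epsilon>.\<close>
  have eq: "zz_coord_op H \<epsilon> i g (x, v) - zz_coord_shift \<epsilon> i g (x, v) - \<epsilon> * zz_coord_jump H i g (x, v) =
      (1 - ?q - \<epsilon> * ?l) * ?D' + \<epsilon> * ?l * (?D' - ?D)"
    by (simp add: zz_coord_op_def zz_coord_shift_def zz_coord_jump_def Let_def algebra_simps)
  show ?thesis
  proof (cases "norm x \<le> R + 1")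
    case True
    have 1: "\<bar>(1 - ?q - \<epsilon> * ?l) * ?D'\<bar> \<le> ((K + K\<^sup>2) * \<epsilon>\<^sup>2) * (2 * C)"
      unfolding abs_mult
    proof (rule mult_mono)
      show "\<bar>1 - ?q - \<epsilon> * ?l\<bar> \<le> (K + K\<^sup>2) * \<epsilon>\<^sup>2" by (rule zz_reject_bounds(3)[OF hb \<epsilon> True v])
      show "\<bar>?D'\<bar> \<le> 2 * C" using lipcD(1)[OF g v, of ?s] lipcD(1)[OF g fv, of x] by linarith
    qed (use K in auto)
    have 2: "\<bar>\<epsilon> * ?l * (?D' - ?D)\<bar> \<le> (\<epsilon> * K) * (L * \<epsilon>)"
      unfolding abs_mult[of "\<epsilon> * ?l"]
    proof (rule mult_mono)
      have "\<bar>v $ i * partial_deriv i H x\<bar> \<le> K"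
        using hboundD(2)[OF hb, of x i] True signs_abs[OF v, of i] by (simp add: abs_mult)
      then have "\<bar>?l\<bar> \<le> K" by (rule order_trans[OF max0_abs])
      then show "\<bar>\<epsilon> * ?l\<bar> \<le> \<epsilon> * K" unfolding abs_mult using \<epsilon> by (intro mult_mono) auto
      have "\<bar>g (x, v) - g (?s, v)\<bar> \<le> L * norm (x - ?s)" by (rule lipcD(2)[OF g v])
      then show "\<bar>?D' - ?D\<bar> \<le> L * \<epsilon>"
        using signs_abs[OF v, of i] \<epsilon> by (simp add: norm_axis_real abs_mult)
    qed (use \<epsilon> K in auto)
    have 3: "((K + K\<^sup>2) * \<epsilon>\<^sup>2) * (2 * C) + (\<epsilon> * K) * (L * \<epsilon>) = ((K + K\<^sup>2) * (2 * C) + K * L) * \<epsilon>\<^sup>2"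
      by (simp add: algebra_simps power2_eq_square)
    show ?thesis unfolding eq
      by (rule order_trans[OF abs_triangle_ineq order_trans[OF add_mono[OF 1 2] eq_refl[OF 3]]])
  next
    case False
    then have x: "R \<le> norm x" by simp
    have s: "R \<le> norm ?s" using norm_shift[OF v \<epsilon>(1), of x i] \<epsilon>(2) False by linarith
    note lipcD(3)[OF g v s] lipcD(3)[OF g fv x] lipcD(3)[OF g v x]
    then show ?thesis unfolding eq using K lip_supp_nonneg[OF g] by simp
  qed
qed

end

text \<open>A product of a rate, which is Lipschitz only because of its positive part, and a
  difference of two Lipschitz functions. The product rule is arranged so that the rate stands
  undifferenced at one point only, which may be taken inside the ball where it is bounded.\<close>

lemma lip_supp_zz_coord_jump:
  fixes H :: "real ^ 'd::finite \<Rightarrow> real"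
  assumes hb: "gradient_bound H R K" and g: "lip_supp R C L g"
  shows "lip_supp R (2 * K * C) (2 * K * C + 2 * K * L) (zz_coord_jump H i g)"
proof (rule lipcI)
  fix v :: "real ^ 'd" and x y assume v: "v \<in> signs"
  note fv = flip_signs[OF v, of i]
  let ?l = "\<lambda>x. max (v $ i * partial_deriv i H x) 0"
  let ?D = "\<lambda>x. g (x, flip i v) - g (x, v)"
  have B: "zz_coord_jump H i g (x, v) = ?l x * ?D x" for x by (simp add: zz_coord_jump_def)
  have K: "0 \<le> K" by (rule hboundD(1)[OF hb])
  have C: "0 \<le> C" "0 \<le> L" by (rule lip_supp_nonneg[OF g])+
  have l: "\<bar>?l x\<bar> \<le> K" if "norm x \<le> R" for x
  proof -
    have "\<bar>v $ i * partial_deriv i H x\<bar> \<le> K"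
      using hboundD(2)[OF hb, of x i] that signs_abs[OF v, of i] by (simp add: abs_mult)
    then show ?thesis by (rule order_trans[OF max0_abs])
  qed
  have D0: "?D x = 0" if "R \<le> norm x" for x using lipcD(3)[OF g v that] lipcD(3)[OF g fv that] by simp
  have DC: "\<bar>?D x\<bar> \<le> 2 * C" for x using lipcD(1)[OF g v, of x] lipcD(1)[OF g fv, of x] by linarith
  have DL: "\<bar>?D x - ?D y\<bar> \<le> 2 * (L * norm (x - y))" for x y
    using lipcD(2)[OF g v, of x y] lipcD(2)[OF g fv, of x y] by linarith
  show "R \<le> norm x \<Longrightarrow> zz_coord_jump H i g (x, v) = 0" unfolding B using D0[of x] by simp
  show "\<bar>zz_coord_jump H i g (x, v)\<bar> \<le> 2 * K * C"
  proof (cases "norm x \<le> R")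
    case True
    have "\<bar>?l x * ?D x\<bar> \<le> K * (2 * C)" unfolding abs_mult using l[OF True] DC[of x] K by (intro mult_mono) auto
    then show ?thesis unfolding B by (simp add: mult_ac)
  next
    case False
    then show ?thesis unfolding B using D0[of x] K C by simp
  qed
  have main: "\<bar>?l x * ?D x - ?l y * ?D y\<bar> \<le> (2 * K * C + 2 * K * L) * norm (x - y)"
    if x: "norm x \<le> R" for x y
  proof -
    have 1: "\<bar>?l x * (?D x - ?D y)\<bar> \<le> K * (2 * (L * norm (x - y)))"
      unfolding abs_mult using l[OF x] DL[of x y] K by (intro mult_mono) auto
    have 2: "\<bar>(?l x - ?l y) * ?D y\<bar> \<le> (K * norm (x - y)) * (2 * C)"
    proof (cases "norm y \<le> R")
      case True
      have "\<bar>?l x - ?l y\<bar> \<le> \<bar>v $ i * partial_deriv i H x - v $ i * partial_deriv i H y\<bar>" by (rule max0_diff)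
      also have "\<dots> = \<bar>partial_deriv i H x - partial_deriv i H y\<bar>"
        unfolding right_diff_distrib[symmetric] abs_mult signs_abs[OF v] by simp
      also have "\<dots> \<le> K * norm (x - y)" by (rule hboundD(3)[OF hb x True])
      finally show ?thesis unfolding abs_mult using DC[of y] K by (intro mult_mono) auto
    next
      case False
      then show ?thesis using D0[of y] K C by simp
    qed
    have eq: "?l x * ?D x - ?l y * ?D y = ?l x * (?D x - ?D y) + (?l x - ?l y) * ?D y" by algebra
    have 3: "K * (2 * (L * norm (x - y))) + (K * norm (x - y)) * (2 * C) = (2 * K * C + 2 * K * L) * norm (x - y)"
      by (simp add: algebra_simps)
    show ?thesis unfolding eq
      by (rule order_trans[OF abs_triangle_ineq order_trans[OF add_mono[OF 1 2] eq_refl[OF 3]]])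
  qed
  show "\<bar>zz_coord_jump H i g (x, v) - zz_coord_jump H i g (y, v)\<bar> \<le> (2 * K * C + 2 * K * L) * norm (x - y)"
  proof (cases "norm x \<le> R")
    case True
    then show ?thesis unfolding B by (rule main)
  next
    case x: False
    show ?thesis
    proof (cases "norm y \<le> R")
      case True
      then show ?thesis unfolding B using main[of y x] by (simp add: abs_minus_commute norm_minus_commute)
    next
      case False
      then show ?thesis unfolding B using x D0[of x] D0[of y] mult_nonneg_nonneg[OF K C(1)] mult_nonneg_nonneg[OF K C(2)] by simp
    qed
  qed
qed


text \<open>The transition operator of \<open>(\<epsilon> X, V)\<close>, see \<open>walk_step\<close>; the first coordinate is updated first,
  hence the outermost factor.\<close>

definition zz_op :: "(real ^ 'd::{finite,linorder} \<Rightarrow> real) \<Rightarrow> real \<Rightarrow>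
    ('d::{finite,linorder} phase \<Rightarrow> real) \<Rightarrow> 'd::{finite,linorder} phase \<Rightarrow> real" where
  "zz_op H \<epsilon> g = foldr (zz_coord_op H \<epsilon>) (sorted_list_of_set UNIV) g"

definition zzflow :: "real \<Rightarrow> ('d::finite phase \<Rightarrow> real) \<Rightarrow> 'd phase \<Rightarrow> real" where
  "zzflow r g z = g (fst z + r *\<^sub>R snd z, snd z)"

definition zzjump :: "(real ^ 'd::finite \<Rightarrow> real) \<Rightarrow> ('d phase \<Rightarrow> real) \<Rightarrow>
    'd phase \<Rightarrow> real" where
  "zzjump H g z = (\<Sum>i\<in>UNIV. zz_coord_jump H i g z)"

section \<open>Expansion of a full step of the walk\<close>

lemma foldr_zz_coord_shift: "foldr (zz_coord_shift \<epsilon>) l g (x, v) = g (x + (\<Sum>i\<leftarrow>l. axis i (\<epsilon> * v $ i)), v)"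
  by (induction l arbitrary: x) (simp_all add: zz_coord_shift_def add.assoc)

lemma norm_sum_list_axis:
  assumes "v \<in> signs" "0 < \<epsilon>"
  shows "norm (\<Sum>i\<leftarrow>l. axis i (\<epsilon> * v $ i) :: real ^ 'd::finite) \<le> real (length l) * \<epsilon>"
proof (induction l)
  case (Cons i l)
  have "norm (axis i (\<epsilon> * v $ i)) = \<epsilon>"
    using assms signs_abs[OF assms(1), of i] by (simp add: norm_axis_real abs_mult)
  then have "norm (axis i (\<epsilon> * v $ i) + (\<Sum>i\<leftarrow>l. axis i (\<epsilon> * v $ i))) \<le> \<epsilon> + real (length l) * \<epsilon>"
    using norm_triangle_ineq[of "axis i (\<epsilon> * v $ i)" "\<Sum>i\<leftarrow>l. axis i (\<epsilon> * v $ i)"] Cons.IH by linarith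
  then show ?case by (simp add: algebra_simps)
qed simp

lemma lip_supp_sum_list:
  fixes f :: "'i \<Rightarrow> 'd::finite phase \<Rightarrow> real"
  assumes "\<And>i. i \<in> set l \<Longrightarrow> lip_supp R C L (f i)"
  shows "lip_supp R (real (length l) * C) (real (length l) * L) (\<lambda>z. \<Sum>i\<leftarrow>l. f i z)"
  using assms
proof (induction l)
  case Nil
  show ?case by (rule lipcI) auto
next
  case (Cons i l)
  have "lip_supp R (C + real (length l) * C) (L + real (length l) * L) (\<lambda>z. f i z + (\<Sum>i\<leftarrow>l. f i z))"
    by (rule lip_supp_add) (use Cons in auto)
  then show ?case by (simp add: algebra_simps)
qed

lemma zz_coord_jump_diff_bound:
  fixes H :: "real ^ 'd::finite \<Rightarrow> real"
  assumes hb: "gradient_bound H R K" and v: "v \<in> signs" and b: "0 \<le> b"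
    and d: "\<And>w. w \<in> signs \<Longrightarrow> \<bar>G (x, w) - g (x, w)\<bar> \<le> b"
    and z: "\<And>w. w \<in> signs \<Longrightarrow> R \<le> norm x \<Longrightarrow> G (x, w) = 0 \<and> g (x, w) = 0"
  shows "\<bar>zz_coord_jump H i G (x, v) - zz_coord_jump H i g (x, v)\<bar> \<le> 2 * K * b"
proof (cases "R \<le> norm x")
  case True
  then show ?thesis using z[OF v True] z[OF flip_signs[OF v] True, of i] hboundD(1)[OF hb] b by (simp add: zz_coord_jump_def)
next
  case False
  let ?l = "max (v $ i * partial_deriv i H x) 0"
  let ?d = "\<lambda>w. G (x, w) - g (x, w)"
  have eq: "zz_coord_jump H i G (x, v) - zz_coord_jump H i g (x, v) = ?l * (?d (flip i v) - ?d v)"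
    by (simp add: zz_coord_jump_def algebra_simps)
  have "\<bar>v $ i * partial_deriv i H x\<bar> \<le> K"
    using hboundD(2)[OF hb, of x i] False signs_abs[OF v, of i] by (simp add: abs_mult)
  then have l: "\<bar>?l\<bar> \<le> K" by (rule order_trans[OF max0_abs])
  have "\<bar>?d (flip i v) - ?d v\<bar> \<le> \<bar>?d (flip i v)\<bar> + \<bar>?d v\<bar>" by (rule abs_triangle_ineq4)
  also have "\<dots> \<le> b + b" by (intro add_mono d v flip_signs)
  finally have "\<bar>?l * (?d (flip i v) - ?d v)\<bar> \<le> K * (b + b)"
    unfolding abs_mult using l by (intro mult_mono) auto
  then show ?thesis unfolding eq by (simp add: algebra_simps)
qed

context
  fixes H :: "real ^ 'd::{finite,linorder} \<Rightarrow> real"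
  assumes C1: "class_C1 H"
begin

lemma lip_supp_foldr_zz_coord_op:
  assumes "gradient_bound H (R + real (length l) + 2) K" and g: "lip_supp R C L g" and \<epsilon>: "0 < \<epsilon>" "\<epsilon> \<le> 1"
  shows "lip_supp (R + real (length l) * \<epsilon>) C (L + real (length l) * (2 * K * C * \<epsilon>)) (foldr (zz_coord_op H \<epsilon>) l g)"
  using assms(1)
proof (induction l)
  case Nil
  then show ?case using g by simp
next
  case (Cons i l)
  have "gradient_bound H (R + real (length l) + 2) K" by (rule gradient_bound_mono[OF Cons.prems]) simp
  note IH = Cons.IH[OF this]
  have "real (length l) * \<epsilon> \<le> real (length l)" using \<epsilon> by (simp add: mult_left_le)
  then have "gradient_bound H (R + real (length l) * \<epsilon> + 2) K" by (intro gradient_bound_mono[OF Cons.prems]) simp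
  from lip_supp_zz_coord_op[OF C1 this IH \<epsilon>, of i] show ?case by (simp add: algebra_simps)
qed

text \<open>Each of the n steps adds at most \<open>2 * K * C * \<epsilon>\<close> per coordinate to
  the Lipschitz constant, with the same C throughout, so the total is linear in
  \<open>n * \<epsilon> \<le> T\<close> and independent of \<epsilon> and n. The final support
  radius is known in advance, so one K covers all steps.\<close>

lemma lip_supp_zz_op_funpow:
  assumes g: "lip_supp R C L g" and \<epsilon>: "0 < \<epsilon>" "\<epsilon> \<le> 1"
    and hb: "gradient_bound H (R + real CARD('d) * T + real CARD('d) + 2) K" and n: "real n * \<epsilon> \<le> T"
  shows "lip_supp (R + real CARD('d) * T) C (L + real CARD('d) * T * (2 * K * C)) ((zz_op H \<epsilon> ^^ n) g)"
proof -
  let ?N = "real CARD('d)"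
  have "lip_supp (R + real n * (?N * \<epsilon>)) C (L + real n * (?N * (2 * K * C * \<epsilon>))) ((zz_op H \<epsilon> ^^ n) g)"
    using n
  proof (induction n)
    case 0
    then show ?case using g by simp
  next
    case (Suc n)
    have n: "real n * \<epsilon> \<le> T" using Suc.prems \<epsilon> by (simp add: algebra_simps)
    have "?N * (real n * \<epsilon>) \<le> ?N * T" using n by (intro mult_left_mono) auto
    then have "gradient_bound H (R + real n * (?N * \<epsilon>) + real (length (sorted_list_of_set (UNIV::'d set))) + 2) K"
      by (intro gradient_bound_mono[OF hb]) (simp add: mult_ac)
    from lip_supp_foldr_zz_coord_op[OF this Suc.IH[OF n] \<epsilon>] show ?case
      by (simp add: zz_op_def algebra_simps)
  qed
  moreover have "?N * (real n * \<epsilon>) \<le> ?N * T" using n by (intro mult_left_mono) auto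
  moreover have "real n * (?N * (2 * K * C * \<epsilon>)) \<le> ?N * T * (2 * K * C)"
  proof -
    have "0 \<le> 2 * K * C" using lip_supp_nonneg(1)[OF g] hboundD(1)[OF hb] by simp
    then have "(?N * (real n * \<epsilon>)) * (2 * K * C) \<le> ?N * T * (2 * K * C)"
      using calculation(2) by (intro mult_right_mono)
    then show ?thesis by (simp add: mult_ac)
  qed
  ultimately show ?thesis by (intro lip_supp_mono[OF \<open>lip_supp (R + real n * (?N * \<epsilon>)) C _ _\<close>]) (simp_all add: mult_ac)
qed

text \<open>Induction on the list, the head being the outermost update. Its own expansion is applied
  to \<open>G\<close>, the result of the tail; then G is replaced by its transport plus jump in the
  shifted argument, and by g in the jump term of the head. The constant must not depend on
  \<epsilon> or g, only on R, C, L and K.\<close>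

lemma zz_coord_op_foldr_expansion:
  assumes CL: "0 \<le> C" "0 \<le> L" and "gradient_bound H (R + real (length l) + 2) K"
  shows "\<exists>K1\<ge>0. \<forall>\<epsilon> g v x. 0 < \<epsilon> \<longrightarrow> \<epsilon> \<le> 1 \<longrightarrow> lip_supp R C L g \<longrightarrow> v \<in> signs \<longrightarrow>
    \<bar>foldr (zz_coord_op H \<epsilon>) l g (x, v) - foldr (zz_coord_shift \<epsilon>) l g (x, v) - \<epsilon> * (\<Sum>i\<leftarrow>l. zz_coord_jump H i g (x, v))\<bar> \<le> K1 * \<epsilon>\<^sup>2"
  using assms(3)
proof (induction l)
  case Nil
  show ?case by (intro exI[of _ 0]) simp
next
  case (Cons i l)
  let ?N = "real (length l)"
  have hb: "gradient_bound H (R + ?N + 2) K" by (rule gradient_bound_mono[OF Cons.prems]) simp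
  have hbN: "gradient_bound H (R + ?N) K" by (rule gradient_bound_mono[OF hb]) simp
  have hbR: "gradient_bound H R K" by (rule gradient_bound_mono[OF hb]) simp
  have K: "0 \<le> K" by (rule hboundD(1)[OF hb])
  obtain K1 where K1: "0 \<le> K1" and IH: "\<And>\<epsilon> g v x. 0 < \<epsilon> \<Longrightarrow> \<epsilon> \<le> 1 \<Longrightarrow> lip_supp R C L g \<Longrightarrow> v \<in> signs \<Longrightarrow>
    \<bar>foldr (zz_coord_op H \<epsilon>) l g (x, v) - foldr (zz_coord_shift \<epsilon>) l g (x, v) - \<epsilon> * (\<Sum>i\<leftarrow>l. zz_coord_jump H i g (x, v))\<bar> \<le> K1 * \<epsilon>\<^sup>2"
    using Cons.IH[OF hb] by (elim exE conjE) (rule that, auto)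
  \<comment> \<open>\<open>L1\<close> is the Lipschitz constant of the result G of the tail,
    \<open>CQ\<close> and \<open>LQ\<close> are the constants of its jump terms, \<open>b\<close>
    bounds G - g in units of \<epsilon>, and \<open>c1\<close> is the error of the outermost update
    applied to G.\<close>
  define L1 where "L1 = L + ?N * (2 * K * C)"
  define CQ where "CQ = ?N * (2 * K * C)"
  define LQ where "LQ = ?N * (2 * K * C + 2 * K * L)"
  define b where "b = K1 + ?N * L + CQ"
  define c1 where "c1 = (K + K\<^sup>2) * (2 * C) + K * L1"
  have nn: "0 \<le> L1" "0 \<le> CQ" "0 \<le> LQ" "0 \<le> b" "0 \<le> c1"
    using K CL K1 unfolding L1_def CQ_def LQ_def b_def c1_def by simp_all
  show ?case
  proof (rule exI[of _ "c1 + (K1 + LQ) + 2 * K * b"], intro conjI allI impI)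
    show "0 \<le> c1 + (K1 + LQ) + 2 * K * b" using nn K K1 by simp
    fix \<epsilon> :: real and g :: "'d::{finite,linorder} phase \<Rightarrow> real" and v x :: "real ^ 'd::{finite,linorder}"
    assume \<epsilon>: "0 < \<epsilon>" "\<epsilon> \<le> 1" and g: "lip_supp R C L g" and v: "v \<in> signs"
    define G where "G = foldr (zz_coord_op H \<epsilon>) l g"
    define Q where "Q z = (\<Sum>i\<leftarrow>l. zz_coord_jump H i g z)" for z
    let ?P = "foldr (zz_coord_shift \<epsilon>) l g"
    have \<epsilon>2: "\<epsilon>\<^sup>2 \<le> \<epsilon>" using \<epsilon> by (simp add: power2_eq_square mult_left_le)
    have "2 * K * C * \<epsilon> \<le> 2 * K * C" using \<epsilon> K CL by (simp add: mult_left_le)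
    then have "?N * (2 * K * C * \<epsilon>) \<le> ?N * (2 * K * C)" by (intro mult_left_mono) auto
    moreover have "?N * \<epsilon> \<le> ?N" using \<epsilon> by (simp add: mult_left_le)
    ultimately have G: "lip_supp (R + ?N) C L1 G"
      unfolding G_def L1_def by (intro lip_supp_mono[OF lip_supp_foldr_zz_coord_op[OF hb g \<epsilon>]]) auto
    have Q: "lip_supp R CQ LQ Q" unfolding CQ_def LQ_def Q_def
      by (rule lip_supp_sum_list) (rule lip_supp_zz_coord_jump[OF hbR g])
    let ?x = "x + axis i (\<epsilon> * v $ i)"
    have 1: "\<bar>zz_coord_op H \<epsilon> i G (x, v) - zz_coord_shift \<epsilon> i G (x, v) - \<epsilon> * zz_coord_jump H i G (x, v)\<bar> \<le> c1 * \<epsilon>\<^sup>2"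
      unfolding c1_def by (rule zz_coord_op_expansion[OF C1 hb G \<epsilon> v])
    have IH': "\<bar>G (y, w) - ?P (y, w) - \<epsilon> * Q (y, w)\<bar> \<le> K1 * \<epsilon>\<^sup>2" if "w \<in> signs" for y w
      unfolding G_def Q_def by (rule IH[OF \<epsilon> g that])
    have "\<bar>Q (?x, v) - Q (x, v)\<bar> \<le> LQ * \<epsilon>"
      using lipcD(2)[OF Q v, of ?x x] signs_abs[OF v, of i] \<epsilon> by (simp add: norm_axis_real abs_mult)
    then have "\<epsilon> * \<bar>Q (?x, v) - Q (x, v)\<bar> \<le> \<epsilon> * (LQ * \<epsilon>)" using \<epsilon> by (intro mult_left_mono) auto
    then have 2: "\<bar>\<epsilon> * (Q (?x, v) - Q (x, v))\<bar> \<le> LQ * \<epsilon>\<^sup>2"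
      using \<epsilon> by (simp add: abs_mult power2_eq_square mult_ac)
    have d: "\<bar>G (x, w) - g (x, w)\<bar> \<le> b * \<epsilon>" if w: "w \<in> signs" for w
    proof -
      have a1: "\<bar>G (x, w) - ?P (x, w) - \<epsilon> * Q (x, w)\<bar> \<le> K1 * \<epsilon>"
        using IH'[OF w, of x] mult_left_mono[OF \<epsilon>2 K1] by simp
      have a2: "\<bar>\<epsilon> * Q (x, w)\<bar> \<le> CQ * \<epsilon>"
        unfolding abs_mult using lipcD(1)[OF Q w, of x] \<epsilon> by (simp add: mult.commute[of \<epsilon>] mult_right_mono)
      have "\<bar>?P (x, w) - g (x, w)\<bar> \<le> L * norm ((x + (\<Sum>i\<leftarrow>l. axis i (\<epsilon> * w $ i))) - x)"
        unfolding foldr_zz_coord_shift by (rule lipcD(2)[OF g w])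
      also have "\<dots> \<le> L * (?N * \<epsilon>)"
        using norm_sum_list_axis[OF w \<epsilon>(1), of l] CL by (intro mult_left_mono) auto
      finally have a3: "\<bar>?P (x, w) - g (x, w)\<bar> \<le> ?N * L * \<epsilon>" by (simp add: mult_ac)
      have "b * \<epsilon> = K1 * \<epsilon> + ?N * L * \<epsilon> + CQ * \<epsilon>" by (simp add: b_def algebra_simps)
      then show ?thesis using a1 a2 a3 by linarith
    qed
    have "\<bar>zz_coord_jump H i G (x, v) - zz_coord_jump H i g (x, v)\<bar> \<le> 2 * K * (b * \<epsilon>)"
    proof (rule zz_coord_jump_diff_bound[OF hbN v])
      show "0 \<le> b * \<epsilon>" using nn \<epsilon> by simp
      show "\<bar>G (x, w) - g (x, w)\<bar> \<le> b * \<epsilon>" if "w \<in> signs" for w by (rule d[OF that])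
      show "G (x, w) = 0 \<and> g (x, w) = 0" if w: "w \<in> signs" and n: "R + ?N \<le> norm x" for w
      proof -
        have "R \<le> norm x" using n by simp
        then show ?thesis using lipcD(3)[OF G w n] lipcD(3)[OF g w] by blast
      qed
    qed
    then have "\<epsilon> * \<bar>zz_coord_jump H i G (x, v) - zz_coord_jump H i g (x, v)\<bar> \<le> \<epsilon> * (2 * K * (b * \<epsilon>))"
      using \<epsilon> by (intro mult_left_mono) auto
    then have 3: "\<bar>\<epsilon> * (zz_coord_jump H i G (x, v) - zz_coord_jump H i g (x, v))\<bar> \<le> 2 * K * b * \<epsilon>\<^sup>2"
      using \<epsilon> by (simp add: abs_mult power2_eq_square mult_ac)
    \<comment> \<open>The groups are the error of the outermost update, the induction hypothesis at
      the shifted point, the displacement of the jump terms back to x, and the replacement of G by g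
      under the outermost jump.\<close>
    have eq: "foldr (zz_coord_op H \<epsilon>) (i # l) g (x, v) - foldr (zz_coord_shift \<epsilon>) (i # l) g (x, v) -
        \<epsilon> * (\<Sum>i\<leftarrow>i # l. zz_coord_jump H i g (x, v)) =
      (zz_coord_op H \<epsilon> i G (x, v) - zz_coord_shift \<epsilon> i G (x, v) - \<epsilon> * zz_coord_jump H i G (x, v)) +
      ((G (?x, v) - ?P (?x, v) - \<epsilon> * Q (?x, v)) + \<epsilon> * (Q (?x, v) - Q (x, v))) +
      \<epsilon> * (zz_coord_jump H i G (x, v) - zz_coord_jump H i g (x, v))"
      by (simp add: G_def[symmetric] Q_def[symmetric] zz_coord_shift_def algebra_simps)
    have "\<bar>(zz_coord_op H \<epsilon> i G (x, v) - zz_coord_shift \<epsilon> i G (x, v) - \<epsilon> * zz_coord_jump H i G (x, v)) +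
      ((G (?x, v) - ?P (?x, v) - \<epsilon> * Q (?x, v)) + \<epsilon> * (Q (?x, v) - Q (x, v))) +
      \<epsilon> * (zz_coord_jump H i G (x, v) - zz_coord_jump H i g (x, v))\<bar> \<le> c1 * \<epsilon>\<^sup>2 + (K1 * \<epsilon>\<^sup>2 + LQ * \<epsilon>\<^sup>2) + 2 * K * b * \<epsilon>\<^sup>2"
      by (rule order_trans[OF abs_triangle_ineq], rule add_mono[OF order_trans[OF abs_triangle_ineq] 3],
          rule add_mono[OF 1 order_trans[OF abs_triangle_ineq]], rule add_mono[OF IH'[OF v] 2])
    then show "\<bar>foldr (zz_coord_op H \<epsilon>) (i # l) g (x, v) - foldr (zz_coord_shift \<epsilon>) (i # l) g (x, v) -
        \<epsilon> * (\<Sum>i\<leftarrow>i # l. zz_coord_jump H i g (x, v))\<bar> \<le> (c1 + (K1 + LQ) + 2 * K * b) * \<epsilon>\<^sup>2"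
      unfolding eq by (simp add: distrib_right)
  qed
qed

text \<open>Shifts along all axes compose to transport by \<epsilon> v and the jump terms add up, so
  the order of the coordinates is visible only in the error.\<close>

lemma zz_op_expansion:
  assumes "0 \<le> C" "0 \<le> L" and "gradient_bound H (R + real CARD('d) + 2) K"
  obtains K1 where "0 \<le> K1" "\<And>\<epsilon> g v x. 0 < \<epsilon> \<Longrightarrow> \<epsilon> \<le> 1 \<Longrightarrow> lip_supp R C L g \<Longrightarrow> v \<in> signs \<Longrightarrow>
    \<bar>zz_op H \<epsilon> g (x, v) - zzflow \<epsilon> g (x, v) - \<epsilon> * zzjump H g (x, v)\<bar> \<le> K1 * \<epsilon>\<^sup>2"
proof -
  let ?l = "sorted_list_of_set (UNIV :: 'd set)"
  have s: "(\<Sum>i\<leftarrow>?l. f i) = (\<Sum>i\<in>UNIV. f i)" for f :: "'d \<Rightarrow> 'b::comm_monoid_add"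
    by (simp add: sum_list_distinct_conv_sum_set)
  have "(\<Sum>i\<in>UNIV. axis i (\<epsilon> * v $ i)) = \<epsilon> *\<^sub>R v" for \<epsilon> and v :: "real ^ 'd::{finite,linorder}"
    by (subst axis_scale) (subst vec_eq_sum_axis[of "\<epsilon> *\<^sub>R v"], simp)
  then have flow: "foldr (zz_coord_shift \<epsilon>) ?l g (x, v) = zzflow \<epsilon> g (x, v)" for \<epsilon> g v x
    unfolding foldr_zz_coord_shift s by (simp add: zzflow_def)
  have jump: "(\<Sum>i\<leftarrow>?l. zz_coord_jump H i g z) = zzjump H g z" for g z
    unfolding s by (simp add: zzjump_def)
  have "gradient_bound H (R + real (length ?l) + 2) K" using assms(3) by simp
  from zz_coord_op_foldr_expansion[OF assms(1,2) this]
  show ?thesis unfolding flow jump zz_op_def[symmetric] using that by blast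
qed

end


section \<open>Compactly supported test functions\<close>

lemma class_C1I:
  fixes g :: "real ^ 'd::finite \<Rightarrow> real"
  assumes d: "\<And>x. (g has_derivative (\<lambda>h. h \<bullet> G x)) (at x)" and c: "continuous_on UNIV G"
  shows "class_C1 g" "gradient g x = G x"
proof -
  have p: "partial_deriv i g x = G x $ i" for i x
  proof -
    have "frechet_derivative g (at x) = (\<lambda>h. h \<bullet> G x)" using frechet_derivative_at[OF d] by simp
    then show ?thesis by (simp add: partial_deriv_def inner_axis')
  qed
  show "gradient g x = G x" by (simp add: gradient_def p vec_eq_iff)
  have "continuous_on UNIV (\<lambda>x. G x $ i)" for i by (intro continuous_intros c)
  then show "class_C1 g" unfolding class_C1_def p using d by (auto simp: differentiable_def)
qed

lemma continuous_gradient: "class_C1 g \<Longrightarrow> continuous_on UNIV (gradient g)"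
  unfolding gradient_def[abs_def] by (intro continuous_on_vec_lambda) (simp add: class_C1_def)

lemma class_C1_mult:
  assumes "class_C1 f" "class_C1 g"
  shows "class_C1 (\<lambda>x. f x * g x)"
proof (rule class_C1I(1))
  show "((\<lambda>x. f x * g x) has_derivative (\<lambda>h. h \<bullet> (f x *\<^sub>R gradient g x + g x *\<^sub>R gradient f x))) (at x)" for x
    using has_derivative_mult[OF class_C1_has_derivative[OF assms(1)] class_C1_has_derivative[OF assms(2)], of x]
    by (simp add: inner_add_right mult.commute)
  show "continuous_on UNIV (\<lambda>x. f x *\<^sub>R gradient g x + g x *\<^sub>R gradient f x)"
    by (intro continuous_intros continuous_gradient class_C1_continuous assms)
qed

lemma class_C1_polynomial:
  fixes p :: "real ^ 'd::finite \<Rightarrow> real"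
  assumes "real_polynomial_function p"
  shows "class_C1 p"
  using assms
proof (induction p rule: real_polynomial_function.induct)
  case (linear f)
  note bl = this
  interpret bounded_linear f by (rule bl)
  define G where "G = (\<chi> i. f (axis i 1))"
  have "h \<bullet> G = f h" for h
  proof -
    have "f h = f (\<Sum>i\<in>UNIV. h $ i *\<^sub>R axis i 1)" using vec_eq_sum_axis[of h] by simp
    then show ?thesis by (simp add: sum scaleR inner_vec_def G_def)
  qed
  then have eq: "(\<lambda>h. h \<bullet> G) = f" by (rule ext)
  show ?case
  proof (rule class_C1I(1))
    show "(f has_derivative (\<lambda>h. h \<bullet> G)) (at x)" for x
      unfolding eq by (rule bounded_linear_imp_has_derivative[OF bl])
    show "continuous_on UNIV (\<lambda>x. G)" by (rule continuous_on_const)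
  qed
next
  case (const c)
  show ?case by (rule class_C1I(1)[of _ "\<lambda>_. 0"]) auto
next
  case (add f g)
  show ?case
  proof (rule class_C1I(1))
    show "((\<lambda>x. f x + g x) has_derivative (\<lambda>h. h \<bullet> (gradient f x + gradient g x))) (at x)" for x
      using has_derivative_add[OF class_C1_has_derivative[OF add.IH(1)] class_C1_has_derivative[OF add.IH(2)], of x]
      by (simp add: inner_add_right)
    show "continuous_on UNIV (\<lambda>x. gradient f x + gradient g x)"
      by (intro continuous_intros continuous_gradient add.IH)
  qed
next
  case (mult f g)
  then show ?case by (intro class_C1_mult)
qed

text \<open>The first-order remainder is at most h^2 in each of the four sign patterns of y and y +
  h, so the kink of the positive part is smoothed by the square.\<close>

lemma DERIV_max0_square: "((\<lambda>y::real. (max 0 y)\<^sup>2) has_real_derivative 2 * max 0 y) (at y)"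
proof -
  have b: "\<bar>(max 0 (y + h))\<^sup>2 - (max 0 y)\<^sup>2 - 2 * max 0 y * h\<bar> \<le> h\<^sup>2" for h :: real
  proof -
    consider "0 \<le> y" "0 \<le> y + h" | "0 \<le> y" "y + h < 0" | "y < 0" "0 \<le> y + h" | "y < 0" "y + h < 0"
      by linarith
    then show ?thesis
    proof cases
      case 1
      have "(y + h)\<^sup>2 - y\<^sup>2 - 2 * y * h = h\<^sup>2" by (simp add: power2_eq_square algebra_simps)
      then show ?thesis using 1 by simp
    next
      case 2
      have "0 \<le> (y + h)\<^sup>2" by simp
      then have "- y\<^sup>2 - 2 * y * h \<le> h\<^sup>2" by (simp add: power2_eq_square algebra_simps)
      moreover have "0 \<le> y * (- (y + 2 * h))" using 2 by (intro mult_nonneg_nonneg) auto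
      then have "0 \<le> - y\<^sup>2 - 2 * y * h" by (simp add: power2_eq_square algebra_simps)
      ultimately show ?thesis using 2 by simp
    next
      case 3
      then have "(y + h)\<^sup>2 \<le> h\<^sup>2" by (intro power_mono) auto
      then show ?thesis using 3 by simp
    next
      case 4
      then show ?thesis by simp
    qed
  qed
  have "((\<lambda>h. ((max 0 (y + h))\<^sup>2 - (max 0 y)\<^sup>2) / h - 2 * max 0 y) \<longlongrightarrow> 0) (at 0)"
  proof (rule Lim_null_comparison)
    show "((\<lambda>h. \<bar>h\<bar>) \<longlongrightarrow> 0) (at (0::real))" by (rule tendsto_eq_intros) (auto intro: tendsto_rabs_zero)
    have "norm (((max 0 (y + h))\<^sup>2 - (max 0 y)\<^sup>2) / h - 2 * max 0 y) \<le> \<bar>h\<bar>" if h: "h \<noteq> 0" for h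
    proof -
      have "((max 0 (y + h))\<^sup>2 - (max 0 y)\<^sup>2) / h - 2 * max 0 y = ((max 0 (y + h))\<^sup>2 - (max 0 y)\<^sup>2 - 2 * max 0 y * h) / h"
        using h by (simp add: field_simps)
      then have "norm (((max 0 (y + h))\<^sup>2 - (max 0 y)\<^sup>2) / h - 2 * max 0 y) \<le> h\<^sup>2 / \<bar>h\<bar>"
        using b[of h] by (simp add: divide_right_mono)
      also have "h\<^sup>2 / \<bar>h\<bar> = \<bar>h\<bar>"
      proof -
        have "h\<^sup>2 = \<bar>h\<bar> * \<bar>h\<bar>" by (simp add: power2_eq_square)
        moreover have "\<bar>h\<bar> * \<bar>h\<bar> / \<bar>h\<bar> = \<bar>h\<bar>" by (rule nonzero_mult_div_cancel_right) (use h in simp)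
        ultimately show ?thesis by (simp only:)
      qed
      finally show ?thesis .
    qed
    then show "\<forall>\<^sub>F h in at 0. norm (((max 0 (y + h))\<^sup>2 - (max 0 y)\<^sup>2) / h - 2 * max 0 y) \<le> \<bar>h\<bar>"
      by (auto simp: eventually_at_filter)
  qed
  then have "((\<lambda>h. ((max 0 (y + h))\<^sup>2 - (max 0 y)\<^sup>2) / h) \<longlongrightarrow> 2 * max 0 y) (at 0)"
    by (rule LIM_zero_cancel)
  then show ?thesis unfolding DERIV_def .
qed

text \<open>A cut-off of class C1 that is positive inside the ball and vanishes outside; C1 is all
  that the test functions of the generator require.\<close>

definition bump :: "real \<Rightarrow> real ^ 'd::finite \<Rightarrow> real" where
  "bump R x = (max 0 (R\<^sup>2 - x \<bullet> x))\<^sup>2"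

lemma class_C1_bump: "class_C1 (bump R :: real ^ 'd::finite \<Rightarrow> real)"
proof (rule class_C1I(1))
  fix x :: "real ^ 'd"
  have 1: "((\<lambda>x. R\<^sup>2 - x \<bullet> x) has_derivative (\<lambda>h. - 2 * (x \<bullet> h))) (at x)"
    by (auto intro!: derivative_eq_intros simp: inner_commute)
  have 2: "((\<lambda>y::real. (max 0 y)\<^sup>2) has_derivative (*) (2 * max 0 (R\<^sup>2 - x \<bullet> x))) (at (R\<^sup>2 - x \<bullet> x))"
    using DERIV_max0_square[of "R\<^sup>2 - x \<bullet> x"] by (simp add: has_field_derivative_def)
  show "(bump R has_derivative (\<lambda>h. h \<bullet> ((- 4 * max 0 (R\<^sup>2 - x \<bullet> x)) *\<^sub>R x))) (at x)"
    using has_derivative_compose[OF 1 2] unfolding bump_def[abs_def] by (simp add: inner_commute mult_ac)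
next
  show "continuous_on UNIV (\<lambda>x :: real ^ 'd. (- 4 * max 0 (R\<^sup>2 - x \<bullet> x)) *\<^sub>R x)"
    by (intro continuous_intros)
qed

lemma bump_zero: "0 \<le> R \<Longrightarrow> R \<le> norm x \<Longrightarrow> bump R x = 0"
  by (simp add: bump_def dot_square_norm power_mono)

lemma bump_le: "bump R x \<le> (R\<^sup>2)\<^sup>2"
  unfolding bump_def by (intro power_mono) auto

lemma bump_ge:
  assumes "norm x \<le> r" "0 \<le> r"
  shows "(max 0 (R\<^sup>2 - r\<^sup>2))\<^sup>2 \<le> bump R x"
  unfolding bump_def dot_square_norm using assms by (intro power_mono max.mono diff_left_mono) auto

lemma finite_signs: "finite (signs :: ('a::ring_1 ^ 'd::finite) set)"
proof -
  have "(signs :: ('a ^ 'd) set) \<subseteq> (\<lambda>f. \<chi> i. f i) ` (UNIV \<rightarrow>\<^sub>E {1, - 1 :: 'a})"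
  proof
    fix v :: "'a ^ 'd" assume "v \<in> signs"
    then have "(\<lambda>i. v $ i) \<in> UNIV \<rightarrow>\<^sub>E {1, - 1}" by (auto simp: signs_def)
    moreover have "v = (\<chi> i. v $ i)" by simp
    ultimately show "v \<in> (\<lambda>f. \<chi> i. f i) ` (UNIV \<rightarrow>\<^sub>E {1, - 1 :: 'a})" by blast
  qed
  then show ?thesis by (rule finite_subset) (simp add: finite_PiE)
qed

text \<open>The l1 bound. It serves as the speed in the support estimates for the flow.\<close>

lemma norm_signs: "v \<in> signs \<Longrightarrow> norm (v :: real ^ 'd::finite) \<le> real CARD('d)"
  using norm_le_l1_cart[of v] by (simp add: signs_abs)

section \<open>Functions of bounded support and the density of C1 functions\<close>

definition cont_supp :: "real \<Rightarrow> ('d::finite phase \<Rightarrow> real) \<Rightarrow> bool" where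
  "cont_supp R f \<longleftrightarrow> (\<forall>v\<in>signs. continuous_on UNIV (\<lambda>x. f (x, v)) \<and> (\<forall>x. R \<le> norm x \<longrightarrow> f (x, v) = 0))"

definition C1_supp :: "real \<Rightarrow> ('d::finite phase \<Rightarrow> real) \<Rightarrow> bool" where
  "C1_supp R f \<longleftrightarrow> (\<forall>v\<in>signs. class_C1 (\<lambda>x. f (x, v)) \<and> (\<forall>x. R \<le> norm x \<longrightarrow> f (x, v) = 0))"

lemma C1_supp_imp_cont_supp: "C1_supp R f \<Longrightarrow> cont_supp R f"
  using class_C1_continuous unfolding C1_supp_def cont_supp_def by blast

lemma lip_supp_imp_cont_supp:
  fixes f :: "'d::finite phase \<Rightarrow> real"
  assumes "lip_supp R C L f"
  shows "cont_supp R f"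
  unfolding cont_supp_def
proof (intro ballI conjI allI impI)
  fix v :: "real ^ 'd" assume v: "v \<in> signs"
  have "L-lipschitz_on UNIV (\<lambda>x. f (x, v))"
    using lipcD(2)[OF assms v] lip_supp_nonneg(2)[OF assms] by (intro lipschitz_onI) (auto simp: dist_norm)
  then show "continuous_on UNIV (\<lambda>x. f (x, v))" by (rule lipschitz_on_continuous_on)
  show "f (x, v) = 0" if "R \<le> norm x" for x by (rule lipcD(3)[OF assms v that])
qed

lemma cont_supp_bounded:
  fixes f :: "'d::finite phase \<Rightarrow> real"
  assumes "cont_supp R f"
  obtains C where "0 \<le> C" "\<And>x v. v \<in> signs \<Longrightarrow> \<bar>f (x, v)\<bar> \<le> C"
proof -
  have ex: "\<exists>C. 0 \<le> C \<and> (\<forall>x. \<bar>f (x, v)\<bar> \<le> C)" if v: "v \<in> signs" for v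
  proof -
    have c: "continuous_on UNIV (\<lambda>x. f (x, v))" using assms v by (simp add: cont_supp_def)
    obtain K where K: "0 \<le> K" "\<And>x. norm x \<le> R \<Longrightarrow> \<bar>f (x, v)\<bar> \<le> K" using class_C1_bounded[OF c, of R] by blast
    have "\<bar>f (x, v)\<bar> \<le> K" for x
    proof (cases "norm x \<le> R")
      case False
      then have "f (x, v) = 0" using assms v by (simp add: cont_supp_def)
      then show ?thesis using K(1) by simp
    qed (rule K(2))
    then show ?thesis using K(1) by blast
  qed
  define C where "C v = (SOME C. 0 \<le> C \<and> (\<forall>x. \<bar>f (x, v)\<bar> \<le> C))" for v
  have C: "0 \<le> C v \<and> (\<forall>x. \<bar>f (x, v)\<bar> \<le> C v)" if "v \<in> signs" for v
    unfolding C_def by (rule someI_ex[OF ex[OF that]])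
  show ?thesis
  proof (rule that[of "\<Sum>v\<in>signs. C v"])
    show "0 \<le> (\<Sum>v\<in>signs. C v)" using C by (intro sum_nonneg) blast
    fix x v :: "real ^ 'd" assume v: "v \<in> signs"
    have "C v \<le> (\<Sum>v\<in>signs. C v)" using C v finite_signs by (intro member_le_sum) auto
    then show "\<bar>f (x, v)\<bar> \<le> (\<Sum>v\<in>signs. C v)" using C[OF v] order_trans by blast
  qed
qed

lemma cont_supp_uniformly_continuous:
  fixes f :: "'d::finite phase \<Rightarrow> real"
  assumes "cont_supp R f" "0 < e"
  obtains d where "0 < d" "\<And>x y v. v \<in> signs \<Longrightarrow> norm (x - y) < d \<Longrightarrow> \<bar>f (x, v) - f (y, v)\<bar> < e"
proof -
  have ex: "\<exists>d. 0 < d \<and> (\<forall>x y. norm (x - y) < d \<longrightarrow> \<bar>f (x, v) - f (y, v)\<bar> < e)" if v: "v \<in> signs" for v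
  proof -
    have "continuous_on (cball 0 (R + 1)) (\<lambda>x. f (x, v))"
      using assms v by (auto simp: cont_supp_def intro: continuous_on_subset)
    then have "uniformly_continuous_on (cball 0 (R + 1)) (\<lambda>x. f (x, v))"
      by (intro compact_uniformly_continuous) auto
    then obtain d where d: "d > 0" "\<And>x y. x \<in> cball 0 (R + 1) \<Longrightarrow> y \<in> cball 0 (R + 1) \<Longrightarrow> dist y x < d \<Longrightarrow>
        dist (f (y, v)) (f (x, v)) < e"
      using assms(2) unfolding uniformly_continuous_on_def by (metis (no_types, lifting))
    show ?thesis
    proof (rule exI[of _ "min d 1"], intro conjI allI impI)
      show "0 < min d 1" using d(1) by simp
      fix x y :: "real ^ 'd" assume xy: "norm (x - y) < min d 1"
      show "\<bar>f (x, v) - f (y, v)\<bar> < e"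
      proof (cases "norm x \<le> R + 1 \<and> norm y \<le> R + 1")
        case True
        then show ?thesis using d(2)[of y x] xy by (simp add: dist_norm)
      next
        case False
        have "norm x \<le> norm y + norm (x - y)" "norm y \<le> norm x + norm (x - y)"
          using norm_triangle_sub[of x y] norm_triangle_sub[of y x] by (simp_all add: norm_minus_commute)
        then have "R \<le> norm x" "R \<le> norm y" using False xy by linarith+
        then have "f (x, v) = 0" "f (y, v) = 0" using assms v by (simp_all add: cont_supp_def)
        then show ?thesis using assms(2) by simp
      qed
    qed
  qed
  define d where "d v = (SOME d. 0 < d \<and> (\<forall>x y. norm (x - y) < d \<longrightarrow> \<bar>f (x, v) - f (y, v)\<bar> < e))" for v
  have d: "0 < d v \<and> (\<forall>x y. norm (x - y) < d v \<longrightarrow> \<bar>f (x, v) - f (y, v)\<bar> < e)" if "v \<in> signs" for v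
    unfolding d_def by (rule someI_ex[OF ex[OF that]])
  show ?thesis
  proof (rule that[of "Min (insert 1 (d ` signs))"])
    have fin: "finite (insert 1 (d ` signs))" by (intro finite.insertI finite_imageI finite_signs)
    show "0 < Min (insert 1 (d ` signs))" using fin d by auto
    fix x y v :: "real ^ 'd" assume v: "v \<in> signs" and xy: "norm (x - y) < Min (insert 1 (d ` signs))"
    have "Min (insert 1 (d ` signs)) \<le> d v" using fin v by (intro Min_le) auto
    then have "norm (x - y) < d v" using xy by linarith
    then show "\<bar>f (x, v) - f (y, v)\<bar> < e" using d[OF v] by blast
  qed
qed

text \<open>For each velocity f is divided by a bump, the quotient is approximated by a polynomial
  on the ball, and the product with the bump is formed again: this restores bounded support and
  keeps the approximation C1.\<close>

lemma C1_supp_dense: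
  fixes f :: "'d::finite phase \<Rightarrow> real"
  assumes f: "cont_supp R f" and R: "0 \<le> R" and e: "0 < e"
  obtains f' where "C1_supp (R + 1) f'" "\<And>x v. v \<in> signs \<Longrightarrow> \<bar>f (x, v) - f' (x, v)\<bar> \<le> e"
proof -
  define b :: "real ^ 'd \<Rightarrow> real" where "b = bump (R + 1)"
  \<comment> \<open>\<open>c0\<close> is a lower bound of the bump on the ball of radius R, so the
    truncation \<open>max (b x) c0\<close> avoids division by zero without changing anything on the
    support of f. \<open>M\<close> bounds the bump from above and turns the precision e / M of the
    polynomial into e.\<close>
  define c0 where "c0 = (max 0 ((R + 1)\<^sup>2 - R\<^sup>2))\<^sup>2"
  define M where "M = ((R + 1)\<^sup>2)\<^sup>2"
  have M: "0 < M" using R by (simp add: M_def)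
  have "0 < (R + 1)\<^sup>2 - R\<^sup>2" using R by (simp add: power2_eq_square algebra_simps)
  then have c0: "0 < c0" by (simp add: c0_def)
  have ex: "\<exists>p. real_polynomial_function p \<and> (\<forall>x. norm x \<le> R + 1 \<longrightarrow> \<bar>f (x, v) / max (b x) c0 - p x\<bar> < e / M)"
    if v: "v \<in> signs" for v
  proof -
    have bc: "continuous_on UNIV b" unfolding b_def by (intro class_C1_continuous class_C1_bump)
    have "continuous_on UNIV (\<lambda>x. f (x, v))" using f v by (simp add: cont_supp_def)
    then have "continuous_on UNIV (\<lambda>x. f (x, v) / max (b x) c0)"
      using c0 by (intro continuous_intros bc) auto
    then have "continuous_on (cball 0 (R + 1)) (\<lambda>x. f (x, v) / max (b x) c0)"
      by (rule continuous_on_subset) simp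
    from Stone_Weierstrass_real_polynomial_function[OF compact_cball this, of "e / M"] e M
    show ?thesis by (auto simp: dist_norm)
  qed
  define p where "p v = (SOME p. real_polynomial_function p \<and> (\<forall>x. norm x \<le> R + 1 \<longrightarrow> \<bar>f (x, v) / max (b x) c0 - p x\<bar> < e / M))" for v
  have p: "real_polynomial_function (p v) \<and> (\<forall>x. norm x \<le> R + 1 \<longrightarrow> \<bar>f (x, v) / max (b x) c0 - p v x\<bar> < e / M)"
    if "v \<in> signs" for v
    unfolding p_def by (rule someI_ex[OF ex[OF that]])
  have b0: "b x = 0" if "R + 1 \<le> norm x" for x unfolding b_def using R that by (intro bump_zero) auto
  show ?thesis
  proof (rule that[of "\<lambda>z. b (fst z) * p (snd z) (fst z)"])
    show "C1_supp (R + 1) (\<lambda>z. b (fst z) * p (snd z) (fst z))"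
      unfolding C1_supp_def
    proof (intro ballI conjI allI impI)
      fix v :: "real ^ 'd" assume v: "v \<in> signs"
      have "class_C1 (\<lambda>x. b x * p v x)"
        using p[OF v] unfolding b_def by (intro class_C1_mult class_C1_bump class_C1_polynomial) blast
      then show "class_C1 (\<lambda>x. b (fst (x, v)) * p (snd (x, v)) (fst (x, v)))" by simp
      show "b (fst (x, v)) * p (snd (x, v)) (fst (x, v)) = 0" if "R + 1 \<le> norm x" for x
        using b0[OF that] by simp
    qed
    fix x v :: "real ^ 'd" assume v: "v \<in> signs"
    show "\<bar>f (x, v) - b (fst (x, v)) * p (snd (x, v)) (fst (x, v))\<bar> \<le> e"
    proof (cases "norm x \<le> R + 1")
      case True
      have fb: "f (x, v) = b x * (f (x, v) / max (b x) c0)"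
      proof (cases "norm x \<le> R")
        case True
        have "c0 \<le> b x" unfolding c0_def b_def by (rule bump_ge[OF True R])
        then show ?thesis using c0 by (simp add: max_def)
      next
        case False
        then have "f (x, v) = 0" using f v by (simp add: cont_supp_def)
        then show ?thesis by simp
      qed
      have bM: "0 \<le> b x" "b x \<le> M" unfolding b_def M_def by (simp add: bump_def) (rule bump_le)
      have "\<bar>f (x, v) - b x * p v x\<bar> = \<bar>b x * (f (x, v) / max (b x) c0 - p v x)\<bar>"
        by (subst fb) (simp add: right_diff_distrib)
      also have "\<dots> = b x * \<bar>f (x, v) / max (b x) c0 - p v x\<bar>" using bM by (simp add: abs_mult)
      also have "\<dots> \<le> M * (e / M)" using p[OF v] True bM M by (intro mult_mono) (auto intro: less_imp_le)
      finally show ?thesis using M by simp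
    next
      case False
      then have "R \<le> norm x" "R + 1 \<le> norm x" by linarith+
      then have "f (x, v) = 0" "b x = 0" using f v b0 by (simp_all add: cont_supp_def)
      then show ?thesis using e by simp
    qed
  qed
qed

text \<open>A mean value inequality that only uses the increments to the right.\<close>

lemma right_increment_bound:
  fixes \<phi> :: "real \<Rightarrow> real"
  assumes ab: "a \<le> b"
    and left: "\<And>s. a < s \<Longrightarrow> s \<le> b \<Longrightarrow> (\<phi> \<longlongrightarrow> \<phi> s) (at_left s)"
    and incr: "\<And>s e. a \<le> s \<Longrightarrow> s < b \<Longrightarrow> 0 < e \<Longrightarrow>
      \<forall>\<^sub>F h in at_right 0. \<bar>\<phi> (s + h) - \<phi> s - c * h\<bar> \<le> (K + e) * h"
  shows "\<bar>\<phi> b - \<phi> a - c * (b - a)\<bar> \<le> K * (b - a)"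
proof (rule field_le_epsilon)
  fix e0 :: real assume e0: "0 < e0"
  define e where "e = e0 / (1 + (b - a))"
  have e: "0 < e" "e * (b - a) \<le> e0"
    using e0 ab by (simp_all add: e_def field_simps)
  define ok where "ok s \<longleftrightarrow> \<bar>\<phi> s - \<phi> a - c * (s - a)\<bar> \<le> (K + e) * (s - a)" for s
  \<comment> \<open>A supremum argument: left continuity carries the estimate to the supremum of
    \<open>S\<close>, and the increment to the right pushes it strictly further unless the supremum
    is b.\<close>
  define S where "S = {s. a \<le> s \<and> s \<le> b \<and> (\<forall>u. a \<le> u \<longrightarrow> u \<le> s \<longrightarrow> ok u)}"
  have aS: "a \<in> S"
  proof -
    have "ok u" if "a \<le> u" "u \<le> a" for u using that by (simp add: ok_def)
    then show ?thesis using ab by (simp add: S_def)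
  qed
  have bdd: "bdd_above S" by (rule bdd_aboveI[of _ b]) (simp add: S_def)
  define m where "m = Sup S"
  have am: "a \<le> m" unfolding m_def by (rule cSup_upper[OF aS bdd])
  have mb: "m \<le> b" unfolding m_def using aS by (intro cSup_least) (auto simp: S_def)
  have below: "ok u" if u: "a \<le> u" "u < m" for u
  proof -
    obtain s where "s \<in> S" "u < s" using u(2) less_cSup_iff[OF _ bdd] aS unfolding m_def by blast
    then show ?thesis using u(1) by (simp add: S_def)
  qed
  have okm: "ok m"
  proof (cases "a = m")
    case True
    then show ?thesis by (simp add: ok_def)
  next
    case False
    then have "a < m" using am by simp
    have l1: "((\<lambda>u. \<bar>\<phi> u - \<phi> a - c * (u - a)\<bar>) \<longlongrightarrow> \<bar>\<phi> m - \<phi> a - c * (m - a)\<bar>) (at_left m)"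
      by (intro tendsto_intros left[OF \<open>a < m\<close> mb])
    have l2: "((\<lambda>u. (K + e) * (u - a)) \<longlongrightarrow> (K + e) * (m - a)) (at_left m)" by (intro tendsto_intros)
    have "\<forall>\<^sub>F u in at_left m. \<bar>\<phi> u - \<phi> a - c * (u - a)\<bar> \<le> (K + e) * (u - a)"
      using \<open>a < m\<close>
    proof (rule eventually_at_leftI[rotated])
      fix u assume "u \<in> {a<..<m}"
      then show "\<bar>\<phi> u - \<phi> a - c * (u - a)\<bar> \<le> (K + e) * (u - a)" using below[of u] by (simp add: ok_def)
    qed
    then show ?thesis unfolding ok_def by (intro tendsto_le[OF _ l2 l1]) simp_all
  qed
  have "m = b"
  proof (rule ccontr)
    assume "m \<noteq> b"
    then have "m < b" using mb by simp
    from incr[OF am this e(1)] obtain d where d: "0 < d"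
      "\<And>h. 0 < h \<Longrightarrow> h < d \<Longrightarrow> \<bar>\<phi> (m + h) - \<phi> m - c * h\<bar> \<le> (K + e) * h"
      unfolding eventually_at_right_field by blast
    define s where "s = m + min (d / 2) (b - m)"
    have s: "m < s" "s \<le> b" "s - m < d" using d(1) \<open>m < b\<close> by (auto simp: s_def min_def)
    have "ok u" if u: "a \<le> u" "u \<le> s" for u
    proof (cases "u \<le> m")
      case True
      then show ?thesis using okm below[OF u(1)] by (cases "u = m") auto
    next
      case False
      have "\<bar>\<phi> (m + (u - m)) - \<phi> m - c * (u - m)\<bar> \<le> (K + e) * (u - m)"
        by (rule d(2)) (use False u s in linarith)+
      then have 1: "\<bar>\<phi> u - \<phi> m - c * (u - m)\<bar> \<le> (K + e) * (u - m)" by simp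
      have eq: "\<phi> u - \<phi> a - c * (u - a) = (\<phi> u - \<phi> m - c * (u - m)) + (\<phi> m - \<phi> a - c * (m - a))"
        by (simp add: algebra_simps)
      have "(K + e) * (u - m) + (K + e) * (m - a) = (K + e) * (u - a)" by (simp add: algebra_simps)
      then show ?thesis unfolding ok_def eq
        using order_trans[OF abs_triangle_ineq add_mono[OF 1 okm[unfolded ok_def]]] by simp
    qed
    then have "s \<in> S" using am s by (simp add: S_def)
    then have "s \<le> m" unfolding m_def by (rule cSup_upper[OF _ bdd])
    then show False using s by simp
  qed
  then have "\<bar>\<phi> b - \<phi> a - c * (b - a)\<bar> \<le> (K + e) * (b - a)" using okm by (simp add: ok_def)
  also have "\<dots> \<le> K * (b - a) + e0" using e(2) by (simp add: distrib_right)
  finally show "\<bar>\<phi> b - \<phi> a - c * (b - a)\<bar> \<le> K * (b - a) + e0" .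
qed


section \<open>The semigroup of the Zig-Zag process\<close>

lemma space_zz: "space zz_state_space = UNIV \<times> signs"
  by (simp add: zz_state_space_def space_restrict_space)

definition zzdrift :: "('d::finite phase \<Rightarrow> real) \<Rightarrow> 'd phase \<Rightarrow> real" where
  "zzdrift f z = snd z \<bullet> gradient (\<lambda>y. f (y, snd z)) (fst z)"

lemma zz_generator_eq: "zz_generator H f z = zzdrift f z + zzjump H f z"
  by (cases z) (simp add: zzdrift_def zzjump_def zz_coord_jump_def)

text \<open>There are finitely many velocities, so f is a finite sum of its velocity slices and
  continuity in the position is enough.\<close>

lemma borel_measurable_zz:
  fixes f :: "'d::finite phase \<Rightarrow> real"
  assumes "\<And>v. v \<in> signs \<Longrightarrow> continuous_on UNIV (\<lambda>x. f (x, v))"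
  shows "f \<in> borel_measurable zz_state_space"
proof -
  let ?g = "\<lambda>z. \<Sum>s\<in>signs. (if snd z = s then f (fst z, s) else 0)"
  have "?g \<in> borel_measurable (borel :: ('d phase) measure)"
  proof (intro borel_measurable_sum measurable_If borel_measurable_const)
    fix s :: "real ^ 'd" assume s: "s \<in> signs"
    have "continuous_on UNIV (\<lambda>z :: 'd phase. f (fst z, s))"
      using continuous_on_compose2[OF assms[OF s] continuous_on_fst[OF continuous_on_id]] by simp
    then show "(\<lambda>z. f (fst z, s)) \<in> borel_measurable (borel :: ('d phase) measure)"
      by (rule borel_measurable_continuous_onI)
    have "closed {z :: 'd phase. snd z = s}"
      by (intro closed_Collect_eq continuous_intros)
    then show "{z \<in> space (borel :: ('d phase) measure). snd z = s} \<in> sets borel" by simp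
  qed
  then have "?g \<in> borel_measurable zz_state_space"
    unfolding zz_state_space_def by (rule measurable_restrict_space1)
  moreover have "f z = ?g z" if "z \<in> space zz_state_space" for z
  proof -
    have "snd z \<in> signs" using that by (auto simp: space_zz)
    then have "?g z = f (fst z, snd z)"
      using sum.delta'[OF finite_signs, of "snd z" "\<lambda>s. f (fst z, s)"] by (simp add: eq_commute)
    then show ?thesis by simp
  qed
  ultimately show ?thesis using measurable_cong[of zz_state_space f ?g borel] by blast
qed

text \<open>The class on which the semigroup acts by integration. Boundedness is asked on the true
  states only, which carry all the measures \<open>P t z\<close>. Unlike continuity, membership is
  preserved by the semigroup for measure-theoretic reasons alone.\<close>

definition bounded_borel :: "('d::finite phase \<Rightarrow> real) \<Rightarrow> bool" where
  "bounded_borel f \<longleftrightarrow> f \<in> borel_measurable zz_state_space \<and> (\<exists>C. \<forall>z\<in>UNIV \<times> signs. \<bar>f z\<bar> \<le> C)"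

lemma cont_supp_bounded_borel:
  fixes f :: "'d::finite phase \<Rightarrow> real"
  assumes "cont_supp R f"
  shows "bounded_borel f"
proof -
  obtain C where "\<And>x v. v \<in> signs \<Longrightarrow> \<bar>f (x, v)\<bar> \<le> C" using cont_supp_bounded[OF assms] by blast
  then have "\<forall>z\<in>UNIV \<times> signs. \<bar>f z\<bar> \<le> C" by auto
  moreover have "f \<in> borel_measurable zz_state_space"
    using assms by (intro borel_measurable_zz) (simp add: cont_supp_def)
  ultimately show ?thesis unfolding bounded_borel_def by blast
qed

lemma bounded_borel_add: "bounded_borel f \<Longrightarrow> bounded_borel g \<Longrightarrow> bounded_borel (\<lambda>z. f z + g z)"
  unfolding bounded_borel_def
proof (elim conjE exE, intro conjI)
  fix C D assume f: "\<forall>z\<in>UNIV \<times> signs. \<bar>f z\<bar> \<le> C" and g: "\<forall>z\<in>UNIV \<times> signs. \<bar>g z\<bar> \<le> D"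
  show "\<exists>C. \<forall>z\<in>UNIV \<times> signs. \<bar>f z + g z\<bar> \<le> C"
  proof (intro exI[of _ "C + D"] ballI)
    fix z :: "(real ^ 'a) \<times> (real ^ 'a)" assume z: "z \<in> UNIV \<times> signs"
    show "\<bar>f z + g z\<bar> \<le> C + D" using bspec[OF f z] bspec[OF g z] by linarith
  qed
qed auto

lemma bounded_borel_const: "bounded_borel (\<lambda>z. c)"
  unfolding bounded_borel_def by auto

lemma bounded_borel_cmult: "bounded_borel f \<Longrightarrow> bounded_borel (\<lambda>z. c * f z)"
  unfolding bounded_borel_def
proof (elim conjE exE, intro conjI)
  fix C assume f: "\<forall>z\<in>UNIV \<times> signs. \<bar>f z\<bar> \<le> C"
  show "\<exists>C. \<forall>z\<in>UNIV \<times> signs. \<bar>c * f z\<bar> \<le> C"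
  proof (intro exI[of _ "\<bar>c\<bar> * C"] ballI)
    fix z :: "(real ^ 'a) \<times> (real ^ 'a)" assume z: "z \<in> UNIV \<times> signs"
    show "\<bar>c * f z\<bar> \<le> \<bar>c\<bar> * C" unfolding abs_mult using bspec[OF f z] by (intro mult_left_mono) auto
  qed
qed auto

lemma bounded_borel_diff: "bounded_borel f \<Longrightarrow> bounded_borel g \<Longrightarrow> bounded_borel (\<lambda>z. f z - g z)"
  using bounded_borel_add[of f "\<lambda>z. -1 * g z"] bounded_borel_cmult[of g "-1"] by simp

lemma zzflow_zzflow: "zzflow r (zzflow s g) = zzflow (r + s) g"
  by (rule ext) (simp add: zzflow_def scaleR_add_left add.assoc)

lemma zzflow_0: "zzflow 0 g = g"
  by (rule ext) (simp add: zzflow_def)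

lemma norm_flow:
  assumes "v \<in> signs"
  shows "norm x \<le> norm (x + r *\<^sub>R v :: real ^ 'd::finite) + real CARD('d) * \<bar>r\<bar>"
proof -
  have "norm x \<le> norm (x + r *\<^sub>R v) + norm (r *\<^sub>R v)"
    using norm_triangle_ineq4[of "x + r *\<^sub>R v" "r *\<^sub>R v"] by simp
  moreover have "norm (r *\<^sub>R v) \<le> real CARD('d) * \<bar>r\<bar>"
    using mult_right_mono[OF norm_signs[OF assms], of "\<bar>r\<bar>"] by (simp add: mult.commute)
  ultimately show ?thesis by linarith
qed

lemma cont_supp_flow:
  fixes g :: "'d::finite phase \<Rightarrow> real"
  assumes "cont_supp R g"
  shows "cont_supp (R + real CARD('d) * \<bar>r\<bar>) (zzflow r g)"
  unfolding cont_supp_def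
proof (intro ballI conjI allI impI)
  fix v :: "real ^ 'd" assume v: "v \<in> signs"
  have "continuous_on UNIV (\<lambda>x. g (x, v))" using assms v by (simp add: cont_supp_def)
  moreover have "continuous_on UNIV (\<lambda>x. x + r *\<^sub>R v)" by (intro continuous_intros)
  ultimately show "continuous_on UNIV (\<lambda>x. zzflow r g (x, v))"
    unfolding zzflow_def using continuous_on_compose2[of UNIV "\<lambda>x. g (x, v)" UNIV "\<lambda>x. x + r *\<^sub>R v"] by simp
  fix x :: "real ^ 'd" assume "R + real CARD('d) * \<bar>r\<bar> \<le> norm x"
  then have "R \<le> norm (x + r *\<^sub>R v)" using norm_flow[OF v, of x r] by linarith
  then show "zzflow r g (x, v) = 0" using assms v by (simp add: cont_supp_def zzflow_def)
qed

lemma C1_supp_flow: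
  fixes g :: "'d::finite phase \<Rightarrow> real"
  assumes "C1_supp R g"
  shows "C1_supp (R + real CARD('d) * \<bar>r\<bar>) (zzflow r g)"
  unfolding C1_supp_def
proof (intro ballI conjI)
  fix v :: "real ^ 'd" assume v: "v \<in> signs"
  have C1: "class_C1 (\<lambda>x. g (x, v))" using assms v by (simp add: C1_supp_def)
  show "class_C1 (\<lambda>x. zzflow r g (x, v))"
  proof (rule class_C1I(1))
    fix x
    have "((\<lambda>x. x + r *\<^sub>R v) has_derivative (\<lambda>h. h)) (at x)" by (auto intro!: derivative_eq_intros)
    from has_derivative_compose[OF this class_C1_has_derivative[OF C1]]
    show "((\<lambda>x. zzflow r g (x, v)) has_derivative (\<lambda>h. h \<bullet> gradient (\<lambda>x. g (x, v)) (x + r *\<^sub>R v))) (at x)"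
      by (simp add: zzflow_def)
  next
    show "continuous_on UNIV (\<lambda>x. gradient (\<lambda>x. g (x, v)) (x + r *\<^sub>R v))"
      by (rule continuous_on_compose2[OF continuous_gradient[OF C1], of UNIV]) (auto intro!: continuous_intros)
  qed
  show "\<forall>x. R + real CARD('d) * \<bar>r\<bar> \<le> norm x \<longrightarrow> zzflow r g (x, v) = 0"
    using cont_supp_flow[OF C1_supp_imp_cont_supp[OF assms], of r] v by (simp add: cont_supp_def)
qed

lemma lip_supp_flow:
  fixes g :: "'d::finite phase \<Rightarrow> real"
  assumes "lip_supp R C L g"
  shows "lip_supp (R + real CARD('d) * \<bar>r\<bar>) C L (zzflow r g)"
proof (rule lipcI)
  fix v :: "real ^ 'd" and x y assume v: "v \<in> signs"
  show "\<bar>zzflow r g (x, v)\<bar> \<le> C" using lipcD(1)[OF assms v] by (simp add: zzflow_def)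
  show "\<bar>zzflow r g (x, v) - zzflow r g (y, v)\<bar> \<le> L * norm (x - y)"
    using lipcD(2)[OF assms v, of "x + r *\<^sub>R v" "y + r *\<^sub>R v"] by (simp add: zzflow_def)
  show "zzflow r g (x, v) = 0" if "R + real CARD('d) * \<bar>r\<bar> \<le> norm x"
    using cont_supp_flow[OF lip_supp_imp_cont_supp[OF assms], of r] v that by (simp add: cont_supp_def)
qed

lemma zzflow_diff_lip_supp:
  fixes g :: "'d::finite phase \<Rightarrow> real"
  assumes g: "lip_supp R C L g" and v: "v \<in> signs" and r: "0 \<le> r"
  shows "\<bar>zzflow r g (x, v) - g (x, v)\<bar> \<le> L * (real CARD('d) * r)"
proof -
  have "\<bar>zzflow r g (x, v) - g (x, v)\<bar> \<le> L * norm (x + r *\<^sub>R v - x)"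
    using lipcD(2)[OF g v, of "x + r *\<^sub>R v" x] by (simp add: zzflow_def)
  also have "\<dots> \<le> L * (real CARD('d) * r)"
    using lip_supp_nonneg(2)[OF g] norm_signs[OF v] r by (intro mult_left_mono) (auto simp: mult.commute mult_left_mono)
  finally show ?thesis .
qed

lemma C1_supp_test_function:
  fixes f :: "'d::finite phase \<Rightarrow> real"
  assumes "C1_supp R f"
  shows "f \<in> zz_test_functions"
  unfolding zz_test_functions_def
proof (intro CollectI ballI conjI)
  fix v :: "real ^ 'd" assume v: "v \<in> signs"
  show "class_C1 (\<lambda>x. f (x, v))" using assms v by (simp add: C1_supp_def)
  have "{x. f (x, v) \<noteq> 0} \<subseteq> cball 0 R" using assms v by (force simp: C1_supp_def)
  then have "bounded (closure {x. f (x, v) \<noteq> 0})" by (meson bounded_cball bounded_closure bounded_subset)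
  then show "compact (closure {x. f (x, v) \<noteq> 0})" by (simp add: compact_eq_bounded_closed)
qed

text \<open>The radius grows to R + 1 because a vanishing gradient needs a whole neighbourhood on
  which f vanishes, and this is provided by the open set of norms above R.\<close>

lemma cont_supp_zzdrift:
  fixes f :: "'d::finite phase \<Rightarrow> real"
  assumes "C1_supp R f"
  shows "cont_supp (R + 1) (zzdrift f)"
  unfolding cont_supp_def
proof (intro ballI conjI allI impI)
  fix v :: "real ^ 'd" assume v: "v \<in> signs"
  have C1: "class_C1 (\<lambda>x. f (x, v))" using assms v by (simp add: C1_supp_def)
  show "continuous_on UNIV (\<lambda>x. zzdrift f (x, v))"
    unfolding zzdrift_def by (auto intro!: continuous_intros continuous_gradient C1)
  fix x :: "real ^ 'd" assume x: "R + 1 \<le> norm x"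
  have "open {y :: real ^ 'd. R < norm y}" by (intro open_Collect_less continuous_intros)
  moreover have "x \<in> {y. R < norm y}" using x by simp
  moreover have "f (y, v) = 0" if "y \<in> {y. R < norm y}" for y using assms v that by (simp add: C1_supp_def)
  ultimately have "((\<lambda>_. 0) has_derivative (\<lambda>h. h \<bullet> gradient (\<lambda>x. f (x, v)) x)) (at x)"
    by (intro has_derivative_transform_within_open[OF class_C1_has_derivative[OF C1]])
  then have "(\<lambda>h. h \<bullet> gradient (\<lambda>x. f (x, v)) x) = (\<lambda>h. 0)"
    by (rule has_derivative_unique) simp
  then show "zzdrift f (x, v) = 0" unfolding zzdrift_def by (metis fst_conv snd_conv)
qed

lemma cont_supp_zzjump:
  fixes f :: "'d::finite phase \<Rightarrow> real"
  assumes "cont_supp R f" "class_C1 H"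
  shows "cont_supp R (zzjump H f)"
  unfolding cont_supp_def
proof (intro ballI conjI allI impI)
  fix v :: "real ^ 'd" assume v: "v \<in> signs"
  have c: "continuous_on UNIV (\<lambda>x. f (x, w))" if "w \<in> signs" for w using assms that by (simp add: cont_supp_def)
  have p: "continuous_on UNIV (partial_deriv i H)" for i using assms by (simp add: class_C1_def)
  show "continuous_on UNIV (\<lambda>x. zzjump H f (x, v))"
    unfolding zzjump_def zz_coord_jump_def by (auto intro!: continuous_intros c p v flip_signs)
  fix x :: "real ^ 'd" assume "R \<le> norm x"
  then have "f (x, w) = 0" if "w \<in> signs" for w using assms that by (simp add: cont_supp_def)
  then show "zzjump H f (x, v) = 0" using v flip_signs[OF v] by (simp add: zzjump_def zz_coord_jump_def)
qed

lemma zzjump_diff_bound: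
  fixes H :: "real ^ 'd::finite \<Rightarrow> real"
  assumes hb: "gradient_bound H R K" and v: "v \<in> signs" and b: "0 \<le> b"
    and d: "\<And>w. w \<in> signs \<Longrightarrow> \<bar>G (x, w) - g (x, w)\<bar> \<le> b"
    and z: "\<And>w. w \<in> signs \<Longrightarrow> R \<le> norm x \<Longrightarrow> G (x, w) = 0 \<and> g (x, w) = 0"
  shows "\<bar>zzjump H G (x, v) - zzjump H g (x, v)\<bar> \<le> real CARD('d) * (2 * K * b)"
proof -
  have "\<bar>zzjump H G (x, v) - zzjump H g (x, v)\<bar> \<le> (\<Sum>i\<in>UNIV. \<bar>zz_coord_jump H i G (x, v) - zz_coord_jump H i g (x, v)\<bar>)"
    unfolding zzjump_def sum_subtractf[symmetric] by (rule sum_abs)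
  also have "\<dots> \<le> (\<Sum>i\<in>(UNIV::'d set). 2 * K * b)"
    by (intro sum_mono zz_coord_jump_diff_bound[where x=x and G=G and g=g, OF hb v b d z])
  finally show ?thesis by simp
qed

lemma zzjump_bound:
  fixes H :: "real ^ 'd::finite \<Rightarrow> real"
  assumes hb: "gradient_bound H R K" and v: "v \<in> signs" and b: "0 \<le> b"
    and d: "\<And>w. w \<in> signs \<Longrightarrow> \<bar>G (x, w)\<bar> \<le> b"
    and z: "\<And>w. w \<in> signs \<Longrightarrow> R \<le> norm x \<Longrightarrow> G (x, w) = 0"
  shows "\<bar>zzjump H G (x, v)\<bar> \<le> real CARD('d) * (2 * K * b)"
  using zzjump_diff_bound[OF hb v b, of G x "\<lambda>_. 0"] d z by (simp add: zzjump_def zz_coord_jump_def)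

lemma lip_supp_zzjump:
  fixes H :: "real ^ 'd::finite \<Rightarrow> real"
  assumes hb: "gradient_bound H R K" and g: "lip_supp R C L g"
  shows "lip_supp R (real CARD('d) * (2 * K * C)) (real CARD('d) * (2 * K * C + 2 * K * L)) (zzjump H g)"
proof -
  obtain l :: "'d list" where l: "distinct l" "set l = UNIV" using finite_distinct_list[of "UNIV :: 'd set"] by auto
  have len: "length l = CARD('d)" using distinct_card[OF l(1)] l(2) by simp
  have eq: "zzjump H g = (\<lambda>z. \<Sum>i\<leftarrow>l. zz_coord_jump H i g z)"
    unfolding zzjump_def[abs_def] sum_list_distinct_conv_sum_set[OF l(1)] l(2) ..
  show ?thesis unfolding eq len[symmetric]
    by (rule lip_supp_sum_list) (rule lip_supp_zz_coord_jump[OF hb g])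
qed

section \<open>The semigroup over short times\<close>

locale zz_semigroup =
  fixes H :: "(real, 'd::{finite,linorder}) vec \<Rightarrow> real"
    and P :: "real \<Rightarrow> 'd phase \<Rightarrow>
      'd phase measure"
  assumes C2: "class_C2 H"
    and sg: "markov_semigroup zz_state_space P"
    and gen: "has_generator zz_state_space P zz_test_functions (zz_generator H)"
begin

lemma C1: "class_C1 H"
  using C2 by (simp add: class_C2_def)

definition PP :: "real \<Rightarrow> ('d phase \<Rightarrow> real) \<Rightarrow> 'd phase \<Rightarrow> real" where
  "PP t f z = (\<integral>y. f y \<partial>P t z)"

lemma P_measurable: "0 \<le> t \<Longrightarrow> P t \<in> zz_state_space \<rightarrow>\<^sub>M prob_algebra zz_state_space"
  using sg by (simp add: markov_semigroup_def)

lemma P_prob: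
  assumes "0 \<le> t" "z \<in> UNIV \<times> signs"
  shows "prob_space (P t z)" "sets (P t z) = sets zz_state_space" "space (P t z) = UNIV \<times> signs"
proof -
  have "P t z \<in> space (prob_algebra zz_state_space)"
    using measurable_space[OF P_measurable[OF assms(1)]] assms(2) by (simp add: space_zz)
  then show "prob_space (P t z)" "sets (P t z) = sets zz_state_space"
    by (simp_all add: space_prob_algebra)
  then show "space (P t z) = UNIV \<times> signs" using sets_eq_imp_space_eq space_zz by blast
qed

lemma PP_integrable:
  assumes f: "bounded_borel f" and t: "0 \<le> t" and z: "z \<in> UNIV \<times> signs"
  shows "integrable (P t z) f"
proof -
  interpret prob_space "P t z" by (rule P_prob[OF t z])
  obtain C where C: "\<forall>z\<in>UNIV \<times> signs. \<bar>f z\<bar> \<le> C" and m: "f \<in> borel_measurable zz_state_space"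
    using f unfolding bounded_borel_def by blast
  show ?thesis
  proof (rule integrable_const_bound[where B=C])
    show "AE x in P t z. norm (f x) \<le> C" using C P_prob(3)[OF t z] by (intro AE_I2) auto
    show "f \<in> borel_measurable (P t z)" using m measurable_cong_sets[OF P_prob(2)[OF t z] refl] by blast
  qed
qed

lemma PP_abs_le:
  assumes f: "bounded_borel f" and t: "0 \<le> t" and z: "z \<in> UNIV \<times> signs" and C: "\<And>z. z \<in> UNIV \<times> signs \<Longrightarrow> \<bar>f z\<bar> \<le> C"
  shows "\<bar>PP t f z\<bar> \<le> C"
proof -
  interpret prob_space "P t z" by (rule P_prob[OF t z])
  have i: "integrable (P t z) f" by (rule PP_integrable[OF f t z])
  have "\<bar>PP t f z\<bar> \<le> (\<integral>y. \<bar>f y\<bar> \<partial>P t z)" unfolding PP_def by (rule integral_abs_bound)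
  also have "\<dots> \<le> (\<integral>y. C \<partial>P t z)"
    using i C P_prob(3)[OF t z] by (intro integral_mono) auto
  finally show ?thesis using prob_space by simp
qed

lemma PP_add_fun:
  "bounded_borel f \<Longrightarrow> bounded_borel g \<Longrightarrow> 0 \<le> t \<Longrightarrow> z \<in> UNIV \<times> signs \<Longrightarrow> PP t (\<lambda>y. f y + g y) z = PP t f z + PP t g z"
  unfolding PP_def by (rule Bochner_Integration.integral_add) (rule PP_integrable; assumption)+

lemma PP_diff_fun:
  "bounded_borel f \<Longrightarrow> bounded_borel g \<Longrightarrow> 0 \<le> t \<Longrightarrow> z \<in> UNIV \<times> signs \<Longrightarrow> PP t (\<lambda>y. f y - g y) z = PP t f z - PP t g z"
  unfolding PP_def by (rule Bochner_Integration.integral_diff) (rule PP_integrable; assumption)+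

lemma PP_cmult: "PP t (\<lambda>y. c * f y) z = c * PP t f z"
  unfolding PP_def by simp

lemma PP_const:
  assumes "0 \<le> t" "z \<in> UNIV \<times> signs"
  shows "PP t (\<lambda>y. c) z = c"
proof -
  interpret prob_space "P t z" by (rule P_prob[OF assms])
  show ?thesis unfolding PP_def using prob_space by simp
qed

lemma PP_diff_le:
  assumes f: "bounded_borel f" and g: "bounded_borel g" and t: "0 \<le> t" and z: "z \<in> UNIV \<times> signs"
    and b: "\<And>z. z \<in> UNIV \<times> signs \<Longrightarrow> \<bar>f z - g z\<bar> \<le> b"
  shows "\<bar>PP t f z - PP t g z\<bar> \<le> b"
  using PP_abs_le[OF bounded_borel_diff[OF f g] t z b] PP_diff_fun[OF f g t z] by simp

lemma PP_bounded_borel: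
  assumes f: "bounded_borel f" and t: "0 \<le> t"
  shows "bounded_borel (PP t f)"
proof -
  obtain C where C: "\<forall>z\<in>UNIV \<times> signs. \<bar>f z\<bar> \<le> C" and m: "f \<in> borel_measurable zz_state_space"
    using f unfolding bounded_borel_def by blast
  have "PP t f \<in> borel_measurable zz_state_space"
    unfolding PP_def[abs_def]
    by (rule measurable_compose[OF measurable_prob_algebraD[OF P_measurable[OF t]]
          integral_measurable_subprob_algebra[OF m]])
  moreover have "\<forall>z\<in>UNIV \<times> signs. \<bar>PP t f z\<bar> \<le> C" using PP_abs_le[OF f t] C by blast
  ultimately show ?thesis unfolding bounded_borel_def by blast
qed

lemma PP_semigroup:
  assumes f: "bounded_borel f" and s: "0 \<le> s" and t: "0 \<le> t" and z: "z \<in> UNIV \<times> signs"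
  shows "PP (s + t) f z = PP s (PP t f) z"
proof -
  interpret prob_space "P s z" by (rule P_prob[OF s z])
  obtain C where C: "\<forall>z\<in>UNIV \<times> signs. \<bar>f z\<bar> \<le> C" and m: "f \<in> borel_measurable zz_state_space"
    using f unfolding bounded_borel_def by blast
  have "P (s + t) z = P s z \<bind> P t"
    using sg s t z unfolding markov_semigroup_def space_zz by blast
  moreover have "integral\<^sup>L (P s z \<bind> P t) f = (\<integral>x. integral\<^sup>L (P t x) f \<partial>P s z)"
  proof (rule integral_bind[where K=zz_state_space and B=C and B'=1])
    show "\<bar>f x\<bar> \<le> C" if "x \<in> space zz_state_space" for x
      using C that unfolding space_zz by blast
    show "P t \<in> P s z \<rightarrow>\<^sub>M subprob_algebra zz_state_space"
      using measurable_prob_algebraD[OF P_measurable[OF t]] measurable_cong_sets[OF P_prob(2)[OF s z] refl] by blast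
    show "finite_measure (P s z)" by unfold_locales
    show "AE x in P s z. emeasure (P t x) (space (P t x)) \<le> ennreal 1"
    proof (rule AE_I2)
      fix x assume "x \<in> space (P s z)"
      then interpret x: prob_space "P t x" using P_prob[OF t] P_prob(3)[OF s z] by simp
      show "emeasure (P t x) (space (P t x)) \<le> ennreal 1" using x.emeasure_space_1 by simp
    qed
  qed (rule m)
  ultimately show ?thesis by (simp add: PP_def[abs_def])
qed

lemma PP_0: "z \<in> UNIV \<times> signs \<Longrightarrow> f \<in> borel_measurable zz_state_space \<Longrightarrow> PP 0 f z = f z"
proof -
  assume z: "z \<in> UNIV \<times> signs" and f: "f \<in> borel_measurable zz_state_space"
  have "P 0 z = return zz_state_space z" using sg z unfolding markov_semigroup_def space_zz by blast
  then show ?thesis using integral_return[OF _ f, of z] z by (simp add: PP_def space_zz)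
qed

lemma generator_estimate:
  assumes f: "C1_supp R f" and e: "0 < e"
  shows "\<forall>\<^sub>F h in at_right 0. \<forall>z\<in>UNIV \<times> signs. \<bar>PP h f z - f z - h * (zzdrift f z + zzjump H f z)\<bar> \<le> e * h"
proof -
  have "uniform_limit (UNIV \<times> signs) (\<lambda>t z. ((\<integral>y. f y \<partial>P t z) - f z) / t) (zz_generator H f) (at_right 0)"
    using gen C1_supp_test_function[OF f] by (simp add: has_generator_def space_zz)
  then have "\<forall>\<^sub>F h in at_right 0. \<forall>z\<in>UNIV \<times> signs. dist (((\<integral>y. f y \<partial>P h z) - f z) / h) (zz_generator H f z) < e"
    using e unfolding uniform_limit_iff by blast
  then show ?thesis
    using eventually_at_right_less[of "0::real"]
  proof (rule eventually_elim2)
    fix h :: real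
    assume 1: "\<forall>z\<in>UNIV \<times> signs. dist (((\<integral>y. f y \<partial>P h z) - f z) / h) (zz_generator H f z) < e" and h: "0 < h"
    show "\<forall>z\<in>UNIV \<times> signs. \<bar>PP h f z - f z - h * (zzdrift f z + zzjump H f z)\<bar> \<le> e * h"
    proof
      fix z :: "'d phase" assume z: "z \<in> UNIV \<times> signs"
      have "\<bar>(PP h f z - f z) / h - (zzdrift f z + zzjump H f z)\<bar> \<le> e"
        using bspec[OF 1 z] by (simp add: dist_real_def zz_generator_eq PP_def)
      then have "\<bar>(PP h f z - f z) / h - (zzdrift f z + zzjump H f z)\<bar> * h \<le> e * h" using h by (intro mult_right_mono) auto
      moreover have "\<bar>(PP h f z - f z) / h - (zzdrift f z + zzjump H f z)\<bar> * h =
          \<bar>((PP h f z - f z) / h - (zzdrift f z + zzjump H f z)) * h\<bar>" using h by (simp add: abs_mult)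
      moreover have "((PP h f z - f z) / h - (zzdrift f z + zzjump H f z)) * h = PP h f z - f z - h * (zzdrift f z + zzjump H f z)"
        using h by (simp add: field_simps)
      ultimately show "\<bar>PP h f z - f z - h * (zzdrift f z + zzjump H f z)\<bar> \<le> e * h" by simp
    qed
  qed
qed

text \<open>Continuity at time 0 follows from the generator. For a C1 approximation f' the increment
  is at most a multiple of h, as its drift and jump terms are bounded; the passage from f' to f
  costs e / 3 twice, since the semigroup is a contraction.\<close>

lemma strong_continuity:
  assumes f: "cont_supp R f" and R: "0 \<le> R" and e: "0 < e"
  shows "\<forall>\<^sub>F h in at_right 0. \<forall>z\<in>UNIV \<times> signs. \<bar>PP h f z - f z\<bar> \<le> e"
proof -
  have e3: "0 < e / 3" using e by simp
  obtain f' where f': "C1_supp (R + 1) f'" "\<And>x v. v \<in> signs \<Longrightarrow> \<bar>f (x, v) - f' (x, v)\<bar> \<le> e / 3"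
    using C1_supp_dense[OF f R e3] by blast
  have d: "\<bar>f z - f' z\<bar> \<le> e / 3" if "z \<in> UNIV \<times> signs" for z using f'(2)[of "snd z" "fst z"] that by auto
  obtain D1 where D1: "0 \<le> D1" "\<And>x v. v \<in> signs \<Longrightarrow> \<bar>zzdrift f' (x, v)\<bar> \<le> D1"
    using cont_supp_bounded[OF cont_supp_zzdrift[OF f'(1)]] by blast
  obtain D2 where D2: "0 \<le> D2" "\<And>x v. v \<in> signs \<Longrightarrow> \<bar>zzjump H f' (x, v)\<bar> \<le> D2"
    using cont_supp_bounded[OF cont_supp_zzjump[OF C1_supp_imp_cont_supp[OF f'(1)] C1]] by blast
  define C where "C = D1 + D2 + 1"
  have C: "0 < C" using D1 D2 by (simp add: C_def)
  have "\<forall>\<^sub>F h in at_right (0::real). h < e / 3 / C"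
    using e3 C by (intro eventually_at_rightI[of 0 "e / 3 / C"]) auto
  then have small: "\<forall>\<^sub>F h in at_right (0::real). 0 < h \<and> h < e / 3 / C"
    using eventually_at_right_less[of "0::real"] by (rule eventually_elim2) simp
  show ?thesis
    using generator_estimate[OF f'(1) zero_less_one] small
  proof (rule eventually_elim2)
    fix h :: real
    assume 1: "\<forall>z\<in>UNIV \<times> signs. \<bar>PP h f' z - f' z - h * (zzdrift f' z + zzjump H f' z)\<bar> \<le> 1 * h"
      and h: "0 < h \<and> h < e / 3 / C"
    then have h0: "0 \<le> h" by simp
    have "h * C < e / 3" using h C by (simp add: pos_less_divide_eq)
    show "\<forall>z\<in>UNIV \<times> signs. \<bar>PP h f z - f z\<bar> \<le> e"
    proof
      fix z :: "'d phase" assume z: "z \<in> UNIV \<times> signs"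
      then have s: "snd z \<in> signs" by auto
      have "\<bar>zzdrift f' z + zzjump H f' z\<bar> \<le> D1 + D2"
        using D1(2)[OF s, of "fst z"] D2(2)[OF s, of "fst z"] by simp
      then have "\<bar>h * (zzdrift f' z + zzjump H f' z)\<bar> \<le> h * (D1 + D2)"
        using h0 by (simp add: abs_mult mult_left_mono)
      moreover have "h * C = h * (D1 + D2) + h" by (simp add: C_def algebra_simps)
      ultimately have "\<bar>PP h f' z - f' z\<bar> \<le> h * C" using bspec[OF 1 z] by linarith
      then have 2: "\<bar>PP h f' z - f' z\<bar> \<le> e / 3" using \<open>h * C < e / 3\<close> by linarith
      have 3: "\<bar>PP h f z - PP h f' z\<bar> \<le> e / 3"
        by (rule PP_diff_le[OF cont_supp_bounded_borel[OF f] cont_supp_bounded_borel[OF C1_supp_imp_cont_supp[OF f'(1)]] h0 z d])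
      show "\<bar>PP h f z - f z\<bar> \<le> e" using 2 3 d[OF z] by linarith
    qed
  qed
qed

text \<open>The mean value theorem along the backward flow; uniformity in the state comes from the
  uniform continuity of the drift, which is continuous with bounded support.\<close>

lemma flow_derivative:
  fixes f :: "'d phase \<Rightarrow> real"
  assumes f: "C1_supp R f" and e: "0 < e"
  shows "\<forall>\<^sub>F h in at_right 0. \<forall>z\<in>UNIV \<times> signs. \<bar>zzflow (- h) f z - f z + h * zzdrift f z\<bar> \<le> e * h"
proof -
  obtain d where d: "0 < d" "\<And>x y v. v \<in> signs \<Longrightarrow> norm (x - y) < d \<Longrightarrow> \<bar>zzdrift f (x, v) - zzdrift f (y, v)\<bar> < e"
    using cont_supp_uniformly_continuous[OF cont_supp_zzdrift[OF f] e] by blast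
  have N: "0 < real CARD('d)" by simp
  show ?thesis
  proof (rule eventually_at_rightI[of 0 "d / real CARD('d)"])
    show "0 < d / real CARD('d)" using d by simp
    fix h assume h: "h \<in> {0<..<d / real CARD('d)}"
    show "\<forall>z\<in>UNIV \<times> signs. \<bar>zzflow (- h) f z - f z + h * zzdrift f z\<bar> \<le> e * h"
    proof
      fix z :: "'d phase" assume z: "z \<in> UNIV \<times> signs"
      obtain x v where zv: "z = (x, v)" "v \<in> signs" using z by auto
      have C1: "class_C1 (\<lambda>x. f (x, v))" using f zv by (simp add: C1_supp_def)
      have der: "((\<lambda>r. f (x + r *\<^sub>R (- v), v)) has_real_derivative - zzdrift f (x + r *\<^sub>R (- v), v)) (at r)" for r
        using class_C1_line[OF C1, of x "- v" r] by (simp add: zzdrift_def)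
      have "0 < h" using h by simp
      from MVT2[OF this der] obtain \<xi> where \<xi>: "0 < \<xi>" "\<xi> < h"
        "f (x + h *\<^sub>R (- v), v) - f (x + 0 *\<^sub>R (- v), v) = (h - 0) * - zzdrift f (x + \<xi> *\<^sub>R (- v), v)" by blast
      have "norm (x - (x + \<xi> *\<^sub>R (- v))) = \<xi> * norm v" using \<xi> by simp
      also have "\<dots> \<le> \<xi> * real CARD('d)" using norm_signs[OF zv(2)] \<xi> by (intro mult_left_mono) auto
      also have "\<dots> < d" using h \<xi> N by (simp add: pos_less_divide_eq) (meson N mult_less_cancel_right_pos order_less_trans)
      finally have "\<bar>zzdrift f (x, v) - zzdrift f (x + \<xi> *\<^sub>R (- v), v)\<bar> < e" by (rule d(2)[OF zv(2)])
      then have "h * \<bar>zzdrift f (x, v) - zzdrift f (x + \<xi> *\<^sub>R (- v), v)\<bar> \<le> h * e" using h by (intro mult_left_mono) auto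
      moreover have "zzflow (- h) f z - f z + h * zzdrift f z = h * (zzdrift f (x, v) - zzdrift f (x + \<xi> *\<^sub>R (- v), v))"
        using \<xi>(3) zv by (simp add: zzflow_def algebra_simps)
      ultimately show "\<bar>zzflow (- h) f z - f z + h * zzdrift f z\<bar> \<le> e * h"
        using h by (simp add: abs_mult mult.commute)
    qed
  qed
qed

text \<open>Moving backwards by the flow cancels the drift in the generator: P_h(flow_{-h} G) is P_h
  G minus h P_h(drift G) up to o(h), and P_h G is G + h(drift + jump) up to o(h). Only the jump term
  remains, and it involves no derivative of G.\<close>

lemma PP_flow_estimate:
  assumes G: "C1_supp R G" and R: "0 \<le> R" and e: "0 < e"
  shows "\<forall>\<^sub>F h in at_right 0. \<forall>z\<in>UNIV \<times> signs. \<bar>PP h (zzflow (- h) G) z - G z - h * zzjump H G z\<bar> \<le> e * h"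
proof -
  have e3: "0 < e / 3" using e by simp
  have R1: "0 \<le> R + 1" using R by simp
  have Gcc: "cont_supp R G" by (rule C1_supp_imp_cont_supp[OF G])
  have bD: "bounded_borel (zzdrift G)" by (rule cont_supp_bounded_borel[OF cont_supp_zzdrift[OF G]])
  have bG: "bounded_borel G" by (rule cont_supp_bounded_borel[OF Gcc])
  have "\<forall>\<^sub>F h in at_right 0. 0 < h \<and> (\<forall>z\<in>UNIV \<times> signs. \<bar>zzflow (- h) G z - G z + h * zzdrift G z\<bar> \<le> e / 3 * h) \<and>
      (\<forall>z\<in>UNIV \<times> signs. \<bar>PP h (zzdrift G) z - zzdrift G z\<bar> \<le> e / 3) \<and>
      (\<forall>z\<in>UNIV \<times> signs. \<bar>PP h G z - G z - h * (zzdrift G z + zzjump H G z)\<bar> \<le> e / 3 * h)"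
    by (intro eventually_conj eventually_at_right_less flow_derivative[OF G e3]
        strong_continuity[OF cont_supp_zzdrift[OF G] R1 e3] generator_estimate[OF G e3])
  then show ?thesis
  proof (rule eventually_mono)
    fix h :: real
    assume A: "0 < h \<and> (\<forall>z\<in>UNIV \<times> signs. \<bar>zzflow (- h) G z - G z + h * zzdrift G z\<bar> \<le> e / 3 * h) \<and>
      (\<forall>z\<in>UNIV \<times> signs. \<bar>PP h (zzdrift G) z - zzdrift G z\<bar> \<le> e / 3) \<and>
      (\<forall>z\<in>UNIV \<times> signs. \<bar>PP h G z - G z - h * (zzdrift G z + zzjump H G z)\<bar> \<le> e / 3 * h)"
    have h: "0 < h" "0 \<le> h" using A by auto
    have bF: "bounded_borel (zzflow (- h) G)" by (rule cont_supp_bounded_borel[OF cont_supp_flow[OF Gcc]])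
    have bhD: "bounded_borel (\<lambda>z. h * zzdrift G z)" by (rule bounded_borel_cmult[OF bD])
    show "\<forall>z\<in>UNIV \<times> signs. \<bar>PP h (zzflow (- h) G) z - G z - h * zzjump H G z\<bar> \<le> e * h"
    proof
      fix z :: "'d phase" assume z: "z \<in> UNIV \<times> signs"
      have "PP h (\<lambda>z. (zzflow (- h) G z - G z) + h * zzdrift G z) z =
          PP h (zzflow (- h) G) z - PP h G z + h * PP h (zzdrift G) z"
        by (simp add: PP_add_fun[OF bounded_borel_diff[OF bF bG] bhD h(2) z] PP_diff_fun[OF bF bG h(2) z] PP_cmult)
      moreover have "\<bar>PP h (\<lambda>z. (zzflow (- h) G z - G z) + h * zzdrift G z) z\<bar> \<le> e / 3 * h"
        by (rule PP_abs_le[OF bounded_borel_add[OF bounded_borel_diff[OF bF bG] bhD] h(2) z]) (use A in blast)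
      ultimately have 1: "\<bar>PP h (zzflow (- h) G) z - PP h G z + h * PP h (zzdrift G) z\<bar> \<le> e / 3 * h" by simp
      have "\<bar>PP h (zzdrift G) z - zzdrift G z\<bar> \<le> e / 3" using A z by blast
      then have "h * \<bar>PP h (zzdrift G) z - zzdrift G z\<bar> \<le> h * (e / 3)" using h by (intro mult_left_mono) auto
      then have 2: "\<bar>h * (PP h (zzdrift G) z - zzdrift G z)\<bar> \<le> e / 3 * h" using h by (simp add: abs_mult mult.commute)
      have 3: "\<bar>PP h G z - G z - h * (zzdrift G z + zzjump H G z)\<bar> \<le> e / 3 * h" using A z by blast
      have eq: "PP h (zzflow (- h) G) z - G z - h * zzjump H G z =
        (PP h (zzflow (- h) G) z - PP h G z + h * PP h (zzdrift G) z) +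
        (PP h G z - G z - h * (zzdrift G z + zzjump H G z)) - h * (PP h (zzdrift G) z - zzdrift G z)"
        by (simp add: algebra_simps)
      have "\<bar>PP h (zzflow (- h) G) z - G z - h * zzjump H G z\<bar> \<le> (e / 3 * h + e / 3 * h) + e / 3 * h"
        unfolding eq by (rule order_trans[OF abs_triangle_ineq4], rule add_mono[OF order_trans[OF abs_triangle_ineq] 2],
            rule add_mono[OF 1 3])
      then show "\<bar>PP h (zzflow (- h) G) z - G z - h * zzjump H G z\<bar> \<le> e * h" by (simp add: field_simps)
    qed
  qed
qed

end


lemma lip_supp_limit:
  fixes f :: "nat \<Rightarrow> 'd::finite phase \<Rightarrow> real"
  assumes ev: "\<forall>\<^sub>F n in sequentially. lip_supp R C L (f n)"
    and lim: "\<And>z. z \<in> UNIV \<times> signs \<Longrightarrow> (\<lambda>n. f n z) \<longlonglongrightarrow> g z"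
  shows "lip_supp R C L g"
proof (rule lipcI)
  fix v :: "real ^ 'd" and x y assume v: "v \<in> signs"
  have l: "(\<lambda>n. f n (x, v)) \<longlonglongrightarrow> g (x, v)" for x by (rule lim) (simp add: v)
  show "\<bar>g (x, v)\<bar> \<le> C"
    by (rule tendsto_upperbound[OF tendsto_rabs[OF l]]) (use ev in \<open>auto elim!: eventually_mono intro: lipcD(1)[OF _ v]\<close>)
  show "\<bar>g (x, v) - g (y, v)\<bar> \<le> L * norm (x - y)"
    by (rule tendsto_upperbound[OF tendsto_rabs[OF tendsto_diff[OF l l]]])
      (use ev in \<open>auto elim!: eventually_mono intro: lipcD(2)[OF _ v]\<close>)
  assume R: "R \<le> norm x"
  have "\<forall>\<^sub>F n in sequentially. f n (x, v) = 0"
    using ev by (rule eventually_mono) (rule lipcD(3)[OF _ v R])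
  then have "(\<lambda>n. f n (x, v)) \<longlonglongrightarrow> 0" by (rule tendsto_eventually)
  then show "g (x, v) = 0" using LIMSEQ_unique l by blast
qed

section \<open>Expansion of the semigroup along the flow\<close>

context zz_semigroup
begin

text \<open>A Duhamel formula in the form of an inequality. The function
  \<open>\<phi> s = PP s (zzflow (t - s) g) z\<close> goes from the flow at s = 0 to the semigroup
  at s = t, and its right derivative is \<open>PP s (zzjump H (zzflow (t - s) g)) z\<close>. If this
  stays within K of c, the total increment is within K t of c t.\<close>

lemma semigroup_increment:
  fixes g :: "'d phase \<Rightarrow> real"
  assumes g: "C1_supp R g" and R: "0 \<le> R" and t: "0 \<le> t" and z: "z \<in> UNIV \<times> signs"
    and K: "\<And>s. 0 \<le> s \<Longrightarrow> s < t \<Longrightarrow> \<bar>PP s (zzjump H (zzflow (t - s) g)) z - c\<bar> \<le> K"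
  shows "\<bar>PP t g z - zzflow t g z - c * t\<bar> \<le> K * t"
proof -
  have gcc: "cont_supp R g" by (rule C1_supp_imp_cont_supp[OF g])
  have bfl: "bounded_borel (zzflow r g)" for r by (rule cont_supp_bounded_borel[OF cont_supp_flow[OF gcc]])
  define \<phi> where "\<phi> s = PP s (zzflow (t - s) g) z" for s
  have "\<bar>\<phi> t - \<phi> 0 - c * (t - 0)\<bar> \<le> K * (t - 0)"
  proof (rule right_increment_bound[OF t])
    fix s :: real assume s: "0 < s" "s \<le> t"
    show "(\<phi> \<longlongrightarrow> \<phi> s) (at_left s)"
    proof (rule tendstoI)
      fix e :: real assume e: "0 < e"
      have e3: "0 < e / 3" using e by simp
      obtain d where d: "0 < d" "\<And>x y v. v \<in> signs \<Longrightarrow> norm (x - y) < d \<Longrightarrow> \<bar>g (x, v) - g (y, v)\<bar> < e / 3"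
        using cont_supp_uniformly_continuous[OF gcc e3] by blast
      let ?G = "zzflow (t - s) g"
      have "0 \<le> R + real CARD('d) * \<bar>t - s\<bar>" using R by simp
      from strong_continuity[OF cont_supp_flow[OF gcc] this e3]
      have "\<forall>\<^sub>F h in at_right 0. \<forall>z\<in>UNIV \<times> signs. \<bar>PP h ?G z - ?G z\<bar> \<le> e / 3" .
      then obtain b where b: "0 < b" "\<And>h z. 0 < h \<Longrightarrow> h < b \<Longrightarrow> z \<in> UNIV \<times> signs \<Longrightarrow> \<bar>PP h ?G z - ?G z\<bar> \<le> e / 3"
        unfolding eventually_at_right_field by blast
      have "max 0 (max (s - b) (s - d / real CARD('d))) < s" using s b d by simp
      then show "\<forall>\<^sub>F u in at_left s. dist (\<phi> u) (\<phi> s) < e"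
      proof (rule eventually_at_leftI[rotated])
        fix u assume u: "u \<in> {max 0 (max (s - b) (s - d / real CARD('d)))<..<s}"
        then have u0: "0 \<le> u" and su: "0 < s - u" "s - u < b" "s - u < d / real CARD('d)" by auto
        have Nd: "(s - u) * real CARD('d) < d" using su(3) by (simp add: pos_less_divide_eq)
        \<comment> \<open>Splitting at u puts both values under the same contraction
          \<open>PP u\<close>. The inner functions differ by the flow over time s - u on one side
          and by the semigroup over time s - u on the other, and both are uniformly close to
          \<open>?G\<close>.\<close>
        have "\<phi> s = PP (u + (s - u)) ?G z" by (simp add: \<phi>_def)
        also have "\<dots> = PP u (PP (s - u) ?G) z" using su(1) by (intro PP_semigroup bfl u0 z) simp
        finally have 0: "\<phi> s = PP u (PP (s - u) ?G) z" .
        have 1: "\<bar>PP u (zzflow (t - u) g) z - PP u ?G z\<bar> \<le> e / 3"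
        proof (rule PP_diff_le[OF bfl bfl u0 z])
          fix y :: "'d phase" assume "y \<in> UNIV \<times> signs"
          then obtain x v where y: "y = (x, v)" "v \<in> signs" by auto
          have "(x + (t - u) *\<^sub>R v) - (x + (t - s) *\<^sub>R v) = (s - u) *\<^sub>R v" by (simp add: algebra_simps)
          then have "norm ((x + (t - u) *\<^sub>R v) - (x + (t - s) *\<^sub>R v)) = (s - u) * norm v" using su by simp
          also have "\<dots> \<le> (s - u) * real CARD('d)" using norm_signs[OF y(2)] su by (intro mult_left_mono) auto
          also note Nd
          finally show "\<bar>zzflow (t - u) g y - ?G y\<bar> \<le> e / 3" using d(2)[OF y(2)] y by (simp add: zzflow_def less_imp_le)
        qed
        have 2: "\<bar>PP u (PP (s - u) ?G) z - PP u ?G z\<bar> \<le> e / 3"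
          using su(1) by (intro PP_diff_le[OF PP_bounded_borel[OF bfl] bfl u0 z] b(2)[OF su(1,2)]) auto
        have "\<bar>\<phi> u - \<phi> s\<bar> \<le> \<bar>PP u (zzflow (t - u) g) z - PP u ?G z\<bar> + \<bar>PP u (PP (s - u) ?G) z - PP u ?G z\<bar>"
          unfolding 0 unfolding \<phi>_def by linarith
        also have "\<dots> \<le> e / 3 + e / 3" by (rule add_mono[OF 1 2])
        finally show "dist (\<phi> u) (\<phi> s) < e" using e by (simp add: dist_real_def)
      qed
    qed
  next
    fix s e :: real assume s: "0 \<le> s" "s < t" and e: "0 < e"
    let ?G = "zzflow (t - s) g"
    have Gc: "C1_supp (R + real CARD('d) * \<bar>t - s\<bar>) ?G" by (rule C1_supp_flow[OF g])
    have bJ: "bounded_borel (zzjump H ?G)" by (rule cont_supp_bounded_borel[OF cont_supp_zzjump[OF C1_supp_imp_cont_supp[OF Gc] C1]])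
    have R': "0 \<le> R + real CARD('d) * \<bar>t - s\<bar>" using R by simp
    show "\<forall>\<^sub>F h in at_right 0. \<bar>\<phi> (s + h) - \<phi> s - c * h\<bar> \<le> (K + e) * h"
      using PP_flow_estimate[OF Gc R' e] eventually_at_right_less[of "0::real"]
    proof (rule eventually_elim2)
      fix h :: real
      assume 1: "\<forall>z\<in>UNIV \<times> signs. \<bar>PP h (zzflow (- h) ?G) z - ?G z - h * zzjump H ?G z\<bar> \<le> e * h" and h: "0 < h"
      then have h0: "0 \<le> h" by simp
      let ?F = "zzflow (- h) ?G"
      have F: "?F = zzflow (t - (s + h)) g" by (simp add: zzflow_zzflow algebra_simps)
      have bF: "bounded_borel ?F" unfolding F by (rule bfl)
      have bhJ: "bounded_borel (\<lambda>z. h * zzjump H ?G z)" by (rule bounded_borel_cmult[OF bJ])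
      have "\<phi> (s + h) = PP s (PP h ?F) z" unfolding \<phi>_def F[symmetric] by (rule PP_semigroup[OF bF s(1) h0 z])
      then have "\<phi> (s + h) - \<phi> s - h * PP s (zzjump H ?G) z = PP s (\<lambda>y. (PP h ?F y - ?G y) - h * zzjump H ?G y) z"
        by (simp add: \<phi>_def PP_diff_fun[OF bounded_borel_diff[OF PP_bounded_borel[OF bF h0] bfl] bhJ s(1) z]
            PP_diff_fun[OF PP_bounded_borel[OF bF h0] bfl s(1) z] PP_cmult)
      moreover have "\<bar>PP s (\<lambda>y. (PP h ?F y - ?G y) - h * zzjump H ?G y) z\<bar> \<le> e * h"
        by (rule PP_abs_le[OF bounded_borel_diff[OF bounded_borel_diff[OF PP_bounded_borel[OF bF h0] bfl] bhJ] s(1) z]) (use 1 in blast)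
      ultimately have 2: "\<bar>\<phi> (s + h) - \<phi> s - h * PP s (zzjump H ?G) z\<bar> \<le> e * h" by simp
      have "\<bar>PP s (zzjump H ?G) z - c\<bar> * h \<le> K * h" using K[OF s] h0 by (intro mult_right_mono)
      then have 3: "\<bar>(PP s (zzjump H ?G) z - c) * h\<bar> \<le> K * h" using h0 by (simp add: abs_mult)
      have eq: "\<phi> (s + h) - \<phi> s - c * h = (\<phi> (s + h) - \<phi> s - h * PP s (zzjump H ?G) z) + (PP s (zzjump H ?G) z - c) * h"
        by (simp add: algebra_simps)
      have "\<bar>\<phi> (s + h) - \<phi> s - c * h\<bar> \<le> e * h + K * h"
        unfolding eq by (rule order_trans[OF abs_triangle_ineq add_mono[OF 2 3]])
      then show "\<bar>\<phi> (s + h) - \<phi> s - c * h\<bar> \<le> (K + e) * h" by (simp add: algebra_simps)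
    qed
  qed
  moreover have "\<phi> t = PP t g z" by (simp add: \<phi>_def zzflow_0)
  moreover have "\<phi> 0 = zzflow t g z" using PP_0[OF z] bfl[of t] by (simp add: \<phi>_def bounded_borel_def)
  ultimately show ?thesis by simp
qed

lemma cont_supp_flow_unit:
  fixes g :: "'d phase \<Rightarrow> real"
  assumes "cont_supp R g" "0 \<le> r" "r \<le> 1" "v \<in> signs" "R + real CARD('d) \<le> norm x"
  shows "zzflow r g (x, v) = 0"
proof -
  have "real CARD('d) * r \<le> real CARD('d)" using assms(3) by (intro mult_left_le) auto
  then have "R + real CARD('d) * \<bar>r\<bar> \<le> norm x" using assms(5) unfolding abs_of_nonneg[OF assms(2)] by linarith
  then show ?thesis using cont_supp_flow[OF assms(1), of r] assms(4) by (simp add: cont_supp_def)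
qed

text \<open>The case c = 0 of \<open>semigroup_increment\<close>: the derivative is bounded by the
  sup norm of the jump term. The support is controlled by the radius
  \<open>R + real CARD('d)\<close> because t \<le> 1.\<close>

lemma flow_approx_c1:
  fixes g :: "'d phase \<Rightarrow> real"
  assumes g: "C1_supp R g" and R: "0 \<le> R" and C: "\<And>z. z \<in> UNIV \<times> signs \<Longrightarrow> \<bar>g z\<bar> \<le> C" and t: "0 \<le> t" "t \<le> 1"
    and hb: "gradient_bound H (R + real CARD('d)) K" and z: "z \<in> UNIV \<times> signs"
  shows "\<bar>PP t g z - zzflow t g z\<bar> \<le> real CARD('d) * (2 * K * C) * t"
proof -
  have gcc: "cont_supp R g" by (rule C1_supp_imp_cont_supp[OF g])
  have C0: "0 \<le> C" using C[OF z] by linarith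
  have "\<bar>PP t g z - zzflow t g z - 0 * t\<bar> \<le> real CARD('d) * (2 * K * C) * t"
  proof (rule semigroup_increment[OF g R t(1) z])
    fix s assume s: "0 \<le> s" "s < t"
    have "\<bar>PP s (zzjump H (zzflow (t - s) g)) z\<bar> \<le> real CARD('d) * (2 * K * C)"
    proof (rule PP_abs_le[OF cont_supp_bounded_borel[OF cont_supp_zzjump[OF cont_supp_flow[OF gcc] C1]] s(1) z])
      fix y :: "'d phase" assume "y \<in> UNIV \<times> signs"
      then obtain x v where y: "y = (x, v)" "v \<in> signs" by auto
      show "\<bar>zzjump H (zzflow (t - s) g) y\<bar> \<le> real CARD('d) * (2 * K * C)" unfolding y(1)
      proof (rule zzjump_bound[OF hb y(2) C0])
        show "\<bar>zzflow (t - s) g (x, w)\<bar> \<le> C" if "w \<in> signs" for w using C that by (simp add: zzflow_def)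
        show "zzflow (t - s) g (x, w) = 0" if "w \<in> signs" "R + real CARD('d) \<le> norm x" for w
          by (rule cont_supp_flow_unit[OF gcc _ _ that]) (use s t in auto)
      qed
    qed
    then show "\<bar>PP s (zzjump H (zzflow (t - s) g)) z - 0\<bar> \<le> real CARD('d) * (2 * K * C)" by simp
  qed
  then show ?thesis by simp
qed

text \<open>The bound for C1 functions contains only their sup norm and support, so it passes to
  uniform limits. The jump term of a Lipschitz function, to which it is applied in the second-order
  expansion, need not be C1.\<close>

lemma flow_approx:
  fixes g :: "'d phase \<Rightarrow> real"
  assumes g: "cont_supp R g" and R: "0 \<le> R" and C: "\<And>z. z \<in> UNIV \<times> signs \<Longrightarrow> \<bar>g z\<bar> \<le> C" and t: "0 \<le> t" "t \<le> 1"
    and hb: "gradient_bound H (R + 1 + real CARD('d)) K" and z: "z \<in> UNIV \<times> signs"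
  shows "\<bar>PP t g z - zzflow t g z\<bar> \<le> real CARD('d) * (2 * K * C) * t"
proof (rule field_le_epsilon)
  fix e0 :: real assume e0: "0 < e0"
  have K: "0 \<le> K" by (rule hboundD(1)[OF hb])
  \<comment> \<open>Replacing g by g' costs e in the semigroup and e in the flow; the last summand
    pays for the sup norm growing from C to C + e over a time at most 1.\<close>
  define D where "D = 2 + real CARD('d) * (2 * K)"
  have D: "0 < D" using K by (simp add: D_def add_pos_nonneg)
  define e where "e = e0 / D"
  have e: "0 < e" using e0 D by (simp add: e_def)
  have eD: "e * D = e0" using D by (simp add: e_def)
  obtain g' where g': "C1_supp (R + 1) g'" "\<And>x v. v \<in> signs \<Longrightarrow> \<bar>g (x, v) - g' (x, v)\<bar> \<le> e"
    using C1_supp_dense[OF g R e] by blast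
  have d: "\<bar>g y - g' y\<bar> \<le> e" if "y \<in> UNIV \<times> signs" for y using g'(2)[of "snd y" "fst y"] that by auto
  have C': "\<bar>g' y\<bar> \<le> C + e" if "y \<in> UNIV \<times> signs" for y using C[OF that] d[OF that] by linarith
  have R1: "0 \<le> R + 1" using R by simp
  have "\<bar>PP t g' z - zzflow t g' z\<bar> \<le> real CARD('d) * (2 * K * (C + e)) * t"
    by (rule flow_approx_c1[OF g'(1) R1 C' t hb z])
  moreover have "\<bar>PP t g z - PP t g' z\<bar> \<le> e"
    by (rule PP_diff_le[OF cont_supp_bounded_borel[OF g] cont_supp_bounded_borel[OF C1_supp_imp_cont_supp[OF g'(1)]] t(1) z d])
  moreover have "\<bar>zzflow t g z - zzflow t g' z\<bar> \<le> e"
    using z unfolding zzflow_def by (intro d) auto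
  moreover have "real CARD('d) * (2 * K * (C + e)) * t + 2 * e \<le> real CARD('d) * (2 * K * C) * t + e0"
  proof -
    have "real CARD('d) * (2 * K) * e * t \<le> real CARD('d) * (2 * K) * e * 1" using K e t by (intro mult_left_mono) auto
    moreover have "e0 = 2 * e + real CARD('d) * (2 * K) * e" unfolding eD[symmetric] D_def by (simp add: algebra_simps)
    moreover have "real CARD('d) * (2 * K * (C + e)) * t = real CARD('d) * (2 * K * C) * t + real CARD('d) * (2 * K) * e * t" by (simp add: algebra_simps)
    ultimately show ?thesis by linarith
  qed
  ultimately show "\<bar>PP t g z - zzflow t g z\<bar> \<le> real CARD('d) * (2 * K * C) * t + e0" by linarith
qed

text \<open>The increment formula is used with c equal to the jump term of g at z, after replacing g
  by a C1 function g' on the left. The derivative is compared with c through four replacements: g'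
  by g, the semigroup by the flow (the first-order bound, applied to the jump term), the flowed
  state by z, and the flowed function by g. Apart from the vanishing approximation error each is
  O(t), with constants that depend on g only through R, C and L.\<close>

lemma PP_expansion:
  assumes R: "0 \<le> R" and CL: "0 \<le> C" "0 \<le> L" and hb: "gradient_bound H (R + 2 * real CARD('d) + 1) K"
  shows "\<exists>K1\<ge>0. \<forall>g t z. lip_supp R C L g \<longrightarrow> 0 \<le> t \<longrightarrow> t \<le> 1 \<longrightarrow> z \<in> UNIV \<times> signs \<longrightarrow>
    \<bar>PP t g z - zzflow t g z - t * zzjump H g z\<bar> \<le> K1 * t\<^sup>2"
proof -
  have K: "0 \<le> K" by (rule hboundD(1)[OF hb])
  have hbR: "gradient_bound H R K" and hbN: "gradient_bound H (R + real CARD('d)) K" and hb1: "gradient_bound H (R + 1 + real CARD('d)) K"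
    and hb2: "gradient_bound H (R + real CARD('d) + 1 + real CARD('d)) K"
    by (rule gradient_bound_mono[OF hb]; simp)+
  define CJ where "CJ = real CARD('d) * (2 * K * C)"
  define LJ where "LJ = real CARD('d) * (2 * K * C + 2 * K * L)"
  \<comment> \<open>The summands belong to the bounds \<open>a2\<close>, \<open>a3\<close> and
    \<open>a4\<close> below, divided by t; the remaining bound \<open>a1\<close> is proportional to
    the approximation error e.\<close>
  define K1 where "K1 = real CARD('d) * (2 * K * CJ) + LJ * real CARD('d) + real CARD('d) * (2 * K * (L * real CARD('d)))"
  have nn: "0 \<le> CJ" "0 \<le> LJ" using K CL by (simp_all add: CJ_def LJ_def)
  then have K1: "0 \<le> K1" using K CL by (simp add: K1_def)
  have "\<bar>PP t g z - zzflow t g z - t * zzjump H g z\<bar> \<le> K1 * t\<^sup>2"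
    if g: "lip_supp R C L g" and t: "0 \<le> t" "t \<le> 1" and z: "z \<in> UNIV \<times> signs" for g t z
  proof (rule field_le_epsilon)
    fix e0 :: real assume e0: "0 < e0"
    define D where "D = 2 + real CARD('d) * (2 * K)"
    have D: "0 < D" using K by (simp add: D_def add_pos_nonneg)
    define e where "e = e0 / D"
    have e: "0 < e" using e0 D by (simp add: e_def)
    have eD: "e * D = e0" using D by (simp add: e_def)
    have gcc: "cont_supp R g" by (rule lip_supp_imp_cont_supp[OF g])
    obtain g' where g': "C1_supp (R + 1) g'" "\<And>x v. v \<in> signs \<Longrightarrow> \<bar>g (x, v) - g' (x, v)\<bar> \<le> e"
      using C1_supp_dense[OF gcc R e] by blast
    have g'cc: "cont_supp (R + 1) g'" by (rule C1_supp_imp_cont_supp[OF g'(1)])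
    have d: "\<bar>g y - g' y\<bar> \<le> e" if "y \<in> UNIV \<times> signs" for y using g'(2)[of "snd y" "fst y"] that by auto
    have R1: "0 \<le> R + 1" using R by simp
    have "\<bar>PP t g' z - zzflow t g' z - zzjump H g z * t\<bar> \<le> (real CARD('d) * (2 * K * e) + K1 * t) * t"
    proof (rule semigroup_increment[OF g'(1) R1 t(1) z])
      fix s assume s: "0 \<le> s" "s < t"
      let ?F = "zzflow (t - s) g" and ?F' = "zzflow (t - s) g'"
      have r: "0 \<le> t - s" "t - s \<le> 1" using s t by auto
      have F: "lip_supp (R + real CARD('d)) C L ?F"
        using r mult_left_le[of "t - s" "real CARD('d)"] by (intro lip_supp_mono[OF lip_supp_flow[OF g, of "t - s"]]) auto
      have J: "lip_supp (R + real CARD('d)) CJ LJ (zzjump H ?F)" unfolding CJ_def LJ_def by (rule lip_supp_zzjump[OF hbN F])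
      have RN: "0 \<le> R + real CARD('d)" using R by simp
      have a1: "\<bar>PP s (zzjump H ?F') z - PP s (zzjump H ?F) z\<bar> \<le> real CARD('d) * (2 * K * e)"
      proof (rule PP_diff_le[OF cont_supp_bounded_borel[OF cont_supp_zzjump[OF cont_supp_flow[OF g'cc] C1]] cont_supp_bounded_borel[OF lip_supp_imp_cont_supp[OF J]] s(1) z])
        fix y :: "'d phase" assume "y \<in> UNIV \<times> signs"
        then obtain x v where y: "y = (x, v)" "v \<in> signs" by auto
        show "\<bar>zzjump H ?F' y - zzjump H ?F y\<bar> \<le> real CARD('d) * (2 * K * e)" unfolding y(1)
        proof (rule zzjump_diff_bound[OF hb1 y(2) less_imp_le[OF e]])
          show "\<bar>?F' (x, w) - ?F (x, w)\<bar> \<le> e" if "w \<in> signs" for w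
            using g'(2)[OF that, of "x + (t - s) *\<^sub>R w"] by (simp add: zzflow_def abs_minus_commute)
          show "?F' (x, w) = 0 \<and> ?F (x, w) = 0" if "w \<in> signs" "R + 1 + real CARD('d) \<le> norm x" for w
            using cont_supp_flow_unit[OF g'cc r that] lipcD(3)[OF F that(1), of x] that(2) by simp
        qed
      qed
      have a2: "\<bar>PP s (zzjump H ?F) z - zzflow s (zzjump H ?F) z\<bar> \<le> real CARD('d) * (2 * K * CJ) * s"
      proof (rule flow_approx[OF lip_supp_imp_cont_supp[OF J] RN _ s(1) _ hb2 z])
        show "\<bar>zzjump H ?F y\<bar> \<le> CJ" if "y \<in> UNIV \<times> signs" for y
          using lipcD(1)[OF J, of "snd y" "fst y"] that by auto
      qed (use s t in simp)
      obtain x v where zv: "z = (x, v)" "v \<in> signs" using z by auto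
      have a3: "\<bar>zzflow s (zzjump H ?F) z - zzjump H ?F z\<bar> \<le> LJ * (real CARD('d) * s)"
        unfolding zv(1) by (rule zzflow_diff_lip_supp[OF J zv(2) s(1)])
      have a4: "\<bar>zzjump H ?F z - zzjump H g z\<bar> \<le> real CARD('d) * (2 * K * (L * (real CARD('d) * (t - s))))"
        unfolding zv(1)
      proof (rule zzjump_diff_bound[OF hbN zv(2)])
        show "0 \<le> L * (real CARD('d) * (t - s))" using CL r by simp
        show "\<bar>?F (x, w) - g (x, w)\<bar> \<le> L * (real CARD('d) * (t - s))" if "w \<in> signs" for w
          by (rule zzflow_diff_lip_supp[OF g that r(1)])
        show "?F (x, w) = 0 \<and> g (x, w) = 0" if "w \<in> signs" "R + real CARD('d) \<le> norm x" for w
        proof -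
          have "0 < real CARD('d)" by simp
          then have "R \<le> norm x" using that(2) by linarith
          then show ?thesis using lipcD(3)[OF F that] lipcD(3)[OF g that(1), of x] by simp
        qed
      qed
      have "real CARD('d) * (2 * K * CJ) * s \<le> real CARD('d) * (2 * K * CJ) * t" "LJ * (real CARD('d) * s) \<le> LJ * (real CARD('d) * t)"
        "real CARD('d) * (2 * K * (L * (real CARD('d) * (t - s)))) \<le> real CARD('d) * (2 * K * (L * (real CARD('d) * t)))"
        using s K CL nn by (intro mult_left_mono; simp)+
      moreover have "K1 * t = real CARD('d) * (2 * K * CJ) * t + LJ * (real CARD('d) * t) + real CARD('d) * (2 * K * (L * (real CARD('d) * t)))"
        by (simp add: K1_def algebra_simps)
      ultimately show "\<bar>PP s (zzjump H ?F') z - zzjump H g z\<bar> \<le> real CARD('d) * (2 * K * e) + K1 * t"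
        using a1 a2 a3 a4 by linarith
    qed
    moreover have "\<bar>PP t g z - PP t g' z\<bar> \<le> e"
      by (rule PP_diff_le[OF cont_supp_bounded_borel[OF gcc] cont_supp_bounded_borel[OF g'cc] t(1) z d])
    moreover have "\<bar>zzflow t g z - zzflow t g' z\<bar> \<le> e"
      using z unfolding zzflow_def by (intro d) auto
    moreover have "(real CARD('d) * (2 * K * e) + K1 * t) * t + 2 * e \<le> K1 * t\<^sup>2 + e0"
    proof -
      have "real CARD('d) * (2 * K * e) * t \<le> real CARD('d) * (2 * K * e) * 1" using K e t by (intro mult_left_mono) auto
      moreover have "e0 = 2 * e + real CARD('d) * (2 * K * e)" unfolding eD[symmetric] D_def by (simp add: algebra_simps)
      moreover have "(real CARD('d) * (2 * K * e) + K1 * t) * t = real CARD('d) * (2 * K * e) * t + K1 * t\<^sup>2"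
        by (simp add: algebra_simps power2_eq_square)
      ultimately show ?thesis by linarith
    qed
    moreover have "t * zzjump H g z = zzjump H g z * t" by simp
    ultimately show "\<bar>PP t g z - zzflow t g z - t * zzjump H g z\<bar> \<le> K1 * t\<^sup>2 + e0" by linarith
  qed
  with K1 show ?thesis by blast
qed

section \<open>Comparison of the walk with the semigroup\<close>

lemma one_step_approx:
  assumes R: "0 \<le> R" and CL: "0 \<le> C" "0 \<le> L"
  obtains K1 where "0 \<le> K1" "\<And>g \<epsilon> z. lip_supp R C L g \<Longrightarrow> 0 < \<epsilon> \<Longrightarrow> \<epsilon> \<le> 1 \<Longrightarrow> z \<in> UNIV \<times> signs \<Longrightarrow>
    \<bar>zz_op H \<epsilon> g z - PP \<epsilon> g z\<bar> \<le> K1 * \<epsilon>\<^sup>2"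
proof -
  obtain K where hb: "gradient_bound H (R + 2 * real CARD('d) + 2) K" using gradient_bound_exists[OF C2] by blast
  have hb1: "gradient_bound H (R + 2 * real CARD('d) + 1) K" and hb2: "gradient_bound H (R + real CARD('d) + 2) K" by (rule gradient_bound_mono[OF hb]; simp)+
  obtain K1 where K1: "0 \<le> K1" "\<forall>g t z. lip_supp R C L g \<longrightarrow> 0 \<le> t \<longrightarrow> t \<le> 1 \<longrightarrow> z \<in> UNIV \<times> signs \<longrightarrow>
    \<bar>PP t g z - zzflow t g z - t * zzjump H g z\<bar> \<le> K1 * t\<^sup>2" using PP_expansion[OF R CL hb1] by blast
  obtain K2 where K2: "0 \<le> K2" "\<And>\<epsilon> g v x. 0 < \<epsilon> \<Longrightarrow> \<epsilon> \<le> 1 \<Longrightarrow> lip_supp R C L g \<Longrightarrow> v \<in> signs \<Longrightarrow>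
    \<bar>zz_op H \<epsilon> g (x, v) - zzflow \<epsilon> g (x, v) - \<epsilon> * zzjump H g (x, v)\<bar> \<le> K2 * \<epsilon>\<^sup>2"
    using zz_op_expansion[OF C1 CL hb2] by blast
  show ?thesis
  proof (rule that[of "K1 + K2"])
    show "0 \<le> K1 + K2" using K1 K2 by simp
    fix g :: "'d phase \<Rightarrow> real" and \<epsilon> :: real and z :: "'d phase"
    assume g: "lip_supp R C L g" and \<epsilon>: "0 < \<epsilon>" "\<epsilon> \<le> 1" and z: "z \<in> UNIV \<times> signs"
    obtain x v where zv: "z = (x, v)" "v \<in> signs" using z by auto
    have "\<bar>PP \<epsilon> g z - zzflow \<epsilon> g z - \<epsilon> * zzjump H g z\<bar> \<le> K1 * \<epsilon>\<^sup>2"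
      by (rule K1(2)[rule_format, OF g less_imp_le[OF \<epsilon>(1)] \<epsilon>(2) z])
    moreover have "\<bar>zz_op H \<epsilon> g z - zzflow \<epsilon> g z - \<epsilon> * zzjump H g z\<bar> \<le> K2 * \<epsilon>\<^sup>2"
      unfolding zv(1) by (rule K2(2)[OF \<epsilon> g zv(2)])
    moreover have "(K1 + K2) * \<epsilon>\<^sup>2 = K1 * \<epsilon>\<^sup>2 + K2 * \<epsilon>\<^sup>2" by (rule distrib_right)
    ultimately show "\<bar>zz_op H \<epsilon> g z - PP \<epsilon> g z\<bar> \<le> (K1 + K2) * \<epsilon>\<^sup>2" by linarith
  qed
qed

text \<open>The error is telescoped in the order T T^n - P T^n + P(T^n - P_n): the one-step estimate
  meets only powers of the walk operator, whose Lipschitz constants and supports are under control,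
  and P acts only as a contraction. In total n K1 \<epsilon>^2 \<le> K1 T \<epsilon>.\<close>

lemma zz_op_funpow_approx:
  assumes g: "lip_supp R C L g" and R: "0 \<le> R" and T: "0 \<le> T"
  obtains R' L' K1 where "0 \<le> R'" "0 \<le> K1"
    "\<And>\<epsilon> n. 0 < \<epsilon> \<Longrightarrow> \<epsilon> \<le> 1 \<Longrightarrow> real n * \<epsilon> \<le> T \<Longrightarrow> lip_supp R' C L' ((zz_op H \<epsilon> ^^ n) g)"
    "\<And>\<epsilon> n z. 0 < \<epsilon> \<Longrightarrow> \<epsilon> \<le> 1 \<Longrightarrow> real n * \<epsilon> \<le> T \<Longrightarrow> z \<in> UNIV \<times> signs \<Longrightarrow>
      \<bar>(zz_op H \<epsilon> ^^ n) g z - PP (real n * \<epsilon>) g z\<bar> \<le> K1 * T * \<epsilon>"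
proof -
  obtain K where hb: "gradient_bound H (R + real CARD('d) * T + real CARD('d) + 2) K" using gradient_bound_exists[OF C2] by blast
  define R' where "R' = R + real CARD('d) * T"
  define L' where "L' = L + real CARD('d) * T * (2 * K * C)"
  have lip: "lip_supp R' C L' ((zz_op H \<epsilon> ^^ n) g)" if "0 < \<epsilon>" "\<epsilon> \<le> 1" "real n * \<epsilon> \<le> T" for \<epsilon> n
    unfolding R'_def L'_def by (rule lip_supp_zz_op_funpow[OF C1 g that(1,2) hb that(3)])
  have R': "0 \<le> R'" using R T by (simp add: R'_def)
  have C: "0 \<le> C" by (rule lip_supp_nonneg(1)[OF g])
  have L': "0 \<le> L'" using lip_supp_nonneg[OF g] T hboundD(1)[OF hb] by (simp add: L'_def)
  obtain K1 where K1: "0 \<le> K1" "\<And>g \<epsilon> z. lip_supp R' C L' g \<Longrightarrow> 0 < \<epsilon> \<Longrightarrow> \<epsilon> \<le> 1 \<Longrightarrow> z \<in> UNIV \<times> signs \<Longrightarrow>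
    \<bar>zz_op H \<epsilon> g z - PP \<epsilon> g z\<bar> \<le> K1 * \<epsilon>\<^sup>2"
    using one_step_approx[OF R' C L'] by blast
  have bg: "bounded_borel g" by (rule cont_supp_bounded_borel[OF lip_supp_imp_cont_supp[OF g]])
  have main: "\<bar>(zz_op H \<epsilon> ^^ n) g z - PP (real n * \<epsilon>) g z\<bar> \<le> real n * (K1 * \<epsilon>\<^sup>2)"
    if \<epsilon>: "0 < \<epsilon>" "\<epsilon> \<le> 1" and n: "real n * \<epsilon> \<le> T" and z: "z \<in> UNIV \<times> signs" for \<epsilon> n z
    using n z
  proof (induction n arbitrary: z)
    case 0
    then show ?case using PP_0 bg by (simp add: bounded_borel_def)
  next
    case (Suc n)
    have n: "real n * \<epsilon> \<le> T" using Suc.prems \<epsilon> by (simp add: algebra_simps)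
    let ?G = "(zz_op H \<epsilon> ^^ n) g"
    have G: "lip_supp R' C L' ?G" by (rule lip[OF \<epsilon> n])
    have 1: "\<bar>zz_op H \<epsilon> ?G z - PP \<epsilon> ?G z\<bar> \<le> K1 * \<epsilon>\<^sup>2" by (rule K1(2)[OF G \<epsilon> Suc.prems(2)])
    have ne: "0 \<le> real n * \<epsilon>" "0 \<le> \<epsilon>" using \<epsilon> by auto
    have 2: "\<bar>PP \<epsilon> ?G z - PP \<epsilon> (PP (real n * \<epsilon>) g) z\<bar> \<le> real n * (K1 * \<epsilon>\<^sup>2)"
      by (rule PP_diff_le[OF cont_supp_bounded_borel[OF lip_supp_imp_cont_supp[OF G]] PP_bounded_borel[OF bg ne(1)] ne(2) Suc.prems(2) Suc.IH[OF n]])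
    have "PP (real (Suc n) * \<epsilon>) g z = PP (\<epsilon> + real n * \<epsilon>) g z" by (simp add: algebra_simps)
    also have "\<dots> = PP \<epsilon> (PP (real n * \<epsilon>) g) z" by (rule PP_semigroup[OF bg ne(2,1) Suc.prems(2)])
    finally show ?case using 1 2 by (simp add: algebra_simps)
  qed
  show ?thesis
  proof (rule that[OF R' K1(1) lip])
    fix \<epsilon> :: real and n and z :: "'d phase" assume A: "0 < \<epsilon>" "\<epsilon> \<le> 1" "real n * \<epsilon> \<le> T" "z \<in> UNIV \<times> signs"
    have "K1 * \<epsilon> * (real n * \<epsilon>) \<le> K1 * \<epsilon> * T" using K1 A by (intro mult_left_mono) auto
    then show "\<bar>(zz_op H \<epsilon> ^^ n) g z - PP (real n * \<epsilon>) g z\<bar> \<le> K1 * T * \<epsilon>"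
      using main[OF A] by (simp add: power2_eq_square mult_ac)
  qed
qed

lemma PP_lip_supp:
  assumes g: "lip_supp R C L g" and R: "0 \<le> R" and t: "0 \<le> t"
  obtains R' L' where "0 \<le> R'" "lip_supp R' C L' (PP t g)"
proof -
  have bg: "bounded_borel g" by (rule cont_supp_bounded_borel[OF lip_supp_imp_cont_supp[OF g]])
  obtain R' L' K1 where A: "0 \<le> R'" "0 \<le> K1"
    "\<And>\<epsilon> n. 0 < \<epsilon> \<Longrightarrow> \<epsilon> \<le> 1 \<Longrightarrow> real n * \<epsilon> \<le> t \<Longrightarrow> lip_supp R' C L' ((zz_op H \<epsilon> ^^ n) g)"
    "\<And>\<epsilon> n z. 0 < \<epsilon> \<Longrightarrow> \<epsilon> \<le> 1 \<Longrightarrow> real n * \<epsilon> \<le> t \<Longrightarrow> z \<in> UNIV \<times> signs \<Longrightarrow>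
      \<bar>(zz_op H \<epsilon> ^^ n) g z - PP (real n * \<epsilon>) g z\<bar> \<le> K1 * t * \<epsilon>"
    by (rule zz_op_funpow_approx[OF g R t]) (rule that; assumption)
  show ?thesis
  proof (cases "t = 0")
    case True
    have "PP t g z = g z" if "z \<in> UNIV \<times> signs" for z using PP_0[OF that] bg True by (simp add: bounded_borel_def)
    then have "lip_supp R C L (PP t g)" using g by (simp add: lip_supp_def)
    then show ?thesis using that R by blast
  next
    case False
    then have t0: "0 < t" using t by simp
    have ev: "\<forall>\<^sub>F n in sequentially. 0 < n \<and> t / real n \<le> 1"
    proof -
      have "\<forall>\<^sub>F n in sequentially. t / real n < 1" by (rule order_tendstoD(2)[OF lim_const_over_n]) simp
      then show ?thesis using eventually_gt_at_top[of "0::nat"] by (rule eventually_elim2) simp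
    qed
    have "lip_supp R' C L' (PP t g)"
    \<comment> \<open>The step size t / n makes n steps reach the time t exactly; the bounds
      \<open>R'\<close>, \<open>C\<close>, \<open>L'\<close> do not depend on n and pass to the
      pointwise limit.\<close>
    proof (rule lip_supp_limit[where f="\<lambda>n. (zz_op H (t / real n) ^^ n) g"])
      show "\<forall>\<^sub>F n in sequentially. lip_supp R' C L' ((zz_op H (t / real n) ^^ n) g)"
        using ev by (rule eventually_mono) (rule A(3), use t0 in auto)
      fix z :: "'d phase" assume z: "z \<in> UNIV \<times> signs"
      have "(\<lambda>n. (zz_op H (t / real n) ^^ n) g z - PP t g z) \<longlonglongrightarrow> 0"
      proof (rule Lim_null_comparison)
        show "\<forall>\<^sub>F n in sequentially. norm ((zz_op H (t / real n) ^^ n) g z - PP t g z) \<le> K1 * t * (t / real n)"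
          using ev
        proof (rule eventually_mono)
          fix n assume n: "0 < n \<and> t / real n \<le> 1"
          have eq: "real n * (t / real n) = t" using n by simp
          have "\<bar>(zz_op H (t / real n) ^^ n) g z - PP (real n * (t / real n)) g z\<bar> \<le> K1 * t * (t / real n)"
            by (rule A(4)) (use n t0 z in auto)
          then show "norm ((zz_op H (t / real n) ^^ n) g z - PP t g z) \<le> K1 * t * (t / real n)"
            unfolding eq by simp
        qed
        show "(\<lambda>n. K1 * t * (t / real n)) \<longlonglongrightarrow> 0"
          using tendsto_mult_right_zero[OF lim_const_over_n[of t], of "K1 * t"] by simp
      qed
      then show "(\<lambda>n. (zz_op H (t / real n) ^^ n) g z) \<longlonglongrightarrow> PP t g z" by (rule LIM_zero_cancel)
    qed
    then show ?thesis using that A(1) by blast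
  qed
qed

text \<open>Absorbs the rounding of times: n steps of length \<epsilon> reach t only approximately.
  Over a short time the semigroup is close to the flow, the flow to the identity, and contraction
  moves the estimate from time 0 to time s.\<close>

lemma PP_time_lipschitz:
  fixes g :: "'d phase \<Rightarrow> real"
  assumes g: "lip_supp R C L g" and R: "0 \<le> R"
  obtains K where "0 \<le> K" "\<And>s t z. 0 \<le> s \<Longrightarrow> s \<le> t \<Longrightarrow> t - s \<le> 1 \<Longrightarrow> z \<in> UNIV \<times> signs \<Longrightarrow>
    \<bar>PP t g z - PP s g z\<bar> \<le> K * (t - s)"
proof -
  obtain K0 where hb: "gradient_bound H (R + 1 + real CARD('d)) K0" using gradient_bound_exists[OF C2] by blast
  have bg: "bounded_borel g" by (rule cont_supp_bounded_borel[OF lip_supp_imp_cont_supp[OF g]])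
  have nn: "0 \<le> K0" "0 \<le> C" "0 \<le> L" using hboundD(1)[OF hb] lip_supp_nonneg[OF g] by auto
  define K where "K = real CARD('d) * (2 * K0 * C) + L * real CARD('d)"
  have small: "\<bar>PP h g z - g z\<bar> \<le> K * h" if h: "0 \<le> h" "h \<le> 1" and z: "z \<in> UNIV \<times> signs" for h z
  proof -
    obtain x v where zv: "z = (x, v)" "v \<in> signs" using z by auto
    have "\<bar>PP h g z - zzflow h g z\<bar> \<le> real CARD('d) * (2 * K0 * C) * h"
    proof (rule flow_approx[OF lip_supp_imp_cont_supp[OF g] R _ h hb z])
      show "\<bar>g y\<bar> \<le> C" if "y \<in> UNIV \<times> signs" for y using lipcD(1)[OF g, of "snd y" "fst y"] that by auto
    qed
    moreover have "\<bar>zzflow h g z - g z\<bar> \<le> L * (real CARD('d) * h)" unfolding zv(1) by (rule zzflow_diff_lip_supp[OF g zv(2) h(1)])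
    moreover have "K * h = real CARD('d) * (2 * K0 * C) * h + L * (real CARD('d) * h)" by (simp add: K_def algebra_simps)
    ultimately show ?thesis by linarith
  qed
  show ?thesis
  proof (rule that[of K])
    show "0 \<le> K" using nn by (simp add: K_def)
    fix s t :: real and z :: "'d phase" assume A: "0 \<le> s" "s \<le> t" "t - s \<le> 1" "z \<in> UNIV \<times> signs"
    have ts: "0 \<le> t - s" using A by simp
    have "PP t g z = PP (s + (t - s)) g z" by simp
    also have "\<dots> = PP s (PP (t - s) g) z" by (rule PP_semigroup[OF bg A(1) ts A(4)])
    finally have eq: "PP t g z = PP s (PP (t - s) g) z" .
    show "\<bar>PP t g z - PP s g z\<bar> \<le> K * (t - s)"
      unfolding eq by (rule PP_diff_le[OF PP_bounded_borel[OF bg ts] bg A(1,4) small[OF ts A(3)]])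
  qed
qed

lemma zz_op_funpow_tendsto:
  assumes g: "lip_supp R C L g" and R: "0 \<le> R" and t: "0 \<le> t"
    and n: "((\<lambda>\<epsilon>. real (n \<epsilon>) * \<epsilon>) \<longlongrightarrow> t) (at_right 0)" and e: "0 < e"
  shows "\<forall>\<^sub>F \<epsilon> in at_right 0. \<forall>z\<in>UNIV \<times> signs. \<bar>(zz_op H \<epsilon> ^^ n \<epsilon>) g z - PP t g z\<bar> \<le> e"
proof -
  have t1: "0 \<le> t + 1" using t by simp
  obtain R' L' K1 where A: "0 \<le> R'" "0 \<le> K1"
    "\<And>\<epsilon> n. 0 < \<epsilon> \<Longrightarrow> \<epsilon> \<le> 1 \<Longrightarrow> real n * \<epsilon> \<le> t + 1 \<Longrightarrow> lip_supp R' C L' ((zz_op H \<epsilon> ^^ n) g)"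
    "\<And>\<epsilon> n z. 0 < \<epsilon> \<Longrightarrow> \<epsilon> \<le> 1 \<Longrightarrow> real n * \<epsilon> \<le> t + 1 \<Longrightarrow> z \<in> UNIV \<times> signs \<Longrightarrow>
      \<bar>(zz_op H \<epsilon> ^^ n) g z - PP (real n * \<epsilon>) g z\<bar> \<le> K1 * (t + 1) * \<epsilon>"
    by (rule zz_op_funpow_approx[OF g R t1]) (rule that; assumption)
  obtain K where K: "0 \<le> K" "\<And>s t z. 0 \<le> s \<Longrightarrow> s \<le> t \<Longrightarrow> t - s \<le> 1 \<Longrightarrow> z \<in> UNIV \<times> signs \<Longrightarrow>
    \<bar>PP t g z - PP s g z\<bar> \<le> K * (t - s)" using PP_time_lipschitz[OF g R] by blast
  define a where "a = K1 * (t + 1)"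
  have a: "0 \<le> a" using A(2) t1 by (simp add: a_def)
  have "\<forall>\<^sub>F \<epsilon> in at_right 0. dist (real (n \<epsilon>) * \<epsilon>) t < min 1 (e / 2 / (K + 1))"
    using n e K(1) by (intro tendstoD) auto
  moreover have "\<forall>\<^sub>F \<epsilon> in at_right (0::real). 0 < \<epsilon> \<and> \<epsilon> \<le> 1 \<and> \<epsilon> \<le> e / 2 / (a + 1)"
    using e a by (intro eventually_at_rightI[of 0 "min 1 (e / 2 / (a + 1))"]) auto
  ultimately show ?thesis
  proof (rule eventually_elim2)
    fix \<epsilon> assume d: "dist (real (n \<epsilon>) * \<epsilon>) t < min 1 (e / 2 / (K + 1))" and \<epsilon>: "0 < \<epsilon> \<and> \<epsilon> \<le> 1 \<and> \<epsilon> \<le> e / 2 / (a + 1)"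
    let ?s = "real (n \<epsilon>) * \<epsilon>"
    have s: "0 \<le> ?s" "\<bar>?s - t\<bar> \<le> 1" "\<bar>?s - t\<bar> \<le> e / 2 / (K + 1)" using d \<epsilon> by (auto simp: dist_real_def)
    then have "?s \<le> t + 1" by linarith
    have "\<epsilon> * (a + 1) \<le> e / 2" using \<epsilon> pos_le_divide_eq[of "a + 1" \<epsilon> "e / 2"] a by simp
    then have 1: "a * \<epsilon> \<le> e / 2" using \<epsilon> a by (simp add: algebra_simps)
    have "\<bar>?s - t\<bar> * (K + 1) \<le> e / 2"
      using s(3) pos_le_divide_eq[of "K + 1" "\<bar>?s - t\<bar>" "e / 2"] K(1) by simp
    moreover have "\<bar>?s - t\<bar> * (K + 1) = K * \<bar>?s - t\<bar> + \<bar>?s - t\<bar>" by (simp add: algebra_simps)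
    ultimately have 2: "K * \<bar>?s - t\<bar> \<le> e / 2" by linarith
    show "\<forall>z\<in>UNIV \<times> signs. \<bar>(zz_op H \<epsilon> ^^ n \<epsilon>) g z - PP t g z\<bar> \<le> e"
    proof
      fix z :: "'d phase" assume z: "z \<in> UNIV \<times> signs"
      have "\<bar>(zz_op H \<epsilon> ^^ n \<epsilon>) g z - PP ?s g z\<bar> \<le> a * \<epsilon>"
        unfolding a_def using \<epsilon> by (intro A(4) z \<open>?s \<le> t + 1\<close>) auto
      moreover have "\<bar>PP ?s g z - PP t g z\<bar> \<le> K * \<bar>?s - t\<bar>"
      proof (cases "?s \<le> t")
        case True
        then show ?thesis using K(2)[OF s(1) True _ z] s(2) by (simp add: abs_minus_commute)
      next
        case False
        then have ts: "t \<le> ?s" by simp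
        then show ?thesis using K(2)[OF t ts _ z] s(2) by simp
      qed
      ultimately show "\<bar>(zz_op H \<epsilon> ^^ n \<epsilon>) g z - PP t g z\<bar> \<le> e" using 1 2 by linarith
    qed
  qed
qed

end


section \<open>Finite-range Markov chains\<close>

text \<open>With finitely many successors of each state and a deterministic start, every expectation
  up to a finite time is a finite sum over trajectories. Since the transition probabilities to
  \<open>succs z\<close> already add up to 1, nothing is lost by ignoring other targets.\<close>

locale finite_range_chain = prob_space M for M :: "'a measure" +
  fixes S :: "'s set" and p :: "'s \<Rightarrow> 's \<Rightarrow> real" and Z :: "nat \<Rightarrow> 'a \<Rightarrow> 's" and succs :: "'s \<Rightarrow> 's set" and z0 :: 's
  assumes chain: "markov_chain M S p Z"
    and succs: "\<And>z. z \<in> S \<Longrightarrow> finite (succs z) \<and> succs z \<subseteq> S"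
    and total: "\<And>z. z \<in> S \<Longrightarrow> (\<Sum>z'\<in>succs z. p z z') = 1"
    and init: "AE \<omega> in M. Z 0 \<omega> = z0" and z0: "z0 \<in> S"
begin

lemma Z_measurable: "Z n \<in> M \<rightarrow>\<^sub>M count_space S"
  using chain by (simp add: markov_chain_def)

lemma Z_in: "\<omega> \<in> space M \<Longrightarrow> Z n \<omega> \<in> S"
  using measurable_space[OF Z_measurable] by simp

text \<open>Trajectories are frozen at \<open>z0\<close> after time \<open>n\<close>, which makes \<open>trajs n\<close> finite.\<close>

primrec trajs :: "nat \<Rightarrow> (nat \<Rightarrow> 's) set" where
  "trajs 0 = {\<lambda>_. z0}"
| "trajs (Suc n) = (\<lambda>(\<tau>, z). \<tau>(Suc n := z)) ` (SIGMA \<tau>:trajs n. succs (\<tau> n))"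

lemma trajs_in: "\<tau> \<in> trajs n \<Longrightarrow> \<tau> k \<in> S"
proof (induction n arbitrary: \<tau> k)
  case 0
  then show ?case using z0 by simp
next
  case (Suc n)
  then obtain \<tau>' z where \<tau>: "\<tau> = \<tau>'(Suc n := z)" "\<tau>' \<in> trajs n" "z \<in> succs (\<tau>' n)" by auto
  then show ?case using Suc.IH succs[of "\<tau>' n"] by auto
qed

lemma trajs_const: "\<tau> \<in> trajs n \<Longrightarrow> n < k \<Longrightarrow> \<tau> k = z0"
proof (induction n arbitrary: \<tau>)
  case (Suc n)
  then obtain \<tau>' z where "\<tau> = \<tau>'(Suc n := z)" "\<tau>' \<in> trajs n" by auto
  then show ?case using Suc.IH[of \<tau>'] Suc.prems by auto
qed simp

lemma finite_trajs: "finite (trajs n)"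
proof (induction n)
  case (Suc n)
  have "finite (SIGMA \<tau>:trajs n. succs (\<tau> n))" using Suc succs trajs_in by (intro finite_SigmaI) blast+
  then show ?case by simp
qed simp

lemma trajs_inj: "inj_on (\<lambda>(\<tau>, z). \<tau>(Suc n := z)) (SIGMA \<tau>:trajs n. succs (\<tau> n))"
proof (rule inj_onI, clarify)
  fix \<tau> z \<tau>' z'
  assume A: "\<tau> \<in> trajs n" "\<tau>' \<in> trajs n" and eq: "\<tau>(Suc n := z) = \<tau>'(Suc n := z')"
  have "\<tau> k = \<tau>' k" for k
    using fun_cong[OF eq, of k] trajs_const[OF A(1), of "Suc n"] trajs_const[OF A(2), of "Suc n"]
    by (cases "k = Suc n") auto
  then show "\<tau> = \<tau>' \<and> z = z'" using fun_cong[OF eq, of "Suc n"] by auto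
qed

definition follow :: "nat \<Rightarrow> (nat \<Rightarrow> 's) \<Rightarrow> 'a set" where
  "follow n \<tau> = {\<omega> \<in> space M. \<forall>k\<le>n. Z k \<omega> = \<tau> k}"

lemma follow_sets: "\<tau> \<in> trajs n \<Longrightarrow> follow n \<tau> \<in> sets M"
proof -
  assume \<tau>: "\<tau> \<in> trajs n"
  have "{\<omega> \<in> space M. Z k \<omega> = \<tau> k} \<in> sets M" for k
  proof -
    have "Z k -` {\<tau> k} \<inter> space M \<in> sets M"
      by (rule measurable_sets[OF Z_measurable]) (simp add: trajs_in[OF \<tau>])
    moreover have "Z k -` {\<tau> k} \<inter> space M = {\<omega> \<in> space M. Z k \<omega> = \<tau> k}" by auto
    ultimately show ?thesis by simp
  qed
  then have "(\<Inter>k\<in>{..n}. {\<omega> \<in> space M. Z k \<omega> = \<tau> k}) \<in> sets M" by (intro sets.finite_INT) auto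
  moreover have "(\<Inter>k\<in>{..n}. {\<omega> \<in> space M. Z k \<omega> = \<tau> k}) = follow n \<tau>" by (auto simp: follow_def)
  ultimately show ?thesis by simp
qed

lemma follow_Suc:
  assumes "\<tau> \<in> trajs n" "z \<in> succs (\<tau> n)"
  shows "prob (follow (Suc n) (\<tau>(Suc n := z))) = prob (follow n \<tau>) * p (\<tau> n) z"
proof -
  let ?\<tau> = "\<tau>(Suc n := z)"
  have "\<tau>(Suc n := z) \<in> trajs (Suc n)" using assms by force
  then have "?\<tau> \<in> {..Suc n} \<rightarrow> S" using trajs_in by blast
  then have "prob {\<omega> \<in> space M. \<forall>k\<le>Suc n. Z k \<omega> = ?\<tau> k} =
      prob {\<omega> \<in> space M. \<forall>k\<le>n. Z k \<omega> = ?\<tau> k} * p (?\<tau> n) (?\<tau> (Suc n))"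
    using chain unfolding markov_chain_def by blast
  moreover have "{\<omega> \<in> space M. \<forall>k\<le>n. Z k \<omega> = ?\<tau> k} = follow n \<tau>" by (auto simp: follow_def)
  ultimately show ?thesis by (simp add: follow_def)
qed

lemma sum_trajs_Suc:
  "(\<Sum>\<tau>\<in>trajs (Suc n). f \<tau>) = (\<Sum>\<tau>\<in>trajs n. \<Sum>z\<in>succs (\<tau> n). f (\<tau>(Suc n := z)))"
proof -
  have "(\<Sum>\<tau>\<in>trajs (Suc n). f \<tau>) = (\<Sum>(\<tau>, z)\<in>(SIGMA \<tau>:trajs n. succs (\<tau> n)). f (\<tau>(Suc n := z)))"
    unfolding trajs.simps by (subst sum.reindex[OF trajs_inj]) (simp add: case_prod_unfold)
  also have "\<dots> = (\<Sum>\<tau>\<in>trajs n. \<Sum>z\<in>succs (\<tau> n). f (\<tau>(Suc n := z)))"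
    using finite_trajs succs trajs_in by (subst sum.Sigma) (auto simp: case_prod_unfold)
  finally show ?thesis .
qed

lemma disjoint_follow:
  assumes "\<tau> \<in> trajs n" "\<tau>' \<in> trajs n" "\<omega> \<in> follow n \<tau>" "\<omega> \<in> follow n \<tau>'"
  shows "\<tau> = \<tau>'"
proof
  fix k
  show "\<tau> k = \<tau>' k"
    using assms(3,4) trajs_const[OF assms(1), of k] trajs_const[OF assms(2), of k]
    by (cases "k \<le> n") (auto simp: follow_def)
qed

lemma sum_prob_follow: "(\<Sum>\<tau>\<in>trajs n. prob (follow n \<tau>)) = 1"
proof (induction n)
  case 0
  have "prob (follow 0 (\<lambda>_. z0)) = 1"
  proof (subst prob_eq_1)
    show "follow 0 (\<lambda>_. z0) \<in> events" by (rule follow_sets) simp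
    show "AE x in M. x \<in> follow 0 (\<lambda>_. z0)" using init by (auto simp: follow_def)
  qed
  then show ?case by simp
next
  case (Suc n)
  have "(\<Sum>\<tau>\<in>trajs (Suc n). prob (follow (Suc n) \<tau>)) =
      (\<Sum>\<tau>\<in>trajs n. \<Sum>z\<in>succs (\<tau> n). prob (follow n \<tau>) * p (\<tau> n) z)"
    unfolding sum_trajs_Suc by (intro sum.cong refl follow_Suc)
  also have "\<dots> = (\<Sum>\<tau>\<in>trajs n. prob (follow n \<tau>))"
    unfolding sum_distrib_left[symmetric] using total trajs_in by (intro sum.cong) auto
  finally show ?case using Suc by simp
qed

text \<open>The trajectory events are disjoint and their probabilities add up to 1. The chain is
  specified through joint probabilities only; this supplies the pathwise information that moves
  outside of \<open>succs\<close> have probability zero.\<close>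

lemma AE_follow: "AE \<omega> in M. \<exists>\<tau>\<in>trajs n. \<omega> \<in> follow n \<tau>"
proof -
  have d: "disjoint_family_on (follow n) (trajs n)"
    using disjoint_follow unfolding disjoint_family_on_def by blast
  have "prob (\<Union>\<tau>\<in>trajs n. follow n \<tau>) = 1"
    using finite_measure_finite_Union[OF finite_trajs _ d] follow_sets sum_prob_follow by auto
  then have "AE \<omega> in M. \<omega> \<in> (\<Union>\<tau>\<in>trajs n. follow n \<tau>)"
    using follow_sets finite_trajs by (subst (asm) prob_eq_1) auto
  then show ?thesis by simp
qed

text \<open>Functionals of trajectories that depend on the states up to time n. They stand for
  random variables measurable with respect to the past, so that on the walk side the Markov property
  can be used without conditional expectations.\<close>

definition adapted :: "nat \<Rightarrow> ((nat \<Rightarrow> 's) \<Rightarrow> real) \<Rightarrow> bool" where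
  "adapted n G \<longleftrightarrow> (\<forall>\<tau> \<tau>'. (\<forall>k\<le>n. \<tau> k = \<tau>' k) \<longrightarrow> G \<tau> = G \<tau>')"

lemma adapted_AE:
  assumes "adapted n G"
  shows "AE \<omega> in M. G (\<lambda>k. Z k \<omega>) = (\<Sum>\<tau>\<in>trajs n. G \<tau> * indicator (follow n \<tau>) \<omega>)"
  using AE_follow[of n]
proof (rule AE_mp, intro AE_I2 impI)
  fix \<omega> assume "\<exists>\<tau>\<in>trajs n. \<omega> \<in> follow n \<tau>"
  then obtain \<tau> where \<tau>: "\<tau> \<in> trajs n" "\<omega> \<in> follow n \<tau>" by blast
  have "(\<Sum>\<tau>'\<in>trajs n. G \<tau>' * indicator (follow n \<tau>') \<omega>) = (\<Sum>\<tau>'\<in>trajs n. if \<tau>' = \<tau> then G \<tau> else 0)"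
    using disjoint_follow[OF \<tau>(1)] \<tau>(2) by (intro sum.cong refl) (auto simp: indicator_def)
  also have "\<dots> = G \<tau>" using \<tau>(1) finite_trajs by simp
  also have "\<dots> = G (\<lambda>k. Z k \<omega>)" using assms \<tau>(2) unfolding adapted_def follow_def by simp
  finally show "G (\<lambda>k. Z k \<omega>) = (\<Sum>\<tau>\<in>trajs n. G \<tau> * indicator (follow n \<tau>) \<omega>)" by simp
qed

lemma adapted_measurable:
  assumes "adapted n G" "countable S"
  shows "(\<lambda>\<omega>. G (\<lambda>k. Z k \<omega>)) \<in> borel_measurable M"
proof -
  let ?T = "{..n} \<rightarrow>\<^sub>E S"
  have c: "countable ?T" using assms(2) by (intro countable_PiE) auto
  have "(\<lambda>\<omega>. restrict (\<lambda>k. Z k \<omega>) {..n}) \<in> M \<rightarrow>\<^sub>M count_space ?T"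
  proof (subst measurable_count_space_eq_countable[OF c], intro conjI ballI)
    show "(\<lambda>\<omega>. restrict (\<lambda>k. Z k \<omega>) {..n}) \<in> space M \<rightarrow> ?T" using Z_in by auto
    fix \<tau> assume \<tau>: "\<tau> \<in> ?T"
    have "Z k -` {\<tau> k} \<inter> space M \<in> sets M" if "k \<le> n" for k
      by (rule measurable_sets[OF Z_measurable]) (use \<tau> that in auto)
    then have "(\<Inter>k\<in>{..n}. Z k -` {\<tau> k} \<inter> space M) \<in> sets M" by (intro sets.finite_INT) auto
    moreover have "(\<Inter>k\<in>{..n}. Z k -` {\<tau> k} \<inter> space M) = (\<lambda>\<omega>. restrict (\<lambda>k. Z k \<omega>) {..n}) -` {\<tau>} \<inter> space M"
      using \<tau> by (auto simp: fun_eq_iff PiE_def extensional_def restrict_def)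
    ultimately show "(\<lambda>\<omega>. restrict (\<lambda>k. Z k \<omega>) {..n}) -` {\<tau>} \<inter> space M \<in> sets M" by simp
  qed
  moreover have "G \<in> count_space ?T \<rightarrow>\<^sub>M borel" by simp
  ultimately have "(\<lambda>\<omega>. G (restrict (\<lambda>k. Z k \<omega>) {..n})) \<in> borel_measurable M" by (rule measurable_compose)
  moreover have "G (restrict (\<lambda>k. Z k \<omega>) {..n}) = G (\<lambda>k. Z k \<omega>)" for \<omega>
    using assms(1) unfolding adapted_def by (auto simp: restrict_def)
  ultimately show ?thesis by simp
qed

lemma adapted_integral:
  assumes G: "adapted n G" "countable S"
  shows "(\<integral>\<omega>. G (\<lambda>k. Z k \<omega>) \<partial>M) = (\<Sum>\<tau>\<in>trajs n. G \<tau> * prob (follow n \<tau>))"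
proof -
  have m: "(\<lambda>\<omega>. \<Sum>\<tau>\<in>trajs n. G \<tau> * indicator (follow n \<tau>) \<omega>) \<in> borel_measurable M"
    by (intro borel_measurable_sum borel_measurable_times borel_measurable_const borel_measurable_indicator follow_sets)
  have "(\<integral>\<omega>. G (\<lambda>k. Z k \<omega>) \<partial>M) = (\<integral>\<omega>. (\<Sum>\<tau>\<in>trajs n. G \<tau> * indicator (follow n \<tau>) \<omega>) \<partial>M)"
    by (rule integral_cong_AE[OF adapted_measurable[OF G] m adapted_AE[OF G(1)]])
  also have "\<dots> = (\<Sum>\<tau>\<in>trajs n. \<integral>\<omega>. G \<tau> * indicator (follow n \<tau>) \<omega> \<partial>M)"
    by (rule Bochner_Integration.integral_sum)
      (intro integrable_mult_right integrable_real_indicator follow_sets, auto simp: emeasure_eq_measure)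
  also have "\<dots> = (\<Sum>\<tau>\<in>trajs n. G \<tau> * prob (follow n \<tau>))"
    using follow_sets by (intro sum.cong refl) simp
  finally show ?thesis .
qed

lemma adapted_integrable:
  assumes G: "adapted n G" "countable S"
  shows "integrable M (\<lambda>\<omega>. G (\<lambda>k. Z k \<omega>))"
proof -
  have m: "(\<lambda>\<omega>. \<Sum>\<tau>\<in>trajs n. G \<tau> * indicator (follow n \<tau>) \<omega>) \<in> borel_measurable M"
    by (intro borel_measurable_sum borel_measurable_times borel_measurable_const borel_measurable_indicator follow_sets)
  have "integrable M (\<lambda>\<omega>. \<Sum>\<tau>\<in>trajs n. G \<tau> * indicator (follow n \<tau>) \<omega>)"
    by (intro Bochner_Integration.integrable_sum integrable_mult_right integrable_real_indicator follow_sets)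
      (auto simp: emeasure_eq_measure)
  then show ?thesis
    using integrable_cong_AE[OF adapted_measurable[OF G] m adapted_AE[OF G(1)]] by blast
qed

text \<open>The Markov property tested against a functional of the past. Both sides are finite sums
  over trajectories; the sum up to time n + 1 splits into a trajectory up to n and its last state,
  which carries the factor p.\<close>

lemma chain_step:
  assumes G: "adapted n G" and S: "countable S"
  shows "(\<integral>\<omega>. G (\<lambda>k. Z k \<omega>) * f (Z (Suc n) \<omega>) \<partial>M) =
    (\<integral>\<omega>. G (\<lambda>k. Z k \<omega>) * (\<Sum>z\<in>succs (Z n \<omega>). p (Z n \<omega>) z * f z) \<partial>M)"
proof -
  let ?Q = "\<lambda>y. \<Sum>z\<in>succs y. p y z * f z"
  have a1: "adapted (Suc n) (\<lambda>\<tau>. G \<tau> * f (\<tau> (Suc n)))" using G unfolding adapted_def by (metis le_Suc_eq)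
  have a2: "adapted n (\<lambda>\<tau>. G \<tau> * ?Q (\<tau> n))" using G unfolding adapted_def by (metis order_refl)
  have Gu: "G (\<tau>(Suc n := z)) = G \<tau>" for \<tau> z using G unfolding adapted_def by simp
  have "(\<integral>\<omega>. G (\<lambda>k. Z k \<omega>) * f (Z (Suc n) \<omega>) \<partial>M) =
      (\<Sum>\<tau>\<in>trajs (Suc n). (G \<tau> * f (\<tau> (Suc n))) * prob (follow (Suc n) \<tau>))"
    using adapted_integral[OF a1 S] by simp
  also have "\<dots> = (\<Sum>\<tau>\<in>trajs n. \<Sum>z\<in>succs (\<tau> n). (G \<tau> * f z) * (prob (follow n \<tau>) * p (\<tau> n) z))"
    unfolding sum_trajs_Suc by (intro sum.cong refl) (simp add: follow_Suc Gu)
  also have "\<dots> = (\<Sum>\<tau>\<in>trajs n. (G \<tau> * ?Q (\<tau> n)) * prob (follow n \<tau>))"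
    by (intro sum.cong refl) (simp add: sum_distrib_left sum_distrib_right mult_ac)
  also have "\<dots> = (\<integral>\<omega>. G (\<lambda>k. Z k \<omega>) * ?Q (Z n \<omega>) \<partial>M)"
    using adapted_integral[OF a2 S] by simp
  finally show ?thesis .
qed

end


section \<open>The transition kernel of the walk\<close>

lemma real_vec_add: "real_vec (x + y) = real_vec x + real_vec y"
  by (simp add: real_vec_def vec_eq_iff)

lemma real_vec_axis: "real_vec (axis i a) = axis i (real_of_int a)"
  by (simp add: real_vec_def axis_def vec_eq_iff)

lemma real_vec_signs: "real_vec v \<in> signs \<longleftrightarrow> v \<in> signs"
proof -
  have "real_of_int a = 1 \<longleftrightarrow> a = 1" "real_of_int a = -1 \<longleftrightarrow> a = -1" for a by linarith+
  then show ?thesis by (simp add: signs_def real_vec_def)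
qed

lemma real_vec_inj: "real_vec v = real_vec w \<longleftrightarrow> v = w"
  by (simp add: real_vec_def vec_eq_iff)

definition iflip :: "'d \<Rightarrow> int ^ 'd::finite \<Rightarrow> int ^ 'd" where
  "iflip i v = (\<chi> j. if j = i then - (v $ j) else v $ j)"

lemma real_vec_iflip: "real_vec (iflip i v) = flip i (real_vec v)"
  by (simp add: iflip_def flip_def real_vec_def vec_eq_iff)

lemma iflip_signs: "v \<in> signs \<Longrightarrow> iflip i v \<in> signs"
  unfolding signs_def iflip_def by (auto simp: minus_equation_iff)

lemma axis_int_zero: "axis i (0::int) = 0"
  by (simp add: axis_def vec_eq_iff)

context
  fixes H :: "(real, 'd::{finite,linorder}) vec \<Rightarrow> real" and \<epsilon> :: real and U
  defines "U \<equiv> \<lambda>x :: (int, 'd) vec. H (\<epsilon> *\<^sub>R real_vec x)"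
begin

definition wstep :: "'d set \<Rightarrow> (int, 'd) vec \<Rightarrow> (int, 'd) vec \<Rightarrow> (int, 'd) vec" where
  "wstep I v w = (\<Sum>j\<in>I. axis j ((v $ j + w $ j) div 2))"

text \<open>The velocities reachable when only the coordinates in \<open>I\<close> have been
  updated, as needed for an induction over the list of coordinates.\<close>

definition wtargets :: "'d set \<Rightarrow> (int, 'd) vec \<Rightarrow> (int, 'd) vec set" where
  "wtargets I v = {w \<in> signs. \<forall>i. i \<notin> I \<longrightarrow> w $ i = v $ i}"

lemma finite_wtargets: "finite (wtargets I v)"
  by (rule finite_subset[OF _ finite_signs]) (auto simp: wtargets_def)

text \<open>Induction on the list, whose head is the smallest coordinate. With probability q it
  moves and keeps its sign, otherwise it stays and flips; the targets split accordingly by the sign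
  of \<open>w $ i\<close>. As the list is sorted, the head precedes all later coordinates, which
  therefore see its displacement exactly as in \<open>zz_p\<close>.\<close>

lemma foldr_zz_coord_op_eq:
  assumes "sorted_wrt (<) l" "v \<in> signs"
  shows "foldr (zz_coord_op H \<epsilon>) l g (\<epsilon> *\<^sub>R real_vec x, real_vec v) =
    (\<Sum>w\<in>wtargets (set l) v.
       (\<Prod>i\<in>set l. zz_p_coord U i (x + wstep {j \<in> set l. j < i} v w) (v $ i) (w $ i)) *
       g (\<epsilon> *\<^sub>R real_vec (x + wstep (set l) v w), real_vec w))"
  using assms
proof (induction l arbitrary: x v)
  case Nil
  have "wtargets {} v = {v}" using Nil(2) by (auto simp: wtargets_def vec_eq_iff)
  then show ?case by (simp add: wstep_def)
next
  case (Cons i l)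
  let ?I = "set l"
  have l: "sorted_wrt (<) l" and il: "\<And>j. j \<in> ?I \<Longrightarrow> i < j" using Cons.prems(1) by auto
  have i: "i \<notin> ?I" using il by blast
  define q where "q = zz_q U i x (v $ i)"
  let ?p = "\<lambda>x v w. \<Prod>k\<in>?I. zz_p_coord U k (x + wstep {j \<in> ?I. j < k} v w) (v $ k) (w $ k)"
  let ?t = "\<lambda>x v w. ?p x v w * g (\<epsilon> *\<^sub>R real_vec (x + wstep ?I v w), real_vec w)"
  let ?p' = "\<lambda>w. \<Prod>k\<in>set (i # l). zz_p_coord U k (x + wstep {j \<in> set (i # l). j < k} v w) (v $ k) (w $ k)"
  let ?t' = "\<lambda>w. ?p' w * g (\<epsilon> *\<^sub>R real_vec (x + wstep (set (i # l)) v w), real_vec w)"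
  have vi: "v $ i = 1 \<or> v $ i = -1" by (rule signsD[OF Cons.prems(2)])
  have sum_i: "wstep (set (i # l)) v w = axis i ((v $ i + w $ i) div 2) + wstep ?I v w" for w
    using i by (simp add: wstep_def)
  have sum_k: "wstep {j \<in> set (i # l). j < k} v w = axis i ((v $ i + w $ i) div 2) + wstep {j \<in> ?I. j < k} v w"
    if "k \<in> ?I" for k w
  proof -
    have "{j \<in> set (i # l). j < k} = insert i {j \<in> ?I. j < k}" using il[OF that] by auto
    then show ?thesis using i by (simp add: wstep_def)
  qed
  have no_pred: "{j \<in> set (i # l). j < i} = {}" using il by force
  have prod_i: "?p' w = zz_p_coord U i x (v $ i) (w $ i) * ?p (x + axis i ((v $ i + w $ i) div 2)) v w" for w
  proof -
    have "?p' w = zz_p_coord U i (x + wstep {j \<in> set (i # l). j < i} v w) (v $ i) (w $ i) *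
        (\<Prod>k\<in>?I. zz_p_coord U k (x + wstep {j \<in> set (i # l). j < k} v w) (v $ k) (w $ k))"
      using i by simp
    also have "(\<Prod>k\<in>?I. zz_p_coord U k (x + wstep {j \<in> set (i # l). j < k} v w) (v $ k) (w $ k)) =
        ?p (x + axis i ((v $ i + w $ i) div 2)) v w"
      by (intro prod.cong refl) (simp only: sum_k add.assoc)
    finally show ?thesis unfolding no_pred by (simp add: wstep_def)
  qed
  have t1: "?t' w = q * ?t (x + axis i (v $ i)) v w" if "w \<in> wtargets ?I v" for w
  proof -
    have wi: "w $ i = v $ i" using that i by (simp add: wtargets_def)
    have p: "zz_p_coord U i x (v $ i) (w $ i) = q" using vi wi by (auto simp: zz_p_coord_def q_def)
    have half: "(v $ i + w $ i) div 2 = v $ i" using wi by simp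
    show ?thesis unfolding prod_i sum_i half p by (simp add: add.assoc)
  qed
  \<comment> \<open>A flip of the head changes only coordinate i, which enters neither the
    displacements nor the factors of the later coordinates.\<close>
  have same: "?t x (iflip i v) w = ?t x v w" for w
  proof -
    have k: "iflip i v $ k = v $ k" if "k \<in> ?I" for k using that i by (auto simp: iflip_def)
    have s: "wstep J (iflip i v) w = wstep J v w" if "J \<subseteq> ?I" for J
      unfolding wstep_def using k that by (intro sum.cong) auto
    have "?p x (iflip i v) w = ?p x v w" by (intro prod.cong refl) (simp add: k s)
    then show ?thesis by (simp add: s)
  qed
  have t2: "?t' w = (1 - q) * ?t x (iflip i v) w" if "w \<in> wtargets ?I (iflip i v)" for w
  proof -
    have wi: "w $ i = - v $ i" using that i by (simp add: wtargets_def iflip_def)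
    have p: "zz_p_coord U i x (v $ i) (w $ i) = 1 - q" using vi wi by (auto simp: zz_p_coord_def q_def)
    have half: "(v $ i + w $ i) div 2 = 0" using wi by simp
    show ?thesis unfolding same unfolding prod_i sum_i half p axis_int_zero by simp
  qed
  have W: "wtargets (set (i # l)) v = wtargets ?I v \<union> wtargets ?I (iflip i v)"
  proof
    show "wtargets (set (i # l)) v \<subseteq> wtargets ?I v \<union> wtargets ?I (iflip i v)"
    proof
      fix w assume w: "w \<in> wtargets (set (i # l)) v"
      then have "w $ i = v $ i \<or> w $ i = - v $ i" using vi signsD[of w i] by (auto simp: wtargets_def)
      then show "w \<in> wtargets ?I v \<union> wtargets ?I (iflip i v)" using w by (auto simp: wtargets_def iflip_def)
    qed
  qed (use i in \<open>auto simp: wtargets_def iflip_def\<close>)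
  have disj: "wtargets ?I v \<inter> wtargets ?I (iflip i v) = {}"
    using vi i by (auto simp: wtargets_def iflip_def)
  have q_eq: "exp (- max (H (\<epsilon> *\<^sub>R real_vec x + axis i (\<epsilon> * real_vec v $ i)) - H (\<epsilon> *\<^sub>R real_vec x)) 0) = q"
    and pos: "\<epsilon> *\<^sub>R real_vec x + axis i (\<epsilon> * real_vec v $ i) = \<epsilon> *\<^sub>R real_vec (x + axis i (v $ i))"
  proof -
    have "\<epsilon> *\<^sub>R real_vec (x + axis i (v $ i)) = \<epsilon> *\<^sub>R real_vec x + \<epsilon> *\<^sub>R axis i (real_of_int (v $ i))"
      by (simp add: real_vec_add real_vec_axis scaleR_add_right)
    also have "\<epsilon> *\<^sub>R axis i (real_of_int (v $ i)) = axis i (\<epsilon> * real_vec v $ i)"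
      by (simp add: vec_eq_iff axis_def real_vec_def)
    finally show pos: "\<epsilon> *\<^sub>R real_vec x + axis i (\<epsilon> * real_vec v $ i) = \<epsilon> *\<^sub>R real_vec (x + axis i (v $ i))" by simp
    show "exp (- max (H (\<epsilon> *\<^sub>R real_vec x + axis i (\<epsilon> * real_vec v $ i)) - H (\<epsilon> *\<^sub>R real_vec x)) 0) = q"
      unfolding pos by (simp add: q_def zz_q_def U_def)
  qed
  have "foldr (zz_coord_op H \<epsilon>) (i # l) g (\<epsilon> *\<^sub>R real_vec x, real_vec v) =
      q * foldr (zz_coord_op H \<epsilon>) l g (\<epsilon> *\<^sub>R real_vec (x + axis i (v $ i)), real_vec v) +
      (1 - q) * foldr (zz_coord_op H \<epsilon>) l g (\<epsilon> *\<^sub>R real_vec x, real_vec (iflip i v))"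
    by (simp add: zz_coord_op_def Let_def pos q_eq[unfolded pos] real_vec_iflip)
  also have "\<dots> = (\<Sum>w\<in>wtargets ?I v. ?t' w) + (\<Sum>w\<in>wtargets ?I (iflip i v). ?t' w)"
    unfolding Cons.IH[OF l Cons.prems(2)] Cons.IH[OF l iflip_signs[OF Cons.prems(2)]] sum_distrib_left
    using t1 t2 by simp
  also have "\<dots> = (\<Sum>w\<in>wtargets (set (i # l)) v. ?t' w)"
    unfolding W using disj by (intro sum.union_disjoint[symmetric] finite_wtargets)
  finally show ?case .
qed

lemma zz_op_eq_sum:
  assumes "v \<in> signs"
  shows "zz_op H \<epsilon> g (\<epsilon> *\<^sub>R real_vec x, real_vec v) =
    (\<Sum>w\<in>signs. zz_p U x v w * g (\<epsilon> *\<^sub>R real_vec (x + (\<chi> i. (v $ i + w $ i) div 2)), real_vec w))"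
proof -
  have W: "wtargets UNIV v = signs" by (simp add: wtargets_def)
  have s: "wstep UNIV v w = (\<chi> i. (v $ i + w $ i) div 2)" for w
    by (simp add: wstep_def vec_eq_iff axis_def if_distrib[of "\<lambda>x. x $ _"] sum.delta cong: if_cong)
  have p: "(\<Prod>i\<in>UNIV. zz_p_coord U i (x + wstep {j. j < i} v w) (v $ i) (w $ i)) = zz_p U x v w" for w
    unfolding zz_p_def wstep_def lessThan_def by simp
  have "sorted_wrt (<) (sorted_list_of_set (UNIV :: 'd set))" by simp
  from foldr_zz_coord_op_eq[OF this assms, of g x] show ?thesis
    unfolding zz_op_def by (simp add: W s p)
qed

end


lemma countable_int_vec: "countable (UNIV :: (int, 'd::finite) vec set)"
proof -
  have "UNIV = (\<lambda>f. \<chi> i. f i) ` (UNIV :: ('d \<Rightarrow> int) set)"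
  proof (rule set_eqI)
    fix v :: "(int, 'd) vec"
    have "v = (\<chi> i. v $ i)" by simp
    then show "v \<in> UNIV \<longleftrightarrow> v \<in> (\<lambda>f. \<chi> i. f i) ` (UNIV :: ('d \<Rightarrow> int) set)" by blast
  qed
  then show ?thesis by (metis countable_image countableI_type)
qed

text \<open>Combined with the kernel formula, the case c = 1 says that the transition probabilities
  add up to 1.\<close>

lemma zz_op_const: "zz_op H \<epsilon> (\<lambda>_. c) z = c"
proof -
  have "foldr (zz_coord_op H \<epsilon>) l (\<lambda>_. c) = (\<lambda>_. c)" for l
    by (induction l) (simp_all add: zz_coord_op_def[abs_def] Let_def algebra_simps)
  then show ?thesis by (simp add: zz_op_def)
qed

text \<open>In the application f is the indicator of a velocity different from v, so the first claim
  bounds the probability that one step changes v. It is a union bound over the coordinates: each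
  flips with probability at most \<open>K * \<epsilon>\<close>, and after a flip f is estimated by
  1. The condition on the norm keeps all intermediate positions in the ball where K is
  valid.\<close>

lemma foldr_zz_coord_op_stay:
  assumes C1: "class_C1 H" and hb: "gradient_bound H (R + 2) K" and \<epsilon>: "0 < \<epsilon>" "\<epsilon> \<le> 1"
    and v: "v \<in> signs" and f: "\<And>y. f (y, v) = 0" "\<And>z. 0 \<le> f z \<and> f z \<le> 1"
  shows "norm x + real (length l) * \<epsilon> \<le> R + 1 \<Longrightarrow> foldr (zz_coord_op H \<epsilon>) l f (x, v) \<le> real (length l) * (K * \<epsilon>)"
    and "0 \<le> foldr (zz_coord_op H \<epsilon>) l f z \<and> foldr (zz_coord_op H \<epsilon>) l f z \<le> 1"
proof -
  have b: "0 \<le> foldr (zz_coord_op H \<epsilon>) l f z \<and> foldr (zz_coord_op H \<epsilon>) l f z \<le> 1" for l z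
  proof (induction l arbitrary: z)
    case (Cons i l)
    let ?q = "exp (- max (H (fst z + axis i (\<epsilon> * snd z $ i)) - H (fst z)) 0)"
    let ?a = "foldr (zz_coord_op H \<epsilon>) l f (fst z + axis i (\<epsilon> * snd z $ i), snd z)"
    let ?b = "foldr (zz_coord_op H \<epsilon>) l f (fst z, flip i (snd z))"
    have q: "0 \<le> ?q" "?q \<le> 1" by simp_all
    have "?q * ?a + (1 - ?q) * ?b \<le> ?q * 1 + (1 - ?q) * 1"
      using Cons q by (intro add_mono mult_left_mono) auto
    moreover have "0 \<le> ?q * ?a + (1 - ?q) * ?b"
      using Cons q by (intro add_nonneg_nonneg mult_nonneg_nonneg) auto
    moreover have "foldr (zz_coord_op H \<epsilon>) (i # l) f z = ?q * ?a + (1 - ?q) * ?b"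
      by (simp add: zz_coord_op_def[of H \<epsilon> i "foldr (zz_coord_op H \<epsilon>) l f" z] Let_def)
    ultimately show ?case by simp
  qed (use f in simp)
  then show "0 \<le> foldr (zz_coord_op H \<epsilon>) l f z \<and> foldr (zz_coord_op H \<epsilon>) l f z \<le> 1" .
  show "norm x + real (length l) * \<epsilon> \<le> R + 1 \<Longrightarrow> foldr (zz_coord_op H \<epsilon>) l f (x, v) \<le> real (length l) * (K * \<epsilon>)"
  proof (induction l arbitrary: x)
    case Nil
    then show ?case using f by simp
  next
    case (Cons i l)
    let ?x = "x + axis i (\<epsilon> * v $ i)"
    let ?q = "exp (- max (H ?x - H x) 0)"
    let ?a = "foldr (zz_coord_op H \<epsilon>) l f (?x, v)" and ?b = "foldr (zz_coord_op H \<epsilon>) l f (x, flip i v)"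
    have "norm ?x \<le> norm x + \<epsilon>"
      using norm_triangle_ineq[of x "axis i (\<epsilon> * v $ i)"] signs_abs[OF v, of i] \<epsilon> by (simp add: norm_axis_real abs_mult)
    then have "norm ?x + real (length l) * \<epsilon> \<le> R + 1" using Cons.prems by (simp add: algebra_simps)
    then have a: "?a \<le> real (length l) * (K * \<epsilon>)" by (rule Cons.IH)
    have "0 \<le> real (length (i # l)) * \<epsilon>" using \<epsilon> by simp
    then have "norm x \<le> R + 1" using Cons.prems by linarith
    note q = zz_reject_bounds(1,2)[OF C1 hb \<epsilon> this v, of i]
    have "?q * ?a \<le> 1 * ?a" using b[of l "(?x, v)"] by (intro mult_right_mono) auto
    then have 1: "?q * ?a \<le> real (length l) * (K * \<epsilon>)" using a by simp
    have "(1 - ?q) * ?b \<le> (1 - ?q) * 1" using b[of l "(x, flip i v)"] q(1) by (intro mult_left_mono) auto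
    then have 2: "(1 - ?q) * ?b \<le> K * \<epsilon>" using q(2) by simp
    have "?q * ?a + (1 - ?q) * ?b \<le> real (length l) * (K * \<epsilon>) + K * \<epsilon>" by (rule add_mono[OF 1 2])
    moreover have "foldr (zz_coord_op H \<epsilon>) (i # l) f (x, v) = ?q * ?a + (1 - ?q) * ?b"
      by (simp add: zz_coord_op_def[of H \<epsilon> i "foldr (zz_coord_op H \<epsilon>) l f" "(x, v)"] Let_def)
    ultimately show ?case by (simp add: algebra_simps)
  qed
qed

section \<open>The walk as a finite-range chain and the probability of its flips\<close>

locale zz_walk =
  fixes H :: "(real, 'd::{finite,linorder}) vec \<Rightarrow> real" and \<epsilon> :: real and M :: "'a measure"
    and X V :: "nat \<Rightarrow> 'a \<Rightarrow> (int, 'd::{finite,linorder}) vec" and x0 v0 :: "(int, 'd::{finite,linorder}) vec"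
  assumes C2: "class_C2 H" and eps: "0 < \<epsilon>"
    and walk: "zigzag_walk M (\<lambda>x. H (\<epsilon> *\<^sub>R real_vec x)) X V"
    and init0: "AE \<omega> in M. X 0 \<omega> = x0 \<and> V 0 \<omega> = v0" and v0: "v0 \<in> signs"
begin

lemma C1: "class_C1 H"
  using C2 by (simp add: class_C2_def)

definition succs :: "(int, 'd) vec \<times> (int, 'd) vec \<Rightarrow> ((int, 'd) vec \<times> (int, 'd) vec) set" where
  "succs z = (\<lambda>w. (fst z + (\<chi> i. (snd z $ i + w $ i) div 2), w)) ` signs"

definition scale :: "(int, 'd) vec \<times> (int, 'd) vec \<Rightarrow> 'd phase" where
  "scale z = (\<epsilon> *\<^sub>R real_vec (fst z), real_vec (snd z))"

definition walk_pos :: "nat \<Rightarrow> 'a \<Rightarrow> 'd phase" where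
  "walk_pos n \<omega> = scale (X n \<omega>, V n \<omega>)"

lemma sum_succs:
  assumes "z \<in> UNIV \<times> signs"
  shows "(\<Sum>z'\<in>succs z. zz_transition (\<lambda>x. H (\<epsilon> *\<^sub>R real_vec x)) z z' * f (scale z')) = zz_op H \<epsilon> f (scale z)"
proof -
  obtain x v where z: "z = (x, v)" "v \<in> signs" using assms by auto
  have inj: "inj_on (\<lambda>w. (x + (\<chi> i. (v $ i + w $ i) div 2), w)) signs" by (rule inj_onI) simp
  have "(\<Sum>z'\<in>succs z. zz_transition (\<lambda>x. H (\<epsilon> *\<^sub>R real_vec x)) z z' * f (scale z')) =
     (\<Sum>w\<in>signs. zz_p (\<lambda>x. H (\<epsilon> *\<^sub>R real_vec x)) x v w *
       f (\<epsilon> *\<^sub>R real_vec (x + (\<chi> i. (v $ i + w $ i) div 2)), real_vec w))"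
    unfolding succs_def z fst_conv snd_conv by (subst sum.reindex[OF inj]) (simp add: scale_def)
  also have "\<dots> = zz_op H \<epsilon> f (scale z)"
    unfolding z scale_def fst_conv snd_conv by (rule zz_op_eq_sum[OF z(2), symmetric])
  finally show ?thesis .
qed

lemma chain0: "markov_chain M (UNIV \<times> signs) (zz_transition (\<lambda>x. H (\<epsilon> *\<^sub>R real_vec x))) (\<lambda>n \<omega>. (X n \<omega>, V n \<omega>))"
  using walk by (simp add: zigzag_walk_def)

sublocale finite_range_chain M "UNIV \<times> signs" "zz_transition (\<lambda>x. H (\<epsilon> *\<^sub>R real_vec x))"
  "\<lambda>n \<omega>. (X n \<omega>, V n \<omega>)" succs "(x0, v0)"
proof -
  interpret prob_space M using chain0 by (simp add: markov_chain_def)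
  show "finite_range_chain M (UNIV \<times> signs) (zz_transition (\<lambda>x. H (\<epsilon> *\<^sub>R real_vec x)))
      (\<lambda>n \<omega>. (X n \<omega>, V n \<omega>)) succs (x0, v0)"
  proof unfold_locales
    show "finite (succs z) \<and> succs z \<subseteq> UNIV \<times> signs" for z
      unfolding succs_def using finite_imageI[OF finite_signs] by auto
    show "(\<Sum>z'\<in>succs z. zz_transition (\<lambda>x. H (\<epsilon> *\<^sub>R real_vec x)) z z') = 1" if "z \<in> UNIV \<times> signs" for z
      using sum_succs[OF that, of "\<lambda>_. 1"] by (simp add: zz_op_const)
    show "AE \<omega> in M. (X 0 \<omega>, V 0 \<omega>) = (x0, v0)" using init0 by simp
  qed (use chain0 v0 in auto)
qed

lemma countable_states: "countable ((UNIV :: (int, 'd) vec set) \<times> (signs :: (int, 'd) vec set))"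
  by (intro countable_SIGMA countable_int_vec countable_finite finite_signs)

lemma V_signs: "\<omega> \<in> space M \<Longrightarrow> V n \<omega> \<in> signs"
  using Z_in[of \<omega> n] by simp

lemma walk_pos_in: "\<omega> \<in> space M \<Longrightarrow> walk_pos n \<omega> \<in> UNIV \<times> signs"
  using V_signs by (simp add: walk_pos_def scale_def real_vec_signs)

lemma walk_pos_measurable: "walk_pos n \<in> borel_measurable M"
proof -
  have "scale \<in> count_space (UNIV \<times> signs) \<rightarrow>\<^sub>M borel" by simp
  from measurable_compose[OF Z_measurable this] show ?thesis by (simp add: walk_pos_def[abs_def])
qed

lemma adapted_mono: "adapted n G \<Longrightarrow> n \<le> m \<Longrightarrow> adapted m G"
  unfolding adapted_def by (meson order_trans)

lemma walk_step:
  assumes G: "adapted n G"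
  shows "(\<integral>\<omega>. G (\<lambda>k. (X k \<omega>, V k \<omega>)) * f (walk_pos (n + j) \<omega>) \<partial>M) =
    (\<integral>\<omega>. G (\<lambda>k. (X k \<omega>, V k \<omega>)) * (zz_op H \<epsilon> ^^ j) f (walk_pos n \<omega>) \<partial>M)"
proof (induction j arbitrary: f)
  case (Suc j)
  have "(\<integral>\<omega>. G (\<lambda>k. (X k \<omega>, V k \<omega>)) * f (walk_pos (n + Suc j) \<omega>) \<partial>M) =
      (\<integral>\<omega>. G (\<lambda>k. (X k \<omega>, V k \<omega>)) * zz_op H \<epsilon> f (walk_pos (n + j) \<omega>) \<partial>M)"
  proof -
    have "(\<integral>\<omega>. G (\<lambda>k. (X k \<omega>, V k \<omega>)) * f (scale (X (Suc (n + j)) \<omega>, V (Suc (n + j)) \<omega>)) \<partial>M) =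
       (\<integral>\<omega>. G (\<lambda>k. (X k \<omega>, V k \<omega>)) * zz_op H \<epsilon> f (scale (X (n + j) \<omega>, V (n + j) \<omega>)) \<partial>M)"
      unfolding chain_step[OF adapted_mono[OF G le_add1] countable_states, where f="\<lambda>z. f (scale z)"]
    proof (rule Bochner_Integration.integral_cong[OF refl])
      fix \<omega> assume "\<omega> \<in> space M"
      then have "(X (n + j) \<omega>, V (n + j) \<omega>) \<in> UNIV \<times> signs" by (rule Z_in)
      from sum_succs[OF this] show "G (\<lambda>k. (X k \<omega>, V k \<omega>)) *
          (\<Sum>z\<in>succs (X (n + j) \<omega>, V (n + j) \<omega>). zz_transition (\<lambda>x. H (\<epsilon> *\<^sub>R real_vec x)) (X (n + j) \<omega>, V (n + j) \<omega>) z * f (scale z)) =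
          G (\<lambda>k. (X k \<omega>, V k \<omega>)) * zz_op H \<epsilon> f (scale (X (n + j) \<omega>, V (n + j) \<omega>))" by simp
    qed
    then show ?thesis by (simp add: walk_pos_def)
  qed
  also have "\<dots> = (\<integral>\<omega>. G (\<lambda>k. (X k \<omega>, V k \<omega>)) * (zz_op H \<epsilon> ^^ j) (zz_op H \<epsilon> f) (walk_pos n \<omega>) \<partial>M)"
    by (rule Suc.IH)
  finally show ?case by (simp add: funpow_swap1)
qed simp

text \<open>The almost sure event on which the sample path really moves by steps of the walk. Speed
  bounds can then be argued path by path.\<close>

definition regular :: "'a \<Rightarrow> bool" where
  "regular \<omega> \<longleftrightarrow> X 0 \<omega> = x0 \<and> V 0 \<omega> = v0 \<and> (\<forall>k. (X (Suc k) \<omega>, V (Suc k) \<omega>) \<in> succs (X k \<omega>, V k \<omega>))"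

lemma AE_regular: "AE \<omega> in M. regular \<omega>"
proof -
  have "AE \<omega> in M. (X (Suc k) \<omega>, V (Suc k) \<omega>) \<in> succs (X k \<omega>, V k \<omega>)" for k
    using AE_follow[of "Suc k"]
  proof (rule AE_mp, intro AE_I2 impI)
    fix \<omega> assume "\<exists>\<tau>\<in>trajs (Suc k). \<omega> \<in> follow (Suc k) \<tau>"
    then obtain \<tau> z where \<tau>: "\<tau> \<in> trajs k" "z \<in> succs (\<tau> k)" "\<omega> \<in> follow (Suc k) (\<tau>(Suc k := z))" by auto
    then have "(X k \<omega>, V k \<omega>) = \<tau> k" "(X (Suc k) \<omega>, V (Suc k) \<omega>) = z"
      unfolding follow_def by (auto dest!: spec[of _ k] spec[of _ "Suc k"])
    then show "(X (Suc k) \<omega>, V (Suc k) \<omega>) \<in> succs (X k \<omega>, V k \<omega>)" using \<tau>(2) by simp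
  qed
  then have "AE \<omega> in M. \<forall>k. (X (Suc k) \<omega>, V (Suc k) \<omega>) \<in> succs (X k \<omega>, V k \<omega>)"
    by (simp add: AE_all_countable)
  with init0 show ?thesis unfolding regular_def by eventually_elim auto
qed

lemma walk_increment:
  assumes "regular \<omega>" "\<omega> \<in> space M"
  shows "norm (fst (walk_pos (n + j) \<omega>) - fst (walk_pos n \<omega>)) \<le> real j * (\<epsilon> * real CARD('d))"
proof (induction j)
  case (Suc j)
  let ?u = "(\<chi> i. (V (n + j) \<omega> $ i + V (Suc (n + j)) \<omega> $ i) div 2)"
  have "(X (Suc (n + j)) \<omega>, V (Suc (n + j)) \<omega>) \<in> succs (X (n + j) \<omega>, V (n + j) \<omega>)"
    using assms(1) unfolding regular_def by blast
  then have "X (Suc (n + j)) \<omega> = X (n + j) \<omega> + ?u" unfolding succs_def by auto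
  then have eq: "fst (walk_pos (n + Suc j) \<omega>) - fst (walk_pos (n + j) \<omega>) = \<epsilon> *\<^sub>R real_vec ?u"
    by (simp add: walk_pos_def scale_def real_vec_add scaleR_add_right)
  have "\<bar>real_vec ?u $ i\<bar> \<le> 1" for i
    using signsD[OF V_signs[OF assms(2)], of "n + j" i] signsD[OF V_signs[OF assms(2)], of "Suc (n + j)" i]
    by (auto simp: real_vec_def)
  then have "(\<Sum>i\<in>UNIV. \<bar>real_vec ?u $ i\<bar>) \<le> (\<Sum>i\<in>(UNIV :: 'd set). 1)" by (intro sum_mono)
  then have "norm (real_vec ?u) \<le> real CARD('d)"
    using norm_le_l1_cart[of "real_vec ?u"] by simp
  then have "norm (fst (walk_pos (n + Suc j) \<omega>) - fst (walk_pos (n + j) \<omega>)) \<le> \<epsilon> * real CARD('d)"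
    unfolding eq using eps by (simp add: mult_left_mono)
  then have "norm ((fst (walk_pos (n + Suc j) \<omega>) - fst (walk_pos (n + j) \<omega>)) +
      (fst (walk_pos (n + j) \<omega>) - fst (walk_pos n \<omega>))) \<le> \<epsilon> * real CARD('d) + real j * (\<epsilon> * real CARD('d))"
    by (rule norm_triangle_le[OF add_mono[OF _ Suc.IH]])
  then show ?case by (simp add: algebra_simps)
qed simp

lemma walk_bound:
  assumes "regular \<omega>" "\<omega> \<in> space M"
  shows "norm (fst (walk_pos n \<omega>)) \<le> norm (\<epsilon> *\<^sub>R real_vec x0) + real n * (\<epsilon> * real CARD('d))"
proof -
  have "fst (walk_pos 0 \<omega>) = \<epsilon> *\<^sub>R real_vec x0"
    using assms(1) by (simp add: regular_def walk_pos_def scale_def)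
  then show ?thesis
    using walk_increment[OF assms, of 0 n] norm_triangle_sub[of "fst (walk_pos n \<omega>)" "\<epsilon> *\<^sub>R real_vec x0"] by simp
qed

definition flips :: "nat \<Rightarrow> 'a \<Rightarrow> bool" where
  "flips k \<omega> \<longleftrightarrow> V (Suc k) \<omega> \<noteq> V k \<omega>"

text \<open>The integrated form of a bound for the conditional flip probability given the past.
  Taking \<open>G = 1\<close> yields one flip, taking an earlier flip indicator yields two.\<close>

lemma flip_given_past:
  assumes G: "adapted k G" "\<And>\<tau>. 0 \<le> G \<tau>"
    and hb: "gradient_bound H (R + 2) K" and \<epsilon>1: "\<epsilon> \<le> 1"
    and R: "norm (\<epsilon> *\<^sub>R real_vec x0) + real k * (\<epsilon> * real CARD('d)) + real CARD('d) * \<epsilon> \<le> R + 1"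
  shows "(\<integral>\<omega>. G (\<lambda>k. (X k \<omega>, V k \<omega>)) * of_bool (flips k \<omega>) \<partial>M) \<le>
    (real CARD('d) * (K * \<epsilon>)) * (\<integral>\<omega>. G (\<lambda>k. (X k \<omega>, V k \<omega>)) \<partial>M)"
proof -
  let ?c = "real CARD('d) * (K * \<epsilon>)"
  let ?Z = "\<lambda>\<omega> k. (X k \<omega>, V k \<omega>)"
  \<comment> \<open>A flip compares the new velocity with the current one, whereas the operator acts
    on functions of the new state alone. Splitting by the current velocity v turns the flip into the
    event that the new velocity differs from the fixed v.\<close>
  define Gv where "Gv v \<tau> = G \<tau> * of_bool (snd (\<tau> k) = v)" for v \<tau>
  define fv :: "(int, 'd) vec \<Rightarrow> 'd phase \<Rightarrow> real" where "fv v z = of_bool (snd z \<noteq> real_vec v)" for v z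
  have Gv: "adapted k (Gv v)" for v using G(1) unfolding adapted_def Gv_def by (metis order_refl)
  have i1: "integrable M (\<lambda>\<omega>. Gv v (?Z \<omega>))" for v by (rule adapted_integrable[OF Gv countable_states])
  have fvZ: "fv v (walk_pos j \<omega>) = of_bool (V j \<omega> \<noteq> v)" for v j \<omega>
    by (simp add: fv_def walk_pos_def scale_def real_vec_inj)
  have i2: "integrable M (\<lambda>\<omega>. Gv v (?Z \<omega>) * fv v (walk_pos (k + 1) \<omega>))" for v
  proof -
    have "adapted (Suc k) (\<lambda>\<tau>. Gv v \<tau> * of_bool (snd (\<tau> (Suc k)) \<noteq> v))"
      using Gv[of v] unfolding adapted_def by (metis le_Suc_eq order_refl)
    from adapted_integrable[OF this countable_states] show ?thesis by (simp add: fvZ)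
  qed
  have one: "(\<integral>\<omega>. Gv v (?Z \<omega>) * fv v (walk_pos (k + 1) \<omega>) \<partial>M) \<le> ?c * (\<integral>\<omega>. Gv v (?Z \<omega>) \<partial>M)"
    if v: "v \<in> signs" for v
  proof -
    have "(\<integral>\<omega>. Gv v (?Z \<omega>) * fv v (walk_pos (k + 1) \<omega>) \<partial>M) = (\<integral>\<omega>. Gv v (?Z \<omega>) * zz_op H \<epsilon> (fv v) (walk_pos k \<omega>) \<partial>M)"
      using walk_step[OF Gv, where f="fv v" and j=1] by simp
    also have "\<dots> \<le> (\<integral>\<omega>. ?c * Gv v (?Z \<omega>) \<partial>M)"
    proof (rule integral_mono_AE)
      have "adapted k (\<lambda>\<tau>. Gv v \<tau> * zz_op H \<epsilon> (fv v) (scale (\<tau> k)))"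
        using Gv[of v] unfolding adapted_def by (metis order_refl)
      from adapted_integrable[OF this countable_states]
      show "integrable M (\<lambda>\<omega>. Gv v (?Z \<omega>) * zz_op H \<epsilon> (fv v) (walk_pos k \<omega>))" by (simp add: walk_pos_def)
      show "integrable M (\<lambda>\<omega>. ?c * Gv v (?Z \<omega>))" using i1 by simp
      show "AE \<omega> in M. Gv v (?Z \<omega>) * zz_op H \<epsilon> (fv v) (walk_pos k \<omega>) \<le> ?c * Gv v (?Z \<omega>)"
        using AE_regular
      proof (rule AE_mp, intro AE_I2 impI)
        fix \<omega> assume \<omega>: "\<omega> \<in> space M" "regular \<omega>"
        show "Gv v (?Z \<omega>) * zz_op H \<epsilon> (fv v) (walk_pos k \<omega>) \<le> ?c * Gv v (?Z \<omega>)"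
        proof (cases "V k \<omega> = v")
          case True
          have "norm (fst (walk_pos k \<omega>)) + real (length (sorted_list_of_set (UNIV :: 'd set))) * \<epsilon> \<le> R + 1"
            using walk_bound[OF \<omega>(2,1), of k] R by simp
          from foldr_zz_coord_op_stay(1)[OF C1 hb eps \<epsilon>1 _ _ _ this, of "real_vec v" "fv v"] v
          have "zz_op H \<epsilon> (fv v) (fst (walk_pos k \<omega>), real_vec v) \<le> ?c"
            by (simp add: zz_op_def real_vec_signs fv_def)
          moreover have "walk_pos k \<omega> = (fst (walk_pos k \<omega>), real_vec v)"
            using True by (simp add: walk_pos_def scale_def)
          ultimately have "zz_op H \<epsilon> (fv v) (walk_pos k \<omega>) \<le> ?c" by metis
          moreover have "0 \<le> Gv v (?Z \<omega>)" using G(2) by (simp add: Gv_def)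
          ultimately show ?thesis using mult_left_mono by (fastforce simp: mult.commute)
        next
          case False
          then show ?thesis by (simp add: Gv_def)
        qed
      qed
    qed
    finally show ?thesis by simp
  qed
  have e1: "(\<integral>\<omega>. G (?Z \<omega>) * of_bool (flips k \<omega>) \<partial>M) = (\<Sum>v\<in>signs. \<integral>\<omega>. Gv v (?Z \<omega>) * fv v (walk_pos (k + 1) \<omega>) \<partial>M)"
  proof -
    have "(\<integral>\<omega>. G (?Z \<omega>) * of_bool (flips k \<omega>) \<partial>M) = (\<integral>\<omega>. (\<Sum>v\<in>signs. Gv v (?Z \<omega>) * fv v (walk_pos (k + 1) \<omega>)) \<partial>M)"
    proof (rule Bochner_Integration.integral_cong[OF refl])
      fix \<omega> assume "\<omega> \<in> space M"
      then have "V k \<omega> \<in> signs" by (rule V_signs)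
      then have "(\<Sum>v\<in>signs. if v = V k \<omega> then c else 0) = c" for c :: real by (simp add: finite_signs)
      moreover have "(\<Sum>v\<in>signs. Gv v (?Z \<omega>) * fv v (walk_pos (k + 1) \<omega>)) =
          (\<Sum>v\<in>signs. if v = V k \<omega> then G (?Z \<omega>) * of_bool (flips k \<omega>) else 0)"
        by (intro sum.cong refl) (auto simp: Gv_def fvZ flips_def)
      ultimately show "G (?Z \<omega>) * of_bool (flips k \<omega>) = (\<Sum>v\<in>signs. Gv v (?Z \<omega>) * fv v (walk_pos (k + 1) \<omega>))"
        by (simp only:)
    qed
    also have "\<dots> = (\<Sum>v\<in>signs. \<integral>\<omega>. Gv v (?Z \<omega>) * fv v (walk_pos (k + 1) \<omega>) \<partial>M)"
      by (rule Bochner_Integration.integral_sum) (rule i2)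
    finally show ?thesis .
  qed
  have e2: "(\<integral>\<omega>. G (?Z \<omega>) \<partial>M) = (\<Sum>v\<in>signs. \<integral>\<omega>. Gv v (?Z \<omega>) \<partial>M)"
  proof -
    have "(\<integral>\<omega>. G (?Z \<omega>) \<partial>M) = (\<integral>\<omega>. (\<Sum>v\<in>signs. Gv v (?Z \<omega>)) \<partial>M)"
    proof (rule Bochner_Integration.integral_cong[OF refl])
      fix \<omega> assume "\<omega> \<in> space M"
      then have "V k \<omega> \<in> signs" by (rule V_signs)
      then have "(\<Sum>v\<in>signs. if v = V k \<omega> then c else 0) = c" for c :: real by (simp add: finite_signs)
      moreover have "(\<Sum>v\<in>signs. Gv v (?Z \<omega>)) = (\<Sum>v\<in>signs. if v = V k \<omega> then G (?Z \<omega>) else 0)"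
        by (intro sum.cong refl) (auto simp: Gv_def)
      ultimately show "G (?Z \<omega>) = (\<Sum>v\<in>signs. Gv v (?Z \<omega>))" by (simp only:)
    qed
    also have "\<dots> = (\<Sum>v\<in>signs. \<integral>\<omega>. Gv v (?Z \<omega>) \<partial>M)" by (rule Bochner_Integration.integral_sum) (rule i1)
    finally show ?thesis .
  qed
  show ?thesis unfolding e1 e2 sum_distrib_left by (intro sum_mono one)
qed

lemma flips_event: "{\<omega> \<in> space M. flips k \<omega>} \<in> events"
proof -
  have "adapted (Suc k) (\<lambda>\<tau>. of_bool (snd (\<tau> (Suc k)) \<noteq> snd (\<tau> k)))"
    unfolding adapted_def by simp
  from adapted_measurable[OF this countable_states]
  have "(\<lambda>\<omega>. of_bool (flips k \<omega>) :: real) \<in> borel_measurable M" by (simp add: flips_def)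
  then have "(\<lambda>\<omega>. of_bool (flips k \<omega>) :: real) -` {1} \<inter> space M \<in> events" by (rule measurable_sets) simp
  moreover have "(\<lambda>\<omega>. of_bool (flips k \<omega>) :: real) -` {1} \<inter> space M = {\<omega> \<in> space M. flips k \<omega>}" by auto
  ultimately show ?thesis by simp
qed

lemma of_bool_integral: "(\<integral>\<omega>. of_bool (Q \<omega>) \<partial>M) = prob {\<omega> \<in> space M. Q \<omega>}"
proof -
  have "(\<integral>\<omega>. of_bool (Q \<omega>) \<partial>M) = (\<integral>\<omega>. indicator {\<omega> \<in> space M. Q \<omega>} \<omega> \<partial>M)"
    by (rule Bochner_Integration.integral_cong) (auto simp: indicator_def)
  also have "\<dots> = prob ({\<omega> \<in> space M. Q \<omega>} \<inter> space M)" by (rule Bochner_Integration.integral_indicator)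
  also have "{\<omega> \<in> space M. Q \<omega>} \<inter> space M = {\<omega> \<in> space M. Q \<omega>}" by auto
  finally show ?thesis .
qed

lemma prob_flips:
  assumes hb: "gradient_bound H (R + 2) K" and \<epsilon>1: "\<epsilon> \<le> 1"
    and R: "norm (\<epsilon> *\<^sub>R real_vec x0) + real k * (\<epsilon> * real CARD('d)) + real CARD('d) * \<epsilon> \<le> R + 1"
  shows "prob {\<omega> \<in> space M. flips k \<omega>} \<le> real CARD('d) * (K * \<epsilon>)"
proof -
  have "adapted k (\<lambda>_. 1)" by (simp add: adapted_def)
  from flip_given_past[OF this _ hb \<epsilon>1 R]
  show ?thesis using of_bool_integral[of "flips k"] by (simp add: prob_space)
qed

text \<open>The earlier flip becomes visible at time \<open>Suc j\<close>, which is at most k, so it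
  belongs to the past of the later one and the two bounds multiply.\<close>

lemma prob_two_flips:
  assumes jk: "j < k" and hb: "gradient_bound H (R + 2) K" and \<epsilon>1: "\<epsilon> \<le> 1"
    and R: "norm (\<epsilon> *\<^sub>R real_vec x0) + real k * (\<epsilon> * real CARD('d)) + real CARD('d) * \<epsilon> \<le> R + 1"
  shows "prob {\<omega> \<in> space M. flips j \<omega> \<and> flips k \<omega>} \<le> (real CARD('d) * (K * \<epsilon>))\<^sup>2"
proof -
  let ?c = "real CARD('d) * (K * \<epsilon>)"
  have c: "0 \<le> ?c" using hboundD(1)[OF hb] eps by simp
  have "adapted k (\<lambda>\<tau>. of_bool (snd (\<tau> (Suc j)) \<noteq> snd (\<tau> j)))"
    unfolding adapted_def using jk by simp
  from flip_given_past[OF this _ hb \<epsilon>1 R]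
  have 1: "(\<integral>\<omega>. of_bool (flips j \<omega>) * of_bool (flips k \<omega>) \<partial>M) \<le> ?c * prob {\<omega> \<in> space M. flips j \<omega>}"
    using of_bool_integral[of "flips j"] by (simp add: flips_def)
  have "norm (\<epsilon> *\<^sub>R real_vec x0) + real j * (\<epsilon> * real CARD('d)) + real CARD('d) * \<epsilon> \<le> R + 1"
  proof -
    have "real j * (\<epsilon> * real CARD('d)) \<le> real k * (\<epsilon> * real CARD('d))" using jk eps by (intro mult_right_mono) auto
    then show ?thesis using R by linarith
  qed
  from mult_left_mono[OF prob_flips[OF hb \<epsilon>1 this] c]
  have "?c * prob {\<omega> \<in> space M. flips j \<omega>} \<le> ?c\<^sup>2" by (simp add: power2_eq_square)
  then show ?thesis using 1 of_bool_integral[of "\<lambda>\<omega>. flips j \<omega> \<and> flips k \<omega>"] by (simp add: of_bool_conj)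
qed

end


section \<open>Approximation of walk paths by step paths\<close>

context zz_walk
begin

definition walk_path :: "'a \<Rightarrow> real \<Rightarrow> 'd phase" where
  "walk_path \<omega> = (\<lambda>t\<in>{0..}. walk_pos (nat \<lfloor>t / \<epsilon>\<rfloor>) \<omega>)"

lemma index_bounds:
  assumes "0 \<le> t"
  shows "real (nat \<lfloor>t / \<epsilon>\<rfloor>) * \<epsilon> \<le> t" "t < (real (nat \<lfloor>t / \<epsilon>\<rfloor>) + 1) * \<epsilon>"
proof -
  have "0 \<le> t / \<epsilon>" using assms eps by simp
  then have "real (nat \<lfloor>t / \<epsilon>\<rfloor>) \<le> t / \<epsilon>" "t / \<epsilon> < real (nat \<lfloor>t / \<epsilon>\<rfloor>) + 1" by linarith+
  then show "real (nat \<lfloor>t / \<epsilon>\<rfloor>) * \<epsilon> \<le> t" "t < (real (nat \<lfloor>t / \<epsilon>\<rfloor>) + 1) * \<epsilon>"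
    using eps by (simp_all add: pos_le_divide_eq pos_divide_less_eq)
qed

text \<open>The deterministic part: if flips before T keep a distance 2/m from each other and from
  0, they can serve as the set A of \<open>sk_close_discretization\<close>. Between flips the
  velocity is constant and only the position oscillates, which is limited by the speed.\<close>

lemma walk_close:
  assumes \<delta>: "0 < \<delta>" and m: "0 < m" "1 / real m \<le> \<delta>" "3 * real CARD('d) / real m \<le> \<delta>" "\<epsilon> \<le> 1 / real m"
    and \<omega>: "regular \<omega>" "\<omega> \<in> space M"
    and T: "T = 1 / \<delta> + 1"
    and g1: "\<And>k. flips k \<omega> \<Longrightarrow> (real k + 1) * \<epsilon> \<le> T \<Longrightarrow> 2 / real m \<le> (real k + 1) * \<epsilon>"
    and g2: "\<And>j k. j < k \<Longrightarrow> flips j \<omega> \<Longrightarrow> flips k \<omega> \<Longrightarrow> (real k + 1) * \<epsilon> \<le> T \<Longrightarrow>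
      2 / real m \<le> (real k - real j) * \<epsilon>"
  shows "sk_close \<delta> (sk_step m (\<lambda>k. walk_path \<omega> (real k / real m))) (walk_path \<omega>)"
proof -
  define J where "J = {k. flips k \<omega> \<and> (real k + 1) * \<epsilon> \<le> T}"
  \<comment> \<open>Index k + 1 and not k: the velocity after the flip is first seen by the path at
    time \<open>(k + 1) * \<epsilon>\<close>.\<close>
  define A where "A = insert 0 ((\<lambda>k. (real k + 1) * \<epsilon>) ` J)"
  have "J \<subseteq> {..nat \<lfloor>T / \<epsilon>\<rfloor>}"
  proof
    fix k assume "k \<in> J"
    then have "real k * \<epsilon> \<le> T" using eps by (simp add: J_def algebra_simps)
    then have "real k \<le> T / \<epsilon>" using eps by (simp add: pos_le_divide_eq)
    then show "k \<in> {..nat \<lfloor>T / \<epsilon>\<rfloor>}" by (simp add: le_nat_floor)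
  qed
  then have fin: "finite J" by (rule finite_subset) simp
  have wlog: "norm (walk_path \<omega> s - walk_path \<omega> t) \<le> \<delta>"
    if st: "0 \<le> s" "s \<le> t" "t \<le> T" "t - s \<le> 2 / real m" "\<And>a. a \<in> A \<Longrightarrow> a \<le> s \<longleftrightarrow> a \<le> t" for s t
  proof -
    define a where "a = nat \<lfloor>s / \<epsilon>\<rfloor>"
    define b where "b = nat \<lfloor>t / \<epsilon>\<rfloor>"
    have t0: "0 \<le> t" using st by simp
    note a = index_bounds[OF st(1), folded a_def] and b = index_bounds[OF t0, folded b_def]
    have ab: "a \<le> b" unfolding a_def b_def using st(2) eps by (intro nat_mono floor_mono divide_right_mono) auto
    have no: "\<not> flips k \<omega>" if k: "a \<le> k" "k < b" for k
    proof
      assume f: "flips k \<omega>"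
      have "real k + 1 \<le> real b" using k(2) by linarith
      then have "(real k + 1) * \<epsilon> \<le> real b * \<epsilon>" using eps by (intro mult_right_mono) auto
      then have 1: "(real k + 1) * \<epsilon> \<le> t" using b(1) by linarith
      have "(real a + 1) * \<epsilon> \<le> (real k + 1) * \<epsilon>" using k(1) eps by (intro mult_right_mono) auto
      then have 2: "s < (real k + 1) * \<epsilon>" using a(2) by linarith
      have "k \<in> J" using f 1 st(3) by (simp add: J_def)
      then have "(real k + 1) * \<epsilon> \<in> A" unfolding A_def by blast
      then show False using st(5)[of "(real k + 1) * \<epsilon>"] 1 2 by simp
    qed
    have Vk: "V k \<omega> = V a \<omega>" if "a \<le> k" "k \<le> b" for k
      using that
    proof (induction k rule: dec_induct)
      case (step k)
      then have "V (Suc k) \<omega> = V k \<omega>" using no[of k] by (simp add: flips_def)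
      then show ?case using step by simp
    qed simp
    have V: "V b \<omega> = V a \<omega>" by (rule Vk[OF ab order_refl])
    have "a + (b - a) = b" using ab by simp
    then have 1: "norm (fst (walk_pos b \<omega>) - fst (walk_pos a \<omega>)) \<le> (real (b - a) * \<epsilon>) * real CARD('d)"
      using walk_increment[OF \<omega>, of a "b - a"] unfolding mult.assoc by (simp only:)
    \<comment> \<open>Rounding to multiples of \<epsilon> can add one step, so a time difference 2/m
      covers at most 2/m + \<epsilon> \<le> 3/m of walking; hence the condition on
      \<open>3 * real CARD('d) / real m\<close>.\<close>
    have "real (b - a) * \<epsilon> = real b * \<epsilon> - (real a + 1) * \<epsilon> + \<epsilon>"
      using ab by (simp add: of_nat_diff algebra_simps)
    also have "\<dots> \<le> t - s + \<epsilon>" using a(2) b(1) by linarith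
    also have "\<dots> \<le> 2 / real m + 1 / real m" using st(4) m(4) by (rule add_mono)
    finally have "real (b - a) * \<epsilon> \<le> 3 / real m" by (simp add: add_divide_distrib[symmetric])
    then have "(real (b - a) * \<epsilon>) * real CARD('d) \<le> 3 / real m * real CARD('d)" by (intro mult_right_mono) auto
    also have "\<dots> \<le> \<delta>" using m(3) by simp
    finally have 2: "norm (fst (walk_pos b \<omega>) - fst (walk_pos a \<omega>)) \<le> \<delta>" using 1 by linarith
    have "walk_path \<omega> s - walk_path \<omega> t = (fst (walk_pos a \<omega>) - fst (walk_pos b \<omega>), 0)"
      using st(1) t0 V by (simp add: walk_path_def walk_pos_def scale_def a_def b_def)
    then have "norm (walk_path \<omega> s - walk_path \<omega> t) = norm (fst (walk_pos a \<omega>) - fst (walk_pos b \<omega>))"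
      by (simp add: norm_Pair)
    then show ?thesis using 2 by (simp add: norm_minus_commute)
  qed
  show ?thesis
  proof (rule sk_close_discretization[where A=A])
    show "finite A" "0 \<in> A" using fin by (simp_all add: A_def)
    show "A \<subseteq> {0..}" using eps by (auto simp: A_def)
    show "0 < m" "1 / real m \<le> \<delta>" by (rule m)+
  next
    fix a b assume ab: "a \<in> A" "b \<in> A" "a < b"
    have "A \<subseteq> {0..}" using eps by (auto simp: A_def)
    then have "0 \<le> a" using ab(1) by auto
    then have "b \<noteq> 0" using ab(3) by simp
    then obtain k where k: "k \<in> J" "b = (real k + 1) * \<epsilon>" using ab(2) by (auto simp: A_def)
    show "2 / real m \<le> b - a"
    proof (cases "a = 0")
      case True
      then show ?thesis using g1[of k] k by (simp add: J_def)
    next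
      case False
      then obtain j where j: "j \<in> J" "a = (real j + 1) * \<epsilon>" using ab(1) by (auto simp: A_def)
      have "j < k" using ab(3) eps unfolding k(2) j(2) by (simp add: mult_less_cancel_right)
      then have "2 / real m \<le> (real k - real j) * \<epsilon>" using g2[of j k] j(1) k(1) by (simp add: J_def)
      then show ?thesis unfolding k(2) j(2) by (simp add: algebra_simps)
    qed
  next
    fix s t assume st: "0 \<le> s" "0 \<le> t" "s \<le> 1 / \<delta> + 1" "t \<le> 1 / \<delta> + 1" "\<bar>s - t\<bar> \<le> 2 / real m"
      "\<And>a. a \<in> A \<Longrightarrow> a \<le> s \<longleftrightarrow> a \<le> t"
    show "norm (walk_path \<omega> s - walk_path \<omega> t) \<le> \<delta>"
    proof (cases "s \<le> t")
      case True
      show ?thesis by (rule wlog[OF st(1) True]) (use st(4,5) T in simp, use st(5) in linarith, rule st(6))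
    next
      case False
      then have ts: "t \<le> s" by simp
      have "norm (walk_path \<omega> t - walk_path \<omega> s) \<le> \<delta>"
        by (rule wlog[OF st(2) ts]) (use st(3,5) T in simp, use st(5) in linarith, rule st(6)[symmetric])
      then show ?thesis by (simp add: norm_minus_commute)
    qed
  qed
qed

text \<open>A union bound. At most r / \<epsilon> indices are too close to 0, each of probability c
  \<epsilon> with c = CARD('d) K, and at most (T / \<epsilon> + 1)(r / \<epsilon>) pairs are too
  close to each other, each of probability (c \<epsilon>)^2. All powers of \<epsilon> cancel, and
  the bound is linear in r.\<close>

lemma prob_close_flips:
  assumes T: "0 \<le> T" and r: "0 \<le> r" and \<epsilon>1: "\<epsilon> \<le> 1" and R0: "norm (\<epsilon> *\<^sub>R real_vec x0) \<le> R0"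
    and hb: "gradient_bound H (R0 + real CARD('d) * T + 2) K"
  obtains B where "B \<in> events" "prob B \<le> r * (real CARD('d) * K + (T + 1) * (real CARD('d) * K)\<^sup>2)"
    "\<And>\<omega> k. \<omega> \<in> space M - B \<Longrightarrow> flips k \<omega> \<Longrightarrow> (real k + 1) * \<epsilon> \<le> T \<Longrightarrow> r \<le> (real k + 1) * \<epsilon>"
    "\<And>\<omega> j k. \<omega> \<in> space M - B \<Longrightarrow> j < k \<Longrightarrow> flips j \<omega> \<Longrightarrow> flips k \<omega> \<Longrightarrow> (real k + 1) * \<epsilon> \<le> T \<Longrightarrow>
      r \<le> (real k - real j) * \<epsilon>"
proof -
  let ?N = "real CARD('d)"
  define c where "c = ?N * K"
  have c: "0 \<le> c" using hboundD(1)[OF hb] by (simp add: c_def)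
  define a where "a = nat \<lfloor>T / \<epsilon>\<rfloor>"
  define b where "b = nat \<lfloor>r / \<epsilon>\<rfloor>"
  have a: "real a * \<epsilon> \<le> T" unfolding a_def by (rule index_bounds(1)[OF T])
  have b: "real b * \<epsilon> \<le> r" unfolding b_def by (rule index_bounds(1)[OF r])
  have ka: "k \<le> a" if "(real k + 1) * \<epsilon> \<le> T" for k
  proof -
    have "real k * \<epsilon> \<le> T" using that eps by (simp add: algebra_simps)
    then have "real k \<le> T / \<epsilon>" using eps by (simp add: pos_le_divide_eq)
    then show ?thesis unfolding a_def by (rule le_nat_floor)
  qed
  have kb: "k \<le> b" if "real k * \<epsilon> < r" for k
  proof -
    have "real k \<le> r / \<epsilon>" using that eps by (simp add: pos_le_divide_eq)
    then show ?thesis unfolding b_def by (rule le_nat_floor)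
  qed
  have pos: "norm (\<epsilon> *\<^sub>R real_vec x0) + real k * (\<epsilon> * ?N) + ?N * \<epsilon> \<le> (R0 + ?N * T) + 1"
    if "(real k + 1) * \<epsilon> \<le> T" for k
  proof -
    have "?N * ((real k + 1) * \<epsilon>) \<le> ?N * T" using that by (intro mult_left_mono) auto
    then show ?thesis using R0 by (simp add: algebra_simps)
  qed
  define I1 where "I1 = {k. (real k + 1) * \<epsilon> \<le> T \<and> (real k + 1) * \<epsilon> < r}"
  define I2 where "I2 = {(j, k). j < k \<and> (real k + 1) * \<epsilon> \<le> T \<and> (real k - real j) * \<epsilon> < r}"
  have "I1 \<subseteq> {..<b}"
  proof
    fix k assume "k \<in> I1"
    then have "real (Suc k) * \<epsilon> < r" by (simp add: I1_def algebra_simps)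
    then show "k \<in> {..<b}" using kb[of "Suc k"] by simp
  qed
  then have I1: "finite I1" "card I1 \<le> b" using finite_subset card_mono[of "{..<b}" I1] by auto
  \<comment> \<open>A close pair is encoded by its later index and the gap between the two, which
    makes its cardinality a product.\<close>
  have "I2 \<subseteq> (\<lambda>(k, i). (k - i, k)) ` ({..a} \<times> {1..b})"
  proof
    fix p assume "p \<in> I2"
    then obtain j k where p: "p = (j, k)" "j < k" "(real k + 1) * \<epsilon> \<le> T" "(real k - real j) * \<epsilon> < r"
      by (auto simp: I2_def)
    have "real (k - j) * \<epsilon> < r" using p by (simp add: of_nat_diff)
    then have "k - j \<in> {1..b}" using kb[of "k - j"] p(2) by simp
    moreover have "k \<in> {..a}" using ka[OF p(3)] by simp
    moreover have "p = (k - (k - j), k)" using p by simp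
    ultimately show "p \<in> (\<lambda>(k, i). (k - i, k)) ` ({..a} \<times> {1..b})" by (intro image_eqI[of _ _ "(k, k - j)"]) auto
  qed
  note sub = this
  have I2: "finite I2" by (rule finite_subset[OF sub]) simp
  have "card I2 \<le> card ({..a} \<times> {1..b})"
    by (rule order_trans[OF card_mono[OF _ sub] card_image_le]) simp_all
  then have I2c: "card I2 \<le> (a + 1) * b" by simp
  define F where "F k = {\<omega> \<in> space M. flips k \<omega>}" for k
  define F2 where "F2 p = {\<omega> \<in> space M. flips (fst p) \<omega> \<and> flips (snd p) \<omega>}" for p
  have F: "F k \<in> events" for k unfolding F_def by (rule flips_event)
  have F2: "F2 p \<in> events" for p
  proof -
    have "F2 p = F (fst p) \<inter> F (snd p)" by (auto simp: F_def F2_def)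
    then show ?thesis using F by simp
  qed
  define B where "B = (\<Union>k\<in>I1. F k) \<union> (\<Union>p\<in>I2. F2 p)"
  have e1: "(\<Union>k\<in>I1. F k) \<in> events" and e2: "(\<Union>p\<in>I2. F2 p) \<in> events"
    using F F2 I1 I2 by (intro sets.finite_UN; simp)+
  have p1: "prob (\<Union>k\<in>I1. F k) \<le> r * c"
  proof -
    have "prob (\<Union>k\<in>I1. F k) \<le> (\<Sum>k\<in>I1. prob (F k))"
      using F by (intro finite_measure_subadditive_finite I1) auto
    also have "\<dots> \<le> (\<Sum>k\<in>I1. c * \<epsilon>)"
    proof (rule sum_mono)
      fix k assume "k \<in> I1"
      then have "(real k + 1) * \<epsilon> \<le> T" by (simp add: I1_def)
      from prob_flips[OF hb \<epsilon>1 pos[OF this]] show "prob (F k) \<le> c * \<epsilon>" by (simp add: F_def c_def mult.assoc)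
    qed
    also have "\<dots> = c * (real (card I1) * \<epsilon>)" by simp
    also have "\<dots> \<le> c * (real b * \<epsilon>)" using I1 c eps by (intro mult_left_mono mult_right_mono) auto
    also have "\<dots> \<le> c * r" using b c by (intro mult_left_mono)
    finally show ?thesis by (simp add: mult.commute)
  qed
  have p2: "prob (\<Union>p\<in>I2. F2 p) \<le> r * ((T + 1) * c\<^sup>2)"
  proof -
    have "prob (\<Union>p\<in>I2. F2 p) \<le> (\<Sum>p\<in>I2. prob (F2 p))"
      using F2 by (intro finite_measure_subadditive_finite I2) auto
    also have "\<dots> \<le> (\<Sum>p\<in>I2. (c * \<epsilon>)\<^sup>2)"
    proof (rule sum_mono)
      fix p assume "p \<in> I2"
      then obtain j k where p: "p = (j, k)" "j < k" "(real k + 1) * \<epsilon> \<le> T" by (auto simp: I2_def)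
      from prob_two_flips[OF p(2) hb \<epsilon>1 pos[OF p(3)]] show "prob (F2 p) \<le> (c * \<epsilon>)\<^sup>2"
        by (simp add: F2_def p(1) c_def mult.assoc)
    qed
    also have "\<dots> = real (card I2) * (c * \<epsilon>)\<^sup>2" by simp
    also have "\<dots> \<le> real ((a + 1) * b) * (c * \<epsilon>)\<^sup>2"
      using I2c by (intro mult_right_mono) (simp_all only: of_nat_le_iff, simp)
    also have "\<dots> = (real a * \<epsilon> + \<epsilon>) * (real b * \<epsilon>) * c\<^sup>2"
      by (simp add: power2_eq_square algebra_simps)
    also have "\<dots> \<le> (T + 1) * r * c\<^sup>2"
      using a b \<epsilon>1 eps T by (intro mult_right_mono mult_mono add_mono) auto
    finally show ?thesis by (simp add: mult_ac)
  qed
  show ?thesis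
  proof (rule that[of B])
    show "B \<in> events" unfolding B_def using e1 e2 by auto
    have "prob B \<le> prob (\<Union>k\<in>I1. F k) + prob (\<Union>p\<in>I2. F2 p)"
      unfolding B_def by (rule measure_Un_le[OF e1 e2])
    also have "\<dots> \<le> r * c + r * ((T + 1) * c\<^sup>2)" by (rule add_mono[OF p1 p2])
    finally show "prob B \<le> r * (?N * K + (T + 1) * (?N * K)\<^sup>2)"
      unfolding c_def by (simp add: distrib_left)
  next
    fix \<omega> k assume A: "\<omega> \<in> space M - B" "flips k \<omega>" "(real k + 1) * \<epsilon> \<le> T"
    show "r \<le> (real k + 1) * \<epsilon>"
    proof (rule ccontr)
      assume "\<not> r \<le> (real k + 1) * \<epsilon>"
      then have "k \<in> I1" using A(3) by (simp add: I1_def)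
      moreover have "\<omega> \<in> F k" using A by (simp add: F_def)
      ultimately have "\<omega> \<in> B" unfolding B_def by blast
      then show False using A by blast
    qed
  next
    fix \<omega> j k assume A: "\<omega> \<in> space M - B" "j < k" "flips j \<omega>" "flips k \<omega>" "(real k + 1) * \<epsilon> \<le> T"
    show "r \<le> (real k - real j) * \<epsilon>"
    proof (rule ccontr)
      assume "\<not> r \<le> (real k - real j) * \<epsilon>"
      then have "(j, k) \<in> I2" using A(2,5) by (simp add: I2_def)
      moreover have "\<omega> \<in> F2 (j, k)" using A by (simp add: F2_def)
      ultimately have "\<omega> \<in> B" unfolding B_def by blast
      then show False using A by blast
    qed
  qed
qed

lemma walk_discretization:
  assumes \<delta>: "0 < \<delta>" and m: "0 < m" "1 / real m \<le> \<delta>" "3 * real CARD('d) / real m \<le> \<delta>" "\<epsilon> \<le> 1 / real m"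
    and R0: "norm (\<epsilon> *\<^sub>R real_vec x0) \<le> R0" and hb: "gradient_bound H (R0 + real CARD('d) * (1 / \<delta> + 1) + 2) K"
  obtains B where "B \<in> events"
    "prob B \<le> 2 / real m * (real CARD('d) * K + (1 / \<delta> + 1 + 1) * (real CARD('d) * K)\<^sup>2)"
    "\<And>\<omega>. \<omega> \<in> space M - B \<Longrightarrow> regular \<omega> \<Longrightarrow>
      sk_dist (sk_step m (\<lambda>k. walk_path \<omega> (real k / real m))) (walk_path \<omega>) \<le> \<delta>"
proof -
  have "1 / real m \<le> 1" using m(1) by simp
  then have \<epsilon>1: "\<epsilon> \<le> 1" using m(4) by simp
  have T: "0 \<le> 1 / \<delta> + 1" using \<delta> by simp
  have r: "0 \<le> 2 / real m" by simp
  obtain B where B: "B \<in> events"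
    "prob B \<le> 2 / real m * (real CARD('d) * K + (1 / \<delta> + 1 + 1) * (real CARD('d) * K)\<^sup>2)"
    "\<And>\<omega> k. \<omega> \<in> space M - B \<Longrightarrow> flips k \<omega> \<Longrightarrow> (real k + 1) * \<epsilon> \<le> 1 / \<delta> + 1 \<Longrightarrow> 2 / real m \<le> (real k + 1) * \<epsilon>"
    "\<And>\<omega> j k. \<omega> \<in> space M - B \<Longrightarrow> j < k \<Longrightarrow> flips j \<omega> \<Longrightarrow> flips k \<omega> \<Longrightarrow> (real k + 1) * \<epsilon> \<le> 1 / \<delta> + 1 \<Longrightarrow>
      2 / real m \<le> (real k - real j) * \<epsilon>"
    by (rule prob_close_flips[OF T r \<epsilon>1 R0 hb]) (rule that; assumption)
  show ?thesis
  proof (rule that[OF B(1,2)])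
    fix \<omega> assume \<omega>: "\<omega> \<in> space M - B" "regular \<omega>"
    then have s: "\<omega> \<in> space M" by simp
    show "sk_dist (sk_step m (\<lambda>k. walk_path \<omega> (real k / real m))) (walk_path \<omega>) \<le> \<delta>"
      by (rule sk_dist_le[OF \<delta> walk_close[OF \<delta> m \<omega>(2) s refl B(3)[OF \<omega>(1)] B(4)[OF \<omega>(1)]]])
  qed
qed

lemma walk_path_in_space: "walk_path \<omega> \<in> skorohod_space"
  using skorohod_space_floor[of "inverse \<epsilon>" "\<lambda>k. walk_pos k \<omega>"] eps
  by (simp add: walk_path_def divide_inverse mult.commute)

end


section \<open>Finite-dimensional distributions\<close>

text \<open>Constants are added to the Lipschitz functions of bounded support because the class must
  contain 1 and be closed under products and under both families of operators. Both families commute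
  with subtracting a constant, so their estimates carry over.\<close>

definition test_fun :: "('d::finite phase \<Rightarrow> real) \<Rightarrow> bool" where
  "test_fun f \<longleftrightarrow> (\<exists>c R C L. 0 \<le> R \<and> lip_supp R C L (\<lambda>z. f z - c))"

lemma test_fun_const: "test_fun (\<lambda>_. c)"
  unfolding test_fun_def
  by (intro exI[of _ c] exI[of _ 0] conjI order_refl) (auto intro: lipcI)

lemma lip_supp_cmult:
  fixes f :: "'d::finite phase \<Rightarrow> real"
  assumes "lip_supp R C L f"
  shows "lip_supp R (\<bar>c\<bar> * C) (\<bar>c\<bar> * L) (\<lambda>z. c * f z)"
proof (rule lipcI)
  fix v :: "real ^ 'd" and x y assume v: "v \<in> signs"
  show "\<bar>c * f (x, v)\<bar> \<le> \<bar>c\<bar> * C" unfolding abs_mult using lipcD(1)[OF assms v] by (intro mult_left_mono) auto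
  have "\<bar>c\<bar> * \<bar>f (x, v) - f (y, v)\<bar> \<le> \<bar>c\<bar> * (L * norm (x - y))"
    using lipcD(2)[OF assms v] by (intro mult_left_mono) auto
  then show "\<bar>c * f (x, v) - c * f (y, v)\<bar> \<le> \<bar>c\<bar> * L * norm (x - y)"
    by (simp add: abs_mult[symmetric] right_diff_distrib mult.assoc)
  show "c * f (x, v) = 0" if "R \<le> norm x" using lipcD(3)[OF assms v that] by simp
qed

lemma lip_supp_mult:
  fixes f :: "'d::finite phase \<Rightarrow> real"
  assumes f: "lip_supp R C L f" and g: "lip_supp R' C' L' g"
  shows "lip_supp R (C * C') (C * L' + L * C') (\<lambda>z. f z * g z)"
proof (rule lipcI)
  fix v :: "real ^ 'd" and x y assume v: "v \<in> signs"
  note nn = lip_supp_nonneg[OF f] lip_supp_nonneg[OF g]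
  show "\<bar>f (x, v) * g (x, v)\<bar> \<le> C * C'"
    unfolding abs_mult using lipcD(1)[OF f v] lipcD(1)[OF g v] nn by (intro mult_mono) auto
  have 1: "\<bar>f (x, v) * (g (x, v) - g (y, v))\<bar> \<le> C * (L' * norm (x - y))"
    unfolding abs_mult using lipcD(1)[OF f v] lipcD(2)[OF g v] nn by (intro mult_mono) auto
  have 2: "\<bar>(f (x, v) - f (y, v)) * g (y, v)\<bar> \<le> (L * norm (x - y)) * C'"
    unfolding abs_mult using lipcD(2)[OF f v] lipcD(1)[OF g v] nn by (intro mult_mono) auto
  have eq: "f (x, v) * g (x, v) - f (y, v) * g (y, v) =
      f (x, v) * (g (x, v) - g (y, v)) + (f (x, v) - f (y, v)) * g (y, v)" by algebra
  have "\<bar>f (x, v) * g (x, v) - f (y, v) * g (y, v)\<bar> \<le> C * (L' * norm (x - y)) + (L * norm (x - y)) * C'"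
    unfolding eq by (rule order_trans[OF abs_triangle_ineq add_mono[OF 1 2]])
  then show "\<bar>f (x, v) * g (x, v) - f (y, v) * g (y, v)\<bar> \<le> (C * L' + L * C') * norm (x - y)"
    by (simp add: algebra_simps)
  show "f (x, v) * g (x, v) = 0" if "R \<le> norm x" using lipcD(3)[OF f v that] by simp
qed

text \<open>Writing f = c + f0 and g = c' + g0, the product is c c' plus terms each containing a
  factor of bounded support; the larger of the two radii serves for all of them.\<close>

lemma test_fun_mult:
  fixes f g :: "'d::finite phase \<Rightarrow> real"
  assumes "test_fun f" "test_fun g"
  shows "test_fun (\<lambda>z. f z * g z)"
proof -
  obtain c R C L where f: "0 \<le> R" "lip_supp R C L (\<lambda>z. f z - c)" using assms(1) unfolding test_fun_def by blast
  obtain c' R' C' L' where g: "0 \<le> R'" "lip_supp R' C' L' (\<lambda>z. g z - c')" using assms(2) unfolding test_fun_def by blast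
  have f': "lip_supp (max R R') C L (\<lambda>z. f z - c)" by (rule lip_supp_mono[OF f(2)]) auto
  have g': "lip_supp (max R R') C' L' (\<lambda>z. g z - c')" by (rule lip_supp_mono[OF g(2)]) auto
  have "lip_supp (max R R') (C * C' + (\<bar>c\<bar> * C' + \<bar>c'\<bar> * C)) (C * L' + L * C' + (\<bar>c\<bar> * L' + \<bar>c'\<bar> * L))
      (\<lambda>z. (f z - c) * (g z - c') + (c * (g z - c') + c' * (f z - c)))"
    by (intro lip_supp_add lip_supp_mult[OF f' g'] lip_supp_cmult f' g')
  moreover have "(\<lambda>z. (f z - c) * (g z - c') + (c * (g z - c') + c' * (f z - c))) = (\<lambda>z. f z * g z - c * c')"
    by (rule ext) algebra
  ultimately have "lip_supp (max R R') (C * C' + (\<bar>c\<bar> * C' + \<bar>c'\<bar> * C)) (C * L' + L * C' + (\<bar>c\<bar> * L' + \<bar>c'\<bar> * L))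
      (\<lambda>z. f z * g z - c * c')" by (simp only:)
  moreover have "0 \<le> max R R'" using f(1) by simp
  ultimately show ?thesis unfolding test_fun_def by blast
qed

lemma test_fun_bounded:
  fixes f :: "'d::finite phase \<Rightarrow> real"
  assumes "test_fun f"
  obtains C L where "0 \<le> C" "\<And>z. z \<in> UNIV \<times> signs \<Longrightarrow> \<bar>f z\<bar> \<le> C"
    "\<And>x y v. v \<in> signs \<Longrightarrow> \<bar>f (x, v) - f (y, v)\<bar> \<le> L * norm (x - y)"
proof -
  obtain c R C L where f: "lip_supp R C L (\<lambda>z. f z - c)" using assms unfolding test_fun_def by blast
  show ?thesis
  proof (rule that[of "\<bar>c\<bar> + C" L])
    show "0 \<le> \<bar>c\<bar> + C" using lip_supp_nonneg(1)[OF f] by simp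
    fix z :: "'d phase" assume "z \<in> UNIV \<times> signs"
    then have "\<bar>f (fst z, snd z) - c\<bar> \<le> C" by (intro lipcD(1)[OF f]) auto
    then show "\<bar>f z\<bar> \<le> \<bar>c\<bar> + C" by (simp add: abs_le_iff) linarith
  next
    fix x y v :: "real ^ 'd" assume "v \<in> signs"
    from lipcD(2)[OF f this, of x y] show "\<bar>f (x, v) - f (y, v)\<bar> \<le> L * norm (x - y)" by simp
  qed
qed

lemma test_fun_bounded_borel:
  fixes f :: "'d::finite phase \<Rightarrow> real"
  assumes "test_fun f"
  shows "bounded_borel f"
proof -
  obtain c R C L where f: "lip_supp R C L (\<lambda>z. f z - c)" using assms unfolding test_fun_def by blast
  have "bounded_borel (\<lambda>z. (f z - c) + c)" by (intro bounded_borel_add bounded_borel_const cont_supp_bounded_borel[OF lip_supp_imp_cont_supp[OF f]])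
  then show ?thesis by simp
qed

text \<open>Expectation of \<open>\<Prod>j\<le>n. h (k + j) (Z (k + j))\<close> given \<open>Z k\<close>, for a Markov chain \<open>Z\<close> with
  transition operators \<open>K\<close>.\<close>

primrec grid_moment :: "(nat \<Rightarrow> ('z \<Rightarrow> real) \<Rightarrow> 'z \<Rightarrow> real) \<Rightarrow> (nat \<Rightarrow> 'z \<Rightarrow> real) \<Rightarrow> nat \<Rightarrow> nat \<Rightarrow> 'z \<Rightarrow> real" where
  "grid_moment K h 0 k = h k"
| "grid_moment K h (Suc n) k = (\<lambda>z. h k z * K k (grid_moment K h n (Suc k)) z)"

text \<open>The recursion opens the first time, whereas the Markov property integrates out the last
  one. Here the last factor is absorbed into the one before it.\<close>

lemma grid_moment_top:
  "grid_moment K h (Suc n) k = grid_moment K (h(k + n := \<lambda>z. h (k + n) z * K (k + n) (h (Suc (k + n))) z)) n k"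
proof (induction n arbitrary: k)
  case (Suc n)
  let ?h = "\<lambda>k n. h(k + n := \<lambda>z. h (k + n) z * K (k + n) (h (Suc (k + n))) z)"
  have "grid_moment K h (Suc (Suc n)) k = (\<lambda>z. h k z * K k (grid_moment K h (Suc n) (Suc k)) z)" by simp
  also have "\<dots> = (\<lambda>z. h k z * K k (grid_moment K (?h (Suc k) n) n (Suc k)) z)" unfolding Suc.IH ..
  also have "\<dots> = grid_moment K (?h k (Suc n)) (Suc n) k" by simp
  finally show ?case .
qed simp

lemma grid_moment_test_fun:
  assumes "\<And>j f. test_fun f \<Longrightarrow> test_fun (K j f)" "\<And>j. test_fun (h j)"
  shows "test_fun (grid_moment K h n k)"
  by (induction n arbitrary: k) (simp_all add: assms test_fun_mult)

text \<open>Stated for an abstract family of random variables, so that it serves both the walk and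
  the limit process; the hypothesis \<open>step\<close> is their Markov property. The last factor is
  integrated out until only the law at time 0 is left.\<close>

lemma expectation_grid_moment:
  assumes K: "\<And>j f. test_fun f \<Longrightarrow> test_fun (K j f)"
    and step: "\<And>n h f. (\<And>j. test_fun (h j)) \<Longrightarrow> test_fun f \<Longrightarrow>
      (\<integral>\<omega>. (\<Prod>j\<le>n. h j (\<zeta> j \<omega>)) * f (\<zeta> (Suc n) \<omega>) \<partial>M) = (\<integral>\<omega>. (\<Prod>j\<le>n. h j (\<zeta> j \<omega>)) * K n f (\<zeta> n \<omega>) \<partial>M)"
    and h: "\<And>j. test_fun (h j)"
  shows "(\<integral>\<omega>. (\<Prod>j\<le>n. h j (\<zeta> j \<omega>)) \<partial>M) = (\<integral>\<omega>. grid_moment K h n 0 (\<zeta> 0 \<omega>) \<partial>M)"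
  using h
proof (induction n arbitrary: h)
  case 0
  then show ?case by simp
next
  case (Suc n)
  let ?h = "h(n := \<lambda>z. h n z * K n (h (Suc n)) z)"
  have h': "test_fun (?h j)" for j using Suc.prems by (auto intro: test_fun_mult K)
  have "(\<Prod>j\<le>n. ?h j (\<zeta> j \<omega>)) = (\<Prod>j\<le>n. h j (\<zeta> j \<omega>)) * K n (h (Suc n)) (\<zeta> n \<omega>)" for \<omega>
  proof -
    have "(\<Prod>j\<le>n. ?h j (\<zeta> j \<omega>)) = (\<Prod>j<n. ?h j (\<zeta> j \<omega>)) * ?h n (\<zeta> n \<omega>)"
      by (simp add: lessThan_Suc_atMost[symmetric])
    also have "(\<Prod>j<n. ?h j (\<zeta> j \<omega>)) = (\<Prod>j<n. h j (\<zeta> j \<omega>))" by (intro prod.cong) auto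
    finally show ?thesis by (simp add: lessThan_Suc_atMost[symmetric] mult.assoc)
  qed
  then have "(\<integral>\<omega>. (\<Prod>j\<le>Suc n. h j (\<zeta> j \<omega>)) \<partial>M) = (\<integral>\<omega>. (\<Prod>j\<le>n. ?h j (\<zeta> j \<omega>)) \<partial>M)"
    using step[where n=n and h=h and f="h (Suc n)", OF Suc.prems Suc.prems] by simp
  also have "\<dots> = (\<integral>\<omega>. grid_moment K ?h n 0 (\<zeta> 0 \<omega>) \<partial>M)" by (rule Suc.IH[OF h'])
  also have "grid_moment K ?h n 0 = grid_moment K h (Suc n) 0" using grid_moment_top[of K h n 0] by simp
  finally show ?case .
qed

lemma zz_coord_op_contraction:
  fixes f g :: "'d::finite phase \<Rightarrow> real"
  assumes "\<And>z. z \<in> UNIV \<times> signs \<Longrightarrow> \<bar>f z - g z\<bar> \<le> b" "z \<in> UNIV \<times> signs"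
  shows "\<bar>zz_coord_op H \<epsilon> i f z - zz_coord_op H \<epsilon> i g z\<bar> \<le> b"
proof -
  let ?q = "exp (- max (H (fst z + axis i (\<epsilon> * snd z $ i)) - H (fst z)) 0)"
  let ?d1 = "f (fst z + axis i (\<epsilon> * snd z $ i), snd z) - g (fst z + axis i (\<epsilon> * snd z $ i), snd z)"
  let ?d2 = "f (fst z, flip i (snd z)) - g (fst z, flip i (snd z))"
  have s: "snd z \<in> signs" using assms(2) by auto
  have q: "0 \<le> ?q" "0 \<le> 1 - ?q" by simp_all
  have 1: "\<bar>?q * ?d1\<bar> \<le> ?q * b" unfolding abs_mult abs_of_nonneg[OF q(1)]
    using s by (intro mult_left_mono q assms(1)) auto
  have 2: "\<bar>(1 - ?q) * ?d2\<bar> \<le> (1 - ?q) * b" unfolding abs_mult abs_of_nonneg[OF q(2)]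
    using s flip_signs[OF s] by (intro mult_left_mono q assms(1)) auto
  have "zz_coord_op H \<epsilon> i f z - zz_coord_op H \<epsilon> i g z = ?q * ?d1 + (1 - ?q) * ?d2"
    by (simp add: zz_coord_op_def[of H \<epsilon> i f z] zz_coord_op_def[of H \<epsilon> i g z] Let_def algebra_simps)
  moreover have "\<bar>?q * ?d1 + (1 - ?q) * ?d2\<bar> \<le> ?q * b + (1 - ?q) * b"
    by (rule order_trans[OF abs_triangle_ineq add_mono[OF 1 2]])
  moreover have "?q * b + (1 - ?q) * b = b" by (simp add: algebra_simps)
  ultimately show ?thesis by simp
qed

lemma zz_op_funpow_contraction:
  assumes fg: "\<And>z. z \<in> UNIV \<times> signs \<Longrightarrow> \<bar>f z - g z\<bar> \<le> b" and z: "z \<in> UNIV \<times> signs"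
  shows "\<bar>(zz_op H \<epsilon> ^^ n) f z - (zz_op H \<epsilon> ^^ n) g z\<bar> \<le> b"
proof -
  have T: "\<bar>zz_op H \<epsilon> f z - zz_op H \<epsilon> g z\<bar> \<le> b"
    if fg: "\<And>z. z \<in> UNIV \<times> signs \<Longrightarrow> \<bar>f z - g z\<bar> \<le> b" and z: "z \<in> UNIV \<times> signs" for f g z
  proof -
    have "\<bar>foldr (zz_coord_op H \<epsilon>) l f z - foldr (zz_coord_op H \<epsilon>) l g z\<bar> \<le> b" if "z \<in> UNIV \<times> signs" for l z
      using that by (induction l arbitrary: z) (simp_all only: foldr.simps id_apply o_apply fg zz_coord_op_contraction)
    then show ?thesis unfolding zz_op_def using z by blast
  qed
  show ?thesis using z by (induction n arbitrary: z) (simp_all only: funpow.simps id_apply o_apply fg T)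
qed

lemma zz_op_funpow_diff_const: "(zz_op H \<epsilon> ^^ n) (\<lambda>z. f z - c) = (\<lambda>z. (zz_op H \<epsilon> ^^ n) f z - c)"
proof -
  have A: "zz_coord_op H \<epsilon> i (\<lambda>z. f z - c) = (\<lambda>z. zz_coord_op H \<epsilon> i f z - c)" for i and f :: "'a phase \<Rightarrow> real"
    by (rule ext) (simp add: zz_coord_op_def Let_def algebra_simps)
  have "foldr (zz_coord_op H \<epsilon>) l (\<lambda>z. f z - c) = (\<lambda>z. foldr (zz_coord_op H \<epsilon>) l f z - c)" for l and f :: "'a phase \<Rightarrow> real"
    by (induction l) (simp_all add: A)
  then have T: "zz_op H \<epsilon> (\<lambda>z. f z - c) = (\<lambda>z. zz_op H \<epsilon> f z - c)" for f by (simp add: zz_op_def)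
  show ?thesis by (induction n) (simp_all add: T)
qed

context zz_semigroup
begin

lemma PP_diff_const:
  fixes f :: "'d phase \<Rightarrow> real"
  assumes "bounded_borel f" "0 \<le> t" "z \<in> UNIV \<times> signs"
  shows "PP t (\<lambda>z. f z - c) z = PP t f z - c"
  using PP_diff_fun[OF assms(1) bounded_borel_const assms(2,3), of c] PP_const[OF assms(2,3)] by simp

lemma test_fun_PP:
  assumes f: "test_fun f" and t: "0 \<le> t"
  shows "test_fun (PP t f)"
proof -
  obtain c R C L where R: "0 \<le> R" and l: "lip_supp R C L (\<lambda>z. f z - c)" using f unfolding test_fun_def by blast
  obtain R' L' where R': "0 \<le> R'" and l': "lip_supp R' C L' (PP t (\<lambda>z. f z - c))" using PP_lip_supp[OF l R t] by blast
  have "lip_supp R' C L' (\<lambda>z. PP t f z - c)"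
    using l' unfolding lip_supp_def by (simp add: PP_diff_const[OF test_fun_bounded_borel[OF f] t])
  then show ?thesis using R' unfolding test_fun_def by blast
qed

lemma test_fun_zz_op_funpow:
  assumes f: "test_fun f" and \<epsilon>: "0 < \<epsilon>" "\<epsilon> \<le> 1"
  shows "test_fun ((zz_op H \<epsilon> ^^ n) f)"
proof -
  obtain c R C L where R: "0 \<le> R" and l: "lip_supp R C L (\<lambda>z. f z - c)" using f unfolding test_fun_def by blast
  have T: "0 \<le> real n * \<epsilon>" using \<epsilon> by simp
  obtain R' L' K1 where A: "0 \<le> R'" "0 \<le> K1"
    "\<And>\<epsilon>' n'. 0 < \<epsilon>' \<Longrightarrow> \<epsilon>' \<le> 1 \<Longrightarrow> real n' * \<epsilon>' \<le> real n * \<epsilon> \<Longrightarrow> lip_supp R' C L' ((zz_op H \<epsilon>' ^^ n') (\<lambda>z. f z - c))"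
    "\<And>\<epsilon>' n' z. 0 < \<epsilon>' \<Longrightarrow> \<epsilon>' \<le> 1 \<Longrightarrow> real n' * \<epsilon>' \<le> real n * \<epsilon> \<Longrightarrow> z \<in> UNIV \<times> signs \<Longrightarrow>
      \<bar>(zz_op H \<epsilon>' ^^ n') (\<lambda>z. f z - c) z - PP (real n' * \<epsilon>') (\<lambda>z. f z - c) z\<bar> \<le> K1 * (real n * \<epsilon>) * \<epsilon>'"
    by (rule zz_op_funpow_approx[OF l R T]) (rule that; assumption)
  have "lip_supp R' C L' (\<lambda>z. (zz_op H \<epsilon> ^^ n) f z - c)"
    using A(3)[OF \<epsilon> order_refl] unfolding zz_op_funpow_diff_const .
  then show ?thesis using A(1) unfolding test_fun_def by blast
qed

lemma test_fun_zz_op_tendsto: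
  assumes f: "test_fun f" and t: "0 \<le> t"
    and n: "((\<lambda>\<epsilon>. real (n \<epsilon>) * \<epsilon>) \<longlongrightarrow> t) (at_right 0)" and e: "0 < e"
  shows "\<forall>\<^sub>F \<epsilon> in at_right 0. \<forall>z\<in>UNIV \<times> signs. \<bar>(zz_op H \<epsilon> ^^ n \<epsilon>) f z - PP t f z\<bar> \<le> e"
proof -
  obtain c R C L where R: "0 \<le> R" and l: "lip_supp R C L (\<lambda>z. f z - c)" using f unfolding test_fun_def by blast
  show ?thesis using zz_op_funpow_tendsto[OF l R t n e]
  proof (rule eventually_mono)
    fix \<epsilon> assume A: "\<forall>z\<in>UNIV \<times> signs. \<bar>(zz_op H \<epsilon> ^^ n \<epsilon>) (\<lambda>z. f z - c) z - PP t (\<lambda>z. f z - c) z\<bar> \<le> e"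
    show "\<forall>z\<in>UNIV \<times> signs. \<bar>(zz_op H \<epsilon> ^^ n \<epsilon>) f z - PP t f z\<bar> \<le> e"
    proof
      fix z :: "'d phase" assume z: "z \<in> UNIV \<times> signs"
      show "\<bar>(zz_op H \<epsilon> ^^ n \<epsilon>) f z - PP t f z\<bar> \<le> e"
        using bspec[OF A z] unfolding zz_op_funpow_diff_const PP_diff_const[OF test_fun_bounded_borel[OF f] t z] by simp
    qed
  qed
qed

text \<open>The operators are replaced one time after the other. The moment inside is exchanged by
  the contraction of the walk operators; the outer operator then acts on the limiting moment, a
  fixed test function to which the convergence of powers applies. Uniformity in z keeps the
  induction going.\<close>

lemma grid_moment_tendsto:
  assumes h: "\<And>j. test_fun (h j)" and t: "\<And>j. 0 \<le> t j"
    and n: "\<And>j. ((\<lambda>\<epsilon>. real (n \<epsilon> j) * \<epsilon>) \<longlongrightarrow> t j) (at_right 0)" and e: "0 < e"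
  shows "\<forall>\<^sub>F \<epsilon> in at_right 0. \<forall>z\<in>UNIV \<times> signs.
    \<bar>grid_moment (\<lambda>j. zz_op H \<epsilon> ^^ n \<epsilon> j) h l k z - grid_moment (\<lambda>j. PP (t j)) h l k z\<bar> \<le> e"
  using e
proof (induction l arbitrary: k e)
  case 0
  then show ?case by simp
next
  case (Suc l)
  obtain C where C: "0 \<le> C" "\<And>z. z \<in> UNIV \<times> signs \<Longrightarrow> \<bar>h k z\<bar> \<le> C" by (rule test_fun_bounded[OF h[of k]]) (rule that; assumption)
  \<comment> \<open>Inner and outer replacement cost d each and are multiplied by the factor
    \<open>h k\<close>; C + 1 instead of C avoids division by zero.\<close>
  define d where "d = e / 2 / (C + 1)"
  have d: "0 < d" using Suc.prems C(1) by (simp add: d_def)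
  have u: "test_fun (grid_moment (\<lambda>j. PP (t j)) h l (Suc k))" by (rule grid_moment_test_fun[OF test_fun_PP[OF _ t] h])
  show ?case
    using Suc.IH[OF d, of "Suc k"] test_fun_zz_op_tendsto[OF u t n d, of k]
  proof (rule eventually_elim2)
    fix \<epsilon>
    let ?u = "grid_moment (\<lambda>j. PP (t j)) h l (Suc k)" and ?u\<epsilon> = "grid_moment (\<lambda>j. zz_op H \<epsilon> ^^ n \<epsilon> j) h l (Suc k)"
    assume 1: "\<forall>z\<in>UNIV \<times> signs. \<bar>?u\<epsilon> z - ?u z\<bar> \<le> d"
      and 2: "\<forall>z\<in>UNIV \<times> signs. \<bar>(zz_op H \<epsilon> ^^ n \<epsilon> k) ?u z - PP (t k) ?u z\<bar> \<le> d"
    show "\<forall>z\<in>UNIV \<times> signs. \<bar>grid_moment (\<lambda>j. zz_op H \<epsilon> ^^ n \<epsilon> j) h (Suc l) k z - grid_moment (\<lambda>j. PP (t j)) h (Suc l) k z\<bar> \<le> e"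
    proof
      fix z :: "'d phase" assume z: "z \<in> UNIV \<times> signs"
      have "\<bar>(zz_op H \<epsilon> ^^ n \<epsilon> k) ?u\<epsilon> z - (zz_op H \<epsilon> ^^ n \<epsilon> k) ?u z\<bar> \<le> d"
        by (rule zz_op_funpow_contraction[OF _ z]) (use 1 in blast)
      then have 3: "\<bar>(zz_op H \<epsilon> ^^ n \<epsilon> k) ?u\<epsilon> z - PP (t k) ?u z\<bar> \<le> 2 * d" using bspec[OF 2 z] by linarith
      have "\<bar>grid_moment (\<lambda>j. zz_op H \<epsilon> ^^ n \<epsilon> j) h (Suc l) k z - grid_moment (\<lambda>j. PP (t j)) h (Suc l) k z\<bar> =
          \<bar>h k z\<bar> * \<bar>(zz_op H \<epsilon> ^^ n \<epsilon> k) ?u\<epsilon> z - PP (t k) ?u z\<bar>"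
        by (simp add: abs_mult[symmetric] right_diff_distrib)
      also have "\<dots> \<le> C * (2 * d)" using C z 3 by (intro mult_mono) auto
      also have "\<dots> \<le> (C + 1) * (2 * d)" using d by (intro mult_right_mono) auto
      also have "\<dots> = e" using C(1) by (simp add: d_def field_simps)
      finally show "\<bar>grid_moment (\<lambda>j. zz_op H \<epsilon> ^^ n \<epsilon> j) h (Suc l) k z - grid_moment (\<lambda>j. PP (t j)) h (Suc l) k z\<bar> \<le> e" .
    qed
  qed
qed

end

lemma floor_div_tendsto:
  assumes "0 \<le> x"
  shows "((\<lambda>\<epsilon>. real (nat \<lfloor>x / \<epsilon>\<rfloor>) * \<epsilon>) \<longlongrightarrow> x) (at_right 0)"
proof (rule tendsto_sandwich)
  show "((\<lambda>\<epsilon>. x - \<epsilon>) \<longlongrightarrow> x) (at_right 0)" by (auto intro!: tendsto_eq_intros)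
  show "((\<lambda>\<epsilon>. x) \<longlongrightarrow> x) (at_right 0)" by simp
  have b: "x - \<epsilon> \<le> real (nat \<lfloor>x / \<epsilon>\<rfloor>) * \<epsilon> \<and> real (nat \<lfloor>x / \<epsilon>\<rfloor>) * \<epsilon> \<le> x" if "0 < \<epsilon>" for \<epsilon>
  proof -
    have "0 \<le> x / \<epsilon>" using assms that by simp
    then have "real (nat \<lfloor>x / \<epsilon>\<rfloor>) \<le> x / \<epsilon>" "x / \<epsilon> \<le> real (nat \<lfloor>x / \<epsilon>\<rfloor>) + 1" by linarith+
    then show ?thesis using that by (simp add: pos_le_divide_eq pos_divide_le_eq algebra_simps)
  qed
  show "\<forall>\<^sub>F \<epsilon> in at_right 0. x - \<epsilon> \<le> real (nat \<lfloor>x / \<epsilon>\<rfloor>) * \<epsilon>"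
    using eventually_at_right_less[of "0::real"] by (rule eventually_mono) (use b in blast)
  show "\<forall>\<^sub>F \<epsilon> in at_right 0. real (nat \<lfloor>x / \<epsilon>\<rfloor>) * \<epsilon> \<le> x"
    using eventually_at_right_less[of "0::real"] by (rule eventually_mono) (use b in blast)
qed


text \<open>The approximation is by the level sets of f at spacing e. It carries the Markov
  property, which is given for indicators, over to bounded measurable functions.\<close>

lemma simple_approx:
  fixes f :: "'z \<Rightarrow> real"
  assumes f: "f \<in> borel_measurable E" and C: "\<And>z. z \<in> space E \<Longrightarrow> \<bar>f z\<bar> \<le> C" and e: "0 < e"
  obtains I :: "int set" and A c where "finite I" "\<And>k. k \<in> I \<Longrightarrow> A k \<in> sets E"
    "\<And>z. z \<in> space E \<Longrightarrow> \<bar>f z - (\<Sum>k\<in>I. c k * indicator (A k) z)\<bar> \<le> e"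
proof -
  define I where "I = {\<lfloor>- C / e\<rfloor>..\<lfloor>C / e\<rfloor>}"
  define A where "A k = {z \<in> space E. \<lfloor>f z / e\<rfloor> = k}" for k
  show ?thesis
  proof (rule that[of I A "\<lambda>k. of_int k * e"])
    show "finite I" by (simp add: I_def)
    show "A k \<in> sets E" for k
    proof -
      have "(\<lambda>z. \<lfloor>f z / e\<rfloor>) \<in> E \<rightarrow>\<^sub>M count_space UNIV" using f by measurable
      then have "(\<lambda>z. \<lfloor>f z / e\<rfloor>) -` {k} \<inter> space E \<in> sets E" by (rule measurable_sets) simp
      moreover have "(\<lambda>z. \<lfloor>f z / e\<rfloor>) -` {k} \<inter> space E = A k" by (auto simp: A_def)
      ultimately show ?thesis by simp
    qed
    fix z assume z: "z \<in> space E"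
    let ?k = "\<lfloor>f z / e\<rfloor>"
    have "- C \<le> f z" "f z \<le> C" using C[OF z] by (simp_all add: abs_le_iff)
    note this[THEN divide_right_mono[OF _ less_imp_le[OF e]]]
    then have "?k \<in> I" unfolding I_def by (simp add: floor_mono)
    have "(\<Sum>k\<in>I. of_int k * e * indicator (A k) z) = (\<Sum>k\<in>I. if k = ?k then of_int ?k * e else 0)"
      using z by (intro sum.cong refl) (auto simp: A_def indicator_def)
    also have "\<dots> = of_int ?k * e" using \<open>?k \<in> I\<close> by (simp add: I_def)
    finally have s: "(\<Sum>k\<in>I. of_int k * e * indicator (A k) z) = of_int ?k * e" .
    have "of_int ?k \<le> f z / e" "f z / e \<le> of_int ?k + 1" by linarith+
    then have "of_int ?k * e \<le> f z" "f z \<le> (of_int ?k + 1) * e"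
      unfolding pos_le_divide_eq[OF e] pos_divide_le_eq[OF e] .
    then show "\<bar>f z - (\<Sum>k\<in>I. of_int k * e * indicator (A k) z)\<bar> \<le> e"
      unfolding s by (simp add: algebra_simps abs_le_iff)
  qed
qed

lemma abs_integral_diff_le:
  fixes f g :: "'a \<Rightarrow> real"
  assumes "prob_space M" "integrable M f" "integrable M g" "\<And>\<omega>. \<omega> \<in> space M \<Longrightarrow> \<bar>f \<omega> - g \<omega>\<bar> \<le> b"
  shows "\<bar>(\<integral>\<omega>. f \<omega> \<partial>M) - (\<integral>\<omega>. g \<omega> \<partial>M)\<bar> \<le> b"
proof -
  interpret prob_space M by fact
  have "\<bar>(\<integral>\<omega>. f \<omega> \<partial>M) - (\<integral>\<omega>. g \<omega> \<partial>M)\<bar> = \<bar>\<integral>\<omega>. f \<omega> - g \<omega> \<partial>M\<bar>" using assms by simp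
  also have "\<dots> \<le> (\<integral>\<omega>. \<bar>f \<omega> - g \<omega>\<bar> \<partial>M)" by (rule integral_abs_bound)
  also have "\<dots> \<le> (\<integral>\<omega>. b \<partial>M)" using assms by (intro integral_mono) auto
  finally show ?thesis using prob_space by simp
qed

lemma bounded_integrable:
  fixes f :: "'a \<Rightarrow> real"
  assumes "prob_space M" "f \<in> borel_measurable M" "\<And>\<omega>. \<omega> \<in> space M \<Longrightarrow> \<bar>f \<omega>\<bar> \<le> C"
  shows "integrable M f"
proof -
  interpret prob_space M by fact
  show ?thesis by (rule integrable_const_bound[where B=C]) (use assms in auto)
qed

section \<open>The Markov property of the limit process\<close>

locale zz_process = zz_semigroup H P for H :: "(real, 'd::{finite,linorder}) vec \<Rightarrow> real" and P +
  fixes M :: "'b measure" and Z :: "real \<Rightarrow> 'b \<Rightarrow> 'd::{finite,linorder} phase"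
  assumes mp: "markov_process M zz_state_space P Z"
begin

lemma M_prob: "prob_space M"
  using mp by (simp add: markov_process_def)

lemma Z_meas: "0 \<le> t \<Longrightarrow> Z t \<in> M \<rightarrow>\<^sub>M zz_state_space"
  using mp by (simp add: markov_process_def)

lemma Z_in: "0 \<le> t \<Longrightarrow> \<omega> \<in> space M \<Longrightarrow> Z t \<omega> \<in> UNIV \<times> signs"
  using measurable_space[OF Z_meas] by (simp add: space_zz)

lemma Z_borel: "0 \<le> t \<Longrightarrow> Z t \<in> borel_measurable M"
  using Z_meas[of t] unfolding zz_state_space_def measurable_restrict_space2_iff by blast

abbreviation Filt :: "real \<Rightarrow> 'b measure" where
  "Filt s \<equiv> natural_filtration M zz_state_space Z s"

lemma filt_gen: "{Z u -` A \<inter> space M |u A. 0 \<le> u \<and> u \<le> s \<and> A \<in> sets zz_state_space} \<subseteq> sets M"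
  using measurable_sets[OF Z_meas] by blast

lemma space_Filt: "space (Filt s) = space M"
  unfolding natural_filtration_def by (rule space_measure_of) (use filt_gen sets.sets_into_space in blast)

lemma sets_Filt: "sets (Filt s) = sigma_sets (space M) {Z u -` A \<inter> space M |u A. 0 \<le> u \<and> u \<le> s \<and> A \<in> sets zz_state_space}"
  unfolding natural_filtration_def by (rule sets_measure_of) (use filt_gen sets.sets_into_space in blast)

lemma subalgebra_Filt: "subalgebra M (Filt s)"
  unfolding subalgebra_def space_Filt sets_Filt using sets.sigma_sets_subset[OF filt_gen] by simp

lemma Z_Filt: "0 \<le> u \<Longrightarrow> u \<le> s \<Longrightarrow> Z u \<in> Filt s \<rightarrow>\<^sub>M zz_state_space"
proof (rule measurableI)
  fix \<omega> assume "0 \<le> u" "\<omega> \<in> space (Filt s)"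
  then show "Z u \<omega> \<in> space zz_state_space" using Z_in by (simp add: space_Filt space_zz)
next
  fix A :: "'d phase set" assume A: "0 \<le> u" "u \<le> s" "A \<in> sets zz_state_space"
  show "Z u -` A \<inter> space (Filt s) \<in> sets (Filt s)"
    unfolding space_Filt sets_Filt by (rule sigma_sets.Basic) (use A in blast)
qed

text \<open>The conditional expectation of an indicator is integrated against a bounded function of
  the past. Finite linear combinations follow by linearity and bounded f by uniform approximation,
  the error being the same for f and for \<open>PP t f\<close>.\<close>

lemma markov_step:
  assumes s: "0 \<le> s" and t: "0 \<le> t" and G: "G \<in> borel_measurable (Filt s)" "\<And>\<omega>. \<omega> \<in> space M \<Longrightarrow> \<bar>G \<omega>\<bar> \<le> C"
    and f: "bounded_borel f"
  shows "(\<integral>\<omega>. G \<omega> * f (Z (s + t) \<omega>) \<partial>M) = (\<integral>\<omega>. G \<omega> * PP t f (Z s \<omega>) \<partial>M)"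
proof -
  interpret prob_space M by (rule M_prob)
  interpret finite_measure_subalgebra M "Filt s" by unfold_locales (rule subalgebra_Filt)
  interpret sigma_finite_subalgebra M "Filt s"
    by (rule finite_measure_subalgebra_is_sigma_finite) unfold_locales
  have st: "0 \<le> s + t" using s t by simp
  have GM: "G \<in> borel_measurable M" by (rule measurable_from_subalg[OF subalgebra_Filt G(1)])
  have comp: "(\<lambda>\<omega>. g (Z u \<omega>)) \<in> borel_measurable M" if "0 \<le> u" "bounded_borel g" for u g
    using measurable_compose[OF Z_meas[OF that(1)]] that(2) unfolding bounded_borel_def by blast
  have int: "integrable M (\<lambda>\<omega>. G \<omega> * g (Z u \<omega>))" if u: "0 \<le> u" and g: "bounded_borel g" for u g
  proof -
    obtain D where D: "\<forall>z\<in>UNIV \<times> signs. \<bar>g z\<bar> \<le> D" using g unfolding bounded_borel_def by blast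
    show ?thesis
    proof (rule bounded_integrable[OF M_prob, where C="C * D"])
      show "(\<lambda>\<omega>. G \<omega> * g (Z u \<omega>)) \<in> borel_measurable M" by (intro borel_measurable_times GM comp u g)
      fix \<omega> assume \<omega>: "\<omega> \<in> space M"
      have "0 \<le> C" using G(2)[OF \<omega>] by linarith
      then show "\<bar>G \<omega> * g (Z u \<omega>)\<bar> \<le> C * D"
        unfolding abs_mult using G(2)[OF \<omega>] bspec[OF D Z_in[OF u \<omega>]] by (intro mult_mono) auto
    qed
  qed
  have bI: "bounded_borel (indicator A)" if "A \<in> sets zz_state_space" for A :: "'d phase set"
    unfolding bounded_borel_def using that by (auto intro!: exI[of _ 1] simp: indicator_def)
  have ind: "(\<integral>\<omega>. G \<omega> * indicator A (Z (s + t) \<omega>) \<partial>M) = (\<integral>\<omega>. G \<omega> * PP t (indicator A) (Z s \<omega>) \<partial>M)"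
    if A: "A \<in> sets zz_state_space" for A
  proof -
    have cA: "(\<lambda>\<omega>. indicator A (Z (s + t) \<omega>) :: real) \<in> borel_measurable M" by (rule comp[OF st bI[OF A]])
    note ce = real_cond_exp_intg[OF int[OF st bI[OF A]] G(1) cA]
    have "(\<integral>\<omega>. G \<omega> * indicator A (Z (s + t) \<omega>) \<partial>M) =
        (\<integral>\<omega>. G \<omega> * real_cond_exp M (Filt s) (\<lambda>\<omega>. indicator A (Z (s + t) \<omega>)) \<omega> \<partial>M)"
      by (rule ce(2)[symmetric])
    also have "\<dots> = (\<integral>\<omega>. G \<omega> * PP t (indicator A) (Z s \<omega>) \<partial>M)"
    proof (rule integral_cong_AE)
      show "(\<lambda>\<omega>. G \<omega> * real_cond_exp M (Filt s) (\<lambda>\<omega>. indicator A (Z (s + t) \<omega>)) \<omega>) \<in> borel_measurable M"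
        using ce(1) by (rule borel_measurable_integrable)
      show "(\<lambda>\<omega>. G \<omega> * PP t (indicator A) (Z s \<omega>)) \<in> borel_measurable M"
        by (intro borel_measurable_times GM comp s PP_bounded_borel bI A t)
      have "AE \<omega> in M. real_cond_exp M (Filt s) (\<lambda>\<omega>. indicator A (Z (s + t) \<omega>)) \<omega> = measure (P t (Z s \<omega>)) A"
        using mp s t A unfolding markov_process_def by blast
      then show "AE \<omega> in M. G \<omega> * real_cond_exp M (Filt s) (\<lambda>\<omega>. indicator A (Z (s + t) \<omega>)) \<omega> =
          G \<omega> * PP t (indicator A) (Z s \<omega>)"
      proof (rule AE_mp, intro AE_I2 impI)
        fix \<omega> assume \<omega>: "\<omega> \<in> space M" and eq: "real_cond_exp M (Filt s) (\<lambda>\<omega>. indicator A (Z (s + t) \<omega>)) \<omega> = measure (P t (Z s \<omega>)) A"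
        have "PP t (indicator A) (Z s \<omega>) = measure (P t (Z s \<omega>)) (A \<inter> space (P t (Z s \<omega>)))"
          unfolding PP_def by (rule Bochner_Integration.integral_indicator)
        also have "A \<inter> space (P t (Z s \<omega>)) = A"
          using sets.sets_into_space[OF A] P_prob(3)[OF t Z_in[OF s \<omega>]] by (auto simp: space_zz)
        finally show "G \<omega> * real_cond_exp M (Filt s) (\<lambda>\<omega>. indicator A (Z (s + t) \<omega>)) \<omega> =
            G \<omega> * PP t (indicator A) (Z s \<omega>)" using eq by simp
      qed
    qed
    finally show ?thesis .
  qed
  have C: "0 \<le> C"
  proof -
    obtain \<omega> where "\<omega> \<in> space M" using not_empty by blast
    then show ?thesis using G(2)[of \<omega>] by linarith
  qed
  obtain D where D: "\<forall>z\<in>UNIV \<times> signs. \<bar>f z\<bar> \<le> D" and fm: "f \<in> borel_measurable zz_state_space"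
    using f unfolding bounded_borel_def by blast
  have "\<bar>(\<integral>\<omega>. G \<omega> * f (Z (s + t) \<omega>) \<partial>M) - (\<integral>\<omega>. G \<omega> * PP t f (Z s \<omega>) \<partial>M)\<bar> \<le> 0"
  proof (rule field_le_epsilon)
    fix e0 :: real assume e0: "0 < e0"
    define e where "e = e0 / (2 * (C + 1))"
    have e: "0 < e" using e0 C by (simp add: e_def)
    have e0': "2 * (C + 1) * e = e0" using C by (simp add: e_def)
    obtain I :: "int set" and A c where I: "finite I" "\<And>k. k \<in> I \<Longrightarrow> A k \<in> sets (zz_state_space :: 'd phase measure)"
      "\<And>z. z \<in> space zz_state_space \<Longrightarrow> \<bar>f z - (\<Sum>k\<in>I. c k * indicator (A k) z)\<bar> \<le> e"
    proof (rule simple_approx[OF fm _ e])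
      show "\<bar>f z\<bar> \<le> D" if "z \<in> space zz_state_space" for z using D that unfolding space_zz by blast
    qed (rule that; assumption)
    let ?g = "\<lambda>z. \<Sum>k\<in>I. c k * indicator (A k) z"
    have gs: "bounded_borel (\<lambda>z. \<Sum>k\<in>J. c k * indicator (A k) z)" if "finite J" "J \<subseteq> I" for J
      using that
    proof (induction J)
      case empty
      then show ?case using bounded_borel_const[of 0] by simp
    next
      case (insert k J)
      have "bounded_borel (\<lambda>z. c k * indicator (A k) z + (\<Sum>k\<in>J. c k * indicator (A k) z))"
        using insert by (intro bounded_borel_add bounded_borel_cmult bI I(2)) auto
      moreover have "(\<lambda>z. \<Sum>k\<in>insert k J. c k * indicator (A k) z) =
          (\<lambda>z. c k * indicator (A k) z + (\<Sum>k\<in>J. c k * indicator (A k) z))"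
        by (rule ext) (rule sum.insert[OF insert.hyps])
      ultimately show ?case by (simp only:)
    qed
    have g: "bounded_borel ?g" by (rule gs[OF I(1) order_refl])
    have fg: "\<bar>f z - ?g z\<bar> \<le> e" if "z \<in> UNIV \<times> signs" for z using I(3)[of z] that by (simp add: space_zz)
    have Pg: "PP t ?g z = (\<Sum>k\<in>I. c k * PP t (indicator (A k)) z)" if z: "z \<in> UNIV \<times> signs" for z
      unfolding PP_def
      by (subst Bochner_Integration.integral_sum) (use PP_integrable[OF bI t z] I(2) in auto)
    have "(\<integral>\<omega>. G \<omega> * ?g (Z (s + t) \<omega>) \<partial>M) = (\<integral>\<omega>. (\<Sum>k\<in>I. c k * (G \<omega> * indicator (A k) (Z (s + t) \<omega>))) \<partial>M)"
      by (intro Bochner_Integration.integral_cong refl) (simp add: sum_distrib_left mult_ac)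
    also have "\<dots> = (\<Sum>k\<in>I. \<integral>\<omega>. c k * (G \<omega> * indicator (A k) (Z (s + t) \<omega>)) \<partial>M)"
      by (rule Bochner_Integration.integral_sum) (intro integrable_mult_right int st bI I(2))
    also have "\<dots> = (\<Sum>k\<in>I. \<integral>\<omega>. c k * (G \<omega> * PP t (indicator (A k)) (Z s \<omega>)) \<partial>M)"
      using ind[OF I(2)] by simp
    also have "\<dots> = (\<integral>\<omega>. (\<Sum>k\<in>I. c k * (G \<omega> * PP t (indicator (A k)) (Z s \<omega>))) \<partial>M)"
      by (rule Bochner_Integration.integral_sum[symmetric]) (intro integrable_mult_right int s PP_bounded_borel bI I(2) t)
    also have "\<dots> = (\<integral>\<omega>. G \<omega> * PP t ?g (Z s \<omega>) \<partial>M)"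
    proof (intro Bochner_Integration.integral_cong refl)
      fix \<omega> assume "\<omega> \<in> space M"
      from Pg[OF Z_in[OF s this]]
      show "(\<Sum>k\<in>I. c k * (G \<omega> * PP t (indicator (A k)) (Z s \<omega>))) = G \<omega> * PP t ?g (Z s \<omega>)"
        by (simp add: sum_distrib_left mult_ac)
    qed
    finally have eq: "(\<integral>\<omega>. G \<omega> * ?g (Z (s + t) \<omega>) \<partial>M) = (\<integral>\<omega>. G \<omega> * PP t ?g (Z s \<omega>) \<partial>M)" .
    have bnd: "\<bar>G \<omega> * a - G \<omega> * b\<bar> \<le> C * e" if "\<omega> \<in> space M" "\<bar>a - b\<bar> \<le> e" for \<omega> a b
    proof -
      have "\<bar>G \<omega>\<bar> * \<bar>a - b\<bar> \<le> C * e" using G(2)[OF that(1)] that(2) C by (intro mult_mono) auto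
      then show ?thesis by (simp add: abs_mult[symmetric] right_diff_distrib)
    qed
    have 1: "\<bar>(\<integral>\<omega>. G \<omega> * f (Z (s + t) \<omega>) \<partial>M) - (\<integral>\<omega>. G \<omega> * ?g (Z (s + t) \<omega>) \<partial>M)\<bar> \<le> C * e"
      by (rule abs_integral_diff_le[OF M_prob int[OF st f] int[OF st g]], rule bnd) (auto intro: fg Z_in[OF st])
    have 2: "\<bar>(\<integral>\<omega>. G \<omega> * PP t f (Z s \<omega>) \<partial>M) - (\<integral>\<omega>. G \<omega> * PP t ?g (Z s \<omega>) \<partial>M)\<bar> \<le> C * e"
    proof (rule abs_integral_diff_le[OF M_prob int[OF s PP_bounded_borel[OF f t]] int[OF s PP_bounded_borel[OF g t]]], rule bnd)
      fix \<omega> assume "\<omega> \<in> space M"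
      from PP_diff_le[OF f g t Z_in[OF s this] fg] show "\<bar>PP t f (Z s \<omega>) - PP t ?g (Z s \<omega>)\<bar> \<le> e" .
    qed
    have "2 * (C * e) \<le> e0" using e unfolding e0'[symmetric] by (simp add: algebra_simps)
    then show "\<bar>(\<integral>\<omega>. G \<omega> * f (Z (s + t) \<omega>) \<partial>M) - (\<integral>\<omega>. G \<omega> * PP t f (Z s \<omega>) \<partial>M)\<bar> \<le> 0 + e0"
      using 1 2 unfolding eq by linarith
  qed
  then show ?thesis by simp
qed

lemma test_fun_Z_measurable:
  assumes "test_fun h" "0 \<le> u" "u \<le> s"
  shows "(\<lambda>\<omega>. h (Z u \<omega>)) \<in> borel_measurable (Filt s)"
  using measurable_compose[OF Z_Filt[OF assms(2,3)]] test_fun_bounded_borel[OF assms(1)] unfolding bounded_borel_def by blast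

lemma process_fdd:
  assumes h: "\<And>j. test_fun (h j)" and m: "0 < m"
  shows "(\<integral>\<omega>. (\<Prod>j\<le>n. h j (Z (real j / real m) \<omega>)) \<partial>M) =
    (\<integral>\<omega>. grid_moment (\<lambda>j. PP (1 / real m)) h n 0 (Z 0 \<omega>) \<partial>M)"
proof -
  have m1: "0 \<le> 1 / real m" by simp
  have "(\<integral>\<omega>. (\<Prod>j\<le>n. h j (Z (real j / real m) \<omega>)) \<partial>M) =
    (\<integral>\<omega>. grid_moment (\<lambda>j. PP (1 / real m)) h n 0 (Z (real 0 / real m) \<omega>) \<partial>M)"
  proof (rule expectation_grid_moment[where \<zeta>="\<lambda>j. Z (real j / real m)", OF test_fun_PP[OF _ m1] _ h])
    fix n and h :: "nat \<Rightarrow> 'd phase \<Rightarrow> real" and f :: "'d phase \<Rightarrow> real"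
    assume h: "\<And>j. test_fun (h j)" and f: "test_fun f"
    let ?G = "\<lambda>\<omega>. \<Prod>j\<le>n. h j (Z (real j / real m) \<omega>)"
    have "\<exists>C. 0 \<le> C \<and> (\<forall>z\<in>UNIV \<times> signs. \<bar>h j z\<bar> \<le> C)" for j
      by (rule test_fun_bounded[OF h[of j]]) blast
    then obtain C where C: "\<And>j. 0 \<le> C j \<and> (\<forall>z\<in>UNIV \<times> signs. \<bar>h j z\<bar> \<le> C j)" by metis
    have "(\<integral>\<omega>. ?G \<omega> * f (Z (real n / real m + 1 / real m) \<omega>) \<partial>M) = (\<integral>\<omega>. ?G \<omega> * PP (1 / real m) f (Z (real n / real m) \<omega>) \<partial>M)"
    proof (rule markov_step[where C="\<Prod>j\<le>n. C j", OF _ m1 _ _ test_fun_bounded_borel[OF f]])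
      show "0 \<le> real n / real m" by simp
      show "?G \<in> borel_measurable (Filt (real n / real m))"
        by (intro borel_measurable_prod test_fun_Z_measurable h) (auto intro: divide_right_mono)
      fix \<omega> assume \<omega>: "\<omega> \<in> space M"
      have "\<bar>?G \<omega>\<bar> = (\<Prod>j\<le>n. \<bar>h j (Z (real j / real m) \<omega>)\<bar>)" by (rule abs_prod)
      also have "\<dots> \<le> (\<Prod>j\<le>n. C j)"
      proof (rule prod_mono)
        fix j
        have "Z (real j / real m) \<omega> \<in> UNIV \<times> signs" by (rule Z_in[OF _ \<omega>]) simp
        then have "\<bar>h j (Z (real j / real m) \<omega>)\<bar> \<le> C j" by (rule bspec[OF conjunct2[OF C]])
        then show "0 \<le> \<bar>h j (Z (real j / real m) \<omega>)\<bar> \<and> \<bar>h j (Z (real j / real m) \<omega>)\<bar> \<le> C j" by simp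
      qed
      finally show "\<bar>?G \<omega>\<bar> \<le> (\<Prod>j\<le>n. C j)" .
    qed
    moreover have "real n / real m + 1 / real m = real (Suc n) / real m" by (simp add: add_divide_distrib)
    ultimately show "(\<integral>\<omega>. ?G \<omega> * f (Z (real (Suc n) / real m) \<omega>) \<partial>M) = (\<integral>\<omega>. ?G \<omega> * PP (1 / real m) f (Z (real n / real m) \<omega>) \<partial>M)"
      by (simp only:)
  qed
  then show ?thesis by simp
qed

end

text \<open>Finite speed in dual form: n steps average f over states within distance
  \<open>n * CARD('d) * \<epsilon>\<close>, and there f equals 1. In the limit this confines the
  process.\<close>

lemma zz_op_funpow_eq_one:
  assumes \<epsilon>: "0 < \<epsilon>" and f: "\<And>x v. v \<in> signs \<Longrightarrow> norm x \<le> r \<Longrightarrow> f (x, v) = 1"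
  shows "v \<in> signs \<Longrightarrow> norm (x :: (real, 'd::{finite,linorder}) vec) + real n * (real CARD('d) * \<epsilon>) \<le> r \<Longrightarrow>
    (zz_op H \<epsilon> ^^ n) f (x, v) = 1"
proof -
  have A: "foldr (zz_coord_op H \<epsilon>) l f (x, v) = 1"
    if f: "\<And>x v. v \<in> signs \<Longrightarrow> norm x \<le> r \<Longrightarrow> f (x, v) = 1"
      and "v \<in> signs" "norm x + real (length l) * \<epsilon> \<le> r" for l f r and x v :: "(real, 'd) vec"
    using that(2,3)
  proof (induction l arbitrary: x v)
    case Nil
    then show ?case using f by simp
  next
    case (Cons i l)
    let ?x = "x + axis i (\<epsilon> * v $ i)"
    have "norm ?x \<le> norm x + \<epsilon>"
      using norm_triangle_ineq[of x "axis i (\<epsilon> * v $ i)"] signs_abs[OF Cons.prems(1), of i] \<epsilon>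
      by (simp add: norm_axis_real abs_mult)
    then have 1: "foldr (zz_coord_op H \<epsilon>) l f (?x, v) = 1"
      using Cons.prems by (intro Cons.IH) (auto simp: algebra_simps)
    have 2: "foldr (zz_coord_op H \<epsilon>) l f (x, flip i v) = 1"
      using Cons.prems \<epsilon> by (intro Cons.IH flip_signs) (auto simp: algebra_simps)
    have "foldr (zz_coord_op H \<epsilon>) (i # l) f (x, v) = zz_coord_op H \<epsilon> i (foldr (zz_coord_op H \<epsilon>) l f) (x, v)" by simp
    also have "\<dots> = 1"
      unfolding zz_coord_op_def[of H \<epsilon> i "foldr (zz_coord_op H \<epsilon>) l f" "(x, v)"] Let_def fst_conv snd_conv 1 2 by simp
    finally show ?case .
  qed
  show "v \<in> signs \<Longrightarrow> norm x + real n * (real CARD('d) * \<epsilon>) \<le> r \<Longrightarrow> (zz_op H \<epsilon> ^^ n) f (x, v) = 1"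
  proof (induction n arbitrary: x v)
    case 0
    then show ?case using f by simp
  next
    case (Suc n)
    have "foldr (zz_coord_op H \<epsilon>) (sorted_list_of_set UNIV) ((zz_op H \<epsilon> ^^ n) f) (x, v) = 1"
    proof (rule A[where r="r - real n * (real CARD('d) * \<epsilon>)"])
      show "(zz_op H \<epsilon> ^^ n) f (x, v) = 1" if "v \<in> signs" "norm x \<le> r - real n * (real CARD('d) * \<epsilon>)" for x v
        using that by (intro Suc.IH) auto
      show "norm x + real (length (sorted_list_of_set (UNIV :: 'd set))) * \<epsilon> \<le> r - real n * (real CARD('d) * \<epsilon>)"
        using Suc.prems(2) by (simp add: algebra_simps)
    qed (rule Suc.prems)
    then show ?case by (simp add: zz_op_def[of H \<epsilon> "(zz_op H \<epsilon> ^^ n) f"])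
  qed
qed

section \<open>Cylinder functions on the grid and their density\<close>

definition hat :: "(real, 'd::finite) vec \<Rightarrow> real \<Rightarrow> (real, 'd) vec \<Rightarrow> real" where
  "hat a r x = max 0 (1 - norm (x - a) / r)"

text \<open>It takes the value 1 exactly on the closed ball of radius r, so that an expectation
  equal to 1 forces almost sure confinement to that ball.\<close>

definition plateau :: "real \<Rightarrow> (real, 'd::finite) vec \<Rightarrow> real" where
  "plateau r x = max 0 (min 1 (r + 1 - norm x))"

lemma max0_min1_lip: "\<bar>max 0 (min 1 a) - max 0 (min 1 b)\<bar> \<le> \<bar>a - b\<bar>" for a b :: real
  by (auto simp: max_def min_def)

lemma test_fun_plateau:
  assumes "0 \<le> r"
  shows "test_fun (\<lambda>z :: 'd::finite phase. plateau r (fst z))"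
proof -
  have "lip_supp (r + 1) 1 1 (\<lambda>z :: 'd phase. plateau r (fst z) - 0)"
  proof (rule lipcI)
    fix v x y :: "(real, 'd) vec"
    show "\<bar>plateau r (fst (x, v)) - 0\<bar> \<le> 1" by (simp add: plateau_def)
    have "\<bar>plateau r x - plateau r y\<bar> \<le> \<bar>(r + 1 - norm x) - (r + 1 - norm y)\<bar>"
      unfolding plateau_def by (rule max0_min1_lip)
    also have "\<dots> = \<bar>norm x - norm y\<bar>" by simp
    also have "\<dots> \<le> norm (x - y)" by (rule norm_triangle_ineq3)
    finally show "\<bar>plateau r (fst (x, v)) - 0 - (plateau r (fst (y, v)) - 0)\<bar> \<le> 1 * norm (x - y)" by simp
    show "plateau r (fst (x, v)) - 0 = 0" if "r + 1 \<le> norm x" using that by (simp add: plateau_def)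
  qed
  moreover have "0 \<le> r + 1" using assms by simp
  ultimately show ?thesis unfolding test_fun_def by blast
qed

lemma test_fun_hat:
  assumes "0 < r"
  shows "test_fun (\<lambda>z :: 'd::finite phase. hat a r (fst z) * of_bool (snd z = w))"
proof -
  have l: "\<bar>hat a r x - hat a r y\<bar> \<le> 1 / r * norm (x - y)" for x y
  proof -
    have "\<bar>hat a r x - hat a r y\<bar> \<le> \<bar>(1 - norm (x - a) / r) - (1 - norm (y - a) / r)\<bar>"
      unfolding hat_def using max0_diff[of "1 - norm (x - a) / r" "1 - norm (y - a) / r"] by (simp add: max.commute)
    also have "\<dots> = \<bar>norm (x - a) - norm (y - a)\<bar> / r"
      using assms by (simp add: diff_divide_distrib[symmetric] abs_minus_commute)
    also have "\<dots> \<le> norm ((x - a) - (y - a)) / r" using assms by (intro divide_right_mono norm_triangle_ineq3) auto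
    finally show ?thesis by simp
  qed
  have "lip_supp (norm a + r) 1 (1 / r) (\<lambda>z :: 'd phase. hat a r (fst z) * of_bool (snd z = w) - 0)"
  proof (rule lipcI)
    fix v x y :: "(real, 'd) vec"
    show "\<bar>hat a r (fst (x, v)) * of_bool (snd (x, v) = w) - 0\<bar> \<le> 1" using assms by (simp add: hat_def)
    show "\<bar>hat a r (fst (x, v)) * of_bool (snd (x, v) = w) - 0 - (hat a r (fst (y, v)) * of_bool (snd (y, v) = w) - 0)\<bar>
        \<le> 1 / r * norm (x - y)" using l[of x y] assms by simp
    assume "norm a + r \<le> norm x"
    then have "r \<le> norm (x - a)" using norm_triangle_sub[of x a] by linarith
    then have "1 \<le> norm (x - a) / r" using assms by (simp add: pos_le_divide_eq)
    then show "hat a r (fst (x, v)) * of_bool (snd (x, v) = w) - 0 = 0" by (simp add: hat_def)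
  qed
  moreover have "0 \<le> norm a + r" using assms by (intro add_nonneg_nonneg) auto
  ultimately show ?thesis unfolding test_fun_def by blast
qed

lemma signs_dist:
  assumes "v \<in> signs" "w \<in> signs" "dist v w < 1"
  shows "v = (w :: (real, 'd::finite) vec)"
proof (rule ccontr)
  assume "v \<noteq> w"
  then obtain i where "v $ i \<noteq> w $ i" by (auto simp: vec_eq_iff)
  then have "\<bar>(v - w) $ i\<bar> = 2" using signsD[OF assms(1), of i] signsD[OF assms(2), of i] by auto
  then show False using component_le_norm_cart[of "v - w" i] assms(3) by (simp add: dist_norm)
qed

lemma test_fun_continuous_on:
  assumes "test_fun (h :: 'd::finite phase \<Rightarrow> real)"
  shows "continuous_on (UNIV \<times> signs) h"
proof -
  obtain C L where CL: "0 \<le> C" "\<And>z. z \<in> UNIV \<times> signs \<Longrightarrow> \<bar>h z\<bar> \<le> C"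
    "\<And>x y v. v \<in> signs \<Longrightarrow> \<bar>h (x, v) - h (y, v)\<bar> \<le> L * norm (x - y)"
    by (rule test_fun_bounded[OF assms]) (rule that; assumption)
  show ?thesis unfolding continuous_on_iff
  proof (intro ballI allI impI)
    fix z :: "'d phase" and e :: real assume z: "z \<in> UNIV \<times> signs" and e: "0 < e"
    define d where "d = min 1 (e / (\<bar>L\<bar> + 1))"
    have d: "0 < d" "d \<le> 1" "d \<le> e / (\<bar>L\<bar> + 1)" using e by (simp_all add: d_def)
    show "\<exists>d>0. \<forall>z'\<in>UNIV \<times> signs. dist z' z < d \<longrightarrow> dist (h z') (h z) < e"
    proof (intro exI[of _ d] conjI ballI impI d(1))
      fix z' :: "'d phase" assume z': "z' \<in> UNIV \<times> signs" and dd: "dist z' z < d"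
      have "dist (snd z') (snd z) \<le> dist z' z" by (rule dist_snd_le)
      then have s: "snd z' = snd z" using z z' dd d(2) by (intro signs_dist) auto
      have "norm (fst z' - fst z) \<le> dist z' z" using dist_fst_le[of z' z] by (simp add: dist_norm)
      then have n: "norm (fst z' - fst z) < e / (\<bar>L\<bar> + 1)" using dd d(3) by linarith
      have "\<bar>h (fst z', snd z) - h (fst z, snd z)\<bar> \<le> L * norm (fst z' - fst z)" using z by (intro CL(3)) auto
      also have "\<dots> \<le> (\<bar>L\<bar> + 1) * norm (fst z' - fst z)" by (intro mult_right_mono) auto
      also have "\<dots> < (\<bar>L\<bar> + 1) * (e / (\<bar>L\<bar> + 1))" using n by (intro mult_strict_left_mono) auto
      also have "\<dots> = e" by simp
      finally show "dist (h z') (h z) < e" using s by (metis dist_real_def prod.collapse)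
    qed
  qed
qed

text \<open>Sums of products of one-time test functions: the algebra for Stone-Weierstrass, and at
  the same time the functions whose expectations are computed by \<open>grid_moment\<close>.\<close>

inductive cyl :: "((nat \<Rightarrow> 'd::finite phase) \<Rightarrow> real) \<Rightarrow> bool" where
  cyl_prod: "(\<And>j. test_fun (h j)) \<Longrightarrow> cyl (\<lambda>z. \<Prod>j\<le>n::nat. h j (z j))"
| cyl_add: "cyl F \<Longrightarrow> cyl G \<Longrightarrow> cyl (\<lambda>z. F z + G z)"

lemma cyl_mult_prod:
  assumes "cyl G" and h: "\<And>j. test_fun (h j)"
  shows "cyl (\<lambda>z. (\<Prod>j\<le>n::nat. h j (z j)) * G z)"
  using assms(1)
proof induction
  case (cyl_prod h' n')
  let ?m = "max n n'"
  \<comment> \<open>Products over different numbers of times are padded with the constant 1 before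
    they are multiplied factor by factor.\<close>
  let ?e = "\<lambda>(h :: nat \<Rightarrow> 'a phase \<Rightarrow> real) n j. if j \<le> n then h j else (\<lambda>_. 1)"
  have e: "(\<Prod>j\<le>?m. ?e h n j (z j)) = (\<Prod>j\<le>n. h j (z j))" if "n \<le> ?m" for h n and z :: "nat \<Rightarrow> 'a phase"
  proof -
    have "(\<Prod>j\<le>?m. ?e h n j (z j)) = (\<Prod>j\<le>n. ?e h n j (z j))"
      using that by (intro prod.mono_neutral_right) auto
    then show ?thesis by simp
  qed
  have "cyl (\<lambda>z. \<Prod>j\<le>?m. (\<lambda>y. ?e h n j y * ?e h' n' j y) (z j))"
    by (rule cyl.cyl_prod) (use h cyl_prod test_fun_const in \<open>auto intro!: test_fun_mult\<close>)
  moreover have "(\<Prod>j\<le>?m. (\<lambda>y. ?e h n j y * ?e h' n' j y) (z j)) = (\<Prod>j\<le>n. h j (z j)) * (\<Prod>j\<le>n'. h' j (z j))" for z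
    using e[of n h z] e[of n' h' z] by (simp add: prod.distrib)
  ultimately show ?case by simp
next
  case (cyl_add F G)
  then show ?case using cyl.cyl_add[OF cyl_add.IH] by (simp add: distrib_left)
qed

lemma cyl_mult:
  assumes "cyl F" "cyl G"
  shows "cyl (\<lambda>z. F z * G z)"
  using assms(1)
proof induction
  case (cyl_prod h n)
  then show ?case by (intro cyl_mult_prod assms(2))
next
  case (cyl_add F F')
  then show ?case using cyl.cyl_add[OF cyl_add.IH] by (simp add: distrib_right)
qed

lemma cyl_const: "cyl (\<lambda>_. c)"
  using cyl_prod[of "\<lambda>_ _. c" 0, OF test_fun_const] by simp

lemma cyl_coordinate: "test_fun h \<Longrightarrow> cyl (\<lambda>z. h (z k))"
proof -
  assume h: "test_fun h"
  have "cyl (\<lambda>z. \<Prod>j\<le>k. (if j = k then h else (\<lambda>_. 1)) (z j))"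
    by (rule cyl_prod) (auto simp: h test_fun_const)
  moreover have "(\<Prod>j\<le>k. (if j = k then h else (\<lambda>_. 1)) (z j)) = h (z k)" for z
  proof -
    have "(\<Prod>j\<le>k. (if j = k then h else (\<lambda>_. 1)) (z j)) = (\<Prod>j\<le>k. if j = k then h (z k) else 1)"
      by (intro prod.cong) auto
    then show ?thesis by simp
  qed
  ultimately show ?thesis by simp
qed

text \<open>The grid sequence of a path has infinitely many entries, each confined by finite speed.
  Compactness comes from Tychonoff's theorem, which replaces a tightness argument at the grid
  times.\<close>

definition box :: "(nat \<Rightarrow> real) \<Rightarrow> (nat \<Rightarrow> 'd::finite phase) set" where
  "box r = {z. \<forall>j. norm (fst (z j)) \<le> r j \<and> snd (z j) \<in> signs}"

lemma compact_box: "compact (box r :: (nat \<Rightarrow> 'd::finite phase) set)"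
proof -
  define B :: "nat \<Rightarrow> 'd phase set" where "B j = cball 0 (r j) \<times> signs" for j
  have eq: "box r = PiE UNIV B"
    by (auto simp: box_def PiE_def Pi_def mem_Times_iff B_def)
  have "compact (B j)" for j
    unfolding B_def by (rule compact_Times[OF compact_cball finite_imp_compact[OF finite_signs]])
  then have "compactin (product_topology (\<lambda>_. euclidean) UNIV) (PiE UNIV B)"
    by (subst compactin_PiE) auto
  then show ?thesis unfolding eq euclidean_product_topology compactin_euclidean_iff .
qed

lemma cyl_continuous_on: "cyl F \<Longrightarrow> continuous_on (box r) F"
proof (induction rule: cyl.induct)
  case (cyl_prod h n)
  have "continuous_on (box r) (\<lambda>z. h j (z j))" for j
  proof (rule continuous_on_compose2[OF test_fun_continuous_on[OF cyl_prod]])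
    show "continuous_on (box r) (\<lambda>z. z j)"
      using continuous_on_product_coordinates by (rule continuous_on_subset) simp
    show "(\<lambda>z. z j) ` box r \<subseteq> UNIV \<times> signs"
      by (rule image_subsetI) (simp add: box_def mem_Times_iff)
  qed
  then show ?case by (intro continuous_on_prod)
next
  case (cyl_add F G)
  then show ?case by (intro continuous_on_add)
qed

lemma cyl_dense:
  fixes \<Psi> :: "(nat \<Rightarrow> 'd::finite phase) \<Rightarrow> real"
  assumes "continuous_on (box r) \<Psi>" "0 < e"
  shows "\<exists>F. cyl F \<and> (\<forall>z\<in>box r. \<bar>\<Psi> z - F z\<bar> < e)"
proof (rule Stone_Weierstrass_HOL[OF compact_box])
  show "cyl (\<lambda>_. c)" for c by (rule cyl_const)
  show "continuous_on (box r) F" if "cyl F" for F by (rule cyl_continuous_on[OF that])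
  show "cyl (\<lambda>z. F z + G z)" if "cyl F \<and> cyl G" for F G using that by (auto intro: cyl_add)
  show "cyl (\<lambda>z. F z * G z)" if "cyl F \<and> cyl G" for F G using that by (auto intro: cyl_mult)
  fix x y :: "nat \<Rightarrow> 'd phase" assume "x \<in> box r \<and> y \<in> box r \<and> x \<noteq> y"
  then obtain j where j: "x j \<noteq> y j" by blast
  \<comment> \<open>If the positions differ, the hat around the first has exactly the radius at
    which it vanishes at the second. If they agree, the velocities differ and the indicator
    separates, with any radius.\<close>
  define \<rho> where "\<rho> = (if fst (x j) = fst (y j) then 1 else norm (fst (y j) - fst (x j)))"
  have \<rho>: "0 < \<rho>" by (simp add: \<rho>_def)
  define h :: "'d phase \<Rightarrow> real" where "h z = hat (fst (x j)) \<rho> (fst z) * of_bool (snd z = snd (x j))" for z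
  have "test_fun h" unfolding h_def[abs_def] by (rule test_fun_hat[OF \<rho>])
  then have "cyl (\<lambda>z. h (z j))" by (rule cyl_coordinate)
  moreover have "h (x j) = 1" by (simp add: h_def hat_def)
  moreover have "h (y j) = 0" using j by (auto simp: h_def hat_def \<rho>_def prod_eq_iff)
  ultimately show "\<exists>F. cyl F \<and> F x \<noteq> F y" by (intro exI[of _ "\<lambda>z. h (z j)"]) simp
qed (use assms in auto)


section \<open>Functionals of cadlag paths\<close>

lemma cadlag_restrict:
  assumes "cadlag x"
  shows "cadlag (\<lambda>t\<in>{0..}. x t)"
  unfolding cadlag_def
proof (intro conjI allI impI)
  fix t :: real assume t: "0 \<le> t"
  have ev: "\<forall>\<^sub>F s in at_right t. x s = (\<lambda>t\<in>{0..}. x t) s"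
    using eventually_at_right_less[of t] by (rule eventually_mono) (use t in simp)
  have "(x \<longlongrightarrow> x t) (at_right t)" using assms t unfolding cadlag_def by blast
  then have "((\<lambda>t\<in>{0..}. x t) \<longlongrightarrow> x t) (at_right t)" by (rule Lim_transform_eventually[OF _ ev])
  then show "((\<lambda>t\<in>{0..}. x t) \<longlongrightarrow> (\<lambda>t\<in>{0..}. x t) t) (at_right t)" using t by simp
next
  fix t :: real assume t: "0 < t"
  have ev: "\<forall>\<^sub>F s in at_left t. x s = (\<lambda>t\<in>{0..}. x t) s"
    by (rule eventually_at_leftI[of 0]) (use t in auto)
  obtain l where "(x \<longlongrightarrow> l) (at_left t)" using assms t unfolding cadlag_def by blast
  then show "\<exists>l. ((\<lambda>t\<in>{0..}. x t) \<longlongrightarrow> l) (at_left t)" using tendsto_cong[OF ev] by blast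
qed

text \<open>Sequential continuity along \<open>sk_dist\<close>, the common property of continuous
  functionals and of their Lipschitz envelopes.\<close>

definition sk_continuous :: "((real \<Rightarrow> 'b::real_normed_vector) \<Rightarrow> real) \<Rightarrow> bool" where
  "sk_continuous \<phi> \<longleftrightarrow> (\<forall>x xs. x \<in> skorohod_space \<longrightarrow> (\<forall>n. xs n \<in> skorohod_space) \<longrightarrow>
     (\<lambda>n. sk_dist (xs n) x) \<longlonglongrightarrow> 0 \<longrightarrow> (\<lambda>n. \<phi> (xs n)) \<longlonglongrightarrow> \<phi> x)"

lemma sk_continuousD:
  "sk_continuous \<phi> \<Longrightarrow> x \<in> skorohod_space \<Longrightarrow> (\<And>n. xs n \<in> skorohod_space) \<Longrightarrow>
    (\<lambda>n. sk_dist (xs n) x) \<longlonglongrightarrow> 0 \<Longrightarrow> (\<lambda>n. \<phi> (xs n)) \<longlonglongrightarrow> \<phi> x"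
  unfolding sk_continuous_def by blast

lemma sk_continuous_lip_env:
  fixes \<Phi> :: "(real \<Rightarrow> 'b::real_normed_vector) \<Rightarrow> real"
  assumes b: "\<And>x. x \<in> skorohod_space \<Longrightarrow> \<bar>\<Phi> x\<bar> \<le> C" and k: "0 \<le> k"
  shows "sk_continuous (lip_env \<Phi> k)"
  unfolding sk_continuous_def
proof (intro allI impI)
  fix x :: "real \<Rightarrow> 'b" and xs assume x: "x \<in> skorohod_space" "\<forall>n. xs n \<in> skorohod_space" and l: "(\<lambda>n. sk_dist (xs n) x) \<longlonglongrightarrow> 0"
  have "(\<lambda>n. lip_env \<Phi> k (xs n) - lip_env \<Phi> k x) \<longlonglongrightarrow> 0"
  proof (rule Lim_null_comparison)
    show "\<forall>\<^sub>F n in sequentially. norm (lip_env \<Phi> k (xs n) - lip_env \<Phi> k x) \<le> k * sk_dist (xs n) x"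
      by (intro always_eventually allI, unfold real_norm_def)
        (rule lip_env_abs_diff[OF b k spec[OF x(2)] x(1)], assumption)
    show "(\<lambda>n. k * sk_dist (xs n) x) \<longlonglongrightarrow> 0" by (rule tendsto_mult_right_zero[OF l])
  qed
  then show "(\<lambda>n. lip_env \<Phi> k (xs n)) \<longlonglongrightarrow> lip_env \<Phi> k x" by (rule LIM_zero_cancel)
qed

text \<open>Convergence in the product topology is coordinatewise, and for a given precision r only
  the finitely many grid values up to the horizon \<open>1 / r\<close> matter.\<close>

lemma sk_continuous_sk_step:
  fixes \<phi> :: "(real \<Rightarrow> 'b::{real_normed_vector,second_countable_topology}) \<Rightarrow> real"
  assumes \<phi>: "sk_continuous \<phi>" and m: "0 < m"
  shows "continuous_on UNIV (\<lambda>z. \<phi> (sk_step m z))"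
  unfolding continuous_on_sequentially
proof (intro allI ballI impI)
  fix zs :: "nat \<Rightarrow> nat \<Rightarrow> 'b" and z assume "(\<forall>n. zs n \<in> UNIV) \<and> zs \<longlonglongrightarrow> z"
  then have lim: "zs \<longlonglongrightarrow> z" by simp
  have coord: "(\<lambda>n. zs n k) \<longlonglongrightarrow> z k" for k
    by (rule continuous_on_tendsto_compose[OF continuous_on_product_coordinates lim]) auto
  have "(\<lambda>n. sk_dist (sk_step m (zs n)) (sk_step m z)) \<longlonglongrightarrow> 0"
  proof (rule tendstoI)
    fix e :: real assume e: "0 < e"
    define r where "r = e / 2"
    have r: "0 < r" using e by (simp add: r_def)
    have fin: "finite {k :: nat. real k \<le> real m * (1 / r)}"
    proof (rule finite_subset)
      show "{k :: nat. real k \<le> real m * (1 / r)} \<subseteq> {..nat \<lfloor>real m * (1 / r)\<rfloor>}" by (auto simp: le_nat_floor)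
    qed simp
    have "\<forall>\<^sub>F n in sequentially. \<forall>k\<in>{k. real k \<le> real m * (1 / r)}. dist (zs n k) (z k) < r"
      using fin by (intro eventually_ball_finite ballI tendstoD[OF coord] r)
    then show "\<forall>\<^sub>F n in sequentially. dist (sk_dist (sk_step m (zs n)) (sk_step m z)) 0 < e"
    proof (rule eventually_mono)
      fix n assume A: "\<forall>k\<in>{k. real k \<le> real m * (1 / r)}. dist (zs n k) (z k) < r"
      have "sk_dist (sk_step m (zs n)) (sk_step m z) \<le> r"
        by (rule sk_dist_step[OF r]) (use A in \<open>auto simp: dist_norm intro: less_imp_le\<close>)
      then show "dist (sk_dist (sk_step m (zs n)) (sk_step m z)) 0 < e"
        using e sk_dist_nonneg[of "sk_step m (zs n)" "sk_step m z"] by (simp add: dist_real_def r_def)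
    qed
  qed
  then show "((\<lambda>z. \<phi> (sk_step m z)) \<circ> zs) \<longlonglongrightarrow> \<phi> (sk_step m z)"
    unfolding o_def by (rule sk_continuousD[OF \<phi> sk_step_in_space[OF m] sk_step_in_space[OF m]])
qed

lemma sk_continuous_discretization:
  fixes x :: "real \<Rightarrow> 'b::real_normed_vector"
  assumes "sk_continuous \<phi>" "x \<in> skorohod_space"
  shows "(\<lambda>m. \<phi> (sk_step (Suc m) (\<lambda>j. x (real j / real (Suc m))))) \<longlonglongrightarrow> \<phi> x"
proof (rule sk_continuousD[OF assms(1,2) sk_step_in_space])
  have "cadlag x" using assms(2) by (simp add: skorohod_space_def)
  from LIMSEQ_Suc[OF sk_dist_discretization_tendsto[OF this]]
  show "(\<lambda>m. sk_dist (sk_step (Suc m) (\<lambda>j. x (real j / real (Suc m)))) x) \<longlonglongrightarrow> 0" .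
qed simp

lemma sk_step_functional_measurable:
  fixes \<phi> :: "(real \<Rightarrow> 'b::{real_normed_vector,second_countable_topology}) \<Rightarrow> real"
  assumes \<phi>: "sk_continuous \<phi>" and m: "0 < m" and \<zeta>: "\<And>j. \<zeta> j \<in> borel_measurable M"
  shows "(\<lambda>\<omega>. \<phi> (sk_step m (\<lambda>j. \<zeta> j \<omega>))) \<in> borel_measurable M"
proof -
  have "(\<lambda>\<omega> j. \<zeta> j \<omega>) \<in> borel_measurable M" by (rule measurable_coordinatewise_then_product) (rule \<zeta>)
  then show ?thesis
    by (rule measurable_compose[OF _ borel_measurable_continuous_onI[OF sk_continuous_sk_step[OF \<phi> m]]])
qed

text \<open>The functional is a pointwise limit of functions of the grid values, so measurability
  follows from that of the individual coordinates and the path space carries no sigma-algebra of its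
  own.\<close>

lemma sk_functional_measurable:
  fixes \<phi> :: "(real \<Rightarrow> 'b::{real_normed_vector,second_countable_topology}) \<Rightarrow> real"
  assumes \<phi>: "sk_continuous \<phi>" and p: "\<And>\<omega>. \<omega> \<in> space M \<Longrightarrow> p \<omega> \<in> skorohod_space"
    and meas: "\<And>t. 0 \<le> t \<Longrightarrow> (\<lambda>\<omega>. p \<omega> t) \<in> borel_measurable M"
  shows "(\<lambda>\<omega>. \<phi> (p \<omega>)) \<in> borel_measurable M"
proof (rule borel_measurable_LIMSEQ_real)
  show "(\<lambda>m. \<phi> (sk_step (Suc m) (\<lambda>j. p \<omega> (real j / real (Suc m))))) \<longlonglongrightarrow> \<phi> (p \<omega>)" if "\<omega> \<in> space M" for \<omega>
    by (rule sk_continuous_discretization[OF \<phi> p[OF that]])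
  show "(\<lambda>\<omega>. \<phi> (sk_step (Suc m) (\<lambda>j. p \<omega> (real j / real (Suc m))))) \<in> borel_measurable M" for m
    by (rule sk_step_functional_measurable[OF \<phi>]) (auto intro: meas)
qed

lemma cyl_bounded:
  assumes "cyl (F :: (nat \<Rightarrow> 'd::finite phase) \<Rightarrow> real)"
  shows "\<exists>C. \<forall>z. (\<forall>j. z j \<in> UNIV \<times> signs) \<longrightarrow> \<bar>F z\<bar> \<le> C"
  using assms
proof induction
  case (cyl_prod h n)
  have "\<exists>C. 0 \<le> C \<and> (\<forall>z\<in>UNIV \<times> signs. \<bar>h j z\<bar> \<le> C)" for j
    by (rule test_fun_bounded[OF cyl_prod[of j]]) blast
  then obtain C where C: "\<And>j. 0 \<le> C j \<and> (\<forall>z\<in>UNIV \<times> signs. \<bar>h j z\<bar> \<le> C j)" by metis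
  show ?case
  proof (intro exI[of _ "\<Prod>j\<le>n. C j"] allI impI)
    fix z :: "nat \<Rightarrow> 'd phase" assume z: "\<forall>j. z j \<in> UNIV \<times> signs"
    have "\<bar>\<Prod>j\<le>n. h j (z j)\<bar> = (\<Prod>j\<le>n. \<bar>h j (z j)\<bar>)" by (rule abs_prod)
    also have "\<dots> \<le> (\<Prod>j\<le>n. C j)"
    proof (rule prod_mono)
      fix j
      have "\<bar>h j (z j)\<bar> \<le> C j" by (rule bspec[OF conjunct2[OF C] spec[OF z]])
      then show "0 \<le> \<bar>h j (z j)\<bar> \<and> \<bar>h j (z j)\<bar> \<le> C j" by simp
    qed
    finally show "\<bar>\<Prod>j\<le>n. h j (z j)\<bar> \<le> (\<Prod>j\<le>n. C j)" .
  qed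
next
  case (cyl_add F G)
  then obtain C D where C: "\<forall>z. (\<forall>j. z j \<in> UNIV \<times> signs) \<longrightarrow> \<bar>F z\<bar> \<le> C"
    and D: "\<forall>z. (\<forall>j. z j \<in> UNIV \<times> signs) \<longrightarrow> \<bar>G z\<bar> \<le> D" by (elim exE)
  show ?case
  proof (intro exI[of _ "C + D"] allI impI)
    fix z :: "nat \<Rightarrow> 'd phase" assume z: "\<forall>j. z j \<in> UNIV \<times> signs"
    have "\<bar>F z\<bar> \<le> C" "\<bar>G z\<bar> \<le> D" using C[rule_format, of z] D[rule_format, of z] z by auto
    then show "\<bar>F z + G z\<bar> \<le> C + D" by linarith
  qed
qed

lemma cyl_measurable:
  assumes "cyl (F :: (nat \<Rightarrow> 'd::finite phase) \<Rightarrow> real)" and \<zeta>: "\<And>j. \<zeta> j \<in> M \<rightarrow>\<^sub>M zz_state_space"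
  shows "(\<lambda>\<omega>. F (\<lambda>j. \<zeta> j \<omega>)) \<in> borel_measurable M"
  using assms(1)
proof induction
  case (cyl_prod h n)
  have "(\<lambda>\<omega>. h j (\<zeta> j \<omega>)) \<in> borel_measurable M" for j
    using measurable_compose[OF \<zeta>] test_fun_bounded_borel[OF cyl_prod[of j]] unfolding bounded_borel_def by blast
  then show ?case by (intro borel_measurable_prod)
next
  case (cyl_add F G)
  then show ?case by (intro borel_measurable_add)
qed

lemma cyl_integrable:
  assumes M: "prob_space M" and F: "cyl (F :: (nat \<Rightarrow> 'd::finite phase) \<Rightarrow> real)"
    and \<zeta>: "\<And>j. \<zeta> j \<in> M \<rightarrow>\<^sub>M zz_state_space"
  shows "integrable M (\<lambda>\<omega>. F (\<lambda>j. \<zeta> j \<omega>))"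
proof -
  obtain C where C: "\<forall>z. (\<forall>j. z j \<in> UNIV \<times> signs) \<longrightarrow> \<bar>F z\<bar> \<le> C" using cyl_bounded[OF F] by (elim exE)
  show ?thesis
  proof (rule bounded_integrable[OF M cyl_measurable[OF F \<zeta>]])
    fix \<omega> assume "\<omega> \<in> space M"
    then have "\<zeta> j \<omega> \<in> UNIV \<times> signs" for j using measurable_space[OF \<zeta>] by (simp add: space_zz)
    then show "\<bar>F (\<lambda>j. \<zeta> j \<omega>)\<bar> \<le> C" using C by simp
  qed
qed

lemma abs_integral_diff_le_AE:
  fixes f g :: "'a \<Rightarrow> real"
  assumes "prob_space M" "integrable M f" "integrable M g" "AE \<omega> in M. \<bar>f \<omega> - g \<omega>\<bar> \<le> b"
  shows "\<bar>(\<integral>\<omega>. f \<omega> \<partial>M) - (\<integral>\<omega>. g \<omega> \<partial>M)\<bar> \<le> b"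
proof -
  interpret prob_space M by fact
  have "\<bar>(\<integral>\<omega>. f \<omega> \<partial>M) - (\<integral>\<omega>. g \<omega> \<partial>M)\<bar> = \<bar>\<integral>\<omega>. f \<omega> - g \<omega> \<partial>M\<bar>" using assms by simp
  also have "\<dots> \<le> (\<integral>\<omega>. \<bar>f \<omega> - g \<omega>\<bar> \<partial>M)" by (rule integral_abs_bound)
  also have "\<dots> \<le> (\<integral>\<omega>. b \<partial>M)" using assms by (intro integral_mono_AE) auto
  finally show ?thesis using prob_space by simp
qed

section \<open>Moments of the walk and confinement of the process\<close>

context zz_walk
begin

lemma walk_pos_state: "walk_pos n \<in> M \<rightarrow>\<^sub>M zz_state_space"
  unfolding zz_state_space_def
  by (rule measurable_restrict_space2[OF _ walk_pos_measurable]) (use walk_pos_in in auto)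

lemma walk_fdd:
  assumes h: "\<And>j. test_fun (h j)" and K: "\<And>j f. test_fun f \<Longrightarrow> test_fun ((zz_op H \<epsilon> ^^ (n (Suc j) - n j)) f)"
    and n: "\<And>j. n j \<le> n (Suc j)" and n0: "n 0 = 0"
  shows "(\<integral>\<omega>. (\<Prod>j\<le>l. h j (walk_pos (n j) \<omega>)) \<partial>M) =
    grid_moment (\<lambda>j. zz_op H \<epsilon> ^^ (n (Suc j) - n j)) h l 0 (\<epsilon> *\<^sub>R real_vec x0, real_vec v0)"
proof -
  let ?K = "\<lambda>j. zz_op H \<epsilon> ^^ (n (Suc j) - n j)"
  have mono: "n j \<le> n k" if "j \<le> k" for j k using n that by (rule lift_Suc_mono_le)
  have "(\<integral>\<omega>. (\<Prod>j\<le>l. h j (walk_pos (n j) \<omega>)) \<partial>M) = (\<integral>\<omega>. grid_moment ?K h l 0 (walk_pos (n 0) \<omega>) \<partial>M)"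
  proof (rule expectation_grid_moment[where \<zeta>="\<lambda>j. walk_pos (n j)", OF K _ h])
    fix l and h :: "nat \<Rightarrow> 'd phase \<Rightarrow> real" and f :: "'d phase \<Rightarrow> real"
    let ?G = "\<lambda>\<tau>. \<Prod>j\<le>l. h j (scale (\<tau> (n j)))"
    have "adapted (n l) ?G"
      unfolding adapted_def using mono by (auto intro!: prod.cong)
    from walk_step[OF this, of f "n (Suc l) - n l"] n[of l]
    show "(\<integral>\<omega>. (\<Prod>j\<le>l. h j (walk_pos (n j) \<omega>)) * f (walk_pos (n (Suc l)) \<omega>) \<partial>M) =
      (\<integral>\<omega>. (\<Prod>j\<le>l. h j (walk_pos (n j) \<omega>)) * ?K l f (walk_pos (n l) \<omega>) \<partial>M)"
      by (simp add: walk_pos_def)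
  qed
  also have "\<dots> = (\<integral>\<omega>. grid_moment ?K h l 0 (\<epsilon> *\<^sub>R real_vec x0, real_vec v0) \<partial>M)"
  proof (rule integral_cong_AE)
    have "adapted 0 (\<lambda>\<tau>. grid_moment ?K h l 0 (scale (\<tau> 0)))" by (simp add: adapted_def)
    from adapted_measurable[OF this countable_states]
    show "(\<lambda>\<omega>. grid_moment ?K h l 0 (walk_pos (n 0) \<omega>)) \<in> borel_measurable M" by (simp add: walk_pos_def n0)
    show "AE \<omega> in M. grid_moment ?K h l 0 (walk_pos (n 0) \<omega>) = grid_moment ?K h l 0 (\<epsilon> *\<^sub>R real_vec x0, real_vec v0)"
      using init0 by eventually_elim (simp add: n0 walk_pos_def scale_def)
  qed simp
  finally show ?thesis using prob_space by simp
qed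

end

context zz_process
begin

text \<open>The speed bound is inherited from the walk. At the starting point every power of the
  walk operator up to time t sends the plateau function to 1, hence so does the semigroup; an
  expectation 1 of a function with values in [0, 1] means that it equals 1 almost surely.\<close>

lemma process_support:
  assumes init: "AE \<omega> in M. Z 0 \<omega> = (x, v)" and v: "v \<in> signs" and t: "0 \<le> t"
  shows "AE \<omega> in M. norm (fst (Z t \<omega>)) \<le> norm x + real CARD('d) * t"
proof -
  interpret prob_space M by (rule M_prob)
  define R where "R = norm x + real CARD('d) * t"
  have R: "0 \<le> R" using t by (simp add: R_def)
  define f :: "'d phase \<Rightarrow> real" where "f z = plateau R (fst z)" for z
  have f: "test_fun f" unfolding f_def[abs_def] by (rule test_fun_plateau[OF R])
  have z: "(x, v) \<in> UNIV \<times> signs" using v by simp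
  have one: "PP t f (x, v) = 1"
  proof -
    have "\<bar>1 - PP t f (x, v)\<bar> \<le> 0"
    proof (rule field_le_epsilon)
      fix e :: real assume e: "0 < e"
      have ev: "\<forall>\<^sub>F \<epsilon> in at_right 0. 0 < \<epsilon> \<and> (\<forall>z\<in>UNIV \<times> signs. \<bar>(zz_op H \<epsilon> ^^ nat \<lfloor>t / \<epsilon>\<rfloor>) f z - PP t f z\<bar> \<le> e)"
        by (intro eventually_conj eventually_at_right_less test_fun_zz_op_tendsto[OF f t floor_div_tendsto[OF t] e])
      obtain \<epsilon> :: real where \<epsilon>: "0 < \<epsilon>" "\<forall>z\<in>UNIV \<times> signs. \<bar>(zz_op H \<epsilon> ^^ nat \<lfloor>t / \<epsilon>\<rfloor>) f z - PP t f z\<bar> \<le> e"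
        using eventually_happens'[OF trivial_limit_at_right_real ev] by (elim exE conjE) (rule that; assumption)
      have "0 \<le> t / \<epsilon>" using t \<epsilon> by simp
      then have "real (nat \<lfloor>t / \<epsilon>\<rfloor>) \<le> t / \<epsilon>" by (rule of_nat_floor)
      then have "real (nat \<lfloor>t / \<epsilon>\<rfloor>) * \<epsilon> \<le> t" using \<epsilon>(1) by (simp add: pos_le_divide_eq)
      then have "real CARD('d) * (real (nat \<lfloor>t / \<epsilon>\<rfloor>) * \<epsilon>) \<le> real CARD('d) * t" by (intro mult_left_mono) auto
      then have "norm x + real (nat \<lfloor>t / \<epsilon>\<rfloor>) * (real CARD('d) * \<epsilon>) \<le> R" by (simp add: R_def mult_ac)
      then have "(zz_op H \<epsilon> ^^ nat \<lfloor>t / \<epsilon>\<rfloor>) f (x, v) = 1"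
        by (intro zz_op_funpow_eq_one[OF \<epsilon>(1) _ v]) (auto simp: f_def plateau_def)
      then show "\<bar>1 - PP t f (x, v)\<bar> \<le> 0 + e" using bspec[OF \<epsilon>(2) z] by simp
    qed
    then show ?thesis by simp
  qed
  have fm: "(\<lambda>\<omega>. g (Z u \<omega>)) \<in> borel_measurable M" if "0 \<le> u" "bounded_borel g" for u g
    using measurable_compose[OF Z_meas[OF that(1)]] that(2) unfolding bounded_borel_def by blast
  have f1: "0 \<le> f z" "f z \<le> 1" for z by (simp_all add: f_def plateau_def)
  have fi: "integrable M (\<lambda>\<omega>. f (Z t \<omega>))"
    by (rule bounded_integrable[OF M_prob fm[OF t test_fun_bounded_borel[OF f]], where C=1]) (use f1 in simp)
  have "(\<integral>\<omega>. 1 * f (Z (0 + t) \<omega>) \<partial>M) = (\<integral>\<omega>. 1 * PP t f (Z 0 \<omega>) \<partial>M)"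
    by (rule markov_step[OF _ t _ _ test_fun_bounded_borel[OF f], where C=1]) auto
  also have "\<dots> = (\<integral>\<omega>. 1 \<partial>M)"
  proof (rule integral_cong_AE)
    show "(\<lambda>\<omega>. 1 * PP t f (Z 0 \<omega>)) \<in> borel_measurable M" using fm[OF _ PP_bounded_borel[OF test_fun_bounded_borel[OF f] t], of 0] by simp
    show "AE \<omega> in M. 1 * PP t f (Z 0 \<omega>) = 1" using init by eventually_elim (simp add: one)
  qed simp
  finally have "(\<integral>\<omega>. f (Z t \<omega>) \<partial>M) = 1" using prob_space by simp
  then have "(\<integral>\<omega>. 1 - f (Z t \<omega>) \<partial>M) = 0" using fi prob_space by simp
  then have "AE \<omega> in M. 1 - f (Z t \<omega>) = 0"
    using fi f1 by (subst (asm) integral_nonneg_eq_0_iff_AE) auto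
  then show ?thesis
    by eventually_elim (simp add: f_def plateau_def R_def max_def min_def split: if_splits)
qed

end


section \<open>Convergence in law\<close>

locale zz_limit = zz_process H P N Z
  for H :: "(real, 'd::{finite,linorder}) vec \<Rightarrow> real" and P and N :: "'b measure"
    and Z :: "real \<Rightarrow> 'b \<Rightarrow> 'd::{finite,linorder} phase" +
  fixes M :: "real \<Rightarrow> 'a measure" and X V :: "real \<Rightarrow> nat \<Rightarrow> 'a \<Rightarrow> (int, 'd::{finite,linorder}) vec"
    and x0 :: "real \<Rightarrow> (int, 'd::{finite,linorder}) vec" and v0 :: "(int, 'd::{finite,linorder}) vec"
    and xstar :: "(real, 'd::{finite,linorder}) vec"
  assumes v0: "v0 \<in> signs"
    and walk: "\<And>\<epsilon>. \<epsilon> > 0 \<Longrightarrow> zigzag_walk (M \<epsilon>) (\<lambda>x. H (\<epsilon> *\<^sub>R real_vec x)) (X \<epsilon>) (V \<epsilon>)"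
    and init_walk: "\<And>\<epsilon>. \<epsilon> > 0 \<Longrightarrow> AE \<omega> in M \<epsilon>. X \<epsilon> 0 \<omega> = x0 \<epsilon> \<and> V \<epsilon> 0 \<omega> = v0"
    and x0_lim: "((\<lambda>\<epsilon>. \<epsilon> *\<^sub>R real_vec (x0 \<epsilon>)) \<longlongrightarrow> xstar) (at_right 0)"
    and init_process: "AE \<omega> in N. Z 0 \<omega> = (xstar, real_vec v0)"
    and cadlag_Z: "\<And>\<omega>. \<omega> \<in> space N \<Longrightarrow> cadlag (\<lambda>t. Z t \<omega>)"
begin

lemma zz_walk: "0 < \<epsilon> \<Longrightarrow> zz_walk H \<epsilon> (M \<epsilon>) (X \<epsilon>) (V \<epsilon>) (x0 \<epsilon>) v0"
  by unfold_locales (use C2 walk init_walk v0 in auto)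

text \<open>The constants of \<open>zz_walk\<close> belong to one fixed \<epsilon>; limits in
  \<epsilon> need versions that take it as an argument.\<close>

definition wpos :: "real \<Rightarrow> nat \<Rightarrow> 'a \<Rightarrow> 'd phase" where
  "wpos \<epsilon> n \<omega> = (\<epsilon> *\<^sub>R real_vec (X \<epsilon> n \<omega>), real_vec (V \<epsilon> n \<omega>))"

definition wpath :: "real \<Rightarrow> 'a \<Rightarrow> real \<Rightarrow> 'd phase" where
  "wpath \<epsilon> \<omega> = (\<lambda>t\<in>{0..}. wpos \<epsilon> (nat \<lfloor>t / \<epsilon>\<rfloor>) \<omega>)"

definition zpath :: "'b \<Rightarrow> real \<Rightarrow> 'd phase" where
  "zpath \<omega> = (\<lambda>t\<in>{0..}. Z t \<omega>)"

lemma walk_pos_eq: "0 < \<epsilon> \<Longrightarrow> zz_walk.walk_pos \<epsilon> (X \<epsilon>) (V \<epsilon>) = wpos \<epsilon>"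
  by (intro ext) (simp add: zz_walk.walk_pos_def[OF zz_walk] zz_walk.scale_def[OF zz_walk] wpos_def)

lemma walk_path_eq: "0 < \<epsilon> \<Longrightarrow> zz_walk.walk_path \<epsilon> (X \<epsilon>) (V \<epsilon>) = wpath \<epsilon>"
  by (intro ext) (simp add: zz_walk.walk_path_def[OF zz_walk] walk_pos_eq wpath_def)

text \<open>Two limits are combined: the operators converge uniformly in the state, which is
  necessary because the start of the walk moves with \<epsilon>, and the limiting moment is
  Lipschitz in the position, which takes care of the start itself.\<close>

lemma grid_prod_tendsto:
  assumes h: "\<And>j. test_fun (h j)" and m: "0 < m"
  shows "((\<lambda>\<epsilon>. \<integral>\<omega>. (\<Prod>j\<le>l. h j (wpath \<epsilon> \<omega> (real j / real m))) \<partial>M \<epsilon>) \<longlongrightarrow>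
    (\<integral>\<omega>. (\<Prod>j\<le>l. h j (Z (real j / real m) \<omega>)) \<partial>N)) (at_right 0)"
proof -
  define n where "n \<epsilon> j = nat \<lfloor>(real j / real m) / \<epsilon>\<rfloor>" for \<epsilon> :: real and j
  \<comment> \<open>The number of walk steps between consecutive grid times. It may vary with j
    because of rounding, but after multiplication by \<epsilon> it tends to 1/m for each j.\<close>
  define \<Delta> where "\<Delta> \<epsilon> j = n \<epsilon> (Suc j) - n \<epsilon> j" for \<epsilon> j
  let ?z = "\<lambda>\<epsilon>. ((\<epsilon> *\<^sub>R real_vec (x0 \<epsilon>), real_vec v0) :: 'd phase)"
  let ?zstar = "(xstar, real_vec v0) :: 'd phase"
  let ?K = "\<lambda>j::nat. PP (1 / real m)"
  have sv: "real_vec v0 \<in> (signs :: (real, 'd) vec set)" using v0 by (simp add: real_vec_signs)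
  have m1: "0 \<le> 1 / real m" by simp
  have nmono: "n \<epsilon> j \<le> n \<epsilon> (Suc j)" if "0 < \<epsilon>" for \<epsilon> j
    unfolding n_def using that by (intro nat_mono floor_mono divide_right_mono) auto
  have \<Delta>lim: "((\<lambda>\<epsilon>. real (\<Delta> \<epsilon> j) * \<epsilon>) \<longlongrightarrow> 1 / real m) (at_right 0)" for j
  proof -
    have nn: "0 \<le> real j / real m" for j by simp
    have "((\<lambda>\<epsilon>. real (n \<epsilon> (Suc j)) * \<epsilon> - real (n \<epsilon> j) * \<epsilon>) \<longlongrightarrow> real (Suc j) / real m - real j / real m) (at_right 0)"
      unfolding n_def by (intro tendsto_diff floor_div_tendsto nn)
    moreover have "real (Suc j) / real m - real j / real m = 1 / real m" by (simp add: diff_divide_distrib[symmetric])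
    moreover have "\<forall>\<^sub>F \<epsilon> in at_right 0. real (n \<epsilon> (Suc j)) * \<epsilon> - real (n \<epsilon> j) * \<epsilon> = real (\<Delta> \<epsilon> j) * \<epsilon>"
      using eventually_at_right_less[of "0::real"]
      by (rule eventually_mono) (simp add: \<Delta>_def of_nat_diff[OF nmono] left_diff_distrib)
    ultimately show ?thesis using Lim_transform_eventually by (simp only:)
  qed
  have walk_eq: "(\<integral>\<omega>. (\<Prod>j\<le>l. h j (wpath \<epsilon> \<omega> (real j / real m))) \<partial>M \<epsilon>) = grid_moment (\<lambda>j. zz_op H \<epsilon> ^^ \<Delta> \<epsilon> j) h l 0 (?z \<epsilon>)"
    if \<epsilon>: "0 < \<epsilon>" "\<epsilon> \<le> 1" for \<epsilon>
  proof -
    interpret w: zz_walk H \<epsilon> "M \<epsilon>" "X \<epsilon>" "V \<epsilon>" "x0 \<epsilon>" v0 by (rule zz_walk[OF \<epsilon>(1)])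
    have "(\<integral>\<omega>. (\<Prod>j\<le>l. h j (w.walk_pos (n \<epsilon> j) \<omega>)) \<partial>M \<epsilon>) = grid_moment (\<lambda>j. zz_op H \<epsilon> ^^ (n \<epsilon> (Suc j) - n \<epsilon> j)) h l 0 (?z \<epsilon>)"
      by (rule w.walk_fdd[where n="n \<epsilon>", OF h test_fun_zz_op_funpow[OF _ \<epsilon>] nmono[OF \<epsilon>(1)]]) (simp_all add: n_def)
    then show ?thesis by (simp add: \<Delta>_def[abs_def] walk_pos_eq[OF \<epsilon>(1)] wpath_def n_def)
  qed
  have proc_eq: "(\<integral>\<omega>. (\<Prod>j\<le>l. h j (Z (real j / real m) \<omega>)) \<partial>N) = grid_moment ?K h l 0 ?zstar"
  proof -
    interpret prob_space N by (rule M_prob)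
    have u: "test_fun (grid_moment ?K h l 0)" by (rule grid_moment_test_fun[OF test_fun_PP[OF _ m1] h])
    have "(\<integral>\<omega>. grid_moment ?K h l 0 (Z 0 \<omega>) \<partial>N) = (\<integral>\<omega>. grid_moment ?K h l 0 ?zstar \<partial>N)"
    proof (rule integral_cong_AE)
      show "(\<lambda>\<omega>. grid_moment ?K h l 0 (Z 0 \<omega>)) \<in> borel_measurable N"
        using measurable_compose[OF Z_meas[OF order_refl]] test_fun_bounded_borel[OF u] unfolding bounded_borel_def by blast
      show "AE \<omega> in N. grid_moment ?K h l 0 (Z 0 \<omega>) = grid_moment ?K h l 0 ?zstar" using init_process by eventually_elim simp
    qed simp
    then show ?thesis using process_fdd[where n=l and h=h, OF h m] prob_space by simp
  qed
  have u: "test_fun (grid_moment ?K h l 0)" by (rule grid_moment_test_fun[OF test_fun_PP[OF _ m1] h])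
  obtain C L where CL: "0 \<le> C" "\<And>z. z \<in> UNIV \<times> signs \<Longrightarrow> \<bar>grid_moment ?K h l 0 z\<bar> \<le> C"
    "\<And>x y v. v \<in> signs \<Longrightarrow> \<bar>grid_moment ?K h l 0 (x, v) - grid_moment ?K h l 0 (y, v)\<bar> \<le> L * norm (x - y)"
    by (rule test_fun_bounded[OF u]) (rule that; assumption)
  have lim1: "((\<lambda>\<epsilon>. grid_moment ?K h l 0 (?z \<epsilon>) - grid_moment ?K h l 0 ?zstar) \<longlongrightarrow> 0) (at_right 0)"
  proof (rule Lim_null_comparison)
    show "\<forall>\<^sub>F \<epsilon> in at_right 0. norm (grid_moment ?K h l 0 (?z \<epsilon>) - grid_moment ?K h l 0 ?zstar) \<le> L * norm (\<epsilon> *\<^sub>R real_vec (x0 \<epsilon>) - xstar)"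
      by (rule always_eventually) (use CL(3)[OF sv] in simp)
    show "((\<lambda>\<epsilon>. L * norm (\<epsilon> *\<^sub>R real_vec (x0 \<epsilon>) - xstar)) \<longlongrightarrow> 0) (at_right 0)"
      by (rule tendsto_mult_right_zero[OF tendsto_norm_zero[OF LIM_zero[OF x0_lim]]])
  qed
  have lim2: "((\<lambda>\<epsilon>. grid_moment (\<lambda>j. zz_op H \<epsilon> ^^ \<Delta> \<epsilon> j) h l 0 (?z \<epsilon>) - grid_moment ?K h l 0 (?z \<epsilon>)) \<longlongrightarrow> 0) (at_right 0)"
  proof (rule tendstoI)
    fix e :: real assume e: "0 < e"
    have e2: "0 < e / 2" using e by simp
    from grid_moment_tendsto[where t="\<lambda>_. 1 / real m" and n=\<Delta> and l=l and k=0, OF h m1 \<Delta>lim e2]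
    show "\<forall>\<^sub>F \<epsilon> in at_right 0. dist (grid_moment (\<lambda>j. zz_op H \<epsilon> ^^ \<Delta> \<epsilon> j) h l 0 (?z \<epsilon>) - grid_moment ?K h l 0 (?z \<epsilon>)) 0 < e"
    proof (rule eventually_mono)
      fix \<epsilon> assume A: "\<forall>z\<in>UNIV \<times> signs. \<bar>grid_moment (\<lambda>j. zz_op H \<epsilon> ^^ \<Delta> \<epsilon> j) h l 0 z - grid_moment ?K h l 0 z\<bar> \<le> e / 2"
      have "?z \<epsilon> \<in> UNIV \<times> signs" using sv by simp
      from bspec[OF A this] show "dist (grid_moment (\<lambda>j. zz_op H \<epsilon> ^^ \<Delta> \<epsilon> j) h l 0 (?z \<epsilon>) - grid_moment ?K h l 0 (?z \<epsilon>)) 0 < e"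
        using e by (simp add: dist_real_def)
    qed
  qed
  have "((\<lambda>\<epsilon>. grid_moment (\<lambda>j. zz_op H \<epsilon> ^^ \<Delta> \<epsilon> j) h l 0 (?z \<epsilon>)) \<longlongrightarrow> grid_moment ?K h l 0 ?zstar) (at_right 0)"
    using tendsto_add[OF lim2 lim1] by (simp add: LIM_zero_iff)
  moreover have "\<forall>\<^sub>F \<epsilon> in at_right 0. grid_moment (\<lambda>j. zz_op H \<epsilon> ^^ \<Delta> \<epsilon> j) h l 0 (?z \<epsilon>) =
      (\<integral>\<omega>. (\<Prod>j\<le>l. h j (wpath \<epsilon> \<omega> (real j / real m))) \<partial>M \<epsilon>)"
    by (rule eventually_at_rightI[of 0 1]) (auto simp: walk_eq)
  ultimately show ?thesis unfolding proc_eq by (rule Lim_transform_eventually)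
qed

lemma wpos_state: "0 < \<epsilon> \<Longrightarrow> wpos \<epsilon> n \<in> M \<epsilon> \<rightarrow>\<^sub>M zz_state_space"
  using zz_walk.walk_pos_state[OF zz_walk] by (simp add: walk_pos_eq)

lemma wpath_state: "0 < \<epsilon> \<Longrightarrow> 0 \<le> t \<Longrightarrow> (\<lambda>\<omega>. wpath \<epsilon> \<omega> t) \<in> M \<epsilon> \<rightarrow>\<^sub>M zz_state_space"
  using wpos_state by (simp add: wpath_def)

lemma M_prob_space: "0 < \<epsilon> \<Longrightarrow> prob_space (M \<epsilon>)"
  using walk by (simp add: zigzag_walk_def markov_chain_def)

lemma grid_cyl_tendsto:
  assumes F: "cyl F" and m: "0 < m"
  shows "((\<lambda>\<epsilon>. \<integral>\<omega>. F (\<lambda>j. wpath \<epsilon> \<omega> (real j / real m)) \<partial>M \<epsilon>) \<longlongrightarrow>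
    (\<integral>\<omega>. F (\<lambda>j. Z (real j / real m) \<omega>) \<partial>N)) (at_right 0)"
  using F
proof induction
  case (cyl_prod h n)
  then show ?case by (intro grid_prod_tendsto m)
next
  case (cyl_add F G)
  have wi: "integrable (M \<epsilon>) (\<lambda>\<omega>. F (\<lambda>j. wpath \<epsilon> \<omega> (real j / real m)))" if "cyl F" "0 < \<epsilon>" for F \<epsilon>
    by (rule cyl_integrable[OF M_prob_space[OF that(2)] that(1)]) (rule wpath_state[OF that(2)], simp)
  have zi: "integrable N (\<lambda>\<omega>. F (\<lambda>j. Z (real j / real m) \<omega>))" if "cyl F" for F
    by (rule cyl_integrable[OF M_prob that]) (rule Z_meas, simp)
  have "\<forall>\<^sub>F \<epsilon> in at_right 0. (\<integral>\<omega>. F (\<lambda>j. wpath \<epsilon> \<omega> (real j / real m)) \<partial>M \<epsilon>) + (\<integral>\<omega>. G (\<lambda>j. wpath \<epsilon> \<omega> (real j / real m)) \<partial>M \<epsilon>)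
      = (\<integral>\<omega>. F (\<lambda>j. wpath \<epsilon> \<omega> (real j / real m)) + G (\<lambda>j. wpath \<epsilon> \<omega> (real j / real m)) \<partial>M \<epsilon>)"
    using eventually_at_right_less[of "0::real"]
    by (rule eventually_mono) (simp add: wi cyl_add.hyps)
  with tendsto_add[OF cyl_add.IH]
  have "((\<lambda>\<epsilon>. \<integral>\<omega>. F (\<lambda>j. wpath \<epsilon> \<omega> (real j / real m)) + G (\<lambda>j. wpath \<epsilon> \<omega> (real j / real m)) \<partial>M \<epsilon>) \<longlongrightarrow>
    (\<integral>\<omega>. F (\<lambda>j. Z (real j / real m) \<omega>) \<partial>N) + (\<integral>\<omega>. G (\<lambda>j. Z (real j / real m) \<omega>) \<partial>N)) (at_right 0)"
    by (rule Lim_transform_eventually)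
  then show ?case by (simp add: zi cyl_add.hyps)
qed

lemma x0_bounded: "\<forall>\<^sub>F \<epsilon> in at_right 0. norm (\<epsilon> *\<^sub>R real_vec (x0 \<epsilon>)) \<le> norm xstar + 1"
  using tendstoD[OF x0_lim zero_less_one]
proof (rule eventually_mono)
  fix \<epsilon> assume "dist (\<epsilon> *\<^sub>R real_vec (x0 \<epsilon>)) xstar < 1"
  then show "norm (\<epsilon> *\<^sub>R real_vec (x0 \<epsilon>)) \<le> norm xstar + 1"
    using norm_triangle_sub[of "\<epsilon> *\<^sub>R real_vec (x0 \<epsilon>)" xstar] by (simp add: dist_norm)
qed

text \<open>Almost surely both grid sequences lie in one compact box, on which the functional is
  uniformly close to a cylinder function; boundedness outside the box is needed only for
  integrability.\<close>

lemma grid_tendsto: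
  fixes \<Psi> :: "(nat \<Rightarrow> 'd phase) \<Rightarrow> real"
  assumes \<Psi>: "continuous_on UNIV \<Psi>" and b: "\<And>z. \<bar>\<Psi> z\<bar> \<le> C" and m: "0 < m"
  shows "((\<lambda>\<epsilon>. \<integral>\<omega>. \<Psi> (\<lambda>j. wpath \<epsilon> \<omega> (real j / real m)) \<partial>M \<epsilon>) \<longlongrightarrow>
    (\<integral>\<omega>. \<Psi> (\<lambda>j. Z (real j / real m) \<omega>) \<partial>N)) (at_right 0)"
proof (rule tendstoI)
  fix e :: real assume e: "0 < e"
  have e3: "0 < e / 3" using e by simp
  let ?D = "real CARD('d)"
  \<comment> \<open>Starting radius plus speed times time. The summand 1 leaves room for the
    starting points of the walk, which are only close to \<open>xstar\<close>.\<close>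
  define r where "r j = norm xstar + 1 + ?D * (real j / real m)" for j
  have sv: "real_vec v0 \<in> (signs :: (real, 'd) vec set)" using v0 by (simp add: real_vec_signs)
  obtain F where F: "cyl F" "\<forall>z\<in>box r. \<bar>\<Psi> z - F z\<bar> < e / 3"
    using cyl_dense[OF continuous_on_subset[OF \<Psi> subset_UNIV] e3, of r] by blast
  have meas: "(\<lambda>\<omega>. \<Psi> (\<lambda>j. \<zeta> j \<omega>)) \<in> borel_measurable M'" if \<zeta>: "\<And>j. \<zeta> j \<in> M' \<rightarrow>\<^sub>M zz_state_space" for M' and \<zeta> :: "nat \<Rightarrow> 'c \<Rightarrow> 'd phase"
  proof -
    have "\<zeta> j \<in> borel_measurable M'" for j
      using \<zeta>[of j] unfolding zz_state_space_def measurable_restrict_space2_iff by blast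
    then have "(\<lambda>\<omega> j. \<zeta> j \<omega>) \<in> borel_measurable M'" by (rule measurable_coordinatewise_then_product)
    then show ?thesis by (rule measurable_compose[OF _ borel_measurable_continuous_onI[OF \<Psi>]])
  qed
  have close: "\<bar>(\<integral>\<omega>. \<Psi> (\<lambda>j. \<zeta> j \<omega>) \<partial>M') - (\<integral>\<omega>. F (\<lambda>j. \<zeta> j \<omega>) \<partial>M')\<bar> \<le> e / 3"
    if M': "prob_space M'" and \<zeta>: "\<And>j. \<zeta> j \<in> M' \<rightarrow>\<^sub>M zz_state_space" and box: "AE \<omega> in M'. (\<lambda>j. \<zeta> j \<omega>) \<in> box r"
    for M' and \<zeta> :: "nat \<Rightarrow> 'c \<Rightarrow> 'd phase"
  proof (rule abs_integral_diff_le_AE[OF M' _ cyl_integrable[OF M' F(1) \<zeta>]])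
    show "integrable M' (\<lambda>\<omega>. \<Psi> (\<lambda>j. \<zeta> j \<omega>))" by (rule bounded_integrable[OF M' meas[OF \<zeta>] b])
    show "AE \<omega> in M'. \<bar>\<Psi> (\<lambda>j. \<zeta> j \<omega>) - F (\<lambda>j. \<zeta> j \<omega>)\<bar> \<le> e / 3"
      using box by eventually_elim (use F(2) in \<open>auto intro: less_imp_le\<close>)
  qed
  have wbox: "AE \<omega> in M \<epsilon>. (\<lambda>j. wpath \<epsilon> \<omega> (real j / real m)) \<in> box r"
    if \<epsilon>: "0 < \<epsilon>" and x0: "norm (\<epsilon> *\<^sub>R real_vec (x0 \<epsilon>)) \<le> norm xstar + 1" for \<epsilon>
  proof -
    interpret w: zz_walk H \<epsilon> "M \<epsilon>" "X \<epsilon>" "V \<epsilon>" "x0 \<epsilon>" v0 by (rule zz_walk[OF \<epsilon>])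
    show ?thesis using w.AE_regular
    proof (rule AE_mp, intro AE_I2 impI)
      fix \<omega> assume \<omega>: "\<omega> \<in> space (M \<epsilon>)" "w.regular \<omega>"
      have "norm (fst (wpath \<epsilon> \<omega> (real j / real m))) \<le> r j" for j
      proof -
        define n where "n = nat \<lfloor>(real j / real m) / \<epsilon>\<rfloor>"
        have "real n \<le> (real j / real m) / \<epsilon>"
          unfolding n_def using \<epsilon> by (intro of_nat_floor divide_nonneg_pos divide_nonneg_nonneg) auto
        then have "real n * \<epsilon> \<le> real j / real m" using \<epsilon> by (simp only: pos_le_divide_eq)
        then have "?D * (real n * \<epsilon>) \<le> ?D * (real j / real m)" by (rule mult_left_mono) simp
        then have "norm (\<epsilon> *\<^sub>R real_vec (x0 \<epsilon>)) + real n * (\<epsilon> * ?D) \<le> r j"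
          unfolding r_def using add_mono[OF x0] by (simp only: mult.assoc mult.commute mult.left_commute)
        with w.walk_bound[OF \<omega>(2,1), of n] show ?thesis
          by (simp add: walk_pos_eq[OF \<epsilon>] wpath_def n_def)
      qed
      moreover have "snd (wpath \<epsilon> \<omega> (real j / real m)) \<in> signs" for j
        using w.walk_pos_in[OF \<omega>(1), of "nat \<lfloor>(real j / real m) / \<epsilon>\<rfloor>"]
        by (simp add: walk_pos_eq[OF \<epsilon>] wpath_def mem_Times_iff)
      ultimately show "(\<lambda>j. wpath \<epsilon> \<omega> (real j / real m)) \<in> box r" by (simp add: box_def)
    qed
  qed
  have zbox: "AE \<omega> in N. (\<lambda>j. Z (real j / real m) \<omega>) \<in> box r"
  proof -
    have "AE \<omega> in N. norm (fst (Z (real j / real m) \<omega>)) \<le> norm xstar + ?D * (real j / real m)" for j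
      by (rule process_support[OF init_process sv]) simp
    then have "AE \<omega> in N. \<forall>j. norm (fst (Z (real j / real m) \<omega>)) \<le> norm xstar + ?D * (real j / real m)"
      by (simp only: AE_all_countable) simp
    then show ?thesis
    proof (rule AE_mp, intro AE_I2 impI)
      fix \<omega> assume \<omega>: "\<omega> \<in> space N" and A: "\<forall>j. norm (fst (Z (real j / real m) \<omega>)) \<le> norm xstar + ?D * (real j / real m)"
      have "norm (fst (Z (real j / real m) \<omega>)) \<le> r j" for j
        using spec[OF A, of j] by (simp add: r_def)
      moreover have "snd (Z (real j / real m) \<omega>) \<in> signs" for j
        using measurable_space[OF Z_meas \<omega>, of "real j / real m"] by (simp add: space_zz mem_Times_iff)
      ultimately show "(\<lambda>j. Z (real j / real m) \<omega>) \<in> box r" by (simp add: box_def)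
    qed
  qed
  have zF: "\<bar>(\<integral>\<omega>. \<Psi> (\<lambda>j. Z (real j / real m) \<omega>) \<partial>N) - (\<integral>\<omega>. F (\<lambda>j. Z (real j / real m) \<omega>) \<partial>N)\<bar> \<le> e / 3"
    by (rule close[OF M_prob _ zbox]) (rule Z_meas, simp)
  have ev_x0: "\<forall>\<^sub>F \<epsilon> in at_right 0. norm (\<epsilon> *\<^sub>R real_vec (x0 \<epsilon>)) \<le> norm xstar + 1" by (rule x0_bounded)
  show "\<forall>\<^sub>F \<epsilon> in at_right 0. dist (\<integral>\<omega>. \<Psi> (\<lambda>j. wpath \<epsilon> \<omega> (real j / real m)) \<partial>M \<epsilon>)
    (\<integral>\<omega>. \<Psi> (\<lambda>j. Z (real j / real m) \<omega>) \<partial>N) < e"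
    using eventually_at_right_less[of "0::real"] ev_x0 tendstoD[OF grid_cyl_tendsto[OF F(1) m] e3]
  proof eventually_elim
    fix \<epsilon> :: real
    assume \<epsilon>: "0 < \<epsilon>" and x0: "norm (\<epsilon> *\<^sub>R real_vec (x0 \<epsilon>)) \<le> norm xstar + 1"
      and d: "dist (\<integral>\<omega>. F (\<lambda>j. wpath \<epsilon> \<omega> (real j / real m)) \<partial>M \<epsilon>) (\<integral>\<omega>. F (\<lambda>j. Z (real j / real m) \<omega>) \<partial>N) < e / 3"
    have wF: "\<bar>(\<integral>\<omega>. \<Psi> (\<lambda>j. wpath \<epsilon> \<omega> (real j / real m)) \<partial>M \<epsilon>) - (\<integral>\<omega>. F (\<lambda>j. wpath \<epsilon> \<omega> (real j / real m)) \<partial>M \<epsilon>)\<bar> \<le> e / 3"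
      by (rule close[OF M_prob_space[OF \<epsilon>] _ wbox[OF \<epsilon> x0]]) (rule wpath_state[OF \<epsilon>], simp)
    show "dist (\<integral>\<omega>. \<Psi> (\<lambda>j. wpath \<epsilon> \<omega> (real j / real m)) \<partial>M \<epsilon>) (\<integral>\<omega>. \<Psi> (\<lambda>j. Z (real j / real m) \<omega>) \<partial>N) < e"
      using wF zF d unfolding dist_real_def by linarith
  qed
qed

end


context zz_limit
begin

text \<open>The order of choices matters: k for the envelope, then \<delta> from k, then the
  gradient bound on the ball reached by the horizon belonging to \<delta>, then the grid m, and only
  then small \<epsilon>. Since an envelope lies below \<Phi>, the closeness of the walk to its step
  path yields a lower bound for \<Phi> itself, with no modulus of continuity of \<Phi>.\<close>

lemma eventually_integral_walk_gt:
  fixes \<Phi> :: "(real \<Rightarrow> 'd phase) \<Rightarrow> real"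
  assumes cont: "continuous_map skorohod_topology euclideanreal \<Phi>"
    and bound: "\<And>x. x \<in> skorohod_space \<Longrightarrow> \<bar>\<Phi> x\<bar> \<le> C" and a: "a < (\<integral>\<omega>. \<Phi> (zpath \<omega>) \<partial>N)"
  shows "\<forall>\<^sub>F \<epsilon> in at_right 0. a < (\<integral>\<omega>. \<Phi> (wpath \<epsilon> \<omega>) \<partial>M \<epsilon>)"
proof -
  interpret N: prob_space N by (rule M_prob)
  let ?D = "real CARD('d)"
  let ?zgrid = "\<lambda>m \<omega> j. Z (real j / real m) \<omega>"
  let ?wgrid = "\<lambda>m \<epsilon> \<omega> j. wpath \<epsilon> \<omega> (real j / real m)"
  define I where "I = (\<integral>\<omega>. \<Phi> (zpath \<omega>) \<partial>N)"
  \<comment> \<open>Three portions are spent: one on envelope and grid together, one on the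
    Lipschitz error \<open>k * \<delta>\<close>, one on the exceptional event. The rest is
    margin.\<close>
  define \<eta> where "\<eta> = (I - a) / 5"
  have \<eta>: "0 < \<eta>" using a by (simp add: \<eta>_def I_def)
  have "sk_step 1 (\<lambda>_. 0) \<in> (skorohod_space :: (real \<Rightarrow> 'd phase) set)" by (rule sk_step_in_space) simp
  from bound[OF this] have C: "0 \<le> C" by linarith
  have \<Phi>c: "sk_continuous \<Phi>"
    unfolding sk_continuous_def by (intro allI impI, rule continuous_skorohod_tendsto[OF cont]) simp_all
  have zsk: "zpath \<omega> \<in> skorohod_space" if "\<omega> \<in> space N" for \<omega>
    using cadlag_restrict[OF cadlag_Z[OF that]] by (simp add: zpath_def skorohod_space_def)
  have zmeas: "(\<lambda>\<omega>. \<phi> (zpath \<omega>)) \<in> borel_measurable N" if "sk_continuous \<phi>" for \<phi> :: "(real \<Rightarrow> 'd phase) \<Rightarrow> real"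
    by (rule sk_functional_measurable[OF that zsk]) (auto simp: zpath_def intro: Z_borel)
  have env_bound: "\<bar>lip_env \<Phi> (real k) x\<bar> \<le> C" if "x \<in> skorohod_space" for k x
    by (rule lip_env_abs[OF bound _ that]) simp_all
  have env_cont: "sk_continuous (lip_env \<Phi> (real k))" for k
    by (rule sk_continuous_lip_env[OF bound]) simp_all
  have "(\<lambda>k. \<integral>\<omega>. lip_env \<Phi> (real k) (zpath \<omega>) \<partial>N) \<longlonglongrightarrow> I"
    unfolding I_def
  proof (rule integral_dominated_convergence[where w="\<lambda>_. C"])
    show "(\<lambda>\<omega>. \<Phi> (zpath \<omega>)) \<in> borel_measurable N" by (rule zmeas[OF \<Phi>c])
    show "(\<lambda>\<omega>. lip_env \<Phi> (real k) (zpath \<omega>)) \<in> borel_measurable N" for k by (rule zmeas[OF env_cont])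
    show "AE \<omega> in N. (\<lambda>k. lip_env \<Phi> (real k) (zpath \<omega>)) \<longlonglongrightarrow> \<Phi> (zpath \<omega>)"
      by (rule AE_I2) (rule lip_env_tendsto[OF bound cont zsk])
    show "AE \<omega> in N. norm (lip_env \<Phi> (real k) (zpath \<omega>)) \<le> C" for k
      by (rule AE_I2, unfold real_norm_def) (rule env_bound[OF zsk])
  qed simp
  from order_tendstoD(1)[OF this, of "I - \<eta>"] \<eta>
  have "\<forall>\<^sub>F k in sequentially. I - \<eta> < (\<integral>\<omega>. lip_env \<Phi> (real k) (zpath \<omega>) \<partial>N)" by simp
  then obtain k where k: "I - \<eta> < (\<integral>\<omega>. lip_env \<Phi> (real k) (zpath \<omega>) \<partial>N)"
    using eventually_happens'[OF sequentially_bot] by blast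
  define \<psi> where "\<psi> = lip_env \<Phi> (real k)"
  have \<psi>c: "sk_continuous \<psi>" and \<psi>b: "\<And>x. x \<in> skorohod_space \<Longrightarrow> \<bar>\<psi> x\<bar> \<le> C"
    unfolding \<psi>_def by (rule env_cont) (rule env_bound)
  define \<delta> where "\<delta> = \<eta> / (real k + 1)"
  have \<delta>: "0 < \<delta>" using \<eta> by (simp add: \<delta>_def)
  have k\<delta>: "real k * \<delta> \<le> \<eta>" using \<eta> by (simp add: \<delta>_def field_simps)
  \<comment> \<open>The radius covers the start, up to distance 1, and the distance walked until the
    horizon \<open>1 / \<delta> + 1\<close>. It does not involve m, so m may still be taken large
    against K.\<close>
  obtain K where K: "gradient_bound H ((norm xstar + 1) + ?D * (1 / \<delta> + 1) + 2) K" by (rule gradient_bound_exists[OF C2])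
  define A where "A = ?D * K + (1 / \<delta> + 1 + 1) * (?D * K)\<^sup>2"
  have small: "\<forall>\<^sub>F m in sequentially. c / real (Suc m) \<le> b" if "0 < b" for b c :: real
    using order_tendstoD(2)[OF LIMSEQ_Suc[OF lim_const_over_n[of c]] that]
    by (rule eventually_mono) (rule less_imp_le)
  have "(\<lambda>m. \<integral>\<omega>. \<psi> (sk_step (Suc m) (?zgrid (Suc m) \<omega>)) \<partial>N) \<longlonglongrightarrow> (\<integral>\<omega>. \<psi> (zpath \<omega>) \<partial>N)"
  proof (rule integral_dominated_convergence[where w="\<lambda>_. C"])
    show "(\<lambda>\<omega>. \<psi> (zpath \<omega>)) \<in> borel_measurable N" by (rule zmeas[OF \<psi>c])
    show "(\<lambda>\<omega>. \<psi> (sk_step (Suc m) (?zgrid (Suc m) \<omega>))) \<in> borel_measurable N" for m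
      by (rule sk_step_functional_measurable[OF \<psi>c]) (auto intro: Z_borel)
    show "AE \<omega> in N. (\<lambda>m. \<psi> (sk_step (Suc m) (?zgrid (Suc m) \<omega>))) \<longlonglongrightarrow> \<psi> (zpath \<omega>)"
    proof (rule AE_I2)
      fix \<omega> assume \<omega>: "\<omega> \<in> space N"
      have "zpath \<omega> (real j / real (Suc m)) = Z (real j / real (Suc m)) \<omega>" for j m
        unfolding zpath_def by (subst restrict_apply') simp_all
      then show "(\<lambda>m. \<psi> (sk_step (Suc m) (?zgrid (Suc m) \<omega>))) \<longlonglongrightarrow> \<psi> (zpath \<omega>)"
        using sk_continuous_discretization[OF \<psi>c zsk[OF \<omega>]] by (simp only:)
    qed
    show "AE \<omega> in N. norm (\<psi> (sk_step (Suc m) (?zgrid (Suc m) \<omega>))) \<le> C" for m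
      by (rule AE_I2, unfold real_norm_def) (rule \<psi>b[OF sk_step_in_space], simp)
  qed simp
  from order_tendstoD(1)[OF this, of "I - 2 * \<eta> + \<eta>"] k
  have "\<forall>\<^sub>F m in sequentially. I - 2 * \<eta> + \<eta> < (\<integral>\<omega>. \<psi> (sk_step (Suc m) (?zgrid (Suc m) \<omega>)) \<partial>N)"
    by (simp add: \<psi>_def)
  with small[OF \<delta>, of 1] small[OF \<delta>, of "3 * ?D"] small[OF \<eta>, of "2 * C * (2 * A)"]
  have "\<forall>\<^sub>F m in sequentially. 1 / real (Suc m) \<le> \<delta> \<and> 3 * ?D / real (Suc m) \<le> \<delta> \<and>
      2 * C * (2 * A) / real (Suc m) \<le> \<eta> \<and> I - \<eta> < (\<integral>\<omega>. \<psi> (sk_step (Suc m) (?zgrid (Suc m) \<omega>)) \<partial>N)"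
    by eventually_elim simp
  then obtain m' where m': "1 / real (Suc m') \<le> \<delta> \<and> 3 * ?D / real (Suc m') \<le> \<delta> \<and>
      2 * C * (2 * A) / real (Suc m') \<le> \<eta> \<and> I - \<eta> < (\<integral>\<omega>. \<psi> (sk_step (Suc m') (?zgrid (Suc m') \<omega>)) \<partial>N)"
    using eventually_happens'[OF sequentially_bot] by blast
  define m where "m = Suc m'"
  have m: "0 < m" "1 / real m \<le> \<delta>" "3 * ?D / real m \<le> \<delta>" "2 * C * (2 * A) / real m \<le> \<eta>"
    "I - \<eta> < (\<integral>\<omega>. \<psi> (sk_step m (?zgrid m \<omega>)) \<partial>N)"
    using m' by (auto simp: m_def)
  have "((\<lambda>\<epsilon>. \<integral>\<omega>. \<psi> (sk_step m (?wgrid m \<epsilon> \<omega>)) \<partial>M \<epsilon>) \<longlongrightarrow> (\<integral>\<omega>. \<psi> (sk_step m (?zgrid m \<omega>)) \<partial>N)) (at_right 0)"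
    by (rule grid_tendsto[OF sk_continuous_sk_step[OF \<psi>c m(1)] \<psi>b[OF sk_step_in_space[OF m(1)]] m(1)])
  from order_tendstoD(1)[OF this m(5)]
  have ev: "\<forall>\<^sub>F \<epsilon> in at_right 0. I - \<eta> < (\<integral>\<omega>. \<psi> (sk_step m (?wgrid m \<epsilon> \<omega>)) \<partial>M \<epsilon>)" .
  have ev_m: "\<forall>\<^sub>F \<epsilon> in at_right 0. \<epsilon> \<le> 1 / real m"
    by (rule eventually_at_rightI[of 0 "1 / real m"]) (use m(1) in auto)
  show ?thesis
    using eventually_at_right_less[of "0::real"] x0_bounded ev ev_m
  proof eventually_elim
    fix \<epsilon> :: real
    assume \<epsilon>: "0 < \<epsilon>" and x0: "norm (\<epsilon> *\<^sub>R real_vec (x0 \<epsilon>)) \<le> norm xstar + 1"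
      and gt: "I - \<eta> < (\<integral>\<omega>. \<psi> (sk_step m (?wgrid m \<epsilon> \<omega>)) \<partial>M \<epsilon>)" and \<epsilon>m: "\<epsilon> \<le> 1 / real m"
    interpret w: zz_walk H \<epsilon> "M \<epsilon>" "X \<epsilon>" "V \<epsilon>" "x0 \<epsilon>" v0 by (rule zz_walk[OF \<epsilon>])
    have wsk: "wpath \<epsilon> \<omega> \<in> skorohod_space" for \<omega>
      using w.walk_path_in_space by (simp add: walk_path_eq[OF \<epsilon>])
    have wb: "(\<lambda>\<omega>. wpath \<epsilon> \<omega> t) \<in> borel_measurable (M \<epsilon>)" if "0 \<le> t" for t
      using w.walk_pos_measurable that by (simp add: walk_pos_eq[OF \<epsilon>] wpath_def)
    have i1: "integrable (M \<epsilon>) (\<lambda>\<omega>. \<psi> (sk_step m (?wgrid m \<epsilon> \<omega>)))"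
    proof (rule bounded_integrable[OF M_prob_space[OF \<epsilon>]])
      show "(\<lambda>\<omega>. \<psi> (sk_step m (?wgrid m \<epsilon> \<omega>))) \<in> borel_measurable (M \<epsilon>)"
        by (rule sk_step_functional_measurable[OF \<psi>c m(1)]) (rule wb, simp)
    qed (rule \<psi>b[OF sk_step_in_space[OF m(1)]])
    have i2: "integrable (M \<epsilon>) (\<lambda>\<omega>. \<Phi> (wpath \<epsilon> \<omega>))"
      by (rule bounded_integrable[OF M_prob_space[OF \<epsilon>] sk_functional_measurable[OF \<Phi>c wsk wb] bound[OF wsk]])
    obtain B where B: "B \<in> sets (M \<epsilon>)" "measure (M \<epsilon>) B \<le> 2 / real m * A"
      "\<And>\<omega>. \<omega> \<in> space (M \<epsilon>) - B \<Longrightarrow> w.regular \<omega> \<Longrightarrow> sk_dist (sk_step m (?wgrid m \<epsilon> \<omega>)) (wpath \<epsilon> \<omega>) \<le> \<delta>"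
      by (rule w.walk_discretization[OF \<delta> m(1-3) \<epsilon>m x0 K], unfold walk_path_eq[OF \<epsilon>] A_def[symmetric]) (rule that; assumption)
    have i3: "integrable (M \<epsilon>) (\<lambda>\<omega>. 2 * C * indicator B \<omega>)"
      using B(1) by (intro integrable_mult_right) (simp add: integrable_indicator_iff w.emeasure_eq_measure)
    have ic: "integrable (M \<epsilon>) (\<lambda>_. real k * \<delta>)" by simp
    have i4: "integrable (M \<epsilon>) (\<lambda>\<omega>. \<psi> (sk_step m (?wgrid m \<epsilon> \<omega>)) - real k * \<delta>)"
      by (rule Bochner_Integration.integrable_diff[OF i1 ic])
    \<comment> \<open>Outside \<open>B\<close> the Lipschitz property of \<psi> and \<psi> \<le>
      \<Phi> give the pointwise bound; on B the difference of two values bounded by C costs at most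
      2C.\<close>
    have "(\<integral>\<omega>. \<psi> (sk_step m (?wgrid m \<epsilon> \<omega>)) - real k * \<delta> - 2 * C * indicator B \<omega> \<partial>M \<epsilon>) \<le> (\<integral>\<omega>. \<Phi> (wpath \<epsilon> \<omega>) \<partial>M \<epsilon>)"
    proof (rule integral_mono_AE[OF Bochner_Integration.integrable_diff[OF i4 i3] i2])
      show "AE \<omega> in M \<epsilon>. \<psi> (sk_step m (?wgrid m \<epsilon> \<omega>)) - real k * \<delta> - 2 * C * indicator B \<omega> \<le> \<Phi> (wpath \<epsilon> \<omega>)"
        using w.AE_regular
      proof (rule AE_mp, intro AE_I2 impI)
        fix \<omega> assume \<omega>: "\<omega> \<in> space (M \<epsilon>)" "w.regular \<omega>"
        let ?s = "sk_step m (?wgrid m \<epsilon> \<omega>)"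
        have s: "?s \<in> skorohod_space" by (rule sk_step_in_space[OF m(1)])
        show "\<psi> ?s - real k * \<delta> - 2 * C * indicator B \<omega> \<le> \<Phi> (wpath \<epsilon> \<omega>)"
        proof (cases "\<omega> \<in> B")
          case True
          have "0 \<le> real k * \<delta>" using \<delta> by simp
          then show ?thesis using True \<psi>b[OF s] bound[OF wsk[of \<omega>]] by simp
        next
          case False
          have "\<psi> ?s \<le> \<psi> (wpath \<epsilon> \<omega>) + real k * sk_dist ?s (wpath \<epsilon> \<omega>)"
            unfolding \<psi>_def by (rule lip_env_lipschitz[OF bound _ s]) simp_all
          moreover have "\<psi> (wpath \<epsilon> \<omega>) \<le> \<Phi> (wpath \<epsilon> \<omega>)"
            unfolding \<psi>_def by (rule lip_env_le[OF bound _ wsk]) simp_all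
          moreover have "real k * sk_dist ?s (wpath \<epsilon> \<omega>) \<le> real k * \<delta>"
            using B(3)[of \<omega>] \<omega> False by (intro mult_left_mono) auto
          ultimately have "\<psi> ?s - real k * \<delta> \<le> \<Phi> (wpath \<epsilon> \<omega>)" by linarith
          then show ?thesis using False by simp
        qed
      qed
    qed
    also have "(\<integral>\<omega>. \<psi> (sk_step m (?wgrid m \<epsilon> \<omega>)) - real k * \<delta> - 2 * C * indicator B \<omega> \<partial>M \<epsilon>) =
        (\<integral>\<omega>. \<psi> (sk_step m (?wgrid m \<epsilon> \<omega>)) \<partial>M \<epsilon>) - real k * \<delta> - 2 * C * measure (M \<epsilon>) B"
      unfolding Bochner_Integration.integral_diff[OF i4 i3] Bochner_Integration.integral_diff[OF i1 ic]
      using B(1) w.prob_space by simp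
    finally have le: "(\<integral>\<omega>. \<psi> (sk_step m (?wgrid m \<epsilon> \<omega>)) \<partial>M \<epsilon>) - real k * \<delta> - 2 * C * measure (M \<epsilon>) B
      \<le> (\<integral>\<omega>. \<Phi> (wpath \<epsilon> \<omega>) \<partial>M \<epsilon>)" .
    have "2 * C * measure (M \<epsilon>) B \<le> 2 * C * (2 / real m * A)"
      by (rule mult_left_mono[OF B(2)]) (use C in simp)
    also have "\<dots> = 2 * C * (2 * A) / real m" by simp
    finally have "2 * C * measure (M \<epsilon>) B \<le> \<eta>" using m(4) by linarith
    then have "I - 3 * \<eta> < (\<integral>\<omega>. \<Phi> (wpath \<epsilon> \<omega>) \<partial>M \<epsilon>)" using le gt k\<delta> by linarith
    moreover have "a \<le> I - 3 * \<eta>" using \<eta> by (simp add: \<eta>_def field_simps)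
    ultimately show "a < (\<integral>\<omega>. \<Phi> (wpath \<epsilon> \<omega>) \<partial>M \<epsilon>)" by linarith
  qed
qed

theorem converges_in_law_wpath: "converges_in_law skorohod_topology M wpath N zpath (at_right 0)"
  unfolding converges_in_law_def
proof (intro allI impI, elim conjE)
  fix \<Phi> :: "(real \<Rightarrow> 'd phase) \<Rightarrow> real"
  assume cont: "continuous_map skorohod_topology euclideanreal \<Phi>" and "bounded (\<Phi> ` topspace skorohod_topology)"
  then obtain C where b: "\<And>x. x \<in> skorohod_space \<Longrightarrow> \<bar>\<Phi> x\<bar> \<le> C"
    unfolding topspace_skorohod_topology bounded_iff real_norm_def by blast
  have cont': "continuous_map skorohod_topology euclideanreal (\<lambda>x. - \<Phi> x)"
    using cont by (rule continuous_map_minus)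
  show "((\<lambda>\<epsilon>. \<integral>\<omega>. \<Phi> (wpath \<epsilon> \<omega>) \<partial>M \<epsilon>) \<longlongrightarrow> (\<integral>\<omega>. \<Phi> (zpath \<omega>) \<partial>N)) (at_right 0)"
  proof (rule order_tendstoI)
    fix a assume "a < (\<integral>\<omega>. \<Phi> (zpath \<omega>) \<partial>N)"
    then show "\<forall>\<^sub>F \<epsilon> in at_right 0. a < (\<integral>\<omega>. \<Phi> (wpath \<epsilon> \<omega>) \<partial>M \<epsilon>)"
      by (rule eventually_integral_walk_gt[OF cont, where C=C, rotated]) (rule b)
  next
    fix a assume "(\<integral>\<omega>. \<Phi> (zpath \<omega>) \<partial>N) < a"
    then have "- a < (\<integral>\<omega>. - \<Phi> (zpath \<omega>) \<partial>N)" by simp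
    then have "\<forall>\<^sub>F \<epsilon> in at_right 0. - a < (\<integral>\<omega>. - \<Phi> (wpath \<epsilon> \<omega>) \<partial>M \<epsilon>)"
      by (rule eventually_integral_walk_gt[OF cont', where C=C, rotated]) (simp add: b)
    then show "\<forall>\<^sub>F \<epsilon> in at_right 0. (\<integral>\<omega>. \<Phi> (wpath \<epsilon> \<omega>) \<partial>M \<epsilon>) < a" by simp
  qed
qed

end

theorem theorem7:
  fixes H :: "real ^ 'd::{finite,linorder} \<Rightarrow> real"
    and M :: "real \<Rightarrow> 'a measure"
    and X V :: "real \<Rightarrow> nat \<Rightarrow> 'a \<Rightarrow> int ^ 'd::{finite,linorder}"
    and x0 :: "real \<Rightarrow> int ^ 'd::{finite,linorder}"
    and v0 :: "int ^ 'd::{finite,linorder}"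
    and xstar :: "real ^ 'd::{finite,linorder}"
    and N :: "'b measure"
    and Y W :: "real \<Rightarrow> 'b \<Rightarrow> real ^ 'd::{finite,linorder}"
  assumes "class_C2 H"
    and "filterlim H at_top at_infinity"
    and "v0 \<in> signs"
    and "\<And>\<epsilon>. \<epsilon> > 0 \<Longrightarrow> zigzag_walk (M \<epsilon>) (\<lambda>x. H (\<epsilon> *\<^sub>R real_vec x)) (X \<epsilon>) (V \<epsilon>)"
    and "\<And>\<epsilon>. \<epsilon> > 0 \<Longrightarrow> AE \<omega> in M \<epsilon>. X \<epsilon> 0 \<omega> = x0 \<epsilon> \<and> V \<epsilon> 0 \<omega> = v0"
    and "((\<lambda>\<epsilon>. \<epsilon> *\<^sub>R real_vec (x0 \<epsilon>)) \<longlongrightarrow> xstar) (at_right 0)"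
    and "zigzag_process N H Y W"
    and "AE \<omega> in N. Y 0 \<omega> = xstar \<and> W 0 \<omega> = real_vec v0"
  shows "converges_in_law skorohod_topology
           M (\<lambda>\<epsilon> \<omega>. \<lambda>t\<in>{0..}. (\<epsilon> *\<^sub>R real_vec (X \<epsilon> (nat \<lfloor>t / \<epsilon>\<rfloor>) \<omega>),
                                 real_vec (V \<epsilon> (nat \<lfloor>t / \<epsilon>\<rfloor>) \<omega>)))
           N (\<lambda>\<omega>. \<lambda>t\<in>{0..}. (Y t \<omega>, W t \<omega>))
           (at_right 0)"
proof -
  obtain P where P: "markov_process N zz_state_space P (\<lambda>t \<omega>. (Y t \<omega>, W t \<omega>))"
    "has_generator zz_state_space P zz_test_functions (zz_generator H)"
    and cad: "\<And>\<omega>. \<omega> \<in> space N \<Longrightarrow> cadlag (\<lambda>t. (Y t \<omega>, W t \<omega>))"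
    using assms(7) unfolding zigzag_process_def by blast
  interpret zz_limit H P N "\<lambda>t \<omega>. (Y t \<omega>, W t \<omega>)" M X V x0 v0 xstar
  proof
    show "markov_semigroup zz_state_space P" using P(1) by (simp add: markov_process_def)
    show "AE \<omega> in N. (Y 0 \<omega>, W 0 \<omega>) = (xstar, real_vec v0)" using assms(8) by simp
  qed (use assms P cad in auto)
  show ?thesis
    using converges_in_law_wpath unfolding wpath_def[abs_def] zpath_def[abs_def] wpos_def .
qed

end
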